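(* Assume $(H_\xi)$, $(H_f)$, $(H_\ell)$ and $(H_L)$ (as written out in the context). Then there exists a unique deterministic flat solution to the BSDE with mean reflection, i.e. a unique triple $(Y,Z,K)\in\mathcal S^2\times\mathcal H^2\times\mathcal A^2_D$ such that $$Y_t=\xi+\int_t^T f(s,Y_s,Z_s)\,ds-\int_t^T Z_s\cdot dB_s+K_T-K_t,\qquad \mathbb E[\ell(t,Y_t)]\ge0,\qquad 0\le t\le T,$$ $$\int_0^T\mathbb E[\ell(t,Y_t)]\,dK_t=0.$$
   Context: $T>0$ is finite; $(\Omega,\mathcal F,\mathbb P)$ is a complete probability space carrying a $d$-dimensional standard Brownian motion $B=(B_t)_{0\le t\le T}$, with usual augmented filtration $\{\mathcal F_t\}_{0\le t\le T}$. $L^2(\mathcal F_t)$: real-valued $\mathcal F_t$-measurable square integrable random variables. $\mathcal S^2$: real-valued adapted continuous processes $Y$ with $\mathbb E[\sup_{0\le t\le T}|Y_t|^2]<\infty$. $\mathcal H^2$: predictable $\mathbb R^d$-valued processes $Z$ with $\mathbb E[\int_0^T|Z_s|^2ds]<\infty$. $\mathcal A^2$: nondecreasing processes $K\in\mathcal S^2$ with $K_0=0$; $\mathcal A^2_D$: the deterministic elements of $\mathcal A^2$. Uniqueness is understood in these spaces (indistinguishability for $Y$ and $K$, $d\mathbb P\otimes dt$-a.e. equality for $Z$). Assumptions: $(H_f)$: $f:\Omega\times[0,T]\times\mathbb R\times\mathbb R^d\to\mathbb R$ is measurable with respect to $\mathcal P\otimes\mathcal B(\mathbb R)\otimes\mathcal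 B(\mathbb R^d)$, $\mathcal P$ being the progressive $\sigma$-algebra on $\Omega\times[0,T]$; there is $\lambda\ge0$ such that $\mathbb P$-a.s., for all $t\in[0,T]$ and all $y,p\in\mathbb R$, $z,q\in\mathbb R^d$, $|f(t,y,z)-f(t,p,q)|\le\lambda(|y-p|+|z-q|)$; and $\mathbb E[\int_0^T|f(t,0,0)|^2dt]<\infty$. $(H_\xi)$: $\xi$ is a square-integrable $\mathcal F_T$-measurable random variable with $\mathbb E[\ell(T,\xi)]\ge0$. $(H_\ell)$: $\ell:\Omega\times[0,T]\times\mathbb R\to\mathbb R$ is $\mathcal F_T\otimes\mathcal B([0,T])\otimes\mathcal B(\mathbb R)$-measurable and there is $C\ge0$ such that $\mathbb P$-a.s.: (1) $(t,y)\mapsto\ell(t,y)$ is continuous; (2) for all $t$, $y\mapsto\ell(t,y)$ is strictly increasing; (3) for all $t$, $\mathbb E[\ell(t,\infty)]>0$, where $\ell(t,\infty)=\lim_{y\to\infty}\ell(t,y)$; (4) for all $t,y$, $|\ell(t,y)|\le C(1+|y|)$. For $t\in[0,T]$ define $L_t:L^2(\mathcal F_T)\to[0,\infty)$ by $L_t(X)=\inf\{x\ge0:\mathbb E[\ell(t,x+X)]\ge0\}$ (finite under $(H_\ell)$). $(H_L)$: there is a constant $C\ge0$ such that $|L_t(X)-L_t(X')|\le C\,\mathbb E[|X-X'|]$ for all $t\in[0,T]$ and all $X,X'\in L^2(\mathcal F_t)$. *)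

theory Defs
  imports "HOL-Probability.Probability"
begin

text \<open>
  Time-indexed processes have type \<open>real \<Rightarrow> 'w \<Rightarrow> 'b\<close>; only their values at times in
  \<open>{0..T}\<close> and at points of \<open>space M\<close> matter.  The driver \<open>f\<close> and the loss function
  \<open>l\<close> take the sample point first.  The state space $\mathbb{R}^d$ is \<open>real ^ 'd\<close>.
\<close>

section \<open>Brownian motion and its filtration\<close>

definition natural_filtration :: "'w measure \<Rightarrow> (real \<Rightarrow> 'w \<Rightarrow> real ^ 'd) \<Rightarrow> real \<Rightarrow> 'w measure" where
  "natural_filtration M B t =
     sigma (space M) (\<Union>s\<in>{0..t}. sets (vimage_algebra (space M) (B s) borel))"

text \<open>
  For a Brownian motion on a complete space the augmented filtration is automatically
  right-continuous, so the augmentation by null sets yields the usual conditions.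
\<close>

definition augmented_filtration :: "'w measure \<Rightarrow> (real \<Rightarrow> 'w \<Rightarrow> real ^ 'd) \<Rightarrow> real \<Rightarrow> 'w measure" where
  "augmented_filtration M B t =
     sigma (space M) (sets (natural_filtration M B t) \<union> null_sets M)"

definition brownian_motion :: "'w measure \<Rightarrow> real \<Rightarrow> (real \<Rightarrow> 'w \<Rightarrow> real ^ 'd) \<Rightarrow> bool" where
  "brownian_motion M T B \<longleftrightarrow>
     (\<forall>t\<in>{0..T}. B t \<in> borel_measurable M) \<and>
     (AE \<omega> in M. B 0 \<omega> = 0) \<and>
     (AE \<omega> in M. continuous_on {0..T} (\<lambda>t. B t \<omega>)) \<and>
     (\<forall>s t. 0 \<le> s \<and> s < t \<and> t \<le> T \<longrightarrow>
        prob_space.indep_set M (sets (natural_filtration M B s))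
          (sets (vimage_algebra (space M) (\<lambda>\<omega>. B t \<omega> - B s \<omega>) borel)) \<and>
        prob_space.indep_vars M (\<lambda>_. borel) (\<lambda>i \<omega>. (B t \<omega> - B s \<omega>) $ i) UNIV \<and>
        (\<forall>i. distributed M lborel (\<lambda>\<omega>. (B t \<omega> - B s \<omega>) $ i)
                (normal_density 0 (sqrt (t - s)))))"

definition progressive_sigma :: "'w measure \<Rightarrow> (real \<Rightarrow> 'w measure) \<Rightarrow> real \<Rightarrow> ('w \<times> real) measure" where
  "progressive_sigma M F T =
     sigma (space M \<times> {0..T})
       {A. A \<subseteq> space M \<times> {0..T} \<and>
           (\<forall>t\<in>{0..T}. A \<inter> (space M \<times> {0..t}) \<in> sets (F t \<Otimes>\<^sub>M restrict_space borel {0..t}))}"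

definition predictable_sigma :: "'w measure \<Rightarrow> (real \<Rightarrow> 'w measure) \<Rightarrow> real \<Rightarrow> ('w \<times> real) measure" where
  "predictable_sigma M F T =
     sigma (space M \<times> {0..T})
       ({A \<times> {0} | A. A \<in> sets (F 0)} \<union>
        {A \<times> {s<..t} | A s t. 0 \<le> s \<and> s < t \<and> t \<le> T \<and> A \<in> sets (F s)})"

section \<open>Spaces of random variables and processes\<close>

definition L2_space :: "'w measure \<Rightarrow> 'w measure \<Rightarrow> ('w \<Rightarrow> real) set" where
  "L2_space M G = {X \<in> borel_measurable G. integrable M (\<lambda>\<omega>. (X \<omega>)\<^sup>2)}"

definition S2_space :: "'w measure \<Rightarrow> (real \<Rightarrow> 'w measure) \<Rightarrow> real \<Rightarrow> (real \<Rightarrow> 'w \<Rightarrow> real) set" where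
  "S2_space M F T =
     {Y. (\<forall>t\<in>{0..T}. Y t \<in> borel_measurable (F t)) \<and>
         (\<forall>\<omega>\<in>space M. continuous_on {0..T} (\<lambda>t. Y t \<omega>)) \<and>
         (\<integral>\<^sup>+\<omega>. (SUP t\<in>{0..T}. ennreal (\<bar>Y t \<omega>\<bar>\<^sup>2)) \<partial>M) < \<infinity>}"

definition H2_space :: "'w measure \<Rightarrow> (real \<Rightarrow> 'w measure) \<Rightarrow> real \<Rightarrow> (real \<Rightarrow> 'w \<Rightarrow> real ^ 'd) set" where
  "H2_space M F T =
     {Z. (\<lambda>(\<omega>, t). Z t \<omega>) \<in> borel_measurable (predictable_sigma M F T) \<and>
         (\<integral>\<^sup>+\<omega>. (\<integral>\<^sup>+s\<in>{0..T}. ennreal ((norm (Z s \<omega>))\<^sup>2) \<partial>lborel) \<partial>M) < \<infinity>}"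

definition A2_space :: "'w measure \<Rightarrow> (real \<Rightarrow> 'w measure) \<Rightarrow> real \<Rightarrow> (real \<Rightarrow> 'w \<Rightarrow> real) set" where
  "A2_space M F T =
     {K \<in> S2_space M F T. \<forall>\<omega>\<in>space M. mono_on {0..T} (\<lambda>t. K t \<omega>) \<and> K 0 \<omega> = 0}"

definition A2D_space :: "'w measure \<Rightarrow> (real \<Rightarrow> 'w measure) \<Rightarrow> real \<Rightarrow> (real \<Rightarrow> real) set" where
  "A2D_space M F T = {K. (\<lambda>t \<omega>. K t) \<in> A2_space M F T}"

section \<open>The It\^o integral\<close>

text \<open>
  A simple integrand \<open>(n, p, \<eta>)\<close> stands for the process
  $\sum_{i<n} \eta_i 1_{(p_i, p_{i+1}]}$.
\<close>

definition simple_integrand ::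
    "'w measure \<Rightarrow> (real \<Rightarrow> 'w measure) \<Rightarrow> real \<Rightarrow> nat \<Rightarrow> (nat \<Rightarrow> real) \<Rightarrow> (nat \<Rightarrow> 'w \<Rightarrow> real ^ 'd) \<Rightarrow> bool" where
  "simple_integrand M F T n p \<eta> \<longleftrightarrow>
     (\<forall>i\<le>n. p i \<in> {0..T}) \<and> (\<forall>i<n. p i \<le> p (Suc i)) \<and>
     (\<forall>i<n. \<eta> i \<in> borel_measurable (F (p i)) \<and> bounded (\<eta> i ` space M))"

definition simple_process ::
    "nat \<Rightarrow> (nat \<Rightarrow> real) \<Rightarrow> (nat \<Rightarrow> 'w \<Rightarrow> real ^ 'd) \<Rightarrow> real \<Rightarrow> 'w \<Rightarrow> real ^ 'd" where
  "simple_process n p \<eta> t \<omega> = (\<Sum>i<n. indicat_real {p i<..p (Suc i)} t *\<^sub>R \<eta> i \<omega>)"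

definition simple_ito_integral ::
    "(real \<Rightarrow> 'w \<Rightarrow> real ^ 'd) \<Rightarrow> nat \<Rightarrow> (nat \<Rightarrow> real) \<Rightarrow> (nat \<Rightarrow> 'w \<Rightarrow> real ^ 'd) \<Rightarrow> real \<Rightarrow> 'w \<Rightarrow> real" where
  "simple_ito_integral B n p \<eta> t \<omega> =
     (\<Sum>i<n. \<eta> i \<omega> \<bullet> (B (min t (p (Suc i))) \<omega> - B (min t (p i)) \<omega>))"

text \<open>
  \<open>has_ito_integral M F T B Z I\<close>: the process \<open>I\<close> is (a continuous version of)
  $t \mapsto \int_0^t Z_s \cdot dB_s$, the limit in $\mathcal{S}^2$ of the integrals of simple
  integrands converging to \<open>Z\<close> in $\mathcal{H}^2$.  This determines \<open>I\<close> up to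
  indistinguishability.
\<close>

definition has_ito_integral ::
    "'w measure \<Rightarrow> (real \<Rightarrow> 'w measure) \<Rightarrow> real \<Rightarrow> (real \<Rightarrow> 'w \<Rightarrow> real ^ 'd) \<Rightarrow>
     (real \<Rightarrow> 'w \<Rightarrow> real ^ 'd) \<Rightarrow> (real \<Rightarrow> 'w \<Rightarrow> real) \<Rightarrow> bool" where
  "has_ito_integral M F T B Z I \<longleftrightarrow>
     Z \<in> H2_space M F T \<and> I \<in> S2_space M F T \<and>
     (\<exists>n p \<eta>.
        (\<forall>k. simple_integrand M F T (n k) (p k) (\<eta> k)) \<and>
        (\<lambda>k. \<integral>\<^sup>+\<omega>. (\<integral>\<^sup>+s\<in>{0..T}.
               ennreal ((norm (simple_process (n k) (p k) (\<eta> k) s \<omega> - Z s \<omega>))\<^sup>2) \<partial>lborel) \<partial>M)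
          \<longlonglongrightarrow> 0 \<and>
        (\<lambda>k. \<integral>\<^sup>+\<omega>. (SUP t\<in>{0..T}.
               ennreal (\<bar>simple_ito_integral B (n k) (p k) (\<eta> k) t \<omega> - I t \<omega>\<bar>\<^sup>2)) \<partial>M)
          \<longlonglongrightarrow> 0)"

section \<open>Assumptions on the data\<close>

definition H_f ::
    "'w measure \<Rightarrow> (real \<Rightarrow> 'w measure) \<Rightarrow> real \<Rightarrow> ('w \<Rightarrow> real \<Rightarrow> real \<Rightarrow> real ^ 'd \<Rightarrow> real) \<Rightarrow> bool" where
  "H_f M F T f \<longleftrightarrow>
     (\<lambda>((\<omega>, t), y, z). f \<omega> t y z)
        \<in> borel_measurable (progressive_sigma M F T \<Otimes>\<^sub>M (borel \<Otimes>\<^sub>M borel)) \<and>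
     (\<exists>c\<ge>0. AE \<omega> in M. \<forall>t\<in>{0..T}. \<forall>y p z q.
        \<bar>f \<omega> t y z - f \<omega> t p q\<bar> \<le> c * (\<bar>y - p\<bar> + norm (z - q))) \<and>
     (\<integral>\<^sup>+\<omega>. (\<integral>\<^sup>+t\<in>{0..T}. ennreal (\<bar>f \<omega> t 0 0\<bar>\<^sup>2) \<partial>lborel) \<partial>M) < \<infinity>"

definition H_xi ::
    "'w measure \<Rightarrow> (real \<Rightarrow> 'w measure) \<Rightarrow> real \<Rightarrow> ('w \<Rightarrow> real \<Rightarrow> real \<Rightarrow> real) \<Rightarrow> ('w \<Rightarrow> real) \<Rightarrow> bool" where
  "H_xi M F T l \<xi> \<longleftrightarrow> \<xi> \<in> L2_space M (F T) \<and> (\<integral>\<omega>. l \<omega> T (\<xi> \<omega>) \<partial>M) \<ge> 0"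

text \<open>
  Expectation of an extended-real random variable whose negative part is integrable;
  \<open>e2ennreal\<close> maps negative values to \<open>0\<close>.  It is needed since $\ell(t,\infty)$ may be
  infinite or have an infinite expectation.
\<close>

definition ereal_expectation :: "'w measure \<Rightarrow> ('w \<Rightarrow> ereal) \<Rightarrow> ereal" where
  "ereal_expectation M X =
     enn2ereal (\<integral>\<^sup>+\<omega>. e2ennreal (X \<omega>) \<partial>M) - enn2ereal (\<integral>\<^sup>+\<omega>. e2ennreal (- X \<omega>) \<partial>M)"

definition H_ell ::
    "'w measure \<Rightarrow> (real \<Rightarrow> 'w measure) \<Rightarrow> real \<Rightarrow> ('w \<Rightarrow> real \<Rightarrow> real \<Rightarrow> real) \<Rightarrow> bool" where
  "H_ell M F T l \<longleftrightarrow>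
     (\<lambda>(\<omega>, t, y). l \<omega> t y)
        \<in> borel_measurable (F T \<Otimes>\<^sub>M (restrict_space borel {0..T} \<Otimes>\<^sub>M borel)) \<and>
     (AE \<omega> in M. continuous_on ({0..T} \<times> UNIV) (\<lambda>(t, y). l \<omega> t y)) \<and>
     (AE \<omega> in M. \<forall>t\<in>{0..T}. strict_mono (l \<omega> t)) \<and>
     (\<forall>t\<in>{0..T}. ereal_expectation M (\<lambda>\<omega>. Lim at_top (\<lambda>y. ereal (l \<omega> t y))) > 0) \<and>
     (\<exists>C\<ge>0. AE \<omega> in M. \<forall>t\<in>{0..T}. \<forall>y. \<bar>l \<omega> t y\<bar> \<le> C * (1 + \<bar>y\<bar>))"

definition L_op :: "'w measure \<Rightarrow> ('w \<Rightarrow> real \<Rightarrow> real \<Rightarrow> real) \<Rightarrow> real \<Rightarrow> ('w \<Rightarrow> real) \<Rightarrow> real" where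
  "L_op M l t X = Inf {x. x \<ge> 0 \<and> (\<integral>\<omega>. l \<omega> t (x + X \<omega>) \<partial>M) \<ge> 0}"

definition H_L ::
    "'w measure \<Rightarrow> (real \<Rightarrow> 'w measure) \<Rightarrow> real \<Rightarrow> ('w \<Rightarrow> real \<Rightarrow> real \<Rightarrow> real) \<Rightarrow> bool" where
  "H_L M F T l \<longleftrightarrow>
     (\<exists>C\<ge>0. \<forall>t\<in>{0..T}. \<forall>X\<in>L2_space M (F t). \<forall>X'\<in>L2_space M (F t).
        \<bar>L_op M l t X - L_op M l t X'\<bar> \<le> C * (\<integral>\<omega>. \<bar>X \<omega> - X' \<omega>\<bar> \<partial>M))"

section \<open>The BSDE with mean reflection\<close>

text \<open>
  In the Skorokhod condition, \<open>K\<close> is extended to the real line as a constant outside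
  \<open>{0..T}\<close>, so that \<open>interval_measure\<close> gives its Stieltjes measure on \<open>{0..T}\<close>.
\<close>

definition deterministic_flat_solution ::
    "'w measure \<Rightarrow> (real \<Rightarrow> 'w measure) \<Rightarrow> real \<Rightarrow> (real \<Rightarrow> 'w \<Rightarrow> real ^ 'd) \<Rightarrow>
     ('w \<Rightarrow> real) \<Rightarrow> ('w \<Rightarrow> real \<Rightarrow> real \<Rightarrow> real ^ 'd \<Rightarrow> real) \<Rightarrow> ('w \<Rightarrow> real \<Rightarrow> real \<Rightarrow> real) \<Rightarrow>
     (real \<Rightarrow> 'w \<Rightarrow> real) \<Rightarrow> (real \<Rightarrow> 'w \<Rightarrow> real ^ 'd) \<Rightarrow> (real \<Rightarrow> real) \<Rightarrow> bool" where
  "deterministic_flat_solution M F T B \<xi> f l Y Z K \<longleftrightarrow>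
     Y \<in> S2_space M F T \<and> Z \<in> H2_space M F T \<and> K \<in> A2D_space M F T \<and>
     (\<exists>I. has_ito_integral M F T B Z I \<and>
        (AE \<omega> in M. \<forall>t\<in>{0..T}.
           Y t \<omega> = \<xi> \<omega> + (LINT s:{t..T}|lborel. f \<omega> s (Y s \<omega>) (Z s \<omega>))
                     - (I T \<omega> - I t \<omega>) + K T - K t)) \<and>
     (\<forall>t\<in>{0..T}. (\<integral>\<omega>. l \<omega> t (Y t \<omega>) \<partial>M) \<ge> 0) \<and>
     (LINT t:{0..T}|interval_measure (\<lambda>t. K (max 0 (min T t))). (\<integral>\<omega>. l \<omega> t (Y t \<omega>) \<partial>M)) = 0"

definition same_solution ::
    "'w measure \<Rightarrow> real \<Rightarrow>
     (real \<Rightarrow> 'w \<Rightarrow> real) \<Rightarrow> (real \<Rightarrow> 'w \<Rightarrow> real ^ 'd) \<Rightarrow> (real \<Rightarrow> real) \<Rightarrow>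
     (real \<Rightarrow> 'w \<Rightarrow> real) \<Rightarrow> (real \<Rightarrow> 'w \<Rightarrow> real ^ 'd) \<Rightarrow> (real \<Rightarrow> real) \<Rightarrow> bool" where
  "same_solution M T Y Z K Y' Z' K' \<longleftrightarrow>
     (AE \<omega> in M. \<forall>t\<in>{0..T}. Y t \<omega> = Y' t \<omega>) \<and>
     (AE (\<omega>, t) in M \<Otimes>\<^sub>M restrict_space lborel {0..T}. Z t \<omega> = Z' t \<omega>) \<and>
     (\<forall>t\<in>{0..T}. K t = K' t)"

end

theory Submission
  imports Defs
begin

text \<open>
  On \<open>{0..T}\<close> write \<open>Y = X + \<kappa>\<close> with \<open>\<kappa> t = K T - K t\<close>.  If the driver is replaced by a given
  process \<open>g\<close>, then \<open>X\<close> solves a BSDE without reflection, which the martingale representation theorem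
  settles, and flatness forces \<open>\<kappa> t\<close> to be the supremum of $L_s(X_s)$ over $s \in [t, T]$: a
  deterministic Skorokhod problem.  Hence flat solutions correspond to fixed points of
  $g \mapsto f(\cdot, Y, Z)$.  The conditional variance of the terminal integral bounds
  $E|X_t - X'_t|^2 + E \int_t^T |Z - Z'|^2$ by a weighted tail of $g - g'$, and by the Lipschitz
  condition on \<open>L\<close> the same tail controls $\kappa - \kappa'$; for a large weight \<open>\<gamma>\<close> the map contracts
  in the norm $E \int_0^T e^{2 \gamma s} |g|^2 ds$ on the whole interval, so neither the Ito formula nor
  patching of small intervals is needed.

  Representation: random variables \<open>c + \<integral> Z dB\<close> form a closed subspace of \<open>L\<^sup>2\<close>.  It contains
  \<open>cos (\<integral> v dB + c)\<close> for deterministic step functions \<open>v\<close>, since the error of a first-order expansion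
  over each step of a refined grid vanishes with the mesh, and these functions span an algebra that
  generates the filtration.
\<close>

section \<open>Square-integrable functions\<close>

text \<open>Taking the driver as the unknown decouples the reflection: once \<open>g\<close> is
  fixed, the constraint involves \<open>X\<close> only through expectations, so \<kappa> is computed
  after \<open>X\<close> and acts back on \<open>g\<close> alone. The supremum in \<kappa> is
  harmless because the bound on E|X_t - X'_t|^2 decreases in \<open>t\<close>: its value at
  \<open>t\<close> covers all later times, so estimates at single times suffice. The weight works as
  follows. Cauchy-Schwarz against exp (\<gamma> s) leaves the factor exp (- \<gamma> t) / \<gamma>;
  integration against exp (2 \<gamma> t) then gives 1/\<gamma>^2 for \<open>Y\<close>, but only
  1/\<gamma> for \<open>Z\<close>, which is known through its integrals over (t, T] and not at
  single times. Both are small for large \<gamma>. Conditional expectation enters only as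
  orthogonality to square-integrable variables known at an earlier time. Two technical obstacles
  recur. Suprema over uncountable time sets may fail to be measurable, so measurable majorants are
  built from grids. \<open>S2_space\<close> asks for continuity of every path, so versions are set
  to 0 on a null set; completeness keeps them adapted.\<close>

definition sqnorm :: "'a measure \<Rightarrow> ('a \<Rightarrow> 'b::{banach, second_countable_topology}) \<Rightarrow> ennreal" where
  "sqnorm N f = (\<integral>\<^sup>+x. ennreal ((norm (f x))\<^sup>2) \<partial>N)"

lemma power2_norm_add_le: "(norm (a + b :: 'b::real_normed_vector))\<^sup>2 \<le> 2 * (norm a)\<^sup>2 + 2 * (norm b)\<^sup>2"
proof -
  have "(norm (a + b))\<^sup>2 \<le> (norm a + norm b)\<^sup>2"
    by (simp add: norm_triangle_ineq power_mono)
  also have "\<dots> \<le> 2 * (norm a)\<^sup>2 + 2 * (norm b)\<^sup>2"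
    using sum_squares_bound[of "norm a" "norm b"] by (simp add: power2_sum)
  finally show ?thesis .
qed

lemma sqnorm_cong_AE: "AE x in N. f x = g x \<Longrightarrow> sqnorm N f = sqnorm N g"
  unfolding sqnorm_def by (rule nn_integral_cong_AE) auto

lemma sqnorm_mono_AE: "AE x in N. norm (f x) \<le> norm (g x) \<Longrightarrow> sqnorm N f \<le> sqnorm N g"
  unfolding sqnorm_def by (rule nn_integral_mono_AE) (auto intro!: ennreal_leI power_mono)

lemma sqnorm_minus_commute: "sqnorm N (\<lambda>x. f x - g x) = sqnorm N (\<lambda>x. g x - f x)"
  unfolding sqnorm_def by (simp add: norm_minus_commute)

lemma sqnorm_add_le:
  assumes [measurable]: "f \<in> borel_measurable N" "g \<in> borel_measurable N"
  shows "sqnorm N (\<lambda>x. f x + g x) \<le> 2 * sqnorm N f + 2 * sqnorm N g"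
proof -
  have "sqnorm N (\<lambda>x. f x + g x) \<le> (\<integral>\<^sup>+x. 2 * ennreal ((norm (f x))\<^sup>2) + 2 * ennreal ((norm (g x))\<^sup>2) \<partial>N)"
    unfolding sqnorm_def
    by (intro nn_integral_mono)
       (use power2_norm_add_le in \<open>simp add: ennreal_plus[symmetric] ennreal_mult[symmetric] flip: ennreal_numeral del: ennreal_plus\<close>)
  also have "\<dots> = 2 * sqnorm N f + 2 * sqnorm N g"
    unfolding sqnorm_def by (simp add: nn_integral_add nn_integral_cmult)
  finally show ?thesis .
qed

lemma sqnorm_diff_triangle:
  assumes [measurable]: "f \<in> borel_measurable N" "g \<in> borel_measurable N" "h \<in> borel_measurable N"
  shows "sqnorm N (\<lambda>x. f x - h x) \<le> 2 * sqnorm N (\<lambda>x. f x - g x) + 2 * sqnorm N (\<lambda>x. g x - h x)"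
  using sqnorm_add_le[of "\<lambda>x. f x - g x" N "\<lambda>x. g x - h x"] by simp

lemma sqnorm_diff_le:
  assumes [measurable]: "f \<in> borel_measurable N" "g \<in> borel_measurable N"
  shows "sqnorm N (\<lambda>x. f x - g x) \<le> 2 * sqnorm N f + 2 * sqnorm N g"
  using sqnorm_add_le[of f N "\<lambda>x. - g x"] by (simp add: sqnorm_def)

lemma sqnorm_cmult:
  assumes [measurable]: "f \<in> borel_measurable N"
  shows "sqnorm N (\<lambda>x. c *\<^sub>R f x) = ennreal (c\<^sup>2) * sqnorm N f"
  unfolding sqnorm_def by (simp add: power_mult_distrib ennreal_mult nn_integral_cmult)

lemma sqnorm_finite_iff:
  assumes [measurable]: "f \<in> borel_measurable N"
  shows "sqnorm N f < \<infinity> \<longleftrightarrow> integrable N (\<lambda>x. (norm (f x))\<^sup>2)"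
  unfolding sqnorm_def integrable_iff_bounded by simp

lemma sqnorm_eq_integral:
  assumes "integrable N (\<lambda>x. (norm (f x))\<^sup>2)"
  shows "sqnorm N f = ennreal (\<integral>x. (norm (f x))\<^sup>2 \<partial>N)"
  unfolding sqnorm_def using assms by (intro nn_integral_eq_integral) auto

lemma sqnorm_eq_0_iff:
  assumes [measurable]: "f \<in> borel_measurable N"
  shows "sqnorm N f = 0 \<longleftrightarrow> (AE x in N. f x = 0)"
  unfolding sqnorm_def by (subst nn_integral_0_iff_AE) auto

lemma integrable_mult_of_squares:
  fixes f g :: "'a \<Rightarrow> real"
  assumes [measurable]: "f \<in> borel_measurable N" "g \<in> borel_measurable N"
    and "integrable N (\<lambda>x. (f x)\<^sup>2)" "integrable N (\<lambda>x. (g x)\<^sup>2)"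
  shows "integrable N (\<lambda>x. f x * g x)"
proof (rule Bochner_Integration.integrable_bound)
  show "integrable N (\<lambda>x. (f x)\<^sup>2 + (g x)\<^sup>2)" using assms by auto
  show "AE x in N. norm (f x * g x) \<le> norm ((f x)\<^sup>2 + (g x)\<^sup>2)"
  proof (rule AE_I2)
    fix x
    have "2 * \<bar>f x * g x\<bar> \<le> (f x)\<^sup>2 + (g x)\<^sup>2"
      using sum_squares_bound[of "\<bar>f x\<bar>" "\<bar>g x\<bar>"] by (simp add: abs_mult)
    then show "norm (f x * g x) \<le> norm ((f x)\<^sup>2 + (g x)\<^sup>2)" by simp
  qed
qed measurable

lemma integrable_add_square:
  fixes f g :: "'a \<Rightarrow> real"
  assumes [measurable]: "f \<in> borel_measurable N" "g \<in> borel_measurable N"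
    and "integrable N (\<lambda>x. (f x)\<^sup>2)" "integrable N (\<lambda>x. (g x)\<^sup>2)"
  shows "integrable N (\<lambda>x. (f x + g x)\<^sup>2)"
  using assms integrable_mult_of_squares[OF assms]
  by (auto simp: power2_sum mult.assoc)

lemma Cauchy_Schwarz_integral:
  fixes f g :: "'a \<Rightarrow> real"
  assumes [measurable]: "f \<in> borel_measurable N" "g \<in> borel_measurable N"
    and "integrable N (\<lambda>x. (f x)\<^sup>2)" "integrable N (\<lambda>x. (g x)\<^sup>2)"
  shows "(\<integral>x. \<bar>f x * g x\<bar> \<partial>N)\<^sup>2 \<le> (\<integral>x. (f x)\<^sup>2 \<partial>N) * (\<integral>x. (g x)\<^sup>2 \<partial>N)"
proof -
  note i = integrable_mult_of_squares[OF assms]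
  have "ennreal ((\<integral>x. \<bar>f x * g x\<bar> \<partial>N)\<^sup>2) = (\<integral>\<^sup>+x. ennreal \<bar>f x\<bar> * ennreal \<bar>g x\<bar> \<partial>N)\<^sup>2"
    using i by (simp add: ennreal_power[symmetric] nn_integral_eq_integral[symmetric] ennreal_mult[symmetric] abs_mult[symmetric])
  also have "\<dots> \<le> (\<integral>\<^sup>+x. (ennreal \<bar>f x\<bar>)\<^sup>2 \<partial>N) * (\<integral>\<^sup>+x. (ennreal \<bar>g x\<bar>)\<^sup>2 \<partial>N)"
    by (rule Cauchy_Schwarz_nn_integral) auto
  also have "\<dots> = ennreal ((\<integral>x. (f x)\<^sup>2 \<partial>N) * (\<integral>x. (g x)\<^sup>2 \<partial>N))"
    using assms by (simp add: ennreal_power ennreal_mult nn_integral_eq_integral)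
  finally show ?thesis by (simp add: integral_nonneg_AE)
qed

lemma Cauchy_Schwarz_integral':
  fixes f g :: "'a \<Rightarrow> real"
  assumes "f \<in> borel_measurable N" "g \<in> borel_measurable N"
    and "integrable N (\<lambda>x. (f x)\<^sup>2)" "integrable N (\<lambda>x. (g x)\<^sup>2)"
  shows "\<bar>\<integral>x. f x * g x \<partial>N\<bar> \<le> sqrt (\<integral>x. (f x)\<^sup>2 \<partial>N) * sqrt (\<integral>x. (g x)\<^sup>2 \<partial>N)"
proof -
  have "\<bar>\<integral>x. f x * g x \<partial>N\<bar> \<le> (\<integral>x. \<bar>f x * g x\<bar> \<partial>N)"
    using integral_norm_bound[of N "\<lambda>x. f x * g x"] by simp
  also have "\<dots> \<le> sqrt ((\<integral>x. (f x)\<^sup>2 \<partial>N) * (\<integral>x. (g x)\<^sup>2 \<partial>N))"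
    using Cauchy_Schwarz_integral[OF assms] by (intro real_le_rsqrt) auto
  finally show ?thesis by (simp add: real_sqrt_mult)
qed

lemma sqrt_integral_square_triangle:
  fixes f g :: "'a \<Rightarrow> 'b::{banach, second_countable_topology}"
  assumes [measurable]: "f \<in> borel_measurable N" "g \<in> borel_measurable N"
    and i: "integrable N (\<lambda>x. (norm (f x))\<^sup>2)" "integrable N (\<lambda>x. (norm (g x))\<^sup>2)"
  shows "sqrt (\<integral>x. (norm (f x + g x))\<^sup>2 \<partial>N) \<le> sqrt (\<integral>x. (norm (f x))\<^sup>2 \<partial>N) + sqrt (\<integral>x. (norm (g x))\<^sup>2 \<partial>N)"
proof -
  define a where "a = (\<integral>x. (norm (f x))\<^sup>2 \<partial>N)"
  define b where "b = (\<integral>x. (norm (g x))\<^sup>2 \<partial>N)"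
  have ab: "a \<ge> 0" "b \<ge> 0" unfolding a_def b_def by auto
  have m: "integrable N (\<lambda>x. norm (f x) * norm (g x))"
    by (rule integrable_mult_of_squares) (use i in auto)
  have i2: "integrable N (\<lambda>x. (norm (f x))\<^sup>2 + 2 * (norm (f x) * norm (g x)) + (norm (g x))\<^sup>2)"
    using i m by auto
  have "(\<integral>x. (norm (f x + g x))\<^sup>2 \<partial>N) \<le> (\<integral>x. (norm (f x))\<^sup>2 + 2 * (norm (f x) * norm (g x)) + (norm (g x))\<^sup>2 \<partial>N)"
  proof (rule integral_mono_AE)
    have le: "(norm (f x + g x))\<^sup>2 \<le> (norm (f x))\<^sup>2 + 2 * (norm (f x) * norm (g x)) + (norm (g x))\<^sup>2" for x
    proof -
      have "(norm (f x + g x))\<^sup>2 \<le> (norm (f x) + norm (g x))\<^sup>2"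
        by (simp add: norm_triangle_ineq power_mono)
      then show ?thesis by (simp add: power2_sum)
    qed
    show "integrable N (\<lambda>x. (norm (f x + g x))\<^sup>2)"
      by (rule Bochner_Integration.integrable_bound[OF i2]) (use le in auto)
    show "AE x in N. (norm (f x + g x))\<^sup>2 \<le> (norm (f x))\<^sup>2 + 2 * (norm (f x) * norm (g x)) + (norm (g x))\<^sup>2"
      using le by auto
  qed (use i2 in auto)
  also have "\<dots> = a + 2 * (\<integral>x. norm (f x) * norm (g x) \<partial>N) + b"
    using i m by (simp add: a_def b_def)
  also have "\<dots> \<le> a + 2 * (sqrt a * sqrt b) + b"
    using Cauchy_Schwarz_integral'[of "\<lambda>x. norm (f x)" N "\<lambda>x. norm (g x)"] i by (simp add: a_def b_def)
  also have "\<dots> = (sqrt a + sqrt b)\<^sup>2"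
    using ab by (simp add: power2_sum)
  finally show ?thesis unfolding a_def[symmetric] b_def[symmetric]
    using ab by (meson add_nonneg_nonneg real_le_lsqrt real_sqrt_ge_zero)
qed

text \<open>Squared norms obey the triangle inequality only up to a factor 2, too weak for
  convergence to the exact limit. The proof therefore compares square roots, where the reverse
  triangle inequality holds with constant 1. The distances are finite only eventually, so every
  real-valued estimate is made for large \<open>k\<close>.\<close>

lemma sqnorm_tendsto:
  fixes f :: "nat \<Rightarrow> 'a \<Rightarrow> 'b::{banach, second_countable_topology}"
  assumes [measurable]: "\<And>k. f k \<in> borel_measurable N" "g \<in> borel_measurable N"
    and lim: "(\<lambda>k. sqnorm N (\<lambda>x. f k x - g x)) \<longlonglongrightarrow> 0"
    and fin: "sqnorm N g < \<infinity>"
  shows "(\<lambda>k. sqnorm N (f k)) \<longlonglongrightarrow> sqnorm N g"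
proof -
  define d where "d k = (\<integral>x. (norm (f k x - g x))\<^sup>2 \<partial>N)" for k
  have ig: "integrable N (\<lambda>x. (norm (g x))\<^sup>2)" using fin sqnorm_finite_iff[of g N] by simp
  have "\<forall>\<^sub>F k in sequentially. sqnorm N (\<lambda>x. f k x - g x) < \<infinity>"
    using order_tendstoD(2)[OF lim, of \<infinity>] by simp
  then have ev: "\<forall>\<^sub>F k in sequentially. integrable N (\<lambda>x. (norm (f k x - g x))\<^sup>2)"
    proof eventually_elim
    case (elim k)
    then show ?case using sqnorm_finite_iff[of "\<lambda>x. f k x - g x" N] by simp
  qed
  have "(\<lambda>k. ennreal (d k)) \<longlonglongrightarrow> ennreal 0"
  proof (rule Lim_transform_eventually)
    show "(\<lambda>k. sqnorm N (\<lambda>x. f k x - g x)) \<longlonglongrightarrow> ennreal 0" using lim by simp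
    show "\<forall>\<^sub>F k in sequentially. sqnorm N (\<lambda>x. f k x - g x) = ennreal (d k)"
      using ev by eventually_elim (simp add: d_def sqnorm_eq_integral)
  qed
  then have d0: "d \<longlonglongrightarrow> 0" by (subst (asm) tendsto_ennreal_iff) (auto simp: d_def)
  define a where "a k = (\<integral>x. (norm (f k x))\<^sup>2 \<partial>N)" for k
  define A where "A = (\<integral>x. (norm (g x))\<^sup>2 \<partial>N)"
  have ev2: "\<forall>\<^sub>F k in sequentially. integrable N (\<lambda>x. (norm (f k x))\<^sup>2) \<and> \<bar>sqrt (a k) - sqrt A\<bar> \<le> sqrt (d k)"
    using ev
  proof eventually_elim
    case (elim k)
    have "sqnorm N (f k) \<le> 2 * sqnorm N (\<lambda>x. f k x - g x) + 2 * sqnorm N g"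
      using sqnorm_add_le[of "\<lambda>x. f k x - g x" N g] by simp
    also have "\<dots> < \<infinity>" using fin elim sqnorm_finite_iff[of "\<lambda>x. f k x - g x" N]
      by (simp add: ennreal_mult_less_top)
    finally have ifk: "integrable N (\<lambda>x. (norm (f k x))\<^sup>2)"
      by (subst (asm) sqnorm_finite_iff) auto
    have 1: "sqrt (a k) \<le> sqrt (d k) + sqrt A"
      using sqrt_integral_square_triangle[of "\<lambda>x. f k x - g x" N g] elim ig by (simp add: a_def A_def d_def)
    have 2: "sqrt A \<le> sqrt (d k) + sqrt (a k)"
      using sqrt_integral_square_triangle[of "\<lambda>x. g x - f k x" N "f k"] elim ifk by (simp add: a_def A_def d_def norm_minus_commute)
    show ?case using ifk 1 2 by auto
  qed
  have "(\<lambda>k. sqrt (a k) - sqrt A) \<longlonglongrightarrow> 0"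
  proof (rule Lim_null_comparison)
    show "\<forall>\<^sub>F k in sequentially. norm (sqrt (a k) - sqrt A) \<le> sqrt (d k)"
      using ev2 by eventually_elim auto
    show "(\<lambda>k. sqrt (d k)) \<longlonglongrightarrow> 0" using tendsto_real_sqrt[OF d0] by simp
  qed
  then have "(\<lambda>k. (sqrt (a k))\<^sup>2) \<longlonglongrightarrow> (sqrt A)\<^sup>2"
    by (intro tendsto_power) (simp add: LIM_zero_iff)
  then have "a \<longlonglongrightarrow> A" by (simp add: a_def[abs_def] A_def)
  then have "(\<lambda>k. ennreal (a k)) \<longlonglongrightarrow> ennreal A" by (rule tendsto_ennrealI)
  moreover have "\<forall>\<^sub>F k in sequentially. ennreal (a k) = sqnorm N (f k)"
    using ev2 by eventually_elim (simp add: a_def sqnorm_eq_integral)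
  ultimately show ?thesis using ig
    by (simp add: A_def sqnorm_eq_integral Lim_transform_eventually)
qed

lemma sqnorm_tendsto_0_le:
  assumes "\<And>k. sqnorm N (f k) \<le> g k" "g \<longlonglongrightarrow> 0"
  shows "(\<lambda>k. sqnorm N (f k)) \<longlonglongrightarrow> 0"
  by (rule tendsto_sandwich[OF _ _ tendsto_const assms(2)]) (use assms(1) in auto)

lemma ennreal_tendsto_0_lincomb:
  fixes f g :: "nat \<Rightarrow> ennreal"
  assumes "f \<longlonglongrightarrow> 0" "g \<longlonglongrightarrow> 0" "c < \<infinity>" "d < \<infinity>"
  shows "(\<lambda>k. c * f k + d * g k) \<longlonglongrightarrow> 0"
proof -
  have "(\<lambda>k. c * f k + d * g k) \<longlonglongrightarrow> c * 0 + d * 0"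
    using assms by (intro tendsto_add ennreal_tendsto_cmult) auto
  then show ?thesis by simp
qed

lemma sqnorm_tendsto_0_diff:
  fixes f :: "nat \<Rightarrow> 'a \<Rightarrow> 'b::{banach, second_countable_topology}"
  assumes [measurable]: "\<And>k. f k \<in> borel_measurable N" "\<And>k. g k \<in> borel_measurable N"
      "f' \<in> borel_measurable N" "g' \<in> borel_measurable N"
    and f: "(\<lambda>k. sqnorm N (\<lambda>x. f k x - f' x)) \<longlonglongrightarrow> 0"
    and g: "(\<lambda>k. sqnorm N (\<lambda>x. g k x - g' x)) \<longlonglongrightarrow> 0"
  shows "(\<lambda>k. sqnorm N (\<lambda>x. (f k x - g k x) - (f' x - g' x))) \<longlonglongrightarrow> 0"
proof (rule sqnorm_tendsto_0_le)
  fix k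
  show "sqnorm N (\<lambda>x. (f k x - g k x) - (f' x - g' x)) \<le> 2 * sqnorm N (\<lambda>x. f k x - f' x) + 2 * sqnorm N (\<lambda>x. g k x - g' x)"
    using sqnorm_diff_le[of "\<lambda>x. f k x - f' x" N "\<lambda>x. g k x - g' x"] by (simp add: algebra_simps)
  show "(\<lambda>k. 2 * sqnorm N (\<lambda>x. f k x - f' x) + 2 * sqnorm N (\<lambda>x. g k x - g' x)) \<longlonglongrightarrow> 0"
    by (intro ennreal_tendsto_0_lincomb f g) auto
qed

text \<open>Strong convergence gives weak convergence by Cauchy-Schwarz. This carries the test
  identities of martingales, and the means of approximating integrals, over to limits.\<close>

lemma integral_mult_tendsto:
  fixes f :: "nat \<Rightarrow> 'a \<Rightarrow> real"
  assumes [measurable]: "\<And>k. f k \<in> borel_measurable N" "g \<in> borel_measurable N" "V \<in> borel_measurable N"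
    and ifk: "\<And>k. integrable N (\<lambda>x. (f k x)\<^sup>2)" and ig: "integrable N (\<lambda>x. (g x)\<^sup>2)" and iV: "integrable N (\<lambda>x. (V x)\<^sup>2)"
    and lim: "(\<lambda>k. sqnorm N (\<lambda>x. f k x - g x)) \<longlonglongrightarrow> 0"
  shows "(\<lambda>k. \<integral>x. V x * f k x \<partial>N) \<longlonglongrightarrow> (\<integral>x. V x * g x \<partial>N)"
proof -
  have id: "integrable N (\<lambda>x. (f k x - g x)\<^sup>2)" for k
    using integrable_add_square[of "f k" N "\<lambda>x. - g x"] ifk ig by simp
  have "(\<lambda>k. ennreal (\<integral>x. (f k x - g x)\<^sup>2 \<partial>N)) \<longlonglongrightarrow> ennreal 0"
    using lim id by (simp add: sqnorm_eq_integral)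
  then have d: "(\<lambda>k. \<integral>x. (f k x - g x)\<^sup>2 \<partial>N) \<longlonglongrightarrow> 0"
    by (subst (asm) tendsto_ennreal_iff) auto
  have "(\<lambda>k. (\<integral>x. V x * f k x \<partial>N) - (\<integral>x. V x * g x \<partial>N)) \<longlonglongrightarrow> 0"
  proof (rule Lim_null_comparison)
    show "(\<lambda>k. sqrt (\<integral>x. (V x)\<^sup>2 \<partial>N) * sqrt (\<integral>x. (f k x - g x)\<^sup>2 \<partial>N)) \<longlonglongrightarrow> 0"
      using tendsto_mult_right_zero[OF tendsto_real_sqrt[OF d, simplified]] by simp
    have "(\<integral>x. V x * f k x \<partial>N) - (\<integral>x. V x * g x \<partial>N) = (\<integral>x. V x * (f k x - g x) \<partial>N)" for k
      using integrable_mult_of_squares[of V N "f k"] integrable_mult_of_squares[of V N g] ifk ig iV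
      by (simp add: right_diff_distrib)
    then show "\<forall>\<^sub>F k in sequentially. norm ((\<integral>x. V x * f k x \<partial>N) - (\<integral>x. V x * g x \<partial>N)) \<le>
        sqrt (\<integral>x. (V x)\<^sup>2 \<partial>N) * sqrt (\<integral>x. (f k x - g x)\<^sup>2 \<partial>N)"
      using Cauchy_Schwarz_integral'[of V N "\<lambda>x. f _ x - g x"] id iV by (auto intro!: always_eventually)
  qed
  then show ?thesis by (simp add: LIM_zero_iff)
qed

lemma sqnorm_dominated_tendsto:
  fixes f :: "nat \<Rightarrow> 'a \<Rightarrow> 'b::{banach, second_countable_topology}"
  assumes [measurable]: "\<And>k. f k \<in> borel_measurable N" "g \<in> borel_measurable N"
    and w: "integrable N w" "\<And>k. AE x in N. (norm (f k x - g x))\<^sup>2 \<le> w x"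
    and lim: "AE x in N. (\<lambda>k. f k x) \<longlonglongrightarrow> g x"
  shows "(\<lambda>k. sqnorm N (\<lambda>x. f k x - g x)) \<longlonglongrightarrow> 0"
proof -
  have [measurable]: "w \<in> borel_measurable N" using w by auto
  have "(\<lambda>k. \<integral>x. (norm (f k x - g x))\<^sup>2 \<partial>N) \<longlonglongrightarrow> (\<integral>x. 0 \<partial>N)"
  proof (rule integral_dominated_convergence[where w = w])
    show "AE x in N. (\<lambda>k. (norm (f k x - g x))\<^sup>2) \<longlonglongrightarrow> 0"
      using lim
    proof eventually_elim
      case (elim x)
      then have "(\<lambda>k. f k x - g x) \<longlonglongrightarrow> 0" by (simp add: LIM_zero_iff)
      from tendsto_power[OF tendsto_norm[OF this], of 2] show ?case by simp
    qed
  qed (use w in auto)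
  then have "(\<lambda>k. ennreal (\<integral>x. (norm (f k x - g x))\<^sup>2 \<partial>N)) \<longlonglongrightarrow> ennreal 0"
    by (intro tendsto_ennrealI) simp
  moreover have "integrable N (\<lambda>x. (norm (f k x - g x))\<^sup>2)" for k
    by (rule Bochner_Integration.integrable_bound[OF w(1)]) (use w(2)[of k] in auto)
  ultimately show ?thesis by (simp add: sqnorm_eq_integral)
qed

text \<open>The weights \<open>2 ^ k\<close> turn a geometric bound in mean into a pathwise geometric bound.\<close>

lemma AE_geometric_bound:
  fixes D :: "nat \<Rightarrow> 'a \<Rightarrow> ennreal"
  assumes [measurable]: "\<And>k. D k \<in> borel_measurable N"
    and le: "\<And>k. (\<integral>\<^sup>+x. D k x \<partial>N) \<le> ennreal (c * (1/4)^k)" and c: "c \<ge> 0"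
  shows "AE x in N. \<exists>b\<ge>0. \<forall>k. D k x \<le> ennreal (b * (1/2)^k)"
proof -
  have "(\<integral>\<^sup>+x. (\<Sum>k. ennreal (2^k) * D k x) \<partial>N) = (\<Sum>k. ennreal (2^k) * (\<integral>\<^sup>+x. D k x \<partial>N))"
    by (simp add: nn_integral_suminf nn_integral_cmult)
  also have "\<dots> \<le> (\<Sum>k. ennreal (c * (1/2)^k))"
  proof (rule suminf_le)
    fix k
    have "ennreal (2^k) * (\<integral>\<^sup>+x. D k x \<partial>N) \<le> ennreal (2^k) * ennreal (c * (1/4)^k)"
      by (intro mult_left_mono le) auto
    also have "\<dots> = ennreal (c * (1/2)^k)"
      using c by (simp add: ennreal_mult[symmetric] field_simps power_mult_distrib[symmetric])
    finally show "ennreal (2^k) * (\<integral>\<^sup>+x. D k x \<partial>N) \<le> ennreal (c * (1/2)^k)" .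
  qed auto
  also have "\<dots> = ennreal (\<Sum>k. c * (1/2)^k)"
    using c by (intro suminf_ennreal2) (auto intro!: summable_mult summable_geometric)
  finally have "(\<integral>\<^sup>+x. (\<Sum>k. ennreal (2^k) * D k x) \<partial>N) \<noteq> \<infinity>"
    by (auto simp: top_unique)
  then have "AE x in N. (\<Sum>k. ennreal (2^k) * D k x) \<noteq> \<infinity>"
    by (intro nn_integral_PInf_AE) auto
  then show ?thesis
  proof eventually_elim
    case (elim x)
    define b where "b = enn2real (\<Sum>k. ennreal (2^k) * D k x)"
    have b: "(\<Sum>k. ennreal (2^k) * D k x) = ennreal b"
      unfolding b_def using elim by (simp add: less_top)
    have "b \<ge> 0" by (simp add: b_def)
    have "D k x \<le> ennreal (b * (1/2)^k)" for k
    proof -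
      have "ennreal (2^k) * D k x \<le> ennreal b"
        unfolding b[symmetric] using sum_le_suminf[of "\<lambda>k. ennreal (2^k) * D k x" "{k}"] by simp
      then have "ennreal ((1/2)^k) * (ennreal (2^k) * D k x) \<le> ennreal ((1/2)^k) * ennreal b"
        by (rule mult_left_mono) auto
      then show ?thesis
        using \<open>b \<ge> 0\<close> by (simp add: mult.assoc[symmetric] ennreal_mult''[symmetric] power_mult_distrib[symmetric] mult.commute[of b])
    qed
    with \<open>b \<ge> 0\<close> show ?case by blast
  qed
qed

lemma summable_sqrt_half_power: "summable (\<lambda>k. sqrt (b * (1/2)^k))"
proof -
  have "sqrt (b * (1/2)^k) = sqrt b * (sqrt (1/2))^k" for k
    by (simp add: real_sqrt_mult real_sqrt_power)
  then show ?thesis by (auto intro!: summable_mult summable_geometric simp: real_sqrt_divide)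
qed

text \<open>The square roots of a geometric bound are still summable, so the M-test applies to the
  telescoping increments. With \<open>S\<close> a singleton this gives pointwise limits, with
  \<open>S\<close> the time interval it gives continuous limit paths.\<close>

lemma uniformly_convergent_on_geometric:
  fixes x :: "nat \<Rightarrow> 'a \<Rightarrow> 'b::banach"
  assumes le: "\<And>k t. t \<in> S \<Longrightarrow> (norm (x (Suc k) t - x k t))\<^sup>2 \<le> b * (1/2)^k"
  shows "uniformly_convergent_on S x"
proof -
  have "uniformly_convergent_on S (\<lambda>n t. \<Sum>k<n. x (Suc k) t - x k t)"
  proof (rule Weierstrass_m_test')
    show "norm (x (Suc n) t - x n t) \<le> sqrt (b * (1/2)^n)" if "t \<in> S" for n t
      using le[OF that, of n] by (intro real_le_rsqrt) auto
  qed (rule summable_sqrt_half_power)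
  then obtain y where "uniform_limit S (\<lambda>n t. \<Sum>k<n. x (Suc k) t - x k t) y sequentially"
    by (auto simp: uniformly_convergent_on_def)
  then have "uniform_limit S (\<lambda>n t. x n t - x 0 t) y sequentially"
    by (simp add: sum_lessThan_telescope[of "\<lambda>k. x k _"])
  moreover have "uniform_limit S (\<lambda>n. x 0) (x 0) sequentially" by (rule uniform_limit_const)
  ultimately have "uniform_limit S (\<lambda>n t. x n t - x 0 t + x 0 t) (\<lambda>t. y t + x 0 t) sequentially"
    by (rule uniform_limit_add)
  then
  have "uniform_limit S x (\<lambda>t. y t + x 0 t) sequentially"
    by simp
  then show ?thesis by (auto simp: uniformly_convergent_on_def)
qed

section \<open>Completeness of L^2 over a sub-sigma-algebra\<close>

definition sqnorm_Cauchy :: "'a measure \<Rightarrow> (nat \<Rightarrow> 'a \<Rightarrow> 'b::{banach, second_countable_topology}) \<Rightarrow> bool" where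
  "sqnorm_Cauchy N f \<longleftrightarrow> (\<forall>e>0. \<exists>K. \<forall>m\<ge>K. \<forall>n\<ge>K. sqnorm N (\<lambda>x. f m x - f n x) \<le> e)"

text \<open>Fatou's lemma: the distance from \<open>f n\<close> to the pointwise limit is at most
  the lower limit of the distances from \<open>f n\<close> to \<open>f (r k)\<close>, which the
  Cauchy property makes small.\<close>

lemma sqnorm_Cauchy_AE_limit:
  fixes f :: "nat \<Rightarrow> 'a \<Rightarrow> 'b::{banach, second_countable_topology}"
  assumes [measurable]: "\<And>k. f k \<in> borel_measurable N"
    and Cauchy: "sqnorm_Cauchy N f" and rge: "\<And>k. r k \<ge> k"
    and conv: "AE x in N. (\<lambda>k. f (r k) x) \<longlonglongrightarrow> g x"
  shows "(\<lambda>k. sqnorm N (\<lambda>x. f k x - g x)) \<longlonglongrightarrow> 0"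
proof (rule tendsto_zero_ennreal)
  fix e :: real assume e: "0 < e"
  then have "\<exists>K. \<forall>m\<ge>K. \<forall>n\<ge>K. sqnorm N (\<lambda>x. f m x - f n x) \<le> ennreal (e/2)"
    using Cauchy unfolding sqnorm_Cauchy_def by simp
  then obtain K' where K': "\<And>m n. m \<ge> K' \<Longrightarrow> n \<ge> K' \<Longrightarrow> sqnorm N (\<lambda>x. f m x - f n x) \<le> ennreal (e/2)"
    by metis
  have "sqnorm N (\<lambda>x. f n x - g x) < e" if "n \<ge> K'" for n
  proof -
    have "sqnorm N (\<lambda>x. f n x - g x) \<le> (\<integral>\<^sup>+x. liminf (\<lambda>k. ennreal ((norm (f n x - f (r k) x))\<^sup>2)) \<partial>N)"
      unfolding sqnorm_def
    proof (rule nn_integral_mono_AE, use conv in eventually_elim)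
      case (elim x)
      then have "(\<lambda>k. ennreal ((norm (f n x - f (r k) x))\<^sup>2)) \<longlonglongrightarrow> ennreal ((norm (f n x - g x))\<^sup>2)"
        by (intro tendsto_ennrealI tendsto_power tendsto_norm tendsto_diff tendsto_const)
      from lim_imp_Liminf[OF sequentially_bot this] show ?case by simp
    qed
    also have "\<dots> \<le> liminf (\<lambda>k. sqnorm N (\<lambda>x. f n x - f (r k) x))"
      unfolding sqnorm_def by (rule nn_integral_liminf) auto
    also have "\<dots> \<le> liminf (\<lambda>k. ennreal (e/2))"
    proof (rule Liminf_mono)
      show "\<forall>\<^sub>F k in sequentially. sqnorm N (\<lambda>x. f n x - f (r k) x) \<le> ennreal (e/2)"
        using eventually_ge_at_top[of K'] by eventually_elim (use K' that rge in \<open>meson order_trans\<close>)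
    qed
    also have "\<dots> = ennreal (e/2)" by (simp add: Liminf_const)
    also have "\<dots> < e" using e by (simp add: ennreal_lessI)
    finally show ?thesis .
  qed
  then show "\<forall>\<^sub>F n in sequentially. sqnorm N (\<lambda>x. f n x - g x) < ennreal e"
    using eventually_sequentially by blast
qed

text \<open>Beyond completeness, the limit is measurable for the smaller \<open>G\<close>, because
  it is the everywhere defined pointwise \<open>lim\<close> of \<open>G\<close>-measurable
  functions. With \<open>G\<close> predictable this yields the integrand \<open>Z\<close>, with
  \<open>G\<close> progressive the fixed point of the driver map.\<close>

theorem Riesz_Fischer:
  fixes f :: "nat \<Rightarrow> 'a \<Rightarrow> 'b::{banach, second_countable_topology}"
  assumes sub: "subalgebra N G" and fG: "\<And>k. f k \<in> borel_measurable G"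
    and Cauchy: "sqnorm_Cauchy N f"
  obtains g where "g \<in> borel_measurable G" "(\<lambda>k. sqnorm N (\<lambda>x. f k x - g x)) \<longlonglongrightarrow> 0"
proof -
  have fN[measurable]: "f k \<in> borel_measurable N" for k by (rule measurable_from_subalg[OF sub fG])
  have "\<exists>K. \<forall>m\<ge>K. \<forall>n\<ge>K. sqnorm N (\<lambda>x. f m x - f n x) \<le> ennreal ((1/4)^k)" for k
    using Cauchy unfolding sqnorm_Cauchy_def by (simp add: ennreal_zero_less_one)
  then obtain K where K: "\<And>k m n. m \<ge> K k \<Longrightarrow> n \<ge> K k \<Longrightarrow> sqnorm N (\<lambda>x. f m x - f n x) \<le> ennreal ((1/4)^k)"
    by metis
  \<comment> \<open>The sum dominates every \<open>K j\<close> with j \<le> k, which makes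
    \<open>r\<close> monotone and at least \<open>K k\<close>; the summand \<open>k\<close> pushes
    it to infinity.\<close>
  define r where "r k = k + (\<Sum>j\<le>k. K j)" for k
  have rK: "r k \<ge> K k" for k unfolding r_def by (simp add: sum.remove[of "{..k}" k])
  have rmono: "r k \<le> r (Suc k)" for k unfolding r_def by simp
  have rge: "r k \<ge> k" for k unfolding r_def by simp
  have "AE x in N. \<exists>b\<ge>0. \<forall>k. ennreal ((norm (f (r (Suc k)) x - f (r k) x))\<^sup>2) \<le> ennreal (b * (1/2)^k)"
  proof (rule AE_geometric_bound[where c = 1])
    fix k
    have "r (Suc k) \<ge> K k" using rK[of k] rmono[of k] by simp
    then show "(\<integral>\<^sup>+x. ennreal ((norm (f (r (Suc k)) x - f (r k) x))\<^sup>2) \<partial>N) \<le> ennreal (1 * (1/4)^k)"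
      using K[of k "r (Suc k)" "r k"] rK by (simp add: sqnorm_def)
  qed auto
  then have conv: "AE x in N. convergent (\<lambda>k. f (r k) x)"
  proof eventually_elim
    case (elim x)
    then obtain b where b: "b \<ge> 0" "\<And>k. (norm (f (r (Suc k)) x - f (r k) x))\<^sup>2 \<le> b * (1/2)^k"
      by (auto simp: ennreal_le_iff)
    have "uniformly_convergent_on {x} (\<lambda>k x. f (r k) x)"
      by (rule uniformly_convergent_on_geometric[of _ _ b]) (use b in auto)
    then show ?case
      by (auto simp: uniformly_convergent_on_def convergent_def dest!: tendsto_uniform_limitI[where x = x])
  qed
  define g where "g x = lim (\<lambda>k. f (r k) x)" for x
  have g: "g \<in> borel_measurable G" unfolding g_def using fG by measurable
  have "AE x in N. (\<lambda>k. f (r k) x) \<longlonglongrightarrow> g x"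
    using conv by eventually_elim (simp add: g_def convergent_LIMSEQ_iff)
  from sqnorm_Cauchy_AE_limit[OF fN Cauchy rge this] g show ?thesis by (intro that)
qed

text \<open>The ratio 1/4 pays for the factor 2 of the squared triangle inequality: the bound 4c
  (1/4)^k reproduces itself, since 2 * 4c (1/4)^(k+1) + 2c (1/4)^k = 4c (1/4)^k. Going from two
  indices through a common \<open>K\<close> doubles two such bounds, hence 16.\<close>

lemma sqnorm_Cauchy_geometric:
  fixes f :: "nat \<Rightarrow> 'a \<Rightarrow> 'b::{banach, second_countable_topology}"
  assumes [measurable]: "\<And>k. f k \<in> borel_measurable N"
    and le: "\<And>k. sqnorm N (\<lambda>x. f (Suc k) x - f k x) \<le> ennreal (c * (1/4)^k)" and c: "c \<ge> 0"
  shows "sqnorm_Cauchy N f"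
proof -
  have *: "sqnorm N (\<lambda>x. f (k + m) x - f k x) \<le> ennreal (4 * c * (1/4)^k)" for k m
  proof (induction m arbitrary: k)
    case 0
    then show ?case by (simp add: sqnorm_def)
  next
    case (Suc m)
    have "sqnorm N (\<lambda>x. f (k + Suc m) x - f k x) \<le> 2 * sqnorm N (\<lambda>x. f (Suc k + m) x - f (Suc k) x) + 2 * sqnorm N (\<lambda>x. f (Suc k) x - f k x)"
      using sqnorm_diff_triangle[of "f (k + Suc m)" N "f (Suc k)" "f k"] by simp
    also have "\<dots> \<le> 2 * ennreal (4 * c * (1/4)^Suc k) + 2 * ennreal (c * (1/4)^k)"
      by (intro add_mono mult_left_mono Suc le) auto
    also have "\<dots> = ennreal (4 * c * (1/4)^k)"
      using c by (simp add: ennreal_mult[symmetric] ennreal_plus[symmetric] flip: ennreal_numeral del: ennreal_plus)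
    finally show ?case .
  qed
  show ?thesis unfolding sqnorm_Cauchy_def
  proof (intro allI impI)
    fix e :: ennreal assume e: "e > 0"
    have "(\<lambda>k. ennreal (16 * c * (1/4)^k)) \<longlonglongrightarrow> ennreal 0"
      by (intro tendsto_ennrealI tendsto_mult_right_zero LIMSEQ_power_zero) auto
    then have "\<forall>\<^sub>F k in sequentially. ennreal (16 * c * (1/4)^k) < e"
      using order_tendstoD(2)[of "\<lambda>k. ennreal (16 * c * (1/4)^k)" 0 sequentially e] e by simp
    then obtain K where K: "ennreal (16 * c * (1/4)^K) < e"
      by (auto simp: eventually_sequentially)
    show "\<exists>K. \<forall>m\<ge>K. \<forall>n\<ge>K. sqnorm N (\<lambda>x. f m x - f n x) \<le> e"
    proof (intro exI allI impI)
      fix m n assume mn: "m \<ge> K" "n \<ge> K"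
      have "sqnorm N (\<lambda>x. f m x - f n x) \<le> 2 * sqnorm N (\<lambda>x. f m x - f K x) + 2 * sqnorm N (\<lambda>x. f K x - f n x)"
        by (rule sqnorm_diff_triangle) auto
      also have "\<dots> \<le> 2 * ennreal (4 * c * (1/4)^K) + 2 * ennreal (4 * c * (1/4)^K)"
        using *[of K "m - K"] *[of K "n - K"] mn
        by (intro add_mono mult_left_mono) (auto simp: sqnorm_minus_commute[of N "f K"])
      also have "\<dots> = ennreal (16 * c * (1/4)^K)"
        using c by (simp add: ennreal_mult[symmetric] ennreal_plus[symmetric] flip: ennreal_numeral del: ennreal_plus)
      finally show "sqnorm N (\<lambda>x. f m x - f n x) \<le> e" using K by simp
    qed
  qed
qed

section \<open>The augmented Brownian filtration\<close>

lemma borel_measurable_vec_nth [measurable (raw)]: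
  fixes f :: "'a \<Rightarrow> real ^ 'n"
  assumes "f \<in> borel_measurable N"
  shows "(\<lambda>x. f x $ i) \<in> borel_measurable N"
  using measurable_compose[OF assms, of "\<lambda>v. v $ i" borel]
  by (simp add: borel_measurable_continuous_onI continuous_on_component)

text \<open>Agreement with a member of \<open>G\<close> up to null sets survives complements and
  countable unions. Completeness turns the two differences, known only to lie inside null sets, into
  null sets themselves.\<close>

lemma (in complete_measure) sigma_sets_augment:
  assumes G: "sigma_algebra (space M) G" "G \<subseteq> sets M"
    and A: "A \<in> sigma_sets (space M) (G \<union> null_sets M)"
  shows "\<exists>A'\<in>G. A - A' \<in> null_sets M \<and> A' - A \<in> null_sets M"
  using A
proof (induction A)
  interpret G: sigma_algebra "space M" G by fact
  {
    case (Basic a)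
    then show ?case
    proof
      assume "a \<in> null_sets M"
      then show ?thesis by (intro bexI[of _ "{}"]) auto
    next
      assume "a \<in> G"
      then show ?thesis by (intro bexI[of _ a]) auto
    qed
  next
    case Empty
    then show ?case by (intro bexI[of _ "{}"]) auto
  next
    case (Compl a)
    then obtain a' where a': "a' \<in> G" "a - a' \<in> null_sets M" "a' - a \<in> null_sets M" by auto
    show ?case
    proof (intro bexI[of _ "space M - a'"] conjI)
      show "space M - a - (space M - a') \<in> null_sets M" using a'(3) by (rule complete2[rotated]) auto
      show "space M - a' - (space M - a) \<in> null_sets M" using a'(2) by (rule complete2[rotated]) auto
    qed (use a' in auto)
  next
    case (Union a)
    then have "\<forall>i. \<exists>A'. A' \<in> G \<and> a i - A' \<in> null_sets M \<and> A' - a i \<in> null_sets M" by auto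
    then obtain a' where a': "\<And>i::nat. a' i \<in> G" "\<And>i. a i - a' i \<in> null_sets M" "\<And>i. a' i - a i \<in> null_sets M"
      by metis
    show ?case
    proof (intro bexI[of _ "\<Union>i. a' i"] conjI)
      show "(\<Union>i. a i) - (\<Union>i. a' i) \<in> null_sets M"
        by (rule complete2[of _ "\<Union>i. a i - a' i"]) (use a' in auto)
      show "(\<Union>i. a' i) - (\<Union>i. a i) \<in> null_sets M"
        by (rule complete2[of _ "\<Union>i. a' i - a i"]) (use a' in auto)
    qed (use a' in auto)
  }
qed

text \<open>The preimages under \<open>X\<close> and \<open>X'\<close> differ only inside the
  exceptional null set, all of whose subsets belong to \<open>N\<close> by completeness. Thus
  versions can be altered on a null set without losing adaptedness.\<close>

lemma (in complete_measure) measurable_AE_cong: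
  fixes X X' :: "'a \<Rightarrow> 'x::topological_space"
  assumes N: "space N = space M" "null_sets M \<subseteq> sets N"
    and X: "X \<in> borel_measurable N" and eq: "AE \<omega> in M. X \<omega> = X' \<omega>"
  shows "X' \<in> borel_measurable N"
proof (rule measurableI)
  fix A :: "'x set" assume A: "A \<in> sets borel"
  define D where "D = {\<omega>\<in>space M. X \<omega> \<noteq> X' \<omega>}"
  have D: "D \<in> null_sets M" using eq unfolding D_def by (simp add: AE_iff_null_sets)
  have eq': "X' -` A \<inter> space M = (X -` A \<inter> space M - D) \<union> (X' -` A \<inter> D)"
    by (auto simp: D_def)
  have "X' -` A \<inter> D \<in> null_sets M" using D by (rule complete2[rotated]) auto
  then have "X' -` A \<inter> D \<in> sets N" "D \<in> sets N" using N(2) D by blast+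
  moreover have "X -` A \<inter> space M \<in> sets N" using measurable_sets[OF X A] N(1) by simp
  ultimately show "X' -` A \<inter> space N \<in> sets N"
    unfolding N(1) eq' by (intro sets.Un sets.Diff)
qed auto

locale brownian = prob_space M for M :: "'w measure" +
  fixes T :: real and B :: "real \<Rightarrow> 'w \<Rightarrow> real ^ 'd"
  assumes complete_measure: "complete_measure M"
    and T_pos: "0 < T"
    and BM: "brownian_motion M T B"
begin

sublocale complete_measure M by (rule complete_measure)

abbreviation F :: "real \<Rightarrow> 'w measure" where "F \<equiv> augmented_filtration M B"

lemma space_natural_filtration [simp]: "space (natural_filtration M B t) = space M"
  unfolding natural_filtration_def by (rule space_measure_of) (auto simp: sets_vimage_algebra2)

lemma natural_filtration_gen_subset:
  "(\<Union>s\<in>{0..t}. sets (vimage_algebra (space M) (B s) borel)) \<subseteq> Pow (space M)"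
  by (auto simp: sets_vimage_algebra2)

lemma sets_natural_filtration:
  "sets (natural_filtration M B t) = sigma_sets (space M) (\<Union>s\<in>{0..t}. sets (vimage_algebra (space M) (B s) borel))"
  unfolding natural_filtration_def by (rule sets_measure_of[OF natural_filtration_gen_subset])

lemma augmented_gen_subset: "sets (natural_filtration M B t) \<union> null_sets M \<subseteq> Pow (space M)"
  using sets.space_closed[of "natural_filtration M B t"] sets.space_closed[of M] by auto

lemma space_F [simp]: "space (F t) = space M"
  unfolding augmented_filtration_def by (rule space_measure_of[OF augmented_gen_subset])

lemma sets_F: "sets (F t) = sigma_sets (space M) (sets (natural_filtration M B t) \<union> null_sets M)"
  unfolding augmented_filtration_def by (rule sets_measure_of[OF augmented_gen_subset])

lemma null_sets_F: "N \<in> null_sets M \<Longrightarrow> N \<in> sets (F t)"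
  unfolding sets_F by auto

lemma B_measurable_M [measurable (raw)]: "0 \<le> s \<Longrightarrow> s \<le> T \<Longrightarrow> B s \<in> borel_measurable M"
  using BM unfolding brownian_motion_def by auto

lemma natural_filtration_subset_M:
  assumes "t \<le> T" shows "sets (natural_filtration M B t) \<subseteq> sets M"
  unfolding sets_natural_filtration
proof (rule sets.sigma_sets_subset, safe)
  fix s X assume s: "s \<in> {0..t}" "X \<in> sets (vimage_algebra (space M) (B s) borel)"
  then have "B s \<in> borel_measurable M" using assms by auto
  with s show "X \<in> sets M" by (auto simp: sets_vimage_algebra2 measurable_sets)
qed

lemma sets_F_subset_M: assumes "t \<le> T" shows "sets (F t) \<subseteq> sets M"
  unfolding sets_F using natural_filtration_subset_M[OF assms] by (intro sets.sigma_sets_subset) auto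

lemma subalgebra_F: "t \<le> T \<Longrightarrow> subalgebra M (F t)"
  unfolding subalgebra_def using sets_F_subset_M by auto

lemma F_measurable_M: "t \<le> T \<Longrightarrow> X \<in> borel_measurable (F t) \<Longrightarrow> X \<in> borel_measurable M"
  using measurable_from_subalg[OF subalgebra_F] .

lemma natural_filtration_mono: "s \<le> t \<Longrightarrow> sets (natural_filtration M B s) \<subseteq> sets (natural_filtration M B t)"
  unfolding sets_natural_filtration by (rule sigma_sets_mono', rule UN_mono) auto

lemma sets_F_mono: "s \<le> t \<Longrightarrow> sets (F s) \<subseteq> sets (F t)"
  unfolding sets_F using natural_filtration_mono[of s t] by (intro sigma_sets_mono') auto

lemma subalgebra_F_mono: "s \<le> t \<Longrightarrow> subalgebra (F t) (F s)"
  unfolding subalgebra_def using sets_F_mono by auto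

lemma F_measurable_mono: "s \<le> t \<Longrightarrow> X \<in> borel_measurable (F s) \<Longrightarrow> X \<in> borel_measurable (F t)"
  using measurable_from_subalg[OF subalgebra_F_mono] .

lemma B_measurable_F: assumes "0 \<le> s" "s \<le> t" shows "B s \<in> borel_measurable (F t)"
proof (rule measurableI)
  fix A :: "(real ^ 'd) set" assume "A \<in> sets borel"
  then have "B s -` A \<inter> space M \<in> sets (vimage_algebra (space M) (B s) borel)"
    by (auto simp: sets_vimage_algebra2)
  then have "B s -` A \<inter> space M \<in> sets (natural_filtration M B t)"
    unfolding sets_natural_filtration using assms by (intro sigma_sets.Basic UN_I[of s]) auto
  then show "B s -` A \<inter> space (F t) \<in> sets (F t)" unfolding sets_F by auto
qed auto

lemma F_measurable_AE:
  fixes X X' :: "'w \<Rightarrow> 'x::topological_space"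
  assumes "X \<in> borel_measurable (F t)" "AE \<omega> in M. X \<omega> = X' \<omega>"
  shows "X' \<in> borel_measurable (F t)"
  using measurable_AE_cong[OF _ _ assms] null_sets_F[of _ t] by auto

lemma AE_B_continuous: "AE \<omega> in M. continuous_on {0..T} (\<lambda>t. B t \<omega>)"
  using BM unfolding brownian_motion_def by auto

section \<open>Increments of the Brownian motion\<close>

lemma increment_natural_indep:
  assumes "0 \<le> s" "s < t" "t \<le> T"
  shows "indep_set (sets (natural_filtration M B s)) (sets (vimage_algebra (space M) (\<lambda>\<omega>. B t \<omega> - B s \<omega>) borel))"
  using BM assms unfolding brownian_motion_def by auto

text \<open>The definition of Brownian motion speaks of the natural filtration. An event of the
  augmented one agrees with a natural event up to null sets, and this changes no
  probability.\<close>

lemma increment_indep_prob: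
  assumes st: "0 \<le> s" "s < t" "t \<le> T" and A: "A \<in> sets (F s)" and C: "C \<in> sets borel"
  shows "prob (A \<inter> ((\<lambda>\<omega>. B t \<omega> - B s \<omega>) -` C \<inter> space M)) = prob A * prob ((\<lambda>\<omega>. B t \<omega> - B s \<omega>) -` C \<inter> space M)"
proof -
  let ?D = "(\<lambda>\<omega>. B t \<omega> - B s \<omega>) -` C \<inter> space M"
  have [measurable]: "B s \<in> borel_measurable M" "B t \<in> borel_measurable M" using st by auto
  have D: "?D \<in> sets M" using C by measurable
  have nat: "sets (natural_filtration M B s) \<subseteq> sets M" using natural_filtration_subset_M st by auto
  obtain A' where A': "A' \<in> sets (natural_filtration M B s)" "A - A' \<in> null_sets M" "A' - A \<in> null_sets M"
    using sigma_sets_augment[OF _ nat] A sets.sigma_algebra_axioms[of "natural_filtration M B s"] unfolding sets_F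
    by auto
  have AM: "A \<in> sets M" "A' \<in> sets M" using sets_F_subset_M[of s] st A A' nat by auto
  have AE: "AE \<omega> in M. \<omega> \<in> A \<longleftrightarrow> \<omega> \<in> A'"
    using AE_not_in[OF A'(2)] AE_not_in[OF A'(3)] by eventually_elim auto
  have "prob (A \<inter> ?D) = prob (A' \<inter> ?D)"
    by (rule finite_measure_eq_AE) (use AE D AM in auto)
  also have "\<dots> = prob A' * prob ?D"
    by (rule indep_setD[OF increment_natural_indep[OF st] A'(1)]) (use C in \<open>auto simp: sets_vimage_algebra2\<close>)
  also have "prob A' = prob A"
    by (rule finite_measure_eq_AE) (use AE AM in auto)
  finally show ?thesis .
qed

lemma increment_indep_var:
  fixes X :: "'w \<Rightarrow> real" and u :: "real ^ 'd \<Rightarrow> real"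
  assumes st: "0 \<le> s" "s < t" "t \<le> T" and X: "X \<in> borel_measurable (F s)"
    and u: "u \<in> borel_measurable borel"
  shows "indep_var borel X borel (\<lambda>\<omega>. u (B t \<omega> - B s \<omega>))"
  unfolding indep_var_eq
proof (intro conjI indep_setI)
  let ?U = "\<lambda>\<omega>. u (B t \<omega> - B s \<omega>)"
  note u[measurable]
  have [measurable]: "B s \<in> borel_measurable M" "B t \<in> borel_measurable M" using st by auto
  show XM: "random_variable borel X" using F_measurable_M[OF _ X] st by auto
  show D: "random_variable borel ?U" by measurable
  \<comment> \<open>Preimages of Borel sets already form a sigma-algebra, so every member of the
    generated one is a single preimage.\<close>
  have vimage_eq: "sigma_sets (space M) {Y -` A \<inter> space M |A. A \<in> sets borel} = {Y -` A \<inter> space M |A. A \<in> sets borel}"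
    for Y :: "'w \<Rightarrow> real"
    using sets_vimage_algebra[of "space M" Y borel] sets_vimage_algebra2[of Y "space M" borel] by simp
  show "sigma_sets (space M) {X -` A \<inter> space M |A. A \<in> sets borel} \<subseteq> events"
    unfolding vimage_eq using XM by (auto simp: measurable_sets)
  show "sigma_sets (space M) {?U -` A \<inter> space M |A. A \<in> sets borel} \<subseteq> events"
    unfolding vimage_eq using D by (auto simp: measurable_sets)
  fix a b assume "a \<in> sigma_sets (space M) {X -` A \<inter> space M |A. A \<in> sets borel}"
    "b \<in> sigma_sets (space M) {?U -` A \<inter> space M |A. A \<in> sets borel}"
  then obtain A C where A: "A \<in> sets borel" "a = X -` A \<inter> space M" and C: "C \<in> sets borel" "b = ?U -` C \<inter> space M"
    unfolding vimage_eq by auto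
  have b: "b = (\<lambda>\<omega>. B t \<omega> - B s \<omega>) -` (u -` C) \<inter> space M" using C by auto
  have uC: "u -` C \<in> sets borel" using measurable_sets[OF u C(1)] by simp
  show "prob (a \<inter> b) = prob a * prob b"
    unfolding b by (rule increment_indep_prob[OF st _ uC]) (use measurable_sets[OF X A(1)] A in simp)
qed

text \<open>The case s = t is included, where the definition of Brownian motion is silent: the
  increment is then identically 0 and \<open>u\<close> contributes a constant. Clamped partitions
  produce such empty steps.\<close>

lemma increment_indep_integral:
  fixes X :: "'w \<Rightarrow> real" and u :: "real ^ 'd \<Rightarrow> real"
  assumes st: "0 \<le> s" "s \<le> t" "t \<le> T" and X: "X \<in> borel_measurable (F s)" "integrable M X"
    and u: "u \<in> borel_measurable borel" "integrable M (\<lambda>\<omega>. u (B t \<omega> - B s \<omega>))"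
  shows "integrable M (\<lambda>\<omega>. X \<omega> * u (B t \<omega> - B s \<omega>))"
    and "(\<integral>\<omega>. X \<omega> * u (B t \<omega> - B s \<omega>) \<partial>M) = (\<integral>\<omega>. X \<omega> \<partial>M) * (\<integral>\<omega>. u (B t \<omega> - B s \<omega>) \<partial>M)"
proof -
  consider "s = t" | "s < t" using st by fastforce
  then have "integrable M (\<lambda>\<omega>. X \<omega> * u (B t \<omega> - B s \<omega>)) \<and>
    (\<integral>\<omega>. X \<omega> * u (B t \<omega> - B s \<omega>) \<partial>M) = (\<integral>\<omega>. X \<omega> \<partial>M) * (\<integral>\<omega>. u (B t \<omega> - B s \<omega>) \<partial>M)"
  proof cases
    case 1
    then show ?thesis using X by (simp add: prob_space)
  next
    case 2
    note i = increment_indep_var[OF st(1) 2 st(3) X(1) u(1)]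
    show ?thesis
      using indep_var_integrable[OF i] indep_var_lebesgue_integral[OF i] X u by auto
  qed
  then show "integrable M (\<lambda>\<omega>. X \<omega> * u (B t \<omega> - B s \<omega>))"
    and "(\<integral>\<omega>. X \<omega> * u (B t \<omega> - B s \<omega>) \<partial>M) = (\<integral>\<omega>. X \<omega> \<partial>M) * (\<integral>\<omega>. u (B t \<omega> - B s \<omega>) \<partial>M)" by auto
qed

lemma increment_distributed:
  assumes "0 \<le> s" "s < t" "t \<le> T"
  shows "distributed M lborel (\<lambda>\<omega>. (B t \<omega> - B s \<omega>) $ i) (normal_density 0 (sqrt (t - s)))"
  using BM assms unfolding brownian_motion_def by blast

lemma increment_components_indep:
  assumes "0 \<le> s" "s < t" "t \<le> T"
  shows "indep_vars (\<lambda>_. borel) (\<lambda>i \<omega>. (B t \<omega> - B s \<omega>) $ i) UNIV"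
  using BM assms unfolding brownian_motion_def by blast

lemma increment_moment:
  assumes st: "0 \<le> s" "s < t" "t \<le> T"
  shows "integrable M (\<lambda>\<omega>. ((B t \<omega> - B s \<omega>) $ i) ^ k)"
    and "(\<integral>\<omega>. ((B t \<omega> - B s \<omega>) $ i) ^ k \<partial>M) = (\<integral>x. normal_density 0 (sqrt (t - s)) x * x ^ k \<partial>lborel)"
proof -
  note D = increment_distributed[OF st, of i]
  show "integrable M (\<lambda>\<omega>. ((B t \<omega> - B s \<omega>) $ i) ^ k)"
    using distributed_integrable[OF D, of "\<lambda>x. x ^ k"] integrable_normal_moment[of "sqrt (t - s)" 0 k] st by simp
  show "(\<integral>\<omega>. ((B t \<omega> - B s \<omega>) $ i) ^ k \<partial>M) = (\<integral>x. normal_density 0 (sqrt (t - s)) x * x ^ k \<partial>lborel)"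
    using distributed_integral[OF D, of "\<lambda>x. x ^ k"] by simp
qed

lemma increment_integrable_power:
  assumes st: "0 \<le> s" "s \<le> t" "t \<le> T"
  shows "integrable M (\<lambda>\<omega>. ((B t \<omega> - B s \<omega>) $ i) ^ k)"
  using increment_moment(1)[of s t i k] st by (cases "s = t") (auto)

lemma increment_mean:
  assumes st: "0 \<le> s" "s \<le> t" "t \<le> T"
  shows "(\<integral>\<omega>. (B t \<omega> - B s \<omega>) $ i \<partial>M) = 0"
proof (cases "s = t")
  case False
  then have st': "s < t" using st by auto
  show ?thesis
    using increment_moment(2)[OF st(1) st' st(3), of i 1] integral_normal_moment_odd[of "sqrt (t - s)" 0 0] st'
    by simp
qed auto

lemma increment_variance:
  assumes st: "0 \<le> s" "s \<le> t" "t \<le> T"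
  shows "(\<integral>\<omega>. ((B t \<omega> - B s \<omega>) $ i)\<^sup>2 \<partial>M) = t - s"
proof (cases "s = t")
  case False
  then have st': "s < t" using st by auto
  show ?thesis
    using increment_moment(2)[OF st(1) st' st(3), of i 2] integral_normal_moment_even[of "sqrt (t - s)" 0 1] st'
    by simp
qed auto

lemma increment_fourth_moment:
  assumes st: "0 \<le> s" "s \<le> t" "t \<le> T"
  shows "(\<integral>\<omega>. ((B t \<omega> - B s \<omega>) $ i)^4 \<partial>M) = 3 * (t - s)\<^sup>2"
proof (cases "s = t")
  case False
  then have st': "s < t" using st by auto
  have "(4 * (6::real)) / ((2 / (t - s))\<^sup>2 * 2) = 3 * (t - s)\<^sup>2"
    using st' by (simp add: field_simps)
  then show ?thesis
    using increment_moment(2)[OF st(1) st' st(3), of i 4] integral_normal_moment_even[of "sqrt (t - s)" 0 2] st'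
    by (simp add: fact_numeral)
qed auto

lemma increment_covariance:
  assumes st: "0 \<le> s" "s \<le> t" "t \<le> T" and ij: "i \<noteq> j"
  shows "(\<integral>\<omega>. (B t \<omega> - B s \<omega>) $ i * (B t \<omega> - B s \<omega>) $ j \<partial>M) = 0"
proof (cases "s = t")
  case False
  then have st': "s < t" using st by auto
  have "indep_vars (\<lambda>_. borel) (\<lambda>i \<omega>. (B t \<omega> - B s \<omega>) $ i) {i, j}"
    by (rule indep_vars_subset[OF increment_components_indep[OF st(1) st' st(3)]]) auto
  from indep_vars_lebesgue_integral[OF _ this]
  show ?thesis using increment_integrable_power[OF st, of _ 1] increment_mean[OF st] ij by simp
qed auto

lemma increment_integrable_mult:
  assumes st: "0 \<le> s" "s \<le> t" "t \<le> T"
  shows "integrable M (\<lambda>\<omega>. (B t \<omega> - B s \<omega>) $ i * (B t \<omega> - B s \<omega>) $ j)"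
proof (rule integrable_mult_of_squares)
  have [measurable]: "B s \<in> borel_measurable M" "B t \<in> borel_measurable M" using st by auto
  show "(\<lambda>x. (B t x - B s x) $ i) \<in> borel_measurable M" "(\<lambda>x. (B t x - B s x) $ j) \<in> borel_measurable M"
    by measurable
qed (use increment_integrable_power[OF st, of _ 2] in auto)

text \<open>Independent coordinates factor the characteristic function into one-dimensional Gaussian
  ones. The exponent found here is the compensator that later turns \<open>cos\<close> and
  \<open>sin\<close> of a stochastic integral into martingales.\<close>

lemma increment_iexp:
  fixes v :: "real ^ 'd"
  assumes st: "0 \<le> s" "s \<le> t" "t \<le> T"
  shows "(CLINT \<omega>|M. iexp (v \<bullet> (B t \<omega> - B s \<omega>))) = complex_of_real (exp (- ((norm v)\<^sup>2 * (t - s) / 2)))"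
proof (cases "s = t")
  case True
  then show ?thesis by (simp add: prob_space)
next
  case False
  then have st': "s < t" using st by auto
  have [measurable]: "B s \<in> borel_measurable M" "B t \<in> borel_measurable M" using st by auto
  have ind: "indep_vars (\<lambda>_. borel) (\<lambda>i \<omega>. v $ i * (B t \<omega> - B s \<omega>) $ i) UNIV"
    using indep_vars_compose2[OF increment_components_indep[OF st(1) st' st(3)], of "\<lambda>i x. v $ i * x" "\<lambda>_. borel"]
    by simp
  have "(CLINT \<omega>|M. iexp (v \<bullet> (B t \<omega> - B s \<omega>))) = char (distr M borel (\<lambda>\<omega>. \<Sum>i\<in>UNIV. v $ i * (B t \<omega> - B s \<omega>) $ i)) 1"
    unfolding char_def by (subst integral_distr) (auto simp: inner_vec_def)
  also have "\<dots> = (\<Prod>i\<in>UNIV. char (distr M borel (\<lambda>\<omega>. v $ i * (B t \<omega> - B s \<omega>) $ i)) 1)"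
    by (rule char_distr_sum[OF ind])
  also have "\<dots> = (\<Prod>i\<in>UNIV. complex_of_real (exp (- ((v $ i)\<^sup>2 * (t - s) / 2))))"
  proof (rule prod.cong[OF refl])
    fix i
    let ?X = "\<lambda>\<omega>. ((B t \<omega> - B s \<omega>) $ i - 0) / sqrt (t - s)"
    have X: "distributed M lborel ?X std_normal_density"
      using increment_distributed[OF st(1) st' st(3), of i] normal_standard_normal_convert[of "sqrt (t - s)" _ 0] st' by simp
    have eq: "distr M borel ?X = std_normal_distribution"
      using distributed_distr_eq_density[OF X] by (simp cong: distr_cong)
    have "char (distr M borel (\<lambda>\<omega>. v $ i * (B t \<omega> - B s \<omega>) $ i)) 1 = (CLINT \<omega>|M. iexp (v $ i * (B t \<omega> - B s \<omega>) $ i))"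
      unfolding char_def by (subst integral_distr) auto
    also have "\<dots> = (CLINT \<omega>|M. iexp ((v $ i * sqrt (t - s)) * ?X \<omega>))"
      using st' by (simp add: mult.assoc)
    also have "\<dots> = char (distr M borel ?X) (v $ i * sqrt (t - s))"
      unfolding char_def by (subst integral_distr) auto
    also have "\<dots> = complex_of_real (exp (- ((v $ i)\<^sup>2 * (t - s) / 2)))"
      unfolding eq char_std_normal_distribution using st' by (simp add: power_mult_distrib)
    finally show "char (distr M borel (\<lambda>\<omega>. v $ i * (B t \<omega> - B s \<omega>) $ i)) 1 = complex_of_real (exp (- ((v $ i)\<^sup>2 * (t - s) / 2)))" .
  qed
  also have "\<dots> = complex_of_real (exp (\<Sum>i\<in>UNIV. - ((v $ i)\<^sup>2 * (t - s) / 2)))"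
    by (simp add: exp_sum)
  also have "(\<Sum>i\<in>UNIV. - ((v $ i)\<^sup>2 * (t - s) / 2)) = - ((norm v)\<^sup>2 * (t - s) / 2)"
    unfolding power2_norm_eq_inner by (simp add: inner_vec_def sum_negf sum_distrib_right sum_divide_distrib power2_eq_square)
  finally show ?thesis .
qed

lemma increment_cos_sin:
  fixes v :: "real ^ 'd"
  assumes st: "0 \<le> s" "s \<le> t" "t \<le> T"
  shows "(\<integral>\<omega>. cos (v \<bullet> (B t \<omega> - B s \<omega>)) \<partial>M) = exp (- ((norm v)\<^sup>2 * (t - s) / 2))"
    and "(\<integral>\<omega>. sin (v \<bullet> (B t \<omega> - B s \<omega>)) \<partial>M) = 0"
proof -
  have [measurable]: "B s \<in> borel_measurable M" "B t \<in> borel_measurable M" using st by auto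
  have i: "integrable M (\<lambda>\<omega>. iexp (v \<bullet> (B t \<omega> - B s \<omega>)))"
    by (intro integrable_iexp) auto
  have "(\<integral>\<omega>. Re (iexp (v \<bullet> (B t \<omega> - B s \<omega>))) \<partial>M) = exp (- ((norm v)\<^sup>2 * (t - s) / 2))"
    unfolding integral_Re[OF i] increment_iexp[OF st] by simp
  then show "(\<integral>\<omega>. cos (v \<bullet> (B t \<omega> - B s \<omega>)) \<partial>M) = exp (- ((norm v)\<^sup>2 * (t - s) / 2))"
    by (simp add: Re_exp)
  have "(\<integral>\<omega>. Im (iexp (v \<bullet> (B t \<omega> - B s \<omega>))) \<partial>M) = 0"
    unfolding integral_Im[OF i] increment_iexp[OF st] by simp
  then show "(\<integral>\<omega>. sin (v \<bullet> (B t \<omega> - B s \<omega>)) \<partial>M) = 0"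
    by (simp add: Im_exp)
qed


section \<open>Square-integrable martingales and Doob's inequality\<close>

lemma L2_space_iff: "X \<in> L2_space M G \<longleftrightarrow> X \<in> borel_measurable G \<and> integrable M (\<lambda>\<omega>. (X \<omega>)\<^sup>2)"
  unfolding L2_space_def by auto

lemma L2_measurable: "t \<le> T \<Longrightarrow> X \<in> L2_space M (F t) \<Longrightarrow> X \<in> borel_measurable M"
  using F_measurable_M by (auto simp: L2_space_iff)

lemma L2_square_integrable: "X \<in> L2_space M G \<Longrightarrow> integrable M (\<lambda>\<omega>. (X \<omega>)\<^sup>2)"
  by (auto simp: L2_space_iff)

lemma L2_mono: "s \<le> t \<Longrightarrow> X \<in> L2_space M (F s) \<Longrightarrow> X \<in> L2_space M (F t)"
  using F_measurable_mono by (auto simp: L2_space_iff)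

lemma L2_integrable:
  assumes "t \<le> T" "X \<in> L2_space M (F t)" shows "integrable M X"
  using square_integrable_imp_integrable[OF L2_measurable[OF assms] L2_square_integrable[OF assms(2)]] .

lemma L2_mult_integrable:
  assumes "t \<le> T" "X \<in> L2_space M (F t)" "Y \<in> L2_space M (F t)"
  shows "integrable M (\<lambda>\<omega>. X \<omega> * Y \<omega>)"
  using assms by (intro integrable_mult_of_squares L2_measurable L2_square_integrable) auto

lemma L2_add:
  assumes "t \<le> T" "X \<in> L2_space M (F t)" "Y \<in> L2_space M (F t)"
  shows "(\<lambda>\<omega>. X \<omega> + Y \<omega>) \<in> L2_space M (F t)"
  using assms integrable_add_square[OF L2_measurable L2_measurable] by (auto simp: L2_space_iff)

lemma L2_cmult:
  assumes "X \<in> L2_space M G" shows "(\<lambda>\<omega>. c * X \<omega>) \<in> L2_space M G"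
  using assms by (auto simp: L2_space_iff power_mult_distrib)

lemma L2_uminus:
  assumes "X \<in> L2_space M G" shows "(\<lambda>\<omega>. - X \<omega>) \<in> L2_space M G"
  using assms by (auto simp: L2_space_iff)

lemma L2_diff:
  assumes "t \<le> T" "X \<in> L2_space M (F t)" "Y \<in> L2_space M (F t)"
  shows "(\<lambda>\<omega>. X \<omega> - Y \<omega>) \<in> L2_space M (F t)"
  using L2_add[OF assms(1,2) L2_uminus[OF assms(3)]] by simp

lemma L2_const: "(\<lambda>\<omega>. c) \<in> L2_space M G"
  by (auto simp: L2_space_iff)

lemma L2_sum:
  assumes "t \<le> T" "finite I" "\<And>i. i \<in> I \<Longrightarrow> X i \<in> L2_space M (F t)"
  shows "(\<lambda>\<omega>. \<Sum>i\<in>I. X i \<omega>) \<in> L2_space M (F t)"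
  using assms(2,3) by (induction I rule: finite_induct) (auto intro!: L2_add L2_const assms(1))

lemma L2_bounded_mult:
  fixes X U :: "'w \<Rightarrow> real"
  assumes t: "t \<le> T" and X: "X \<in> L2_space M (F t)" and U: "U \<in> borel_measurable (F t)" "\<And>\<omega>. \<omega> \<in> space M \<Longrightarrow> \<bar>U \<omega>\<bar> \<le> K"
  shows "(\<lambda>\<omega>. X \<omega> * U \<omega>) \<in> L2_space M (F t)"
  unfolding L2_space_iff
proof
  have m: "X \<in> borel_measurable (F t)" using X by (auto simp: L2_space_iff)
  then show m2: "(\<lambda>\<omega>. X \<omega> * U \<omega>) \<in> borel_measurable (F t)" using U by auto
  show "integrable M (\<lambda>\<omega>. (X \<omega> * U \<omega>)\<^sup>2)"
  proof (rule Bochner_Integration.integrable_bound[where f = "\<lambda>\<omega>. K\<^sup>2 * (X \<omega>)\<^sup>2"])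
    show "integrable M (\<lambda>\<omega>. K\<^sup>2 * (X \<omega>)\<^sup>2)" using X by (auto simp: L2_space_iff)
    show "(\<lambda>\<omega>. (X \<omega> * U \<omega>)\<^sup>2) \<in> borel_measurable M" using F_measurable_M[OF t m2] by auto
    show "AE \<omega> in M. norm ((X \<omega> * U \<omega>)\<^sup>2) \<le> norm (K\<^sup>2 * (X \<omega>)\<^sup>2)"
    proof (rule AE_I2)
      fix \<omega> assume "\<omega> \<in> space M"
      then have "(U \<omega>)\<^sup>2 \<le> K\<^sup>2" using U(2) by (metis abs_ge_zero power2_abs power_mono)
      then show "norm ((X \<omega> * U \<omega>)\<^sup>2) \<le> norm (K\<^sup>2 * (X \<omega>)\<^sup>2)"
        by (simp add: power_mult_distrib mult.commute mult_right_mono)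
    qed
  qed
qed

lemma L2_bounded:
  fixes U :: "'w \<Rightarrow> real"
  assumes t: "t \<le> T" and U: "U \<in> borel_measurable (F t)" "\<And>\<omega>. \<omega> \<in> space M \<Longrightarrow> \<bar>U \<omega>\<bar> \<le> K"
  shows "U \<in> L2_space M (F t)"
  using L2_bounded_mult[OF t L2_const[of 1] U] by simp

lemma L2_AE_cong:
  assumes "t \<le> T" "X \<in> L2_space M (F t)" "AE \<omega> in M. X \<omega> = Y \<omega>"
  shows "Y \<in> L2_space M (F t)"
proof -
  have Y: "Y \<in> borel_measurable (F t)" using F_measurable_AE[OF _ assms(3)] assms(2) by (auto simp: L2_space_iff)
  have "AE \<omega> in M. (X \<omega>)\<^sup>2 = (Y \<omega>)\<^sup>2" using assms(3) by eventually_elim simp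
  then have "integrable M (\<lambda>\<omega>. (Y \<omega>)\<^sup>2)"
    using integrable_cong_AE[of "\<lambda>\<omega>. (X \<omega>)\<^sup>2" M "\<lambda>\<omega>. (Y \<omega>)\<^sup>2"] assms F_measurable_M[OF assms(1) Y] L2_measurable[OF assms(1,2)]
    by (auto simp: L2_space_iff elim: eventually_mono)
  with Y show ?thesis by (auto simp: L2_space_iff)
qed

lemma L2_abs:
  assumes "X \<in> L2_space M G" shows "(\<lambda>\<omega>. \<bar>X \<omega>\<bar>) \<in> L2_space M G"
  using assms by (auto simp: L2_space_iff)

lemma L2_max:
  assumes t: "t \<le> T" and X: "X \<in> L2_space M (F t)" and Y: "Y \<in> L2_space M (F t)"
  shows "(\<lambda>\<omega>. max (X \<omega>) (Y \<omega>)) \<in> L2_space M (F t)"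
  unfolding L2_space_iff
proof
  show m2: "(\<lambda>\<omega>. max (X \<omega>) (Y \<omega>)) \<in> borel_measurable (F t)" using X Y by (auto simp: L2_space_iff)
  show "integrable M (\<lambda>\<omega>. (max (X \<omega>) (Y \<omega>))\<^sup>2)"
  proof (rule Bochner_Integration.integrable_bound[where f = "\<lambda>\<omega>. (X \<omega>)\<^sup>2 + (Y \<omega>)\<^sup>2"])
    show "integrable M (\<lambda>\<omega>. (X \<omega>)\<^sup>2 + (Y \<omega>)\<^sup>2)" using X Y by (auto simp: L2_space_iff)
    show "(\<lambda>\<omega>. (max (X \<omega>) (Y \<omega>))\<^sup>2) \<in> borel_measurable M" using F_measurable_M[OF t m2] by auto
  qed (auto simp: max_def)
qed

lemma L2_sqnorm_finite:
  assumes "t \<le> T" "X \<in> L2_space M (F t)" shows "sqnorm M X < \<infinity>"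
  using sqnorm_finite_iff[OF L2_measurable[OF assms]] L2_square_integrable[OF assms(2)] by simp

lemma sqnorm_eq_integral_L2:
  assumes "X \<in> L2_space M G" shows "sqnorm M X = ennreal (\<integral>\<omega>. (X \<omega>)\<^sup>2 \<partial>M)"
  using sqnorm_eq_integral[of M X] assms by (simp add: L2_space_iff)

text \<open>The second clause is the martingale property E[X_t | F_s] = X_s, expressed by testing
  against L^2(F_s). Continuity of almost all paths is part of the notion because Doob's inequality
  uses it to pass from grids to all times.\<close>

definition martingale :: "(real \<Rightarrow> 'w \<Rightarrow> real) \<Rightarrow> bool" where
  "martingale X \<longleftrightarrow> (\<forall>t\<in>{0..T}. X t \<in> L2_space M (F t)) \<and>
     (\<forall>s t V. 0 \<le> s \<and> s \<le> t \<and> t \<le> T \<and> V \<in> L2_space M (F s) \<longrightarrow> (\<integral>\<omega>. V \<omega> * X t \<omega> \<partial>M) = (\<integral>\<omega>. V \<omega> * X s \<omega> \<partial>M)) \<and>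
     (AE \<omega> in M. continuous_on {0..T} (\<lambda>t. X t \<omega>))"

lemma martingale_L2: "martingale X \<Longrightarrow> 0 \<le> t \<Longrightarrow> t \<le> T \<Longrightarrow> X t \<in> L2_space M (F t)"
  unfolding martingale_def by auto

lemma martingale_integral_eq:
  assumes "martingale X" "0 \<le> s" "s \<le> t" "t \<le> T" "V \<in> L2_space M (F s)"
  shows "(\<integral>\<omega>. V \<omega> * X t \<omega> \<partial>M) = (\<integral>\<omega>. V \<omega> * X s \<omega> \<partial>M)"
  using assms unfolding martingale_def by blast

lemma martingale_orthogonal:
  assumes X: "martingale X" and st: "0 \<le> s" "s \<le> t" "t \<le> T" and V: "V \<in> L2_space M (F s)"
  shows "(\<integral>\<omega>. V \<omega> * (X t \<omega> - X s \<omega>) \<partial>M) = 0"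
proof -
  have "(\<integral>\<omega>. V \<omega> * (X t \<omega> - X s \<omega>) \<partial>M) = (\<integral>\<omega>. V \<omega> * X t \<omega> \<partial>M) - (\<integral>\<omega>. V \<omega> * X s \<omega> \<partial>M)"
    using L2_mult_integrable[of t V "X t"] L2_mult_integrable[of t V "X s"] martingale_L2[OF X] st V L2_mono[of s t]
    by (simp add: right_diff_distrib)
  also have "\<dots> = 0" using X st V unfolding martingale_def by simp
  finally show ?thesis .
qed

lemma martingale_diff:
  assumes X: "martingale X" and Y: "martingale Y"
  shows "martingale (\<lambda>t \<omega>. X t \<omega> - Y t \<omega>)"
  unfolding martingale_def
proof (intro conjI ballI allI impI)
  fix t assume "t \<in> {0..T}" then show "(\<lambda>\<omega>. X t \<omega> - Y t \<omega>) \<in> L2_space M (F t)"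
    using martingale_L2[OF X] martingale_L2[OF Y] by (auto intro!: L2_diff)
next
  fix s t V assume st: "0 \<le> s \<and> s \<le> t \<and> t \<le> T \<and> V \<in> L2_space M (F s)"
  then have "integrable M (\<lambda>\<omega>. V \<omega> * X t \<omega>)" "integrable M (\<lambda>\<omega>. V \<omega> * Y t \<omega>)" "integrable M (\<lambda>\<omega>. V \<omega> * X s \<omega>)" "integrable M (\<lambda>\<omega>. V \<omega> * Y s \<omega>)"
    using martingale_L2[OF X] martingale_L2[OF Y] L2_mono[of s t] L2_mult_integrable[of t] L2_mult_integrable[of s] by auto
  then show "(\<integral>\<omega>. V \<omega> * (X t \<omega> - Y t \<omega>) \<partial>M) = (\<integral>\<omega>. V \<omega> * (X s \<omega> - Y s \<omega>) \<partial>M)"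
    using martingale_integral_eq[OF X, of s t V] martingale_integral_eq[OF Y, of s t V] st by (simp add: right_diff_distrib)
next
  show "AE \<omega> in M. continuous_on {0..T} (\<lambda>t. X t \<omega> - Y t \<omega>)"
    using X Y unfolding martingale_def by (auto elim!: eventually_elim2 intro!: continuous_on_diff)
qed

fun running_max :: "(nat \<Rightarrow> real) \<Rightarrow> nat \<Rightarrow> real" where
  "running_max x 0 = \<bar>x 0\<bar>"
| "running_max x (Suc n) = max (running_max x n) \<bar>x (Suc n)\<bar>"

lemma running_max_nonneg: "0 \<le> running_max x n"
  by (induction n) auto

lemma running_max_ge: "k \<le> n \<Longrightarrow> \<bar>x k\<bar> \<le> running_max x n"
  by (induction n) (auto simp: le_Suc_eq)

text \<open>A pathwise version of Doob's inequality: the sum is a discrete stochastic integral, which vanishes in mean.\<close>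

lemma running_max_pathwise:
  "(running_max x n)\<^sup>2 + 4 * (\<Sum>k<n. running_max x k * sgn (x k) * (x (Suc k) - x k)) \<le> 4 * (x n)\<^sup>2"
proof -
  let ?m = "running_max x"
  \<comment> \<open>Summation by parts for the running maximum, which moves only at steps where it
    equals the new |x|. At such a step the inequality loses exactly the square (b - m)^2; otherwise
    the induction hypothesis carries over unchanged.\<close>
  have *: "(?m n)\<^sup>2 + 2 * (\<Sum>k<n. ?m k * (\<bar>x (Suc k)\<bar> - \<bar>x k\<bar>)) \<le> 2 * ?m n * \<bar>x n\<bar>"
  proof (induction n)
    case 0
    show ?case by (simp add: power2_eq_square mult.assoc)
  next
    case (Suc n)
    define m a b S where "m = ?m n" and "a = \<bar>x n\<bar>" and "b = \<bar>x (Suc n)\<bar>"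
      and "S = (\<Sum>k<n. ?m k * (\<bar>x (Suc k)\<bar> - \<bar>x k\<bar>))"
    have IH: "m\<^sup>2 + 2 * S \<le> 2 * m * a" using Suc by (simp add: m_def a_def S_def)
    have "(max m b)\<^sup>2 + 2 * (S + m * (b - a)) \<le> 2 * max m b * b"
    proof (cases "b \<le> m")
      case True
      then show ?thesis using IH by (simp add: max_def algebra_simps)
    next
      case False
      have "0 \<le> (b - m)\<^sup>2" by simp
      then show ?thesis using IH False by (simp add: max_def power2_eq_square algebra_simps)
    qed
    then show ?case by (simp add: m_def a_def b_def S_def)
  qed
  \<comment> \<open>\<open>sgn\<close> is a subgradient of the absolute value. It replaces
    increments of |x| by increments of \<open>x\<close>, which are centred for a martingale.\<close>
  have "(\<Sum>k<n. ?m k * sgn (x k) * (x (Suc k) - x k)) \<le> (\<Sum>k<n. ?m k * (\<bar>x (Suc k)\<bar> - \<bar>x k\<bar>))"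
  proof (rule sum_mono)
    fix k
    have "sgn (x k) * (x (Suc k) - x k) \<le> \<bar>x (Suc k)\<bar> - \<bar>x k\<bar>"
      by (auto simp: sgn_if abs_if)
    from mult_left_mono[OF this running_max_nonneg[of x k]]
    show "?m k * sgn (x k) * (x (Suc k) - x k) \<le> ?m k * (\<bar>x (Suc k)\<bar> - \<bar>x k\<bar>)"
      by (simp add: mult.assoc)
  qed
  then have "(?m n)\<^sup>2 + 2 * (\<Sum>k<n. ?m k * sgn (x k) * (x (Suc k) - x k)) \<le> 2 * ?m n * \<bar>x n\<bar>"
    using * by simp
  \<comment> \<open>Young's inequality with weight chosen to leave half of the squared maximum on
    the left; doubling then yields Doob's constant 4.\<close>
  moreover have "2 * ?m n * \<bar>x n\<bar> \<le> (?m n)\<^sup>2 / 2 + 2 * (x n)\<^sup>2"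
    using zero_le_power2[of "?m n - 2 * \<bar>x n\<bar>"] by (simp add: power2_eq_square algebra_simps)
  ultimately show ?thesis by simp
qed

lemma grid_le:
  assumes "k \<le> Suc n" shows "real k * T / real (Suc n) \<le> T" "0 \<le> real k * T / real (Suc n)"
proof -
  have "real k * T \<le> real (Suc n) * T" using assms T_pos by (intro mult_right_mono) (auto simp del: of_nat_Suc)
  then show "real k * T / real (Suc n) \<le> T" by (simp add: divide_le_eq mult.commute del: of_nat_Suc)
  show "0 \<le> real k * T / real (Suc n)" using T_pos by simp
qed

text \<open>The pathwise inequality in expectation. The weight \<open>V k\<close>, running maximum
  times sign, is known at the k-th grid time and hence orthogonal to the next increment. As a
  maximum of finitely many square-integrable variables the running maximum is square-integrable, so
  every integral is finite before anything cancels.\<close>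

lemma Doob_discrete:
  assumes X: "martingale X"
  defines "x \<equiv> \<lambda>n \<omega> k. X (real k * T / real (Suc n)) \<omega>"
  shows "(\<integral>\<^sup>+\<omega>. ennreal ((running_max (x n \<omega>) (Suc n))\<^sup>2) \<partial>M) \<le> 4 * sqnorm M (X T)"
    and "(\<lambda>\<omega>. running_max (x n \<omega>) (Suc n)) \<in> borel_measurable M"
proof -
  let ?t = "\<lambda>k. real k * T / real (Suc n)"
  have tmono: "?t k \<le> ?t (Suc k)" for k using T_pos by (simp add: divide_right_mono)
  have mL2: "(\<lambda>\<omega>. running_max (x n \<omega>) k) \<in> L2_space M (F (?t k))" if "k \<le> Suc n" for k
    using that
  proof (induction k)
    case 0
    then show ?case using martingale_L2[OF X, of 0] T_pos by (auto simp: x_def intro!: L2_abs)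
  next
    case (Suc k)
    show ?case unfolding running_max.simps
    proof (rule L2_max)
      show "?t (Suc k) \<le> T" using grid_le[OF Suc.prems] by simp
      show "(\<lambda>\<omega>. running_max (x n \<omega>) k) \<in> L2_space M (F (?t (Suc k)))"
        using Suc L2_mono[OF tmono] by auto
      show "(\<lambda>\<omega>. \<bar>x n \<omega> (Suc k)\<bar>) \<in> L2_space M (F (?t (Suc k)))"
        unfolding x_def using grid_le[OF Suc.prems] by (intro L2_abs martingale_L2[OF X]) auto
    qed
  qed
  have tT: "?t (Suc n) = T" by (simp del: of_nat_Suc)
  show meas: "(\<lambda>\<omega>. running_max (x n \<omega>) (Suc n)) \<in> borel_measurable M"
    using L2_measurable[OF grid_le(1) mL2[of "Suc n"]] by simp
  define V where "V k \<omega> = running_max (x n \<omega>) k * sgn (x n \<omega> k)" for k \<omega>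
  have xL2: "(\<lambda>\<omega>. x n \<omega> k) \<in> L2_space M (F (?t k))" if "k \<le> Suc n" for k
    unfolding x_def using grid_le[OF that] by (intro martingale_L2[OF X]) auto
  have V: "V k \<in> L2_space M (F (?t k))" if "k \<le> Suc n" for k
    unfolding V_def
  proof (rule L2_bounded_mult[OF grid_le(1)[OF that] mL2[OF that]])
    show "(\<lambda>\<omega>. sgn (x n \<omega> k)) \<in> borel_measurable (F (?t k))"
      using xL2[OF that] by (auto simp: L2_space_iff)
    show "\<bar>sgn (x n \<omega> k)\<bar> \<le> 1" for \<omega> by (simp add: abs_sgn_eq)
  qed
  have dL2: "(\<lambda>\<omega>. x n \<omega> (Suc k) - x n \<omega> k) \<in> L2_space M (F T)" if "k < Suc n" for k
    using xL2[of k] xL2[of "Suc k"] that grid_le[of k n] grid_le[of "Suc k" n] L2_mono[of _ T] by (intro L2_diff) auto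
  have iV: "integrable M (\<lambda>\<omega>. V k \<omega> * (x n \<omega> (Suc k) - x n \<omega> k))" if "k < Suc n" for k
    using V[of k] grid_le(1)[of k n] L2_mono[of "?t k" T "V k"] that
    by (intro L2_mult_integrable[OF order_refl _ dL2]) auto
  have V0: "(\<integral>\<omega>. V k \<omega> * (x n \<omega> (Suc k) - x n \<omega> k) \<partial>M) = 0" if "k < Suc n" for k
    unfolding x_def using that grid_le[of k n] grid_le[of "Suc k" n] tmono V[of k]
    by (intro martingale_orthogonal[OF X]) auto
  have i1: "integrable M (\<lambda>\<omega>. (running_max (x n \<omega>) (Suc n))\<^sup>2)"
    using mL2[of "Suc n"] by (auto simp: L2_space_iff)
  have XT: "X T \<in> L2_space M (F T)" using martingale_L2[OF X] T_pos by auto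
  have iS: "integrable M (\<lambda>\<omega>. \<Sum>k<Suc n. V k \<omega> * (x n \<omega> (Suc k) - x n \<omega> k))"
    by (intro Bochner_Integration.integrable_sum iV) simp
  have eS: "(\<integral>\<omega>. (\<Sum>k<Suc n. V k \<omega> * (x n \<omega> (Suc k) - x n \<omega> k)) \<partial>M) = 0"
  proof -
    have "(\<integral>\<omega>. (\<Sum>k<Suc n. V k \<omega> * (x n \<omega> (Suc k) - x n \<omega> k)) \<partial>M) = (\<Sum>k<Suc n. \<integral>\<omega>. V k \<omega> * (x n \<omega> (Suc k) - x n \<omega> k) \<partial>M)"
      by (intro Bochner_Integration.integral_sum iV) simp
    also have "\<dots> = 0" using V0 by (intro sum.neutral) auto
    finally show ?thesis .
  qed
  have "(\<integral>\<omega>. (running_max (x n \<omega>) (Suc n))\<^sup>2 \<partial>M) =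
      (\<integral>\<omega>. (running_max (x n \<omega>) (Suc n))\<^sup>2 + 4 * (\<Sum>k<Suc n. V k \<omega> * (x n \<omega> (Suc k) - x n \<omega> k)) \<partial>M)"
    using i1 iS eS by (simp del: sum.lessThan_Suc running_max.simps)
  also have "\<dots> \<le> (\<integral>\<omega>. 4 * (X T \<omega>)\<^sup>2 \<partial>M)"
  proof (rule integral_mono)
    show "integrable M (\<lambda>\<omega>. (running_max (x n \<omega>) (Suc n))\<^sup>2 + 4 * (\<Sum>k<Suc n. V k \<omega> * (x n \<omega> (Suc k) - x n \<omega> k)))"
      using i1 iS by (intro Bochner_Integration.integrable_add) (auto simp del: sum.lessThan_Suc running_max.simps)
    show "(running_max (x n \<omega>) (Suc n))\<^sup>2 + 4 * (\<Sum>k<Suc n. V k \<omega> * (x n \<omega> (Suc k) - x n \<omega> k)) \<le> 4 * (X T \<omega>)\<^sup>2" for \<omega>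
      using running_max_pathwise[of "x n \<omega>" "Suc n"] tT unfolding V_def x_def by (simp del: sum.lessThan_Suc running_max.simps of_nat_Suc)
  qed (use XT in \<open>auto simp: L2_space_iff\<close>)
  finally have "ennreal (\<integral>\<omega>. (running_max (x n \<omega>) (Suc n))\<^sup>2 \<partial>M) \<le> ennreal (4 * (\<integral>\<omega>. (X T \<omega>)\<^sup>2 \<partial>M))"
    by (intro ennreal_leI) (simp del: running_max.simps)
  then show "(\<integral>\<^sup>+\<omega>. ennreal ((running_max (x n \<omega>) (Suc n))\<^sup>2) \<partial>M) \<le> 4 * sqnorm M (X T)"
    using i1 XT by (simp add: nn_integral_eq_integral sqnorm_eq_integral_L2 ennreal_mult del: running_max.simps)
qed

text \<open>Rounding \<open>t\<close> down to the grid with n + 1 steps. Most passages from grid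
  times to all times by path continuity run along this sequence.\<close>

lemma grid_approx:
  fixes k :: "nat \<Rightarrow> nat"
  assumes t: "0 \<le> t" "t \<le> T" and k: "\<And>n. k n = nat \<lfloor>t * real (Suc n) / T\<rfloor>"
  shows "k n \<le> Suc n" "(\<lambda>n. real (k n) * T / real (Suc n)) \<longlonglongrightarrow> t" "real (k n) * T / real (Suc n) \<le> t"
proof -
  have bounds: "t - T / N \<le> real (nat \<lfloor>t * N / T\<rfloor>) * T / N \<and> real (nat \<lfloor>t * N / T\<rfloor>) * T / N \<le> t \<and> real (nat \<lfloor>t * N / T\<rfloor>) \<le> N"
    if N: "N > 0" for N :: real
  proof -
    define x where "x = real (nat \<lfloor>t * N / T\<rfloor>)"
    have nn: "0 \<le> t * N / T" using t T_pos N by simp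
    have le: "x \<le> t * N / T" and ge: "t * N / T - 1 \<le> x"
      unfolding x_def using nn by linarith+
    have "t * N / T \<le> N" using t T_pos N by (simp add: divide_le_eq mult.commute)
    then have 1: "x \<le> N" using le by linarith
    have "x * T \<le> t * N" using le T_pos by (simp add: le_divide_eq)
    then have 2: "x * T / N \<le> t" using N by (simp add: divide_le_eq)
    have "(t * N / T - 1) * T \<le> x * T" using ge T_pos by (intro mult_right_mono) auto
    then have "t * N \<le> T + x * T" using T_pos by (simp add: left_diff_distrib)
    then have "t \<le> (T + x * T) / N" using N by (simp add: pos_le_divide_eq)
    then show ?thesis using 1 2 unfolding x_def[symmetric] by (simp add: add_divide_distrib)
  qed
  have b: "t - T / real (Suc n) \<le> real (k n) * T / real (Suc n)" "real (k n) * T / real (Suc n) \<le> t" "real (k n) \<le> real (Suc n)" for n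
    using bounds[of "real (Suc n)"] unfolding k by auto
  show "k n \<le> Suc n" using b(3)[of n] by (simp only: of_nat_le_iff)
  show "real (k n) * T / real (Suc n) \<le> t" by (rule b)
  have "(\<lambda>n. t - T / real (Suc n)) \<longlonglongrightarrow> t - 0"
    by (intro tendsto_diff tendsto_const LIMSEQ_Suc[OF lim_const_over_n])
  then have l: "(\<lambda>n. t - T / real (Suc n)) \<longlonglongrightarrow> t" by simp
  show "(\<lambda>n. real (k n) * T / real (Suc n)) \<longlonglongrightarrow> t"
    by (rule tendsto_sandwich[OF _ _ l tendsto_const]; intro always_eventually allI b)
qed

text \<open>The supremum over all times need not be measurable, so a measurable majorant is
  supplied: the lower limit of the squared grid maxima. The grids are not nested, hence a lower
  limit and not a supremum, and Fatou's lemma bounds its mean.\<close>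

lemma Doob_dominated:
  assumes X: "martingale X"
  obtains D where "D \<in> borel_measurable M" "AE \<omega> in M. \<forall>t\<in>{0..T}. ennreal (\<bar>X t \<omega>\<bar>\<^sup>2) \<le> D \<omega>"
    "(\<integral>\<^sup>+\<omega>. D \<omega> \<partial>M) \<le> 4 * sqnorm M (X T)"
proof -
  define x where "x = (\<lambda>n \<omega> k. X (real k * T / real (Suc n)) \<omega>)"
  define D where "D \<omega> = liminf (\<lambda>n. ennreal ((running_max (x n \<omega>) (Suc n))\<^sup>2))" for \<omega>
  have m: "(\<lambda>\<omega>. ennreal ((running_max (x n \<omega>) (Suc n))\<^sup>2)) \<in> borel_measurable M" for n
    using Doob_discrete(2)[OF X, of n] unfolding x_def by (simp del: running_max.simps)
  show ?thesis
  proof (rule that)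
    show "D \<in> borel_measurable M" unfolding D_def using m by measurable
    have "AE \<omega> in M. continuous_on {0..T} (\<lambda>t. X t \<omega>)" using X unfolding martingale_def by auto
    then show "AE \<omega> in M. \<forall>t\<in>{0..T}. ennreal (\<bar>X t \<omega>\<bar>\<^sup>2) \<le> D \<omega>"
    proof eventually_elim
      case (elim \<omega>)
      show ?case unfolding D_def
      proof (rule ballI)
        fix t assume t: "t \<in> {0..T}"
        define k where "k n = nat \<lfloor>t * real (Suc n) / T\<rfloor>" for n
        have t': "0 \<le> t" "t \<le> T" using t by auto
        note g = grid_approx[OF t' k_def]
        have "(\<lambda>n. X (real (k n) * T / real (Suc n)) \<omega>) \<longlonglongrightarrow> X t \<omega>"
          by (rule continuous_on_tendsto_compose[OF elim g(2) t]) (use grid_le[OF g(1)] in \<open>auto simp del: of_nat_Suc\<close>)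
        then have "(\<lambda>n. ennreal (\<bar>x n \<omega> (k n)\<bar>\<^sup>2)) \<longlonglongrightarrow> ennreal (\<bar>X t \<omega>\<bar>\<^sup>2)"
          unfolding x_def by (intro tendsto_ennrealI tendsto_power tendsto_rabs)
        from lim_imp_Liminf[OF sequentially_bot this]
        have "ennreal (\<bar>X t \<omega>\<bar>\<^sup>2) = liminf (\<lambda>n. ennreal (\<bar>x n \<omega> (k n)\<bar>\<^sup>2))" by (rule sym)
        also have "\<dots> \<le> liminf (\<lambda>n. ennreal ((running_max (x n \<omega>) (Suc n))\<^sup>2))"
        proof (rule Liminf_mono, rule always_eventually, rule allI)
          fix n
          show "ennreal (\<bar>x n \<omega> (k n)\<bar>\<^sup>2) \<le> ennreal ((running_max (x n \<omega>) (Suc n))\<^sup>2)"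
            using running_max_ge[OF g(1)[of n], of "x n \<omega>"] by (intro ennreal_leI power_mono) simp_all
        qed
        finally show "ennreal (\<bar>X t \<omega>\<bar>\<^sup>2) \<le> liminf (\<lambda>n. ennreal ((running_max (x n \<omega>) (Suc n))\<^sup>2))" .
      qed
    qed
    have "(\<integral>\<^sup>+\<omega>. D \<omega> \<partial>M) \<le> liminf (\<lambda>n. \<integral>\<^sup>+\<omega>. ennreal ((running_max (x n \<omega>) (Suc n))\<^sup>2) \<partial>M)"
      unfolding D_def by (rule nn_integral_liminf[OF m])
    also have "\<dots> \<le> liminf (\<lambda>n::nat. 4 * sqnorm M (X T))"
      using Doob_discrete(1)[OF X] unfolding x_def by (intro Liminf_mono always_eventually allI) (simp del: running_max.simps)
    also have "\<dots> = 4 * sqnorm M (X T)" by (simp add: Liminf_const)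
    finally show "(\<integral>\<^sup>+\<omega>. D \<omega> \<partial>M) \<le> 4 * sqnorm M (X T)" .
  qed
qed

text \<open>The integrand on the left may be non-measurable; \<open>nn_integral\<close> is monotone
  all the same, so the measurable majorant is enough.\<close>

theorem Doob:
  assumes X: "martingale X"
  shows "(\<integral>\<^sup>+\<omega>. (SUP t\<in>{0..T}. ennreal (\<bar>X t \<omega>\<bar>\<^sup>2)) \<partial>M) \<le> 4 * sqnorm M (X T)"
proof -
  obtain D where D: "D \<in> borel_measurable M" "AE \<omega> in M. \<forall>t\<in>{0..T}. ennreal (\<bar>X t \<omega>\<bar>\<^sup>2) \<le> D \<omega>"
    "(\<integral>\<^sup>+\<omega>. D \<omega> \<partial>M) \<le> 4 * sqnorm M (X T)" using Doob_dominated[OF X] by blast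
  have "(\<integral>\<^sup>+\<omega>. (SUP t\<in>{0..T}. ennreal (\<bar>X t \<omega>\<bar>\<^sup>2)) \<partial>M) \<le> (\<integral>\<^sup>+\<omega>. D \<omega> \<partial>M)"
    by (rule nn_integral_mono_AE) (use D(2) in eventually_elim, auto intro!: SUP_least)
  with D(3) show ?thesis by simp
qed

lemma martingale_sqnorm_le:
  assumes X: "martingale X" and t: "t \<in> {0..T}"
  shows "sqnorm M (X t) \<le> 4 * sqnorm M (X T)"
proof -
  have "sqnorm M (X t) \<le> (\<integral>\<^sup>+\<omega>. (SUP t\<in>{0..T}. ennreal (\<bar>X t \<omega>\<bar>\<^sup>2)) \<partial>M)"
    unfolding sqnorm_def by (intro nn_integral_mono SUP_upper2[OF t]) simp
  also have "\<dots> \<le> 4 * sqnorm M (X T)" by (rule Doob[OF X])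
  finally show ?thesis .
qed

text \<open>Convergence in mean square at each single time preserves the orthogonality tests. It
  says nothing about paths, so continuity of the limit is a separate hypothesis.\<close>

lemma martingale_limit:
  assumes X: "\<And>k. martingale (X k)" and Y: "\<And>t. t \<in> {0..T} \<Longrightarrow> Y t \<in> borel_measurable (F t)"
    and lim: "\<And>t. t \<in> {0..T} \<Longrightarrow> (\<lambda>k. sqnorm M (\<lambda>\<omega>. X k t \<omega> - Y t \<omega>)) \<longlonglongrightarrow> 0"
    and cont: "AE \<omega> in M. continuous_on {0..T} (\<lambda>t. Y t \<omega>)"
  shows "martingale Y"
proof -
  have L: "Y t \<in> L2_space M (F t)" if t: "t \<in> {0..T}" for t
  proof -
    have [measurable]: "Y t \<in> borel_measurable M" using Y[OF t] F_measurable_M t by auto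
    have X2: "X k t \<in> L2_space M (F t)" for k using martingale_L2[OF X] t by auto
    then have [measurable]: "X k t \<in> borel_measurable M" for k using L2_measurable t by auto
    have "\<forall>\<^sub>F k in sequentially. sqnorm M (\<lambda>\<omega>. X k t \<omega> - Y t \<omega>) < 1"
      using order_tendstoD(2)[OF lim[OF t], of 1] by simp
    then obtain k where k: "sqnorm M (\<lambda>\<omega>. X k t \<omega> - Y t \<omega>) < 1" by (auto simp: eventually_sequentially)
    have "sqnorm M (Y t) \<le> 2 * sqnorm M (X k t) + 2 * sqnorm M (\<lambda>\<omega>. X k t \<omega> - Y t \<omega>)"
      using sqnorm_diff_le[of "X k t" M "\<lambda>\<omega>. X k t \<omega> - Y t \<omega>"] by simp
    also have "\<dots> < \<infinity>" using L2_sqnorm_finite[OF _ X2] k t less_trans[OF k, of top] by (auto simp: ennreal_mult_less_top)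
    finally show ?thesis using sqnorm_finite_iff[of "Y t" M] Y[OF t] by (simp add: L2_space_iff)
  qed
  show ?thesis unfolding martingale_def
  proof (intro conjI ballI allI impI L cont)
    fix s t V assume st: "0 \<le> s \<and> s \<le> t \<and> t \<le> T \<and> V \<in> L2_space M (F s)"
    then have V: "V \<in> L2_space M (F t)" using L2_mono by blast
    have l: "(\<lambda>k. \<integral>\<omega>. V \<omega> * X k r \<omega> \<partial>M) \<longlonglongrightarrow> (\<integral>\<omega>. V \<omega> * Y r \<omega> \<partial>M)" if "r \<in> {0..T}" for r
      using that st V L[OF that] martingale_L2[OF X] lim
      by (intro integral_mult_tendsto) (auto intro: L2_measurable L2_square_integrable)
    have eq: "(\<integral>\<omega>. V \<omega> * X k t \<omega> \<partial>M) = (\<integral>\<omega>. V \<omega> * X k s \<omega> \<partial>M)" for k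
      using martingale_integral_eq[OF X] st by blast
    show "(\<integral>\<omega>. V \<omega> * Y t \<omega> \<partial>M) = (\<integral>\<omega>. V \<omega> * Y s \<omega> \<partial>M)"
      using LIMSEQ_unique[OF l[of t, unfolded eq] l[of s]] st by simp
  qed
qed


section \<open>Stochastic integrals of simple integrands\<close>

definition incr :: "real \<Rightarrow> real \<Rightarrow> ('w \<Rightarrow> real ^ 'd) \<Rightarrow> 'w \<Rightarrow> real" where
  "incr a b \<eta> \<omega> = \<eta> \<omega> \<bullet> (B b \<omega> - B a \<omega>)"

definition bounded_meas :: "real \<Rightarrow> ('w \<Rightarrow> real ^ 'd) \<Rightarrow> bool" where
  "bounded_meas a \<eta> \<longleftrightarrow> \<eta> \<in> borel_measurable (F a) \<and> bounded (\<eta> ` space M)"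

lemma bounded_meas_mono: "a \<le> b \<Longrightarrow> bounded_meas a \<eta> \<Longrightarrow> bounded_meas b \<eta>"
  unfolding bounded_meas_def using F_measurable_mono by auto

lemma bounded_measE:
  assumes "bounded_meas a \<eta>"
  obtains K where "K \<ge> 0" "\<And>\<omega>. \<omega> \<in> space M \<Longrightarrow> norm (\<eta> \<omega>) \<le> K" "\<And>\<omega> i. \<omega> \<in> space M \<Longrightarrow> \<bar>\<eta> \<omega> $ i\<bar> \<le> K"
proof -
  obtain K where K: "\<forall>x\<in>\<eta> ` space M. norm x \<le> K" "K > 0"
    using assms unfolding bounded_meas_def bounded_pos by auto
  show ?thesis
    by (rule that[of K]) (use K component_le_norm_cart order_trans in \<open>auto simp: less_imp_le, blast\<close>)
qed

lemma bounded_meas_component: "bounded_meas a \<eta> \<Longrightarrow> (\<lambda>\<omega>. \<eta> \<omega> $ i) \<in> borel_measurable (F a)"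
  unfolding bounded_meas_def by auto

lemma bounded_meas_inner:
  assumes a: "a \<le> T" and \<eta>: "bounded_meas a \<eta>" and \<theta>: "bounded_meas c \<theta>" and c: "c \<le> T"
  shows "integrable M (\<lambda>\<omega>. \<eta> \<omega> \<bullet> \<theta> \<omega>)"
proof -
  obtain K where K: "K \<ge> 0" "\<And>\<omega>. \<omega> \<in> space M \<Longrightarrow> norm (\<eta> \<omega>) \<le> K" using bounded_measE[OF \<eta>] by metis
  obtain K' where K': "K' \<ge> 0" "\<And>\<omega>. \<omega> \<in> space M \<Longrightarrow> norm (\<theta> \<omega>) \<le> K'" using bounded_measE[OF \<theta>] by metis
  have [measurable]: "\<eta> \<in> borel_measurable M" "\<theta> \<in> borel_measurable M"
    using F_measurable_M[OF a] F_measurable_M[OF c] \<eta> \<theta> unfolding bounded_meas_def by auto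
  show ?thesis
  proof (rule integrable_const_bound[where B = "K * K'"])
    show "AE \<omega> in M. norm (\<eta> \<omega> \<bullet> \<theta> \<omega>) \<le> K * K'"
    proof (rule AE_I2)
      fix \<omega> assume \<omega>: "\<omega> \<in> space M"
      have "norm (\<eta> \<omega> \<bullet> \<theta> \<omega>) \<le> norm (\<eta> \<omega>) * norm (\<theta> \<omega>)" using Cauchy_Schwarz_ineq2 by simp
      also have "\<dots> \<le> K * K'" using K K' \<omega> by (intro mult_mono) auto
      finally show "norm (\<eta> \<omega> \<bullet> \<theta> \<omega>) \<le> K * K'" .
    qed
  qed measurable
qed

lemma incr_refl [simp]: "incr a a \<eta> = (\<lambda>\<omega>. 0)"
  unfolding incr_def by simp

lemma incr_split: "incr a c \<eta> \<omega> = incr a b \<eta> \<omega> + incr b c \<eta> \<omega>"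
  unfolding incr_def by (simp add: inner_diff_right)

lemma incr_eq_sum: "incr a b \<eta> \<omega> = (\<Sum>i\<in>UNIV. \<eta> \<omega> $ i * (B b \<omega> - B a \<omega>) $ i)"
  unfolding incr_def inner_vec_def by simp

lemma incr_L2:
  assumes ab: "0 \<le> a" "a \<le> b" "b \<le> T" and \<eta>: "bounded_meas a \<eta>"
  shows "incr a b \<eta> \<in> L2_space M (F b)"
proof -
  obtain K where K: "K \<ge> 0" "\<And>\<omega> i. \<omega> \<in> space M \<Longrightarrow> \<bar>\<eta> \<omega> $ i\<bar> \<le> K" using bounded_measE[OF \<eta>] by metis
  have Bm[measurable]: "B a \<in> borel_measurable (F b)" "B b \<in> borel_measurable (F b)" using B_measurable_F ab by auto
  have "(\<lambda>\<omega>. \<Sum>i\<in>UNIV. (B b \<omega> - B a \<omega>) $ i * \<eta> \<omega> $ i) \<in> L2_space M (F b)"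
  proof (rule L2_sum[OF ab(3)], simp)
    fix i
    have "(\<lambda>\<omega>. (B b \<omega> - B a \<omega>) $ i) \<in> L2_space M (F b)"
      unfolding L2_space_iff
    proof
      show "(\<lambda>\<omega>. (B b \<omega> - B a \<omega>) $ i) \<in> borel_measurable (F b)" by measurable
      show "integrable M (\<lambda>\<omega>. ((B b \<omega> - B a \<omega>) $ i)\<^sup>2)" by (rule increment_integrable_power[OF ab])
    qed
    then show "(\<lambda>\<omega>. (B b \<omega> - B a \<omega>) $ i * \<eta> \<omega> $ i) \<in> L2_space M (F b)"
      by (rule L2_bounded_mult[OF ab(3)]) (use K bounded_meas_component[OF bounded_meas_mono[OF ab(2) \<eta>]] in auto)
  qed
  then show ?thesis by (simp add: incr_eq_sum[abs_def] mult.commute)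
qed

lemma incr_orthogonal:
  assumes ab: "0 \<le> a" "a \<le> b" "b \<le> T" and \<eta>: "bounded_meas a \<eta>" and V: "V \<in> L2_space M (F a)"
  shows "(\<integral>\<omega>. V \<omega> * incr a b \<eta> \<omega> \<partial>M) = 0"
proof -
  obtain K where K: "K \<ge> 0" "\<And>\<omega> i. \<omega> \<in> space M \<Longrightarrow> \<bar>\<eta> \<omega> $ i\<bar> \<le> K" using bounded_measE[OF \<eta>] by metis
  have aT: "a \<le> T" using ab by auto
  have V\<eta>: "(\<lambda>\<omega>. V \<omega> * \<eta> \<omega> $ i) \<in> L2_space M (F a)" for i
    by (rule L2_bounded_mult[OF aT V bounded_meas_component[OF \<eta>] K(2)])
  have u: "(\<lambda>x::real^'d. x $ i) \<in> borel_measurable borel" for i by measurable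
  have iu: "integrable M (\<lambda>\<omega>. (B b \<omega> - B a \<omega>) $ i)" for i
    using increment_integrable_power[OF ab, of i 1] by simp
  note ii = increment_indep_integral[OF ab _ L2_integrable[OF aT V\<eta>] u iu]
  have m: "(\<lambda>\<omega>. V \<omega> * \<eta> \<omega> $ i) \<in> borel_measurable (F a)" for i using V\<eta> by (auto simp: L2_space_iff)
  have "(\<integral>\<omega>. V \<omega> * incr a b \<eta> \<omega> \<partial>M) = (\<integral>\<omega>. (\<Sum>i\<in>UNIV. (V \<omega> * \<eta> \<omega> $ i) * (B b \<omega> - B a \<omega>) $ i) \<partial>M)"
    by (simp add: incr_eq_sum sum_distrib_left mult.assoc)
  also have "\<dots> = (\<Sum>i\<in>UNIV. \<integral>\<omega>. (V \<omega> * \<eta> \<omega> $ i) * (B b \<omega> - B a \<omega>) $ i \<partial>M)"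
    by (rule Bochner_Integration.integral_sum) (rule ii(1)[OF m])
  also have "\<dots> = 0"
    by (intro sum.neutral ballI) (simp only: ii(2)[OF m] increment_mean[OF ab] mult_zero_right)
  finally show ?thesis .
qed

text \<open>The increment is independent of both coefficients and has covariance matrix (b - a)
  times the identity, so only the diagonal of the double sum over coordinates survives.\<close>

lemma incr_same:
  assumes ab: "0 \<le> a" "a \<le> b" "b \<le> T" and \<eta>: "bounded_meas a \<eta>" and \<theta>: "bounded_meas a \<theta>"
  shows "(\<integral>\<omega>. incr a b \<eta> \<omega> * incr a b \<theta> \<omega> \<partial>M) = (b - a) * (\<integral>\<omega>. \<eta> \<omega> \<bullet> \<theta> \<omega> \<partial>M)"
proof -
  obtain K where K: "K \<ge> 0" "\<And>\<omega> i. \<omega> \<in> space M \<Longrightarrow> \<bar>\<eta> \<omega> $ i\<bar> \<le> K" using bounded_measE[OF \<eta>] by metis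
  obtain K' where K': "K' \<ge> 0" "\<And>\<omega> i. \<omega> \<in> space M \<Longrightarrow> \<bar>\<theta> \<omega> $ i\<bar> \<le> K'" using bounded_measE[OF \<theta>] by metis
  have aT: "a \<le> T" using ab by auto
  let ?D = "\<lambda>\<omega>. B b \<omega> - B a \<omega>"
  have L: "(\<lambda>\<omega>. \<eta> \<omega> $ i * \<theta> \<omega> $ j) \<in> L2_space M (F a)" for i j
    by (rule L2_bounded_mult[OF aT L2_bounded[OF aT bounded_meas_component[OF \<eta>] K(2)] bounded_meas_component[OF \<theta>] K'(2)])
  then have m: "(\<lambda>\<omega>. \<eta> \<omega> $ i * \<theta> \<omega> $ j) \<in> borel_measurable (F a)" for i j by (auto simp: L2_space_iff)
  have u: "(\<lambda>x::real^'d. x $ i * x $ j) \<in> borel_measurable borel" for i j by measurable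
  note ii = increment_indep_integral[OF ab m L2_integrable[OF aT L] u increment_integrable_mult[OF ab]]
  have "(\<integral>\<omega>. incr a b \<eta> \<omega> * incr a b \<theta> \<omega> \<partial>M) = (\<integral>\<omega>. (\<Sum>i\<in>UNIV. \<Sum>j\<in>UNIV. (\<eta> \<omega> $ i * \<theta> \<omega> $ j) * (?D \<omega> $ i * ?D \<omega> $ j)) \<partial>M)"
    unfolding incr_eq_sum sum_product by (intro Bochner_Integration.integral_cong sum.cong refl) (simp add: mult_ac)
  also have "\<dots> = (\<Sum>i\<in>UNIV. \<integral>\<omega>. (\<Sum>j\<in>UNIV. (\<eta> \<omega> $ i * \<theta> \<omega> $ j) * (?D \<omega> $ i * ?D \<omega> $ j)) \<partial>M)"
    by (rule Bochner_Integration.integral_sum) (intro Bochner_Integration.integrable_sum ii(1))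
  also have "\<dots> = (\<Sum>i\<in>UNIV. \<Sum>j\<in>UNIV. \<integral>\<omega>. (\<eta> \<omega> $ i * \<theta> \<omega> $ j) * (?D \<omega> $ i * ?D \<omega> $ j) \<partial>M)"
    by (intro sum.cong refl Bochner_Integration.integral_sum ii(1))
  also have "\<dots> = (\<Sum>i\<in>UNIV. \<Sum>j\<in>UNIV. (\<integral>\<omega>. \<eta> \<omega> $ i * \<theta> \<omega> $ j \<partial>M) * (if i = j then b - a else 0))"
  proof (intro sum.cong refl)
    fix i j
    have "(\<integral>\<omega>. ?D \<omega> $ i * ?D \<omega> $ j \<partial>M) = (if i = j then b - a else 0)"
      using increment_covariance[OF ab, of i j] increment_variance[OF ab, of i] by (auto simp: power2_eq_square)
    then show "(\<integral>\<omega>. (\<eta> \<omega> $ i * \<theta> \<omega> $ j) * (?D \<omega> $ i * ?D \<omega> $ j) \<partial>M) = (\<integral>\<omega>. \<eta> \<omega> $ i * \<theta> \<omega> $ j \<partial>M) * (if i = j then b - a else 0)"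
      by (simp only: ii(2))
  qed
  also have "\<dots> = (\<Sum>i\<in>UNIV. (\<integral>\<omega>. \<eta> \<omega> $ i * \<theta> \<omega> $ i \<partial>M) * (b - a))"
    by (simp add: if_distrib[of "\<lambda>x. _ * x"] cong: if_cong)
  also have "\<dots> = (b - a) * (\<integral>\<omega>. \<eta> \<omega> \<bullet> \<theta> \<omega> \<partial>M)"
    using L2_integrable[OF aT L] by (simp add: inner_vec_def sum_distrib_left mult.commute)
  finally show ?thesis .
qed

lemma incr_disjoint:
  assumes "0 \<le> a" "a \<le> b" "b \<le> c" "c \<le> d" "d \<le> T" and \<eta>: "bounded_meas a \<eta>" and \<theta>: "bounded_meas c \<theta>"
  shows "(\<integral>\<omega>. incr a b \<eta> \<omega> * incr c d \<theta> \<omega> \<partial>M) = 0"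
  by (rule incr_orthogonal) (use assms incr_L2[of a b \<eta>] L2_mono[of b c "incr a b \<eta>"] in auto)

lemma incr_mult_integrable:
  assumes "0 \<le> a" "a \<le> b" "b \<le> T" "0 \<le> c" "c \<le> d" "d \<le> T" "bounded_meas a \<eta>" "bounded_meas c \<theta>"
  shows "integrable M (\<lambda>\<omega>. incr a b \<eta> \<omega> * incr c d \<theta> \<omega>)"
  by (rule L2_mult_integrable[of T]) (use assms incr_L2 L2_mono in auto)

lemma incr_common_left:
  assumes le: "0 \<le> a" "a \<le> b" "b \<le> d" "d \<le> T" and \<eta>: "bounded_meas a \<eta>" and \<theta>: "bounded_meas a \<theta>"
  shows "(\<integral>\<omega>. incr a b \<eta> \<omega> * incr a d \<theta> \<omega> \<partial>M) = (b - a) * (\<integral>\<omega>. \<eta> \<omega> \<bullet> \<theta> \<omega> \<partial>M)"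
proof -
  have \<theta>b: "bounded_meas b \<theta>" using bounded_meas_mono[OF le(2) \<theta>] .
  have "(\<integral>\<omega>. incr a b \<eta> \<omega> * incr a d \<theta> \<omega> \<partial>M) = (\<integral>\<omega>. incr a b \<eta> \<omega> * incr a b \<theta> \<omega> + incr a b \<eta> \<omega> * incr b d \<theta> \<omega> \<partial>M)"
    by (simp add: incr_split[of a d \<theta> _ b] distrib_left)
  also have "\<dots> = (\<integral>\<omega>. incr a b \<eta> \<omega> * incr a b \<theta> \<omega> \<partial>M) + (\<integral>\<omega>. incr a b \<eta> \<omega> * incr b d \<theta> \<omega> \<partial>M)"
    by (intro Bochner_Integration.integral_add incr_mult_integrable) (use le \<eta> \<theta> \<theta>b in auto)
  finally show ?thesis
    using incr_same[of a b \<eta> \<theta>] incr_disjoint[of a b b d \<eta> \<theta>] le \<eta> \<theta> \<theta>b by simp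
qed

text \<open>Cutting the two intervals at \<open>c\<close> and at the smaller right end leaves pieces
  that either coincide or are disjoint. With this, simple integrands on unrelated partitions are
  compared term by term, without a common refinement.\<close>

lemma incr_covariance_ordered:
  assumes le: "0 \<le> a" "a \<le> b" "b \<le> T" "a \<le> c" "c \<le> d" "d \<le> T"
    and \<eta>: "bounded_meas a \<eta>" and \<theta>: "bounded_meas c \<theta>"
  shows "(\<integral>\<omega>. incr a b \<eta> \<omega> * incr c d \<theta> \<omega> \<partial>M) = measure lborel ({a<..b} \<inter> {c<..d}) * (\<integral>\<omega>. \<eta> \<omega> \<bullet> \<theta> \<omega> \<partial>M)"
proof (cases "b \<le> c")
  case True
  then have "{a<..b} \<inter> {c<..d} = {}" by auto
  then show ?thesis using incr_disjoint[of a b c d] True assms by simp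
next
  case False
  then have c: "c \<le> b" by simp
  have \<eta>c: "bounded_meas c \<eta>" using bounded_meas_mono[OF le(4) \<eta>] .
  have int: "{a<..b} \<inter> {c<..d} = {c<..min b d}" using le by auto
  have "(\<integral>\<omega>. incr a b \<eta> \<omega> * incr c d \<theta> \<omega> \<partial>M) = (\<integral>\<omega>. incr a c \<eta> \<omega> * incr c d \<theta> \<omega> + incr c b \<eta> \<omega> * incr c d \<theta> \<omega> \<partial>M)"
    by (simp add: incr_split[of a b \<eta> _ c] distrib_right)
  also have "\<dots> = (\<integral>\<omega>. incr a c \<eta> \<omega> * incr c d \<theta> \<omega> \<partial>M) + (\<integral>\<omega>. incr c b \<eta> \<omega> * incr c d \<theta> \<omega> \<partial>M)"
    by (intro Bochner_Integration.integral_add incr_mult_integrable) (use le c \<eta> \<theta> \<eta>c in auto)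
  also have "(\<integral>\<omega>. incr a c \<eta> \<omega> * incr c d \<theta> \<omega> \<partial>M) = 0"
    by (rule incr_disjoint) (use le c \<eta> \<theta> in auto)
  also have "(\<integral>\<omega>. incr c b \<eta> \<omega> * incr c d \<theta> \<omega> \<partial>M) = (min b d - c) * (\<integral>\<omega>. \<eta> \<omega> \<bullet> \<theta> \<omega> \<partial>M)"
  proof (cases "b \<le> d")
    case True
    then show ?thesis using incr_common_left[of c b d \<eta> \<theta>] le c \<eta>c \<theta> by simp
  next
    case False
    then show ?thesis using incr_common_left[of c d b \<theta> \<eta>] le c \<eta>c \<theta> by (simp add: mult.commute[of "incr c b \<eta> _"] inner_commute)
  qed
  finally show ?thesis using c le unfolding int by simp
qed

lemma incr_covariance:
  assumes le: "0 \<le> a" "a \<le> b" "b \<le> T" "0 \<le> c" "c \<le> d" "d \<le> T"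
    and \<eta>: "bounded_meas a \<eta>" and \<theta>: "bounded_meas c \<theta>"
  shows "(\<integral>\<omega>. incr a b \<eta> \<omega> * incr c d \<theta> \<omega> \<partial>M) = measure lborel ({a<..b} \<inter> {c<..d}) * (\<integral>\<omega>. \<eta> \<omega> \<bullet> \<theta> \<omega> \<partial>M)"
proof (cases "a \<le> c")
  case True
  then show ?thesis using incr_covariance_ordered[of a b c d] assms by simp
next
  case False
  then show ?thesis using incr_covariance_ordered[of c d a b \<theta> \<eta>] assms
    by (simp add: mult.commute[of "incr a b \<eta> _"] inner_commute Int_commute)
qed

text \<open>Projection of \<open>x\<close> onto the interval from \<open>s\<close> to
  \<open>t\<close>. Applied to partition points it restricts an integral to that interval while
  keeping the index set; steps outside become empty.\<close>

definition clamp_time :: "real \<Rightarrow> real \<Rightarrow> real \<Rightarrow> real" where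
  "clamp_time s t x = max s (min t x)"

lemma clamp_time_bounds: "s \<le> t \<Longrightarrow> s \<le> clamp_time s t x" "s \<le> t \<Longrightarrow> clamp_time s t x \<le> t"
  "x \<le> y \<Longrightarrow> clamp_time s t x \<le> clamp_time s t y"
  unfolding clamp_time_def by auto

text \<open>Clamping can move the left end \<open>a\<close> down only when t \<le> a, and then the
  step is empty. Otherwise the left end moves up or stays, so \<eta> is still measurable at the new
  left end.\<close>

lemma incr_clamp_cases:
  assumes "s \<le> t" "a \<le> b" and \<eta>: "bounded_meas a \<eta>"
  obtains "incr (clamp_time s t a) (clamp_time s t b) \<eta> = (\<lambda>\<omega>. 0)" "t \<le> a"
  | "bounded_meas (clamp_time s t a) \<eta>" "a < t" "{clamp_time s t a<..clamp_time s t b} = {a<..b} \<inter> {s<..t}"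
proof (cases "t \<le> a")
  case True
  then have "clamp_time s t a = clamp_time s t b" using assms unfolding clamp_time_def by auto
  with True show ?thesis using that by simp
next
  case False
  then have "a \<le> clamp_time s t a" unfolding clamp_time_def by auto
  moreover have "{clamp_time s t a<..clamp_time s t b} = {a<..b} \<inter> {s<..t}"
    using False assms by (auto simp: clamp_time_def)
  ultimately show ?thesis using that(2) False bounded_meas_mono[OF _ \<eta>] by auto
qed

lemma incr_clamp_L2:
  assumes st: "0 \<le> s" "s \<le> t" "t \<le> T" and ab: "a \<le> b" and \<eta>: "bounded_meas a \<eta>"
  shows "incr (clamp_time s t a) (clamp_time s t b) \<eta> \<in> L2_space M (F t)"
  using incr_clamp_cases[OF st(2) ab \<eta>]
proof cases
  case 2
  have "incr (clamp_time s t a) (clamp_time s t b) \<eta> \<in> L2_space M (F (clamp_time s t b))"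
    using clamp_time_bounds[OF st(2), of a] clamp_time_bounds[OF st(2), of b] clamp_time_bounds(3)[OF ab, of s t] 2 st
    by (intro incr_L2) auto
  then show ?thesis using L2_mono clamp_time_bounds(2)[OF st(2)] by blast
qed (simp add: L2_const)

lemma incr_clamp_orthogonal:
  assumes st: "0 \<le> s" "s \<le> t" "t \<le> T" and ab: "a \<le> b" and \<eta>: "bounded_meas a \<eta>" and V: "V \<in> L2_space M (F s)"
  shows "(\<integral>\<omega>. V \<omega> * incr (clamp_time s t a) (clamp_time s t b) \<eta> \<omega> \<partial>M) = 0"
  using incr_clamp_cases[OF st(2) ab \<eta>]
proof cases
  case 2
  then show ?thesis
    using clamp_time_bounds[OF st(2), of a] clamp_time_bounds[OF st(2), of b] clamp_time_bounds(3)[OF ab, of s t] 2 st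
      L2_mono[OF _ V, of "clamp_time s t a"]
    by (intro incr_orthogonal) auto
qed simp

lemma incr_clamp_covariance:
  assumes st: "0 \<le> s" "s \<le> t" "t \<le> T" and ab: "a \<le> b" "c \<le> d" and \<eta>: "bounded_meas a \<eta>" "bounded_meas c \<theta>"
  shows "(\<integral>\<omega>. incr (clamp_time s t a) (clamp_time s t b) \<eta> \<omega> * incr (clamp_time s t c) (clamp_time s t d) \<theta> \<omega> \<partial>M)
    = measure lborel ({a<..b} \<inter> {c<..d} \<inter> {s<..t}) * (\<integral>\<omega>. \<eta> \<omega> \<bullet> \<theta> \<omega> \<partial>M)"
  using incr_clamp_cases[OF st(2) ab(1) \<eta>(1)]
proof cases
  case 1
  then have "{a<..b} \<inter> {c<..d} \<inter> {s<..t} = {}" by auto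
  with 1 show ?thesis by simp
next
  case 2
  note 2 = this
  show ?thesis using incr_clamp_cases[OF st(2) ab(2) \<eta>(2)]
  proof cases
    case 1
    then have "{a<..b} \<inter> {c<..d} \<inter> {s<..t} = {}" by auto
    with 1 show ?thesis by simp
  next
    case c2: 2
    have eq: "{clamp_time s t a<..clamp_time s t b} \<inter> {clamp_time s t c<..clamp_time s t d} = {a<..b} \<inter> {c<..d} \<inter> {s<..t}"
      unfolding 2 c2 by auto
    show ?thesis unfolding eq[symmetric]
      using clamp_time_bounds[OF st(2)] clamp_time_bounds(3)[OF ab(1), of s t] clamp_time_bounds(3)[OF ab(2), of s t] 2 c2 st order_trans
      by (intro incr_covariance) blast+
  qed
qed

lemma simple_integrandD:
  assumes "simple_integrand M F T n p \<eta>"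
  shows "\<And>i. i \<le> n \<Longrightarrow> 0 \<le> p i" "\<And>i. i \<le> n \<Longrightarrow> p i \<le> T" "\<And>i. i < n \<Longrightarrow> p i \<le> p (Suc i)" "\<And>i. i < n \<Longrightarrow> bounded_meas (p i) (\<eta> i)"
  using assms unfolding simple_integrand_def bounded_meas_def by auto

lemma simple_ito_integral_diff:
  assumes s: "simple_integrand M F T n p \<eta>" and st: "s \<le> t"
  shows "simple_ito_integral B n p \<eta> t \<omega> - simple_ito_integral B n p \<eta> s \<omega>
     = (\<Sum>i<n. incr (clamp_time s t (p i)) (clamp_time s t (p (Suc i))) (\<eta> i) \<omega>)"
proof -
  have *: "B (min t x) \<omega> - B (min s x) \<omega> = B (clamp_time s t x) \<omega> - B s \<omega>" for x
    using st by (auto simp: clamp_time_def min_def max_def)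
  have "\<eta> i \<omega> \<bullet> (B (min t (p (Suc i))) \<omega> - B (min t (p i)) \<omega>) - \<eta> i \<omega> \<bullet> (B (min s (p (Suc i))) \<omega> - B (min s (p i)) \<omega>)
    = incr (clamp_time s t (p i)) (clamp_time s t (p (Suc i))) (\<eta> i) \<omega>" for i
  proof -
    have "(B (min t (p (Suc i))) \<omega> - B (min t (p i)) \<omega>) - (B (min s (p (Suc i))) \<omega> - B (min s (p i)) \<omega>)
      = (B (min t (p (Suc i))) \<omega> - B (min s (p (Suc i))) \<omega>) - (B (min t (p i)) \<omega> - B (min s (p i)) \<omega>)" by simp
    also have "\<dots> = B (clamp_time s t (p (Suc i))) \<omega> - B (clamp_time s t (p i)) \<omega>" unfolding * by simp
    finally show ?thesis unfolding incr_def inner_diff_right[symmetric] by simp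
  qed
  then show ?thesis unfolding simple_ito_integral_def sum_subtractf[symmetric] by simp
qed

lemma simple_ito_integral_0:
  assumes s: "simple_integrand M F T n p \<eta>"
  shows "simple_ito_integral B n p \<eta> 0 \<omega> = 0"
  unfolding simple_ito_integral_def
proof (rule sum.neutral, rule ballI)
  fix i assume "i \<in> {..<n}"
  then have "min 0 (p i) = 0" "min 0 (p (Suc i)) = 0" using simple_integrandD[OF s] by (auto simp: min_def)
  then show "\<eta> i \<omega> \<bullet> (B (min 0 (p (Suc i))) \<omega> - B (min 0 (p i)) \<omega>) = 0" by simp
qed

lemma simple_ito_diff_L2:
  assumes s: "simple_integrand M F T n p \<eta>" and st: "0 \<le> s" "s \<le> t" "t \<le> T"
  shows "(\<lambda>\<omega>. simple_ito_integral B n p \<eta> t \<omega> - simple_ito_integral B n p \<eta> s \<omega>) \<in> L2_space M (F t)"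
  unfolding simple_ito_integral_diff[OF s st(2)]
  using simple_integrandD[OF s] st by (intro L2_sum incr_clamp_L2) auto

lemma martingale_simple:
  assumes s: "simple_integrand M F T n p \<eta>"
  shows "martingale (simple_ito_integral B n p \<eta>)"
  unfolding martingale_def
proof (intro conjI ballI allI impI)
  fix t assume t: "t \<in> {0..T}"
  show L: "simple_ito_integral B n p \<eta> t \<in> L2_space M (F t)"
    using simple_ito_diff_L2[OF s, of 0 t] simple_ito_integral_0[OF s] t by simp
next
  fix s' t V assume st: "0 \<le> s' \<and> s' \<le> t \<and> t \<le> T \<and> V \<in> L2_space M (F s')"
  have L: "simple_ito_integral B n p \<eta> r \<in> L2_space M (F t)" if "0 \<le> r" "r \<le> t" for r
    using simple_ito_diff_L2[OF s, of 0 r] simple_ito_integral_0[OF s] that L2_mono[of r t] st by simp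
  have V: "V \<in> L2_space M (F t)" using st L2_mono by blast
  let ?I = "simple_ito_integral B n p \<eta>"
  have "(\<integral>\<omega>. V \<omega> * ?I t \<omega> \<partial>M) - (\<integral>\<omega>. V \<omega> * ?I s' \<omega> \<partial>M) = (\<integral>\<omega>. V \<omega> * (?I t \<omega> - ?I s' \<omega>) \<partial>M)"
    using L2_mult_integrable[of t V] V L st by (simp add: right_diff_distrib)
  also have "\<dots> = (\<integral>\<omega>. (\<Sum>i<n. V \<omega> * incr (clamp_time s' t (p i)) (clamp_time s' t (p (Suc i))) (\<eta> i) \<omega>) \<partial>M)"
    using st by (simp add: simple_ito_integral_diff[OF s] sum_distrib_left)
  also have "\<dots> = (\<Sum>i<n. \<integral>\<omega>. V \<omega> * incr (clamp_time s' t (p i)) (clamp_time s' t (p (Suc i))) (\<eta> i) \<omega> \<partial>M)"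
    using st V simple_integrandD[OF s] by (intro Bochner_Integration.integral_sum L2_mult_integrable[of t] incr_clamp_L2) auto
  also have "\<dots> = 0"
    using st simple_integrandD[OF s] by (intro sum.neutral ballI incr_clamp_orthogonal) auto
  finally show "(\<integral>\<omega>. V \<omega> * ?I t \<omega> \<partial>M) = (\<integral>\<omega>. V \<omega> * ?I s' \<omega> \<partial>M)" by simp
next
  show "AE \<omega> in M. continuous_on {0..T} (\<lambda>t. simple_ito_integral B n p \<eta> t \<omega>)"
    using AE_B_continuous
  proof eventually_elim
    case (elim \<omega>)
    have c: "continuous_on {0..T} (\<lambda>t. B (min t x) \<omega>)" if "x \<ge> 0" for x
      by (rule continuous_on_compose2[OF elim]) (use that in \<open>auto intro!: continuous_intros\<close>)
    show ?case unfolding simple_ito_integral_def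
      using simple_integrandD[OF s] by (intro continuous_intros c) auto
  qed
qed

abbreviation P :: "('w \<times> real) measure" where "P \<equiv> M \<Otimes>\<^sub>M restrict_space lborel {0..T}"

lemma finite_measure_time: "finite_measure (restrict_space lborel {0..T::real})"
  using T_pos by (intro finite_measureI) (simp add: emeasure_restrict_space space_restrict_space)

sublocale P: pair_sigma_finite M "restrict_space lborel {0..T}"
  unfolding pair_sigma_finite_def
  using finite_measure_time by (auto intro: finite_measure.axioms sigma_finite_measure_axioms)

lemma finite_measure_P: "finite_measure P"
proof
  interpret finite_measure "restrict_space lborel {0..T::real}" by (rule finite_measure_time)
  have "emeasure P (space M \<times> {0..T}) = emeasure M (space M) * emeasure (restrict_space lborel {0..T}) {0..T}"
    by (rule P.M2.emeasure_pair_measure_Times) (auto simp: sets_restrict_space)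
  then show "emeasure P (space P) \<noteq> \<infinity>"
    using T_pos by (simp add: space_pair_measure space_restrict_space emeasure_space_1 emeasure_restrict_space)
qed

lemma integral_P_indicator:
  fixes f :: "'w \<Rightarrow> real"
  assumes f: "integrable M f" and A: "A \<in> sets borel" "A \<subseteq> {0..T}"
  shows "integrable P (\<lambda>(\<omega>, r). indicat_real A r * f \<omega>)"
    and "(\<integral>(\<omega>, r). indicat_real A r * f \<omega> \<partial>P) = measure lborel A * (\<integral>\<omega>. f \<omega> \<partial>M)"
proof -
  note [measurable] = A(1)
  have [measurable]: "f \<in> borel_measurable M" using f by auto
  have [measurable]: "(\<lambda>r. r) \<in> borel_measurable (restrict_space lborel {0..T})"
    by (rule measurable_restrict_space1) simp
  interpret L: finite_measure "restrict_space lborel {0..T::real}" by (rule finite_measure_time)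
  have AT: "indicat_real {0..T} r * indicat_real A r = indicat_real A r" for r using A(2) by (auto simp: indicator_def)
  have iA: "(\<integral>r. indicat_real A r * c \<partial>restrict_space lborel {0..T}) = measure lborel A * c" for c :: real
    by (subst integral_restrict_space) (auto simp: AT mult.assoc[symmetric] A simp del: Bochner_Integration.integral_mult_left Bochner_Integration.integral_mult_left_zero intro!: trans[OF Bochner_Integration.integral_mult_left_zero])
  have iA': "integrable (restrict_space lborel {0..T}) (\<lambda>r. indicat_real A r * c)" for c :: real
    by (rule L.integrable_const_bound[where B = "\<bar>c\<bar>"]) (auto simp: indicator_def)
  show i: "integrable P (\<lambda>(\<omega>, r). indicat_real A r * f \<omega>)"
  proof (rule P.Fubini_integrable)
    show "(\<lambda>(\<omega>, r). indicat_real A r * f \<omega>) \<in> borel_measurable P" by measurable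
    have "(\<integral>r. norm (indicat_real A r * f \<omega>) \<partial>restrict_space lborel {0..T}) = measure lborel A * \<bar>f \<omega>\<bar>" for \<omega>
      using iA[of "\<bar>f \<omega>\<bar>"] by (simp add: abs_mult)
    then show "integrable M (\<lambda>\<omega>. \<integral>r. norm (case (\<omega>, r) of (\<omega>, r) \<Rightarrow> indicat_real A r * f \<omega>) \<partial>restrict_space lborel {0..T})"
      using f by simp
  qed (use iA' in auto)
  show "(\<integral>(\<omega>, r). indicat_real A r * f \<omega> \<partial>P) = measure lborel A * (\<integral>\<omega>. f \<omega> \<partial>M)"
    using P.integral_fst[OF i] by (simp only: iA prod.case) simp
qed

text \<open>The bilinear form of the isometry, for two integrands with independent partitions. Both
  sides reduce to the same double sum over pairs of steps, weighted by the length of their overlap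
  within (s, t].\<close>

lemma simple_covariance:
  assumes s: "simple_integrand M F T n p \<eta>" and s': "simple_integrand M F T m q \<theta>" and st: "0 \<le> s" "s \<le> t" "t \<le> T"
  shows "(\<integral>\<omega>. (simple_ito_integral B n p \<eta> t \<omega> - simple_ito_integral B n p \<eta> s \<omega>) * (simple_ito_integral B m q \<theta> t \<omega> - simple_ito_integral B m q \<theta> s \<omega>) \<partial>M)
    = (\<integral>(\<omega>, r). indicat_real {s<..t} r * (simple_process n p \<eta> r \<omega> \<bullet> simple_process m q \<theta> r \<omega>) \<partial>P)"
    and "integrable P (\<lambda>(\<omega>, r). indicat_real {s<..t} r * (simple_process n p \<eta> r \<omega> \<bullet> simple_process m q \<theta> r \<omega>))"
proof -
  note D = simple_integrandD[OF s] and D' = simple_integrandD[OF s']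
  let ?A = "\<lambda>i j. {p i<..p (Suc i)} \<inter> {q j<..q (Suc j)} \<inter> {s<..t}"
  let ?J = "\<lambda>i \<omega>. incr (clamp_time s t (p i)) (clamp_time s t (p (Suc i))) (\<eta> i) \<omega>"
  let ?J' = "\<lambda>i \<omega>. incr (clamp_time s t (q i)) (clamp_time s t (q (Suc i))) (\<theta> i) \<omega>"
  have JI: "integrable M (\<lambda>\<omega>. ?J i \<omega> * ?J' j \<omega>)" if "i < n" "j < m" for i j
    using that D D' st by (intro L2_mult_integrable[of t] incr_clamp_L2) auto
  have "(\<integral>\<omega>. (simple_ito_integral B n p \<eta> t \<omega> - simple_ito_integral B n p \<eta> s \<omega>) * (simple_ito_integral B m q \<theta> t \<omega> - simple_ito_integral B m q \<theta> s \<omega>) \<partial>M)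
    = (\<integral>\<omega>. (\<Sum>i<n. \<Sum>j<m. ?J i \<omega> * ?J' j \<omega>) \<partial>M)"
    unfolding simple_ito_integral_diff[OF s st(2)] simple_ito_integral_diff[OF s' st(2)] sum_product ..
  also have "\<dots> = (\<Sum>i<n. \<integral>\<omega>. (\<Sum>j<m. ?J i \<omega> * ?J' j \<omega>) \<partial>M)"
    by (intro Bochner_Integration.integral_sum Bochner_Integration.integrable_sum JI) auto
  also have "\<dots> = (\<Sum>i<n. \<Sum>j<m. \<integral>\<omega>. ?J i \<omega> * ?J' j \<omega> \<partial>M)"
    by (intro sum.cong refl Bochner_Integration.integral_sum JI) auto
  also have "\<dots> = (\<Sum>i<n. \<Sum>j<m. measure lborel (?A i j) * (\<integral>\<omega>. \<eta> i \<omega> \<bullet> \<theta> j \<omega> \<partial>M))"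
    using D D' st by (intro sum.cong refl incr_clamp_covariance) auto
  finally have 1: "(\<integral>\<omega>. (simple_ito_integral B n p \<eta> t \<omega> - simple_ito_integral B n p \<eta> s \<omega>) * (simple_ito_integral B m q \<theta> t \<omega> - simple_ito_integral B m q \<theta> s \<omega>) \<partial>M)
    = (\<Sum>i<n. \<Sum>j<m. measure lborel (?A i j) * (\<integral>\<omega>. \<eta> i \<omega> \<bullet> \<theta> j \<omega> \<partial>M))" .
  have eq: "(\<lambda>(\<omega>, r). indicat_real {s<..t} r * (simple_process n p \<eta> r \<omega> \<bullet> simple_process m q \<theta> r \<omega>))
    = (\<lambda>x. \<Sum>i<n. \<Sum>j<m. (case x of (\<omega>, r) \<Rightarrow> indicat_real (?A i j) r * (\<eta> i \<omega> \<bullet> \<theta> j \<omega>)))"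
  proof (rule ext, clarify)
    fix \<omega> r
    have "simple_process n p \<eta> r \<omega> \<bullet> simple_process m q \<theta> r \<omega> =
        (\<Sum>i<n. \<Sum>j<m. (indicat_real {p i<..p (Suc i)} r *\<^sub>R \<eta> i \<omega>) \<bullet> (indicat_real {q j<..q (Suc j)} r *\<^sub>R \<theta> j \<omega>))"
      unfolding simple_process_def by (simp only: inner_sum_left inner_sum_right) (rule sum.swap)
    then have "indicat_real {s<..t} r * (simple_process n p \<eta> r \<omega> \<bullet> simple_process m q \<theta> r \<omega>) =
        (\<Sum>i<n. \<Sum>j<m. indicat_real {s<..t} r * ((indicat_real {p i<..p (Suc i)} r *\<^sub>R \<eta> i \<omega>) \<bullet> (indicat_real {q j<..q (Suc j)} r *\<^sub>R \<theta> j \<omega>)))"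
      by (simp only: sum_distrib_left)
    also have "\<dots> = (\<Sum>i<n. \<Sum>j<m. indicat_real (?A i j) r * (\<eta> i \<omega> \<bullet> \<theta> j \<omega>))"
      by (intro sum.cong refl) (auto simp: indicator_def)
    finally show "indicat_real {s<..t} r * (simple_process n p \<eta> r \<omega> \<bullet> simple_process m q \<theta> r \<omega>) =
        (\<Sum>i<n. \<Sum>j<m. indicat_real (?A i j) r * (\<eta> i \<omega> \<bullet> \<theta> j \<omega>))" .
  qed
  have ii: "integrable P (\<lambda>(\<omega>, r). indicat_real (?A i j) r * (\<eta> i \<omega> \<bullet> \<theta> j \<omega>))"
    "(\<integral>(\<omega>, r). indicat_real (?A i j) r * (\<eta> i \<omega> \<bullet> \<theta> j \<omega>) \<partial>P) = measure lborel (?A i j) * (\<integral>\<omega>. \<eta> i \<omega> \<bullet> \<theta> j \<omega> \<partial>M)"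
    if ij: "i < n" "j < m" for i j
  proof -
    have "integrable M (\<lambda>\<omega>. \<eta> i \<omega> \<bullet> \<theta> j \<omega>)" using D D' ij by (intro bounded_meas_inner[of "p i" _ "q j"]) auto
    note x = integral_P_indicator[OF this]
    have A: "?A i j \<in> sets borel" "?A i j \<subseteq> {0..T}" using st by auto
    show "integrable P (\<lambda>(\<omega>, r). indicat_real (?A i j) r * (\<eta> i \<omega> \<bullet> \<theta> j \<omega>))"
      "(\<integral>(\<omega>, r). indicat_real (?A i j) r * (\<eta> i \<omega> \<bullet> \<theta> j \<omega>) \<partial>P) = measure lborel (?A i j) * (\<integral>\<omega>. \<eta> i \<omega> \<bullet> \<theta> j \<omega> \<partial>M)"
      by (rule x[OF A])+
  qed
  show "integrable P (\<lambda>(\<omega>, r). indicat_real {s<..t} r * (simple_process n p \<eta> r \<omega> \<bullet> simple_process m q \<theta> r \<omega>))"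
    unfolding eq by (intro Bochner_Integration.integrable_sum ii) auto
  have "(\<integral>(\<omega>, r). indicat_real {s<..t} r * (simple_process n p \<eta> r \<omega> \<bullet> simple_process m q \<theta> r \<omega>) \<partial>P)
    = (\<Sum>i<n. \<integral>x. (\<Sum>j<m. (case x of (\<omega>, r) \<Rightarrow> indicat_real (?A i j) r * (\<eta> i \<omega> \<bullet> \<theta> j \<omega>))) \<partial>P)"
    unfolding eq by (intro Bochner_Integration.integral_sum Bochner_Integration.integrable_sum ii) auto
  also have "\<dots> = (\<Sum>i<n. \<Sum>j<m. (\<integral>(\<omega>, r). indicat_real (?A i j) r * (\<eta> i \<omega> \<bullet> \<theta> j \<omega>) \<partial>P))"
    by (intro sum.cong refl Bochner_Integration.integral_sum ii) auto
  also have "\<dots> = (\<Sum>i<n. \<Sum>j<m. measure lborel (?A i j) * (\<integral>\<omega>. \<eta> i \<omega> \<bullet> \<theta> j \<omega> \<partial>M))"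
    by (intro sum.cong refl ii) auto
  finally show "(\<integral>\<omega>. (simple_ito_integral B n p \<eta> t \<omega> - simple_ito_integral B n p \<eta> s \<omega>) * (simple_ito_integral B m q \<theta> t \<omega> - simple_ito_integral B m q \<theta> s \<omega>) \<partial>M)
    = (\<integral>(\<omega>, r). indicat_real {s<..t} r * (simple_process n p \<eta> r \<omega> \<bullet> simple_process m q \<theta> r \<omega>) \<partial>P)"
    using 1 by simp
qed

lemma simple_isometry:
  assumes s: "simple_integrand M F T n p \<eta>" and s': "simple_integrand M F T m q \<theta>" and st: "0 \<le> s" "s \<le> t" "t \<le> T"
  shows "sqnorm M (\<lambda>\<omega>. (simple_ito_integral B n p \<eta> t \<omega> - simple_ito_integral B n p \<eta> s \<omega>) - (simple_ito_integral B m q \<theta> t \<omega> - simple_ito_integral B m q \<theta> s \<omega>))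
    = sqnorm P (\<lambda>(\<omega>, r). indicat_real {s<..t} r *\<^sub>R (simple_process n p \<eta> r \<omega> - simple_process m q \<theta> r \<omega>))"
proof -
  let ?D = "\<lambda>\<omega>. simple_ito_integral B n p \<eta> t \<omega> - simple_ito_integral B n p \<eta> s \<omega>"
  let ?D' = "\<lambda>\<omega>. simple_ito_integral B m q \<theta> t \<omega> - simple_ito_integral B m q \<theta> s \<omega>"
  let ?z = "\<lambda>r \<omega>. simple_process n p \<eta> r \<omega>" and ?z' = "\<lambda>r \<omega>. simple_process m q \<theta> r \<omega>"
  let ?i = "indicat_real {s<..t}"
  note L = simple_ito_diff_L2[OF s st] and L' = simple_ito_diff_L2[OF s' st]
  note c1 = simple_covariance[OF s s st] and c2 = simple_covariance[OF s s' st] and c3 = simple_covariance[OF s' s' st]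
  have M: "integrable M (\<lambda>\<omega>. ?D \<omega> * ?D \<omega>)" "integrable M (\<lambda>\<omega>. ?D \<omega> * ?D' \<omega>)" "integrable M (\<lambda>\<omega>. ?D' \<omega> * ?D' \<omega>)"
    using L L' st by (auto intro: L2_mult_integrable)
  have "(\<integral>\<omega>. (?D \<omega> - ?D' \<omega>)\<^sup>2 \<partial>M) = (\<integral>\<omega>. ?D \<omega> * ?D \<omega> - 2 * (?D \<omega> * ?D' \<omega>) + ?D' \<omega> * ?D' \<omega> \<partial>M)"
    by (intro Bochner_Integration.integral_cong) (simp_all add: power2_eq_square algebra_simps)
  also have "\<dots> = (\<integral>\<omega>. ?D \<omega> * ?D \<omega> \<partial>M) - 2 * (\<integral>\<omega>. ?D \<omega> * ?D' \<omega> \<partial>M) + (\<integral>\<omega>. ?D' \<omega> * ?D' \<omega> \<partial>M)"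
    using M by (simp del: Bochner_Integration.integral_diff add: Bochner_Integration.integral_diff[of M "\<lambda>\<omega>. ?D \<omega> * ?D \<omega>" "\<lambda>\<omega>. 2 * (?D \<omega> * ?D' \<omega>)"])
  also have "\<dots> = (\<integral>x. (case x of (\<omega>, r) \<Rightarrow> ?i r * (?z r \<omega> \<bullet> ?z r \<omega>)) - 2 * (case x of (\<omega>, r) \<Rightarrow> ?i r * (?z r \<omega> \<bullet> ?z' r \<omega>)) + (case x of (\<omega>, r) \<Rightarrow> ?i r * (?z' r \<omega> \<bullet> ?z' r \<omega>)) \<partial>P)"
    unfolding c1(1) c2(1) c3(1) using c1(2) c2(2) c3(2) by simp
  also have "\<dots> = (\<integral>x. (norm (case x of (\<omega>, r) \<Rightarrow> ?i r *\<^sub>R (?z r \<omega> - ?z' r \<omega>)))\<^sup>2 \<partial>P)"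
    by (intro Bochner_Integration.integral_cong)
      (auto simp: power2_norm_eq_inner inner_diff_left inner_diff_right inner_commute indicator_def split: if_splits)
  finally have eq: "(\<integral>\<omega>. (?D \<omega> - ?D' \<omega>)\<^sup>2 \<partial>M) = (\<integral>x. (norm (case x of (\<omega>, r) \<Rightarrow> ?i r *\<^sub>R (?z r \<omega> - ?z' r \<omega>)))\<^sup>2 \<partial>P)" .
  have "integrable P (\<lambda>x. (case x of (\<omega>, r) \<Rightarrow> ?i r * (?z r \<omega> \<bullet> ?z r \<omega>)) - 2 * (case x of (\<omega>, r) \<Rightarrow> ?i r * (?z r \<omega> \<bullet> ?z' r \<omega>)) + (case x of (\<omega>, r) \<Rightarrow> ?i r * (?z' r \<omega> \<bullet> ?z' r \<omega>)))"
    using c1(2) c2(2) c3(2) by simp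
  also have "?this \<longleftrightarrow> integrable P (\<lambda>x. (norm (case x of (\<omega>, r) \<Rightarrow> ?i r *\<^sub>R (?z r \<omega> - ?z' r \<omega>)))\<^sup>2)"
    by (intro Bochner_Integration.integrable_cong)
      (auto simp: power2_norm_eq_inner inner_diff_left inner_diff_right inner_commute indicator_def split: if_splits)
  finally have i: "integrable P (\<lambda>x. (norm (case x of (\<omega>, r) \<Rightarrow> ?i r *\<^sub>R (?z r \<omega> - ?z' r \<omega>)))\<^sup>2)" .
  have "(\<lambda>\<omega>. ?D \<omega> - ?D' \<omega>) \<in> L2_space M (F t)" using L2_diff[OF st(3) L L'] .
  from sqnorm_eq_integral_L2[OF this] show ?thesis
    unfolding sqnorm_eq_integral[OF i] eq .
qed


section \<open>The predictable and the progressive sigma-algebra\<close>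

abbreviation Pred :: "('w \<times> real) measure" where "Pred \<equiv> predictable_sigma M F T"
abbreviation Prog :: "('w \<times> real) measure" where "Prog \<equiv> progressive_sigma M F T"

lemma sets_F_into_space: "A \<in> sets (F s) \<Longrightarrow> A \<subseteq> space M"
  using sets.sets_into_space[of A "F s"] by simp

lemma sets_P: "sets P = sets (M \<Otimes>\<^sub>M restrict_space borel {0..T})"
  by (intro sets_pair_measure_cong sets_restrict_space_cong) auto

lemma space_P: "space P = space M \<times> {0..T}"
  by (simp add: space_pair_measure space_restrict_space)

lemma predictable_gen_subset:
  "{A \<times> {0} | A. A \<in> sets (F 0)} \<union> {A \<times> {s<..t} | A s t. 0 \<le> s \<and> s < t \<and> t \<le> T \<and> A \<in> sets (F s)} \<subseteq> Pow (space M \<times> {0..T})"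
  using T_pos sets_F_into_space by fastforce

lemma space_Pred: "space Pred = space M \<times> {0..T}"
  unfolding predictable_sigma_def by (rule space_measure_of[OF predictable_gen_subset])

lemma sets_Pred: "sets Pred = sigma_sets (space M \<times> {0..T})
   ({A \<times> {0} | A. A \<in> sets (F 0)} \<union> {A \<times> {s<..t} | A s t. 0 \<le> s \<and> s < t \<and> t \<le> T \<and> A \<in> sets (F s)})"
  unfolding predictable_sigma_def by (rule sets_measure_of[OF predictable_gen_subset])

abbreviation time_alg :: "real \<Rightarrow> ('w \<times> real) measure" where "time_alg t \<equiv> F t \<Otimes>\<^sub>M restrict_space borel {0..t}"

lemma space_time_alg: "space (time_alg t) = space M \<times> {0..t}"
  by (simp add: space_pair_measure space_restrict_space)

definition prog_sets :: "('w \<times> real) set set" where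
  "prog_sets = {A. A \<subseteq> space M \<times> {0..T} \<and> (\<forall>t\<in>{0..T}. A \<inter> (space M \<times> {0..t}) \<in> sets (time_alg t))}"

text \<open>\<open>progressive_sigma\<close> is defined as a generated sigma-algebra. Its generators
  being a sigma-algebra already, progressive measurability can be tested on each time section, in
  both directions.\<close>

lemma sigma_algebra_prog_sets: "sigma_algebra (space M \<times> {0..T}) prog_sets"
  unfolding sigma_algebra_iff2
proof (intro conjI ballI allI impI)
  show "prog_sets \<subseteq> Pow (space M \<times> {0..T})" unfolding prog_sets_def by auto
  show "{} \<in> prog_sets" unfolding prog_sets_def by auto
next
  fix A assume A: "A \<in> prog_sets"
  show "space M \<times> {0..T} - A \<in> prog_sets" unfolding prog_sets_def
  proof (intro CollectI conjI ballI)
    fix t assume t: "t \<in> {0..T}"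
    have "(space M \<times> {0..T} - A) \<inter> (space M \<times> {0..t}) = space (time_alg t) - A \<inter> (space M \<times> {0..t})"
      using t unfolding space_time_alg by auto
    also have "\<dots> \<in> sets (time_alg t)" using A t unfolding prog_sets_def by auto
    finally show "(space M \<times> {0..T} - A) \<inter> (space M \<times> {0..t}) \<in> sets (time_alg t)" .
  qed auto
next
  fix A :: "nat \<Rightarrow> _" assume A: "range A \<subseteq> prog_sets"
  show "(\<Union>i. A i) \<in> prog_sets" unfolding prog_sets_def
  proof (intro CollectI conjI ballI)
    show "\<Union> (range A) \<subseteq> space M \<times> {0..T}" using A unfolding prog_sets_def by blast
    fix t assume t: "t \<in> {0..T}"
    have "(\<Union>i. A i) \<inter> (space M \<times> {0..t}) = (\<Union>i. A i \<inter> (space M \<times> {0..t}))" by auto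
    also have "\<dots> \<in> sets (time_alg t)" using A t unfolding prog_sets_def by (intro sets.countable_UN) auto
    finally show "(\<Union>i. A i) \<inter> (space M \<times> {0..t}) \<in> sets (time_alg t)" .
  qed
qed

lemma space_Prog: "space Prog = space M \<times> {0..T}"
  unfolding progressive_sigma_def by (rule space_measure_of) auto

lemma sets_Prog: "sets Prog = prog_sets"
  unfolding progressive_sigma_def prog_sets_def[symmetric]
  using sigma_algebra.sets_measure_of_eq[OF sigma_algebra_prog_sets] .

lemma Prog_measurableI:
  assumes "\<And>t. t \<in> {0..T} \<Longrightarrow> h \<in> measurable (time_alg t) N"
  shows "h \<in> measurable Prog N"
proof (rule measurableI)
  fix x assume "x \<in> space Prog"
  then show "h x \<in> space N" using measurable_space[OF assms[of T], of x] T_pos by (simp add: space_Prog space_time_alg)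
next
  fix A assume A: "A \<in> sets N"
  show "h -` A \<inter> space Prog \<in> sets Prog"
    unfolding sets_Prog prog_sets_def space_Prog
  proof (intro CollectI conjI ballI)
    fix t assume t: "t \<in> {0..T}"
    have "h -` A \<inter> (space M \<times> {0..T}) \<inter> (space M \<times> {0..t}) = h -` A \<inter> space (time_alg t)"
      using t unfolding space_time_alg by auto
    also have "\<dots> \<in> sets (time_alg t)" using assms[OF t] A by (rule measurable_sets)
    finally show "h -` A \<inter> (space M \<times> {0..T}) \<inter> (space M \<times> {0..t}) \<in> sets (time_alg t)" .
  qed auto
qed

lemma Prog_measurableD:
  assumes h: "h \<in> measurable Prog N" and t: "t \<in> {0..T}"
  shows "h \<in> measurable (time_alg t) N"
proof (rule measurableI)
  fix x assume "x \<in> space (time_alg t)"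
  then show "h x \<in> space N" using measurable_space[OF h, of x] t by (auto simp: space_Prog space_time_alg)
next
  fix A assume A: "A \<in> sets N"
  have "h -` A \<inter> space (time_alg t) = (h -` A \<inter> space Prog) \<inter> (space M \<times> {0..t})"
    using t unfolding space_time_alg space_Prog by auto
  also have "\<dots> \<in> sets (time_alg t)"
    using measurable_sets[OF h A] t unfolding sets_Prog prog_sets_def by auto
  finally show "h -` A \<inter> space (time_alg t) \<in> sets (time_alg t)" .
qed

lemma sets_Prog_subset_P: "sets Prog \<subseteq> sets P"
proof
  fix A assume "A \<in> sets Prog"
  then have A: "A \<subseteq> space M \<times> {0..T}" "A \<inter> (space M \<times> {0..T}) \<in> sets (time_alg T)"
    using T_pos unfolding sets_Prog prog_sets_def by auto
  then have "A \<in> sets (time_alg T)" by (simp add: Int_absorb2)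
  also have "sets (time_alg T) \<subseteq> sets (M \<Otimes>\<^sub>M restrict_space borel {0..T})"
    unfolding sets_pair_measure space_F using sets_F_subset_M[of T] by (intro sigma_sets_mono') auto
  also have "\<dots> = sets P" by (rule sets_P[symmetric])
  finally show "A \<in> sets P" .
qed

lemma subalgebra_Prog: "subalgebra P Prog"
  unfolding subalgebra_def using sets_Prog_subset_P by (simp add: space_P space_Prog)

lemma sets_Pred_subset_Prog: "sets Pred \<subseteq> sets Prog"
proof -
  have "sigma_sets (space Prog) ({A \<times> {0} | A. A \<in> sets (F 0)} \<union> {A \<times> {s<..t} | A s t. 0 \<le> s \<and> s < t \<and> t \<le> T \<and> A \<in> sets (F s)}) \<subseteq> sets Prog"
  proof (rule sets.sigma_sets_subset, safe)
    fix A assume A: "A \<in> sets (F 0)"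
    show "A \<times> {0} \<in> sets Prog" unfolding sets_Prog prog_sets_def
    proof (intro CollectI conjI ballI)
      show "A \<times> {0} \<subseteq> space M \<times> {0..T}" using sets_F_into_space[OF A] T_pos by auto
      fix t assume t: "t \<in> {0..T}"
      have "A \<times> {0} \<inter> (space M \<times> {0..t}) = A \<times> {0}" using t sets_F_into_space[OF A] by auto
      also have "\<dots> \<in> sets (time_alg t)" using t A sets_F_mono[of 0 t] by (intro pair_measureI) (auto simp: sets_restrict_space)
      finally show "A \<times> {0} \<inter> (space M \<times> {0..t}) \<in> sets (time_alg t)" .
    qed
  next
    fix A s u assume A: "A \<in> sets (F s)" and su: "0 \<le> s" "s < u" "u \<le> T"
    show "A \<times> {s<..u} \<in> sets Prog" unfolding sets_Prog prog_sets_def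
    proof (intro CollectI conjI ballI)
      show "A \<times> {s<..u} \<subseteq> space M \<times> {0..T}" using sets_F_into_space[OF A] su by auto
      fix t assume t: "t \<in> {0..T}"
      show "A \<times> {s<..u} \<inter> (space M \<times> {0..t}) \<in> sets (time_alg t)"
      proof (cases "t \<le> s")
        case True
        then have "A \<times> {s<..u} \<inter> (space M \<times> {0..t}) = {}" by auto
        then show ?thesis by simp
      next
        case False
        have "A \<times> {s<..u} \<inter> (space M \<times> {0..t}) = A \<times> ({0..t} \<inter> {s<..u})" using sets_F_into_space[OF A] by auto
        also have "\<dots> \<in> sets (time_alg t)" using t A sets_F_mono[of s t] False
          by (intro pair_measureI) (auto simp: sets_restrict_space)
        finally show ?thesis .
      qed
    qed
  qed
  then show ?thesis unfolding sets_Pred space_Prog .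
qed

lemma subalgebra_Prog_Pred: "subalgebra Prog Pred"
  unfolding subalgebra_def using sets_Pred_subset_Prog by (simp add: space_Pred space_Prog)

lemma subalgebra_Pred: "subalgebra P Pred"
  unfolding subalgebra_def using sets_Prog_subset_P sets_Pred_subset_Prog by (simp add: space_P space_Pred)

lemma Prog_measurable_P: "h \<in> borel_measurable Prog \<Longrightarrow> h \<in> borel_measurable P"
  by (rule measurable_from_subalg[OF subalgebra_Prog])

lemma Pred_measurable_P: "h \<in> borel_measurable Pred \<Longrightarrow> h \<in> borel_measurable P"
  by (rule measurable_from_subalg[OF subalgebra_Pred])

lemma Pred_measurable_Prog: "h \<in> borel_measurable Pred \<Longrightarrow> h \<in> borel_measurable Prog"
  by (rule measurable_from_subalg[OF subalgebra_Prog_Pred])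

lemma Pred_measurable_indicator:
  fixes \<eta> :: "'w \<Rightarrow> real ^ 'd"
  assumes ab: "0 \<le> a" "a \<le> b" "b \<le> T" and \<eta>: "\<eta> \<in> borel_measurable (F a)"
  shows "(\<lambda>(\<omega>, r). indicat_real {a<..b} r *\<^sub>R \<eta> \<omega>) \<in> borel_measurable Pred"
proof (cases "a = b")
  case False
  then have ab': "a < b" using ab by simp
  let ?h = "\<lambda>(\<omega>, r). indicat_real {a<..b} r *\<^sub>R \<eta> \<omega>"
  have rect: "(\<eta> -` C \<inter> space M) \<times> {a<..b} \<in> sets Pred" if "C \<in> sets borel" for C
  proof -
    have "\<eta> -` C \<inter> space M \<in> sets (F a)" using measurable_sets[OF \<eta> that] by simp
    then show ?thesis unfolding sets_Pred using ab ab' by (intro sigma_sets.Basic UnI2 CollectI exI conjI refl) auto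
  qed
  show ?thesis
  proof (rule measurableI)
    fix C :: "(real ^ 'd) set" assume C: "C \<in> sets borel"
    show "?h -` C \<inter> space Pred \<in> sets Pred"
    \<comment> \<open>Off the strip the process is 0. So the preimage of a set containing 0 is the
      complement of a predictable rectangle, and otherwise it is a rectangle.\<close>
    proof (cases "0 \<in> C")
      case True
      have "?h -` C \<inter> space Pred = space Pred - (\<eta> -` (- C) \<inter> space M) \<times> {a<..b}"
        using True ab unfolding space_Pred by (auto simp: indicator_def of_bool_def split: if_splits)
      also have "\<dots> \<in> sets Pred" using rect[of "- C"] C by (intro sets.Diff sets.top) auto
      finally show ?thesis .
    next
      case False
      have "?h -` C \<inter> space Pred = (\<eta> -` C \<inter> space M) \<times> {a<..b}"
        using False ab unfolding space_Pred by (auto simp: indicator_def of_bool_def split: if_splits)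
      then show ?thesis using rect[OF C] by simp
    qed
  qed simp
qed simp

lemma simple_process_measurable:
  fixes \<eta> :: "nat \<Rightarrow> 'w \<Rightarrow> real ^ 'd"
  assumes s: "simple_integrand M F T n p \<eta>"
  shows "(\<lambda>(\<omega>, r). simple_process n p \<eta> r \<omega>) \<in> borel_measurable Pred"
proof -
  have "(\<lambda>x. \<Sum>i<n. (case x of (\<omega>, r) \<Rightarrow> indicat_real {p i<..p (Suc i)} r *\<^sub>R \<eta> i \<omega>)) \<in> borel_measurable Pred"
    using simple_integrandD[OF s] by (intro borel_measurable_sum Pred_measurable_indicator) (auto simp: bounded_meas_def)
  then show ?thesis by (simp add: simple_process_def case_prod_beta')
qed

lemma snd_measurable_P: "snd \<in> borel_measurable P"
proof -
  have "(\<lambda>r. r) \<in> borel_measurable (restrict_space lborel {0..T})" by (rule measurable_restrict_space1) simp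
  from measurable_compose[OF measurable_snd[of M "restrict_space lborel {0..T}"] this] show ?thesis by simp
qed

lemma nn_integral_time:
  fixes h :: "'w \<times> real \<Rightarrow> ennreal"
  assumes [measurable]: "h \<in> borel_measurable P"
  shows "(\<integral>\<^sup>+\<omega>. (\<integral>\<^sup>+s\<in>{0..T}. h (\<omega>, s) \<partial>lborel) \<partial>M) = (\<integral>\<^sup>+x. h x \<partial>P)"
proof -
  have "(\<integral>\<^sup>+x. h x \<partial>P) = (\<integral>\<^sup>+\<omega>. (\<integral>\<^sup>+s. h (\<omega>, s) \<partial>restrict_space lborel {0..T}) \<partial>M)"
    by (rule P.M2.nn_integral_fst[symmetric]) measurable
  also have "\<dots> = (\<integral>\<^sup>+\<omega>. (\<integral>\<^sup>+s\<in>{0..T}. h (\<omega>, s) \<partial>lborel) \<partial>M)"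
    by (simp add: nn_integral_restrict_space)
  finally show ?thesis ..
qed

lemma sqnorm_P_eq:
  assumes [measurable]: "h \<in> borel_measurable P"
  shows "(\<integral>\<^sup>+\<omega>. (\<integral>\<^sup>+s\<in>{0..T}. ennreal ((norm (h (\<omega>, s)))\<^sup>2) \<partial>lborel) \<partial>M) = sqnorm P h"
  unfolding sqnorm_def by (rule nn_integral_time) measurable

lemma H2_space_iff:
  fixes Z :: "real \<Rightarrow> 'w \<Rightarrow> real ^ 'd"
  shows "Z \<in> H2_space M F T \<longleftrightarrow> (\<lambda>(\<omega>, t). Z t \<omega>) \<in> borel_measurable Pred \<and> sqnorm P (\<lambda>(\<omega>, t). Z t \<omega>) < \<infinity>"
  unfolding H2_space_def using sqnorm_P_eq[OF Pred_measurable_P, of "\<lambda>(\<omega>, t). Z t \<omega>"] by auto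

lemma S2_L2:
  assumes Y: "Y \<in> S2_space M F T" and t: "t \<in> {0..T}"
  shows "Y t \<in> L2_space M (F t)"
proof -
  have m: "Y t \<in> borel_measurable (F t)" using Y t unfolding S2_space_def by auto
  have "sqnorm M (Y t) \<le> (\<integral>\<^sup>+\<omega>. (SUP t\<in>{0..T}. ennreal (\<bar>Y t \<omega>\<bar>\<^sup>2)) \<partial>M)"
    unfolding sqnorm_def by (intro nn_integral_mono SUP_upper2[OF t]) simp
  also have "\<dots> < \<infinity>" using Y unfolding S2_space_def by auto
  finally show ?thesis using m sqnorm_finite_iff[OF F_measurable_M[OF _ m]] t by (simp add: L2_space_iff)
qed

section \<open>The It\^o integral\<close>

text \<open>A weakening of \<open>has_ito_integral\<close>: convergence of the integrals at each
  fixed time instead of uniformly in time. It suffices for the isometry and the martingale property,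
  and it keeps possibly non-measurable suprema out of those arguments.\<close>

definition ito_approx :: "(nat \<Rightarrow> nat) \<Rightarrow> (nat \<Rightarrow> nat \<Rightarrow> real) \<Rightarrow> (nat \<Rightarrow> nat \<Rightarrow> 'w \<Rightarrow> real ^ 'd) \<Rightarrow>
    (real \<Rightarrow> 'w \<Rightarrow> real ^ 'd) \<Rightarrow> (real \<Rightarrow> 'w \<Rightarrow> real) \<Rightarrow> bool" where
  "ito_approx n p \<eta> Z I \<longleftrightarrow> (\<forall>k. simple_integrand M F T (n k) (p k) (\<eta> k)) \<and>
    (\<lambda>k. sqnorm P (\<lambda>(\<omega>, s). simple_process (n k) (p k) (\<eta> k) s \<omega> - Z s \<omega>)) \<longlonglongrightarrow> 0 \<and>
    (\<forall>t\<in>{0..T}. (\<lambda>k. sqnorm M (\<lambda>\<omega>. simple_ito_integral B (n k) (p k) (\<eta> k) t \<omega> - I t \<omega>)) \<longlonglongrightarrow> 0)"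

lemma ito_approxD:
  assumes "ito_approx n p \<eta> Z I"
  shows "\<And>k. simple_integrand M F T (n k) (p k) (\<eta> k)"
    "(\<lambda>k. sqnorm P (\<lambda>(\<omega>, s). simple_process (n k) (p k) (\<eta> k) s \<omega> - Z s \<omega>)) \<longlonglongrightarrow> 0"
    "\<And>t. t \<in> {0..T} \<Longrightarrow> (\<lambda>k. sqnorm M (\<lambda>\<omega>. simple_ito_integral B (n k) (p k) (\<eta> k) t \<omega> - I t \<omega>)) \<longlonglongrightarrow> 0"
  using assms unfolding ito_approx_def by blast+

lemma has_ito_integral_approx:
  assumes I: "has_ito_integral M F T B Z I"
  obtains n p \<eta> where "ito_approx n p \<eta> Z I"
proof -
  obtain n p \<eta> where s: "\<And>k. simple_integrand M F T (n k) (p k) (\<eta> k)" and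
    1: "(\<lambda>k. \<integral>\<^sup>+\<omega>. (\<integral>\<^sup>+s\<in>{0..T}. ennreal ((norm (simple_process (n k) (p k) (\<eta> k) s \<omega> - Z s \<omega>))\<^sup>2) \<partial>lborel) \<partial>M) \<longlonglongrightarrow> 0" and
    2: "(\<lambda>k. \<integral>\<^sup>+\<omega>. (SUP t\<in>{0..T}. ennreal (\<bar>simple_ito_integral B (n k) (p k) (\<eta> k) t \<omega> - I t \<omega>\<bar>\<^sup>2)) \<partial>M) \<longlonglongrightarrow> 0"
    using I unfolding has_ito_integral_def by auto
  have Z: "(\<lambda>(\<omega>, t). Z t \<omega>) \<in> borel_measurable Pred" using I unfolding has_ito_integral_def H2_space_iff by auto
  have m: "(\<lambda>(\<omega>, s). simple_process (n k) (p k) (\<eta> k) s \<omega> - Z s \<omega>) \<in> borel_measurable P" for k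
    using Pred_measurable_P[OF borel_measurable_diff[OF simple_process_measurable[OF s[of k]] Z]] by (simp add: case_prod_beta')
  have "(\<lambda>k. sqnorm P (\<lambda>(\<omega>, s). simple_process (n k) (p k) (\<eta> k) s \<omega> - Z s \<omega>)) \<longlonglongrightarrow> 0"
    using 1 sqnorm_P_eq[OF m] by simp
  moreover have "(\<lambda>k. sqnorm M (\<lambda>\<omega>. simple_ito_integral B (n k) (p k) (\<eta> k) t \<omega> - I t \<omega>)) \<longlonglongrightarrow> 0" if t: "t \<in> {0..T}" for t
    by (rule sqnorm_tendsto_0_le[OF _ 2]) (auto simp: sqnorm_def intro!: nn_integral_mono SUP_upper2[OF t])
  ultimately have "ito_approx n p \<eta> Z I" unfolding ito_approx_def using s by blast
  then show ?thesis by (rule that)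
qed

lemma has_ito_integral_martingale:
  assumes I: "has_ito_integral M F T B Z I"
  shows "martingale I"
proof -
  have S2: "I \<in> S2_space M F T" using I unfolding has_ito_integral_def by auto
  obtain n p \<eta> where a: "ito_approx n p \<eta> Z I" using has_ito_integral_approx[OF I] .
  note s = ito_approxD(1)[OF a] and l = ito_approxD(3)[OF a]
  show ?thesis
    by (rule martingale_limit[OF martingale_simple[OF s] _ l]) (use S2 in \<open>auto simp: S2_space_def\<close>)
qed

text \<open>Both sides of \<open>simple_isometry\<close> converge and limits are unique. Stating it
  for a difference of two integrals lets it measure Z - Z' for two solutions directly.\<close>

theorem ito_isometry:
  assumes I: "has_ito_integral M F T B Z I" and I': "has_ito_integral M F T B Z' I'" and st: "0 \<le> s" "s \<le> t" "t \<le> T"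
  shows "sqnorm M (\<lambda>\<omega>. (I t \<omega> - I s \<omega>) - (I' t \<omega> - I' s \<omega>)) = sqnorm P (\<lambda>(\<omega>, r). indicat_real {s<..t} r *\<^sub>R (Z r \<omega> - Z' r \<omega>))"
proof -
  obtain n p \<eta> where a: "ito_approx n p \<eta> Z I" using has_ito_integral_approx[OF I] .
  note sim = ito_approxD(1)[OF a] and z = ito_approxD(2)[OF a] and l = ito_approxD(3)[OF a]
  obtain n' p' \<eta>' where a': "ito_approx n' p' \<eta>' Z' I'" using has_ito_integral_approx[OF I'] .
  note sim' = ito_approxD(1)[OF a'] and z' = ito_approxD(2)[OF a'] and l' = ito_approxD(3)[OF a']
  define S where "S k r \<omega> = simple_ito_integral B (n k) (p k) (\<eta> k) r \<omega>" for k r \<omega>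
  define S' where "S' k r \<omega> = simple_ito_integral B (n' k) (p' k) (\<eta>' k) r \<omega>" for k r \<omega>
  define zz where "zz k = (\<lambda>(\<omega>, r). simple_process (n k) (p k) (\<eta> k) r \<omega>)" for k
  define zz' where "zz' k = (\<lambda>(\<omega>, r). simple_process (n' k) (p' k) (\<eta>' k) r \<omega>)" for k
  define ZZ where "ZZ = (\<lambda>(\<omega>, r). Z r \<omega>)"
  define ZZ' where "ZZ' = (\<lambda>(\<omega>, r). Z' r \<omega>)"
  have [measurable]: "zz k \<in> borel_measurable P" "zz' k \<in> borel_measurable P" for k
    unfolding zz_def zz'_def by (rule Pred_measurable_P[OF simple_process_measurable[OF sim]] Pred_measurable_P[OF simple_process_measurable[OF sim']])+
  have Zf: "ZZ \<in> borel_measurable P" "sqnorm P ZZ < \<infinity>" "ZZ' \<in> borel_measurable P" "sqnorm P ZZ' < \<infinity>"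
    using I I' Pred_measurable_P unfolding has_ito_integral_def H2_space_iff ZZ_def ZZ'_def by auto
  note [measurable] = Zf(1,3)
  note [measurable] = snd_measurable_P
  have [measurable]: "S k r \<in> borel_measurable M" "S' k r \<in> borel_measurable M" "I r \<in> borel_measurable M" "I' r \<in> borel_measurable M"
    if "0 \<le> r" "r \<le> T" for k r
    using that L2_measurable[OF that(2)] martingale_L2[OF has_ito_integral_martingale[OF I]] martingale_L2[OF has_ito_integral_martingale[OF I']]
      martingale_L2[OF martingale_simple[OF sim]] martingale_L2[OF martingale_simple[OF sim']] unfolding S_def S'_def by auto
  note stm = order_trans[OF st(1,2)] order_trans[OF st(2,3)]
  have fin1: "sqnorm M (\<lambda>\<omega>. (I t \<omega> - I s \<omega>) - (I' t \<omega> - I' s \<omega>)) < \<infinity>"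
  proof (rule L2_sqnorm_finite[OF st(3)], intro L2_diff[OF st(3)])
    note m = martingale_L2[OF has_ito_integral_martingale[OF I]] martingale_L2[OF has_ito_integral_martingale[OF I']]
    show "I t \<in> L2_space M (F t)" "I' t \<in> L2_space M (F t)" using m stm st by auto
    show "I s \<in> L2_space M (F t)" "I' s \<in> L2_space M (F t)" using m stm st L2_mono[OF st(2)] by auto
  qed
  have lim1: "(\<lambda>k. sqnorm M (\<lambda>\<omega>. (S k t \<omega> - S k s \<omega>) - (S' k t \<omega> - S' k s \<omega>))) \<longlonglongrightarrow> sqnorm M (\<lambda>\<omega>. (I t \<omega> - I s \<omega>) - (I' t \<omega> - I' s \<omega>))"
    using st stm by (intro sqnorm_tendsto sqnorm_tendsto_0_diff fin1) (use l l' st stm in \<open>simp_all add: S_def[symmetric] S'_def[symmetric]\<close>)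
  have zlim: "(\<lambda>k. sqnorm P (\<lambda>x. (zz k x - zz' k x) - (ZZ x - ZZ' x))) \<longlonglongrightarrow> 0"
  proof (intro sqnorm_tendsto_0_diff)
    show "(\<lambda>k. sqnorm P (\<lambda>x. zz k x - ZZ x)) \<longlonglongrightarrow> 0" "(\<lambda>k. sqnorm P (\<lambda>x. zz' k x - ZZ' x)) \<longlonglongrightarrow> 0"
      using z z' by (simp_all add: zz_def zz'_def ZZ_def ZZ'_def case_prod_beta')
  qed measurable
  have "(\<lambda>k. sqnorm P (\<lambda>x. indicat_real {s<..t} (snd x) *\<^sub>R (zz k x - zz' k x) - indicat_real {s<..t} (snd x) *\<^sub>R (ZZ x - ZZ' x))) \<longlonglongrightarrow> 0"
    by (rule sqnorm_tendsto_0_le[OF _ zlim]) (auto intro!: sqnorm_mono_AE AE_I2 simp: indicator_def)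
  moreover have "sqnorm P (\<lambda>x. indicat_real {s<..t} (snd x) *\<^sub>R (ZZ x - ZZ' x)) < \<infinity>"
  proof -
    have "sqnorm P (\<lambda>x. indicat_real {s<..t} (snd x) *\<^sub>R (ZZ x - ZZ' x)) \<le> sqnorm P (\<lambda>x. ZZ x - ZZ' x)"
      by (auto intro!: sqnorm_mono_AE AE_I2 simp: indicator_def)
    also have "\<dots> \<le> 2 * sqnorm P ZZ + 2 * sqnorm P ZZ'" by (rule sqnorm_diff_le) auto
    also have "\<dots> < \<infinity>" using Zf by (auto simp: ennreal_mult_less_top)
    finally show ?thesis .
  qed
  ultimately have lim2: "(\<lambda>k. sqnorm P (\<lambda>x. indicat_real {s<..t} (snd x) *\<^sub>R (zz k x - zz' k x))) \<longlonglongrightarrow> sqnorm P (\<lambda>x. indicat_real {s<..t} (snd x) *\<^sub>R (ZZ x - ZZ' x))"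
    by (intro sqnorm_tendsto) auto
  have "sqnorm M (\<lambda>\<omega>. (S k t \<omega> - S k s \<omega>) - (S' k t \<omega> - S' k s \<omega>)) = sqnorm P (\<lambda>x. indicat_real {s<..t} (snd x) *\<^sub>R (zz k x - zz' k x))" for k
    using simple_isometry[OF sim sim' st] by (simp add: S_def S'_def zz_def zz'_def case_prod_beta')
  with lim1 lim2 have "sqnorm M (\<lambda>\<omega>. (I t \<omega> - I s \<omega>) - (I' t \<omega> - I' s \<omega>)) = sqnorm P (\<lambda>x. indicat_real {s<..t} (snd x) *\<^sub>R (ZZ x - ZZ' x))"
    by (simp add: LIMSEQ_unique)
  then show ?thesis by (simp add: ZZ_def ZZ'_def case_prod_beta')
qed

text \<open>Completeness of both sides of the isometry, together with Doob's inequality, yields the stochastic integral of the limit.\<close>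

theorem ito_integral_of_Cauchy:
  assumes sim: "\<And>k. simple_integrand M F T (n k) (p k) (\<eta> k)"
    and Cauchy: "\<And>k. sqnorm M (\<lambda>\<omega>. simple_ito_integral B (n (Suc k)) (p (Suc k)) (\<eta> (Suc k)) T \<omega> - simple_ito_integral B (n k) (p k) (\<eta> k) T \<omega>) \<le> ennreal (c * (1/4)^k)"
    and c: "c \<ge> 0"
  obtains Z I where "has_ito_integral M F T B Z I" "(\<lambda>k. sqnorm M (\<lambda>\<omega>. simple_ito_integral B (n k) (p k) (\<eta> k) T \<omega> - I T \<omega>)) \<longlonglongrightarrow> 0"
proof -
  define S where "S k = simple_ito_integral B (n k) (p k) (\<eta> k)" for k
  define zz where "zz k = (\<lambda>(\<omega>, r). simple_process (n k) (p k) (\<eta> k) r \<omega>)" for k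
  note CS = Cauchy[folded S_def]
  have mart: "martingale (S k)" for k unfolding S_def by (rule martingale_simple[OF sim])
  have S_L2: "S k t \<in> L2_space M (F t)" if "t \<in> {0..T}" for k t using martingale_L2[OF mart] that by auto
  have S_m[measurable]: "S k t \<in> borel_measurable M" if "t \<in> {0..T}" for k t using L2_measurable[OF _ S_L2[OF that]] that by auto
  have zPred: "zz k \<in> borel_measurable Pred" for k unfolding zz_def by (rule simple_process_measurable[OF sim])
  then have [measurable]: "zz k \<in> borel_measurable P" for k using Pred_measurable_P by auto
  \<comment> \<open>The isometry only sees times in (0, T]. Simple processes vanish at time 0, so
    cutting off that instant changes nothing.\<close>
  have zz0: "indicat_real {0<..T} (snd x) *\<^sub>R zz k x = zz k x" if "x \<in> space P" for x k
  proof -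
    obtain \<omega> r where x: "x = (\<omega>, r)" "0 \<le> r" "r \<le> T" using \<open>x \<in> space P\<close> by (auto simp: space_P)
    show ?thesis
    proof (cases "r = 0")
      case True
      have "simple_process (n k) (p k) (\<eta> k) 0 \<omega> = 0"
        unfolding simple_process_def
      proof (rule sum.neutral, rule ballI)
        fix i assume "i \<in> {..<n k}"
        then have "0 \<le> p k i" using simple_integrandD(1)[OF sim[of k]] by simp
        then show "indicat_real {p k i<..p k (Suc i)} 0 *\<^sub>R \<eta> k i \<omega> = 0" by simp
      qed
      then show ?thesis using x True by (simp add: zz_def)
    next
      case False
      then show ?thesis using x by simp
    qed
  qed
  have z0: "indicat_real {0<..T} (snd x) *\<^sub>R (zz k x - zz j x) = zz k x - zz j x" if "x \<in> space P" for x k j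
    using zz0[OF that] by (simp add: scaleR_diff_right)
  have iso: "sqnorm M (\<lambda>\<omega>. S k T \<omega> - S j T \<omega>) = sqnorm P (\<lambda>x. zz k x - zz j x)" for k j
  proof -
    have "sqnorm M (\<lambda>\<omega>. S k T \<omega> - S j T \<omega>) = sqnorm P (\<lambda>x. indicat_real {0<..T} (snd x) *\<^sub>R (zz k x - zz j x))"
      using simple_isometry[OF sim[of k] sim[of j], of 0 T] T_pos simple_ito_integral_0[OF sim]
      by (simp add: S_def zz_def case_prod_beta')
    also have "\<dots> = sqnorm P (\<lambda>x. zz k x - zz j x)"
      by (intro sqnorm_cong_AE AE_I2 z0)
    finally show ?thesis .
  qed
  have zCauchy: "sqnorm_Cauchy P zz"
    by (rule sqnorm_Cauchy_geometric[OF _ _ c]) (use CS iso in auto)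
  obtain ZZ where ZPred: "ZZ \<in> borel_measurable Pred" and ZZlim: "(\<lambda>k. sqnorm P (\<lambda>x. zz k x - ZZ x)) \<longlonglongrightarrow> 0"
    using Riesz_Fischer[OF subalgebra_Pred zPred zCauchy] .
  have [measurable]: "ZZ \<in> borel_measurable P" using ZPred by (rule Pred_measurable_P)
  have zfin: "sqnorm P (zz k) < \<infinity>" for k
  proof -
    have "sqnorm P (zz k) = sqnorm P (\<lambda>x. indicat_real {0<..T} (snd x) *\<^sub>R zz k x)"
      by (intro sqnorm_cong_AE AE_I2) (simp add: zz0)
    also have "\<dots> = sqnorm M (S k T)"
    proof -
      \<comment> \<open>Comparison with the empty integrand turns the isometry for differences into
        the isometry for a single integral.\<close>
      have s0: "simple_integrand M F T 0 (\<lambda>_. 0) (\<lambda>_ _. 0)" using T_pos unfolding simple_integrand_def by auto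
      show ?thesis using simple_isometry[OF sim[of k] s0, of 0 T] T_pos simple_ito_integral_0[OF sim]
        by (simp add: S_def zz_def case_prod_beta' simple_ito_integral_def[of _ 0] simple_process_def[of 0])
    qed
    also have "\<dots> < \<infinity>" using L2_sqnorm_finite[OF _ S_L2] T_pos by auto
    finally show ?thesis .
  qed
  have ZH2: "(\<lambda>r \<omega>. ZZ (\<omega>, r)) \<in> H2_space M F T"
  proof -
    have "\<forall>\<^sub>F k in sequentially. sqnorm P (\<lambda>x. zz k x - ZZ x) < 1"
      using order_tendstoD(2)[OF ZZlim, of 1] by simp
    then obtain k where k: "sqnorm P (\<lambda>x. zz k x - ZZ x) < 1" by (auto simp: eventually_sequentially)
    have "sqnorm P ZZ \<le> 2 * sqnorm P (zz k) + 2 * sqnorm P (\<lambda>x. zz k x - ZZ x)"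
      using sqnorm_diff_le[of "zz k" P "\<lambda>x. zz k x - ZZ x"] by simp
    also have "\<dots> < \<infinity>" using zfin less_trans[OF k, of top] by (auto simp: ennreal_mult_less_top)
    finally show ?thesis using ZPred unfolding H2_space_iff by (simp add: case_prod_beta')
  qed
  have mdiff: "martingale (\<lambda>t \<omega>. S k t \<omega> - S j t \<omega>)" for k j by (rule martingale_diff[OF mart mart])
  define good where "good \<omega> \<longleftrightarrow> (\<exists>b. \<forall>k. \<forall>t\<in>{0..T}. (norm (S (Suc k) t \<omega> - S k t \<omega>))\<^sup>2 \<le> b * (1/2)^k) \<and> (\<forall>k. continuous_on {0..T} (\<lambda>t. S k t \<omega>))" for \<omega>
  have good: "AE \<omega> in M. good \<omega>"
  proof -
    \<comment> \<open>\<open>AE_geometric_bound\<close> asks for measurable functions, so the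
      majorants from Doob's inequality stand in for the suprema of the path differences.\<close>
    have "\<forall>k. \<exists>D. D \<in> borel_measurable M \<and> (AE \<omega> in M. \<forall>t\<in>{0..T}. ennreal (\<bar>S (Suc k) t \<omega> - S k t \<omega>\<bar>\<^sup>2) \<le> D \<omega>) \<and>
        (\<integral>\<^sup>+\<omega>. D \<omega> \<partial>M) \<le> 4 * sqnorm M (\<lambda>\<omega>. S (Suc k) T \<omega> - S k T \<omega>)"
    proof
      fix k
      show "\<exists>D. D \<in> borel_measurable M \<and> (AE \<omega> in M. \<forall>t\<in>{0..T}. ennreal (\<bar>S (Suc k) t \<omega> - S k t \<omega>\<bar>\<^sup>2) \<le> D \<omega>) \<and>
        (\<integral>\<^sup>+\<omega>. D \<omega> \<partial>M) \<le> 4 * sqnorm M (\<lambda>\<omega>. S (Suc k) T \<omega> - S k T \<omega>)"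
        by (rule Doob_dominated[OF mdiff[of "Suc k" k]]) blast
    qed
    from choice[OF this] obtain D where
      D': "\<forall>k. D k \<in> borel_measurable M \<and> (AE \<omega> in M. \<forall>t\<in>{0..T}. ennreal (\<bar>S (Suc k) t \<omega> - S k t \<omega>\<bar>\<^sup>2) \<le> D k \<omega>) \<and>
        (\<integral>\<^sup>+\<omega>. D k \<omega> \<partial>M) \<le> 4 * sqnorm M (\<lambda>\<omega>. S (Suc k) T \<omega> - S k T \<omega>)" ..
    have D: "\<And>k. D k \<in> borel_measurable M" "\<And>k. AE \<omega> in M. \<forall>t\<in>{0..T}. ennreal (\<bar>S (Suc k) t \<omega> - S k t \<omega>\<bar>\<^sup>2) \<le> D k \<omega>"
        "\<And>k. (\<integral>\<^sup>+\<omega>. D k \<omega> \<partial>M) \<le> 4 * sqnorm M (\<lambda>\<omega>. S (Suc k) T \<omega> - S k T \<omega>)" using D' by blast+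
    have "(\<integral>\<^sup>+\<omega>. D k \<omega> \<partial>M) \<le> ennreal ((4 * c) * (1/4)^k)" for k
    proof -
      have "(\<integral>\<^sup>+\<omega>. D k \<omega> \<partial>M) \<le> 4 * ennreal (c * (1/4)^k)"
        by (rule order_trans[OF D(3) mult_left_mono[OF CS]]) simp
      then show ?thesis using c by (simp add: ennreal_mult mult.assoc)
    qed
    from AE_geometric_bound[OF D(1) this] c
    have "AE \<omega> in M. \<exists>b\<ge>0. \<forall>k. D k \<omega> \<le> ennreal (b * (1/2)^k)" by simp
    moreover have "AE \<omega> in M. \<forall>k. \<forall>t\<in>{0..T}. ennreal (\<bar>S (Suc k) t \<omega> - S k t \<omega>\<bar>\<^sup>2) \<le> D k \<omega>"
      using D(2) by (simp add: AE_all_countable)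
    moreover have "AE \<omega> in M. \<forall>k. continuous_on {0..T} (\<lambda>t. S k t \<omega>)"
      using mart unfolding martingale_def by (simp add: AE_all_countable)
    ultimately show ?thesis
    proof eventually_elim
      case (elim \<omega>)
      then obtain b where b: "b \<ge> 0" "\<And>k. D k \<omega> \<le> ennreal (b * (1/2)^k)" by auto
      have "(norm (S (Suc k) t \<omega> - S k t \<omega>))\<^sup>2 \<le> b * (1/2)^k" if t: "t \<in> {0..T}" for k t
      proof -
        have "ennreal (\<bar>S (Suc k) t \<omega> - S k t \<omega>\<bar>\<^sup>2) \<le> ennreal (b * (1/2)^k)"
          using elim(2) t b(2) order_trans by blast
        then show ?thesis using b(1) by (subst (asm) ennreal_le_iff) auto
      qed
      then show ?case unfolding good_def using elim(3) by blast
    qed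
  qed
  \<comment> \<open>The value 0 off the good set makes every path continuous, as
    \<open>S2_space\<close> demands. Adaptedness survives because the bad set is null.\<close>
  define I where "I t \<omega> = (if good \<omega> then lim (\<lambda>k. S k t \<omega>) else 0)" for t \<omega>
  have unif: "uniform_limit {0..T} (\<lambda>k t. S k t \<omega>) (\<lambda>t. I t \<omega>) sequentially" if g: "good \<omega>" for \<omega>
  proof -
    obtain b where b: "\<And>k t. t \<in> {0..T} \<Longrightarrow> (norm (S (Suc k) t \<omega> - S k t \<omega>))\<^sup>2 \<le> b * (1/2)^k"
      using g unfolding good_def by blast
    have "uniformly_convergent_on {0..T} (\<lambda>k t. S k t \<omega>)"
      by (rule uniformly_convergent_on_geometric[OF b])
    then show ?thesis using g by (simp add: uniformly_convergent_uniform_limit_iff I_def)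
  qed
  have ptw: "(\<lambda>k. S k t \<omega>) \<longlonglongrightarrow> I t \<omega>" if "good \<omega>" "t \<in> {0..T}" for \<omega> t
    using tendsto_uniform_limitI[OF unif[OF that(1)] that(2)] .
  have Icont: "continuous_on {0..T} (\<lambda>t. I t \<omega>)" for \<omega>
  proof (cases "good \<omega>")
    case True
    have "\<forall>\<^sub>F k in sequentially. continuous_on {0..T} (\<lambda>t. S k t \<omega>)" using True unfolding good_def by simp
    then show ?thesis by (rule uniform_limit_theorem[OF _ unif[OF True]]) simp
  qed (simp add: I_def)
  have Im: "I t \<in> borel_measurable (F t)" if t: "t \<in> {0..T}" for t
  proof (rule F_measurable_AE)
    have [measurable]: "S k t \<in> borel_measurable (F t)" for k using S_L2[OF t] by (auto simp: L2_space_iff)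
    show "(\<lambda>\<omega>. lim (\<lambda>k. S k t \<omega>)) \<in> borel_measurable (F t)" by measurable
    show "AE \<omega> in M. lim (\<lambda>k. S k t \<omega>) = I t \<omega>" using good by eventually_elim (simp add: I_def)
  qed
  have Ilim: "(\<lambda>k. sqnorm M (\<lambda>\<omega>. S k t \<omega> - I t \<omega>)) \<longlonglongrightarrow> 0" if t: "t \<in> {0..T}" for t
  proof (rule sqnorm_Cauchy_AE_limit[where r = "\<lambda>k. k"])
    show "sqnorm_Cauchy M (\<lambda>k. S k t)"
    proof (rule sqnorm_Cauchy_geometric[where c = "4 * c"])
      show "sqnorm M (\<lambda>x. S (Suc k) t x - S k t x) \<le> ennreal (4 * c * (1/4)^k)" for k
      proof -
        have "sqnorm M (\<lambda>x. S (Suc k) t x - S k t x) \<le> 4 * ennreal (c * (1/4)^k)"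
          by (rule order_trans[OF martingale_sqnorm_le[OF mdiff t] mult_left_mono[OF CS]]) simp
        then show ?thesis using c by (simp add: ennreal_mult mult.assoc)
      qed
    qed (use c S_m[OF t] in auto)
    show "AE \<omega> in M. (\<lambda>k. S k t \<omega>) \<longlonglongrightarrow> I t \<omega>" using good by eventually_elim (rule ptw[OF _ t])
  qed (use S_m[OF t] in auto)
  have martI: "martingale I"
    by (rule martingale_limit[OF mart Im Ilim]) (use Icont in auto)
  have IS2: "I \<in> S2_space M F T"
  proof -
    have "(\<integral>\<^sup>+\<omega>. (SUP t\<in>{0..T}. ennreal (\<bar>I t \<omega>\<bar>\<^sup>2)) \<partial>M) < \<infinity>"
      using Doob[OF martI] L2_sqnorm_finite[OF _ martingale_L2[OF martI], of T] T_pos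
      by (auto simp: ennreal_mult_less_top elim!: order.strict_trans1)
    then show ?thesis using Im Icont unfolding S2_space_def by auto
  qed
  have Tin: "T \<in> {0..T}" using T_pos by auto
  have "has_ito_integral M F T B (\<lambda>r \<omega>. ZZ (\<omega>, r)) I"
    unfolding has_ito_integral_def
  proof (intro conjI ZH2 IS2 exI allI)
    show "simple_integrand M F T (n k) (p k) (\<eta> k)" for k by (rule sim)
    have m: "(\<lambda>x. zz k x - ZZ x) \<in> borel_measurable P" for k by measurable
    show "(\<lambda>k. \<integral>\<^sup>+\<omega>. (\<integral>\<^sup>+s\<in>{0..T}. ennreal ((norm (simple_process (n k) (p k) (\<eta> k) s \<omega> - ZZ (\<omega>, s)))\<^sup>2) \<partial>lborel) \<partial>M) \<longlonglongrightarrow> 0"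
      using ZZlim sqnorm_P_eq[OF m] by (simp add: zz_def)
    show "(\<lambda>k. \<integral>\<^sup>+\<omega>. (SUP t\<in>{0..T}. ennreal (\<bar>simple_ito_integral B (n k) (p k) (\<eta> k) t \<omega> - I t \<omega>\<bar>\<^sup>2)) \<partial>M) \<longlonglongrightarrow> 0"
    proof (rule tendsto_sandwich[OF _ _ tendsto_const])
      show "\<forall>\<^sub>F k in sequentially. (\<integral>\<^sup>+\<omega>. (SUP t\<in>{0..T}. ennreal (\<bar>simple_ito_integral B (n k) (p k) (\<eta> k) t \<omega> - I t \<omega>\<bar>\<^sup>2)) \<partial>M)
         \<le> 4 * sqnorm M (\<lambda>\<omega>. S k T \<omega> - I T \<omega>)"
        using Doob[OF martingale_diff[OF mart martI]] by (intro always_eventually allI) (simp add: S_def)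
      show "(\<lambda>k. 4 * sqnorm M (\<lambda>\<omega>. S k T \<omega> - I T \<omega>)) \<longlonglongrightarrow> 0"
        using ennreal_tendsto_0_lincomb[OF Ilim[OF Tin] tendsto_const, of 4 0] by simp
    qed simp
  qed
  then show ?thesis using that Ilim[OF Tin] unfolding S_def by blast
qed


section \<open>Random variables approximable by stochastic integrals\<close>

definition grid :: "nat \<Rightarrow> nat \<Rightarrow> real" where
  "grid N k = real k * T / real N"

lemma grid_bounds:
  assumes "k \<le> N" "0 < N" shows "0 \<le> grid N k" "grid N k \<le> T"
proof -
  show "0 \<le> grid N k" using T_pos by (simp add: grid_def)
  have "real k * T \<le> real N * T" using assms T_pos by (intro mult_right_mono) auto
  then show "grid N k \<le> T" using assms by (simp add: grid_def divide_le_eq mult.commute)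
qed

lemma grid_mono: "j \<le> k \<Longrightarrow> grid N j \<le> grid N k"
  using T_pos by (simp add: grid_def divide_right_mono)

lemma grid_Suc: "0 < N \<Longrightarrow> grid N (Suc k) - grid N k = T / real N"
  by (simp add: grid_def field_simps)

lemma grid_refine: "0 < m \<Longrightarrow> grid (N * m) (k * m) = grid N k"
  by (simp add: grid_def)

text \<open>Only uniform grids are used here: grids with \<open>N\<close> and N' steps have the one
  with N * N' steps as common refinement, so sums of integrands are formed by re-indexing with
  \<open>div\<close>.\<close>

definition unif :: "nat \<Rightarrow> (nat \<Rightarrow> 'w \<Rightarrow> real ^ 'd) \<Rightarrow> bool" where
  "unif N \<eta> \<longleftrightarrow> 0 < N \<and> (\<forall>k<N. bounded_meas (grid N k) (\<eta> k))"

definition ugint :: "nat \<Rightarrow> (nat \<Rightarrow> 'w \<Rightarrow> real ^ 'd) \<Rightarrow> 'w \<Rightarrow> real" where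
  "ugint N \<eta> \<omega> = (\<Sum>k<N. incr (grid N k) (grid N (Suc k)) (\<eta> k) \<omega>)"

lemma unif_simple: "unif N \<eta> \<Longrightarrow> simple_integrand M F T N (grid N) \<eta>"
  unfolding simple_integrand_def unif_def bounded_meas_def
  using grid_bounds grid_mono by auto

lemma ugint_eq: "0 < N \<Longrightarrow> simple_ito_integral B N (grid N) \<eta> T = ugint N \<eta>"
  unfolding ugint_def simple_ito_integral_def incr_def
  by (intro ext sum.cong refl) (simp add: min_absorb2 grid_bounds)

lemma ugint_L2: "unif N \<eta> \<Longrightarrow> ugint N \<eta> \<in> L2_space M (F T)"
  using martingale_L2[OF martingale_simple[OF unif_simple], of N \<eta> T] T_pos ugint_eq[of N \<eta>] by (auto simp: unif_def)

text \<open>On the finer grid each block of \<open>m\<close> steps carries the same coefficient, so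
  its increments telescope to the coarse increment.\<close>

lemma ugint_refine:
  assumes m: "0 < m"
  shows "ugint (N * m) (\<lambda>k. \<eta> (k div m)) \<omega> = ugint N \<eta> \<omega>"
proof -
  let ?f = "\<lambda>k. incr (grid (N * m) k) (grid (N * m) (Suc k)) (\<eta> (k div m)) \<omega>"
  have "ugint (N * m) (\<lambda>k. \<eta> (k div m)) \<omega> = (\<Sum>i<N. sum ?f {i * m..<i * m + m})"
    unfolding ugint_def by (rule sum.nat_group[symmetric])
  also have "\<dots> = (\<Sum>i<N. incr (grid N i) (grid N (Suc i)) (\<eta> i) \<omega>)"
  proof (rule sum.cong[OF refl])
    fix i
    have "sum ?f {i * m..<i * m + m} = (\<Sum>k\<in>{i * m..<i * m + m}. \<eta> i \<omega> \<bullet> B (grid (N * m) (Suc k)) \<omega> - \<eta> i \<omega> \<bullet> B (grid (N * m) k) \<omega>)"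
    proof (rule sum.cong[OF refl])
      fix k assume "k \<in> {i * m..<i * m + m}"
      then have "k div m = i" using m by (intro div_nat_eqI) (auto simp: mult.commute add.commute)
      then show "?f k = \<eta> i \<omega> \<bullet> B (grid (N * m) (Suc k)) \<omega> - \<eta> i \<omega> \<bullet> B (grid (N * m) k) \<omega>"
        by (simp add: incr_def inner_diff_right)
    qed
    also have "\<dots> = \<eta> i \<omega> \<bullet> B (grid (N * m) (i * m + m)) \<omega> - \<eta> i \<omega> \<bullet> B (grid (N * m) (i * m)) \<omega>"
      by (rule sum_Suc_diff') simp
    also have "\<dots> = incr (grid N i) (grid N (Suc i)) (\<eta> i) \<omega>"
      using grid_refine[OF m, of N i] grid_refine[OF m, of N "Suc i"] by (simp add: incr_def inner_diff_right add.commute)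
    finally show "sum ?f {i * m..<i * m + m} = incr (grid N i) (grid N (Suc i)) (\<eta> i) \<omega>" .
  qed
  finally show ?thesis by (simp add: ugint_def)
qed

lemma unif_refine:
  assumes m: "0 < m" and u: "unif N \<eta>"
  shows "unif (N * m) (\<lambda>k. \<eta> (k div m))"
  unfolding unif_def
proof (intro conjI allI impI)
  show "0 < N * m" using m u by (simp add: unif_def)
  fix k assume k: "k < N * m"
  then have "k div m < N" using m by (simp add: less_mult_imp_div_less)
  then have b: "bounded_meas (grid N (k div m)) (\<eta> (k div m))" using u by (simp add: unif_def)
  have "grid N (k div m) = grid (N * m) (k div m * m)" using grid_refine[OF m] by simp
  also have "\<dots> \<le> grid (N * m) k" by (rule grid_mono) simp
  finally show "bounded_meas (grid (N * m) k) (\<eta> (k div m))" using bounded_meas_mono b by blast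
qed

lemma bounded_meas_lincomb:
  assumes "bounded_meas a \<eta>" "bounded_meas a \<theta>"
  shows "bounded_meas a (\<lambda>\<omega>. c *\<^sub>R \<eta> \<omega> + d *\<^sub>R \<theta> \<omega>)"
proof -
  obtain K where K: "\<And>\<omega>. \<omega> \<in> space M \<Longrightarrow> norm (\<eta> \<omega>) \<le> K" using bounded_measE[OF assms(1)] by metis
  obtain K' where K': "\<And>\<omega>. \<omega> \<in> space M \<Longrightarrow> norm (\<theta> \<omega>) \<le> K'" using bounded_measE[OF assms(2)] by metis
  have "norm (c *\<^sub>R \<eta> \<omega> + d *\<^sub>R \<theta> \<omega>) \<le> \<bar>c\<bar> * K + \<bar>d\<bar> * K'" if "\<omega> \<in> space M" for \<omega>
  proof -
    have "norm (c *\<^sub>R \<eta> \<omega> + d *\<^sub>R \<theta> \<omega>) \<le> \<bar>c\<bar> * norm (\<eta> \<omega>) + \<bar>d\<bar> * norm (\<theta> \<omega>)"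
      by (rule norm_triangle_le) simp
    also have "\<dots> \<le> \<bar>c\<bar> * K + \<bar>d\<bar> * K'" using K K' that by (intro add_mono mult_left_mono) auto
    finally show ?thesis .
  qed
  then show ?thesis using assms unfolding bounded_meas_def by (auto intro!: boundedI)
qed

text \<open>Membership in the L^2-closure of constants plus simple integrals. Being phrased by
  approximation, it is stable under limits at once; an actual integrand is extracted only once, in
  \<open>repr_ito_integral\<close>.\<close>

definition repr :: "('w \<Rightarrow> real) \<Rightarrow> bool" where
  "repr X \<longleftrightarrow> X \<in> L2_space M (F T) \<and>
     (\<forall>e>0. \<exists>c N \<eta>. unif N \<eta> \<and> sqnorm M (\<lambda>\<omega>. X \<omega> - (c + ugint N \<eta> \<omega>)) \<le> ennreal e)"

lemma reprD_L2: "repr X \<Longrightarrow> X \<in> L2_space M (F T)"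
  unfolding repr_def by auto

lemma repr_limit:
  assumes X: "X \<in> L2_space M (F T)" and lim: "\<And>e. e > 0 \<Longrightarrow> \<exists>Y. repr Y \<and> sqnorm M (\<lambda>\<omega>. X \<omega> - Y \<omega>) \<le> ennreal e"
  shows "repr X"
  unfolding repr_def
proof (intro conjI X allI impI)
  fix e :: real assume e: "e > 0"
  obtain Y where Y: "repr Y" "sqnorm M (\<lambda>\<omega>. X \<omega> - Y \<omega>) \<le> ennreal (e/4)" using lim[of "e/4"] e by auto
  obtain c N \<eta> where u: "unif N \<eta>" "sqnorm M (\<lambda>\<omega>. Y \<omega> - (c + ugint N \<eta> \<omega>)) \<le> ennreal (e/4)"
    using Y(1) e unfolding repr_def by (meson divide_pos_pos zero_less_numeral)
  have [measurable]: "X \<in> borel_measurable M" "Y \<in> borel_measurable M" "ugint N \<eta> \<in> borel_measurable M"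
    using L2_measurable[of T] X reprD_L2[OF Y(1)] ugint_L2[OF u(1)] by auto
  have "sqnorm M (\<lambda>\<omega>. X \<omega> - (c + ugint N \<eta> \<omega>)) \<le> 2 * sqnorm M (\<lambda>\<omega>. X \<omega> - Y \<omega>) + 2 * sqnorm M (\<lambda>\<omega>. Y \<omega> - (c + ugint N \<eta> \<omega>))"
    by (rule sqnorm_diff_triangle) auto
  also have "\<dots> \<le> 2 * ennreal (e/4) + 2 * ennreal (e/4)"
    by (intro add_mono mult_left_mono Y u) auto
  also have "\<dots> = ennreal e"
    using e by (simp add: ennreal_mult[symmetric] ennreal_plus[symmetric] flip: ennreal_numeral del: ennreal_plus)
  finally show "\<exists>c N \<eta>. unif N \<eta> \<and> sqnorm M (\<lambda>\<omega>. X \<omega> - (c + ugint N \<eta> \<omega>)) \<le> ennreal e"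
    using u(1) by blast
qed

lemma repr_tendsto:
  assumes X: "X \<in> L2_space M (F T)" and Y: "\<And>k. repr (Y k)" and lim: "(\<lambda>k. sqnorm M (\<lambda>\<omega>. Y k \<omega> - X \<omega>)) \<longlonglongrightarrow> 0"
  shows "repr X"
proof (rule repr_limit[OF X])
  fix e :: real assume "e > 0"
  then have "\<forall>\<^sub>F k in sequentially. sqnorm M (\<lambda>\<omega>. Y k \<omega> - X \<omega>) < ennreal e" using order_tendstoD(2)[OF lim] by simp
  then obtain k where "sqnorm M (\<lambda>\<omega>. Y k \<omega> - X \<omega>) < ennreal e" by (auto simp: eventually_sequentially)
  then show "\<exists>Y. repr Y \<and> sqnorm M (\<lambda>\<omega>. X \<omega> - Y \<omega>) \<le> ennreal e"
    using Y[of k] sqnorm_minus_commute[of M X "Y k"] by (intro exI[of _ "Y k"]) auto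
qed

lemma repr_AE_cong:
  assumes X: "repr X" and eq: "AE \<omega> in M. X \<omega> = Y \<omega>"
  shows "repr Y"
proof (rule repr_limit)
  show "Y \<in> L2_space M (F T)" using L2_AE_cong[OF _ reprD_L2[OF X] eq] by simp
  have "sqnorm M (\<lambda>\<omega>. Y \<omega> - X \<omega>) = sqnorm M (\<lambda>\<omega>. 0::real)"
    by (rule sqnorm_cong_AE) (use eq in auto)
  then show "\<exists>Y'. repr Y' \<and> sqnorm M (\<lambda>\<omega>. Y \<omega> - Y' \<omega>) \<le> ennreal e" for e
    using X by (auto simp: sqnorm_def intro!: exI[of _ X])
qed

lemma repr_const: "repr (\<lambda>\<omega>. c)"
  unfolding repr_def
proof (intro conjI L2_const allI impI)
  fix e :: real
  have "unif 1 (\<lambda>_ _. 0)" unfolding unif_def bounded_meas_def by (auto intro!: boundedI[of _ 0])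
  moreover have "sqnorm M (\<lambda>\<omega>. c - (c + ugint 1 (\<lambda>_ _. 0) \<omega>)) \<le> ennreal e"
    by (simp add: ugint_def incr_def sqnorm_def)
  ultimately show "\<exists>c' N \<eta>. unif N \<eta> \<and> sqnorm M (\<lambda>\<omega>. c - (c' + ugint N \<eta> \<omega>)) \<le> ennreal e" by blast
qed

lemma repr_lincomb:
  assumes X: "repr X" and Y: "repr Y"
  shows "repr (\<lambda>\<omega>. a * X \<omega> + b * Y \<omega>)"
  unfolding repr_def
proof (intro conjI allI impI)
  show "(\<lambda>\<omega>. a * X \<omega> + b * Y \<omega>) \<in> L2_space M (F T)"
    by (intro L2_add L2_cmult reprD_L2 X Y) simp
  fix e :: real assume e: "e > 0"
  \<comment> \<open>Chosen so that the error 2 (a^2 + b^2) e' of the combination stays below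
    \<open>e\<close>; the added 1 avoids division by 0.\<close>
  define e' where "e' = e / (2 * (a\<^sup>2 + b\<^sup>2 + 1))"
  have p: "a\<^sup>2 + b\<^sup>2 + 1 > 0" by (simp add: add_nonneg_pos)
  have e': "e' > 0" unfolding e'_def using e p by simp
  obtain c N \<eta> where u: "unif N \<eta>" "sqnorm M (\<lambda>\<omega>. X \<omega> - (c + ugint N \<eta> \<omega>)) \<le> ennreal e'"
    using X e' unfolding repr_def by blast
  obtain c' N' \<theta> where u': "unif N' \<theta>" "sqnorm M (\<lambda>\<omega>. Y \<omega> - (c' + ugint N' \<theta> \<omega>)) \<le> ennreal e'"
    using Y e' unfolding repr_def by blast
  have pos: "0 < N" "0 < N'" using u u' by (auto simp: unif_def)
  define \<zeta> where "\<zeta> k \<omega> = a *\<^sub>R \<eta> (k div N') \<omega> + b *\<^sub>R \<theta> (k div N) \<omega>" for k \<omega>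
  have r: "unif (N * N') (\<lambda>k. \<eta> (k div N'))" "unif (N * N') (\<lambda>k. \<theta> (k div N))"
    using unif_refine[OF pos(2) u(1)] unif_refine[OF pos(1) u'(1)] by (simp_all add: mult.commute)
  have uz: "unif (N * N') \<zeta>"
    using r bounded_meas_lincomb unfolding unif_def \<zeta>_def by blast
  have "ugint (N * N') \<zeta> \<omega> = a * ugint (N * N') (\<lambda>k. \<eta> (k div N')) \<omega> + b * ugint (N * N') (\<lambda>k. \<theta> (k div N)) \<omega>" for \<omega>
    unfolding ugint_def \<zeta>_def incr_def by (simp add: inner_add_left sum.distrib sum_distrib_left)
  then have eq: "ugint (N * N') \<zeta> \<omega> = a * ugint N \<eta> \<omega> + b * ugint N' \<theta> \<omega>" for \<omega>
    using ugint_refine[OF pos(2), of N \<eta> \<omega>] ugint_refine[OF pos(1), of N' \<theta> \<omega>] by (simp add: mult.commute)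
  have [measurable]: "X \<in> borel_measurable M" "Y \<in> borel_measurable M" "ugint N \<eta> \<in> borel_measurable M" "ugint N' \<theta> \<in> borel_measurable M"
    using L2_measurable[of T] reprD_L2[OF X] reprD_L2[OF Y] ugint_L2[OF u(1)] ugint_L2[OF u'(1)] by auto
  have "sqnorm M (\<lambda>\<omega>. a * X \<omega> + b * Y \<omega> - ((a * c + b * c') + ugint (N * N') \<zeta> \<omega>))
      = sqnorm M (\<lambda>\<omega>. a *\<^sub>R (X \<omega> - (c + ugint N \<eta> \<omega>)) + b *\<^sub>R (Y \<omega> - (c' + ugint N' \<theta> \<omega>)))"
    unfolding eq by (simp add: algebra_simps)
  also have "\<dots> \<le> 2 * sqnorm M (\<lambda>\<omega>. a *\<^sub>R (X \<omega> - (c + ugint N \<eta> \<omega>))) + 2 * sqnorm M (\<lambda>\<omega>. b *\<^sub>R (Y \<omega> - (c' + ugint N' \<theta> \<omega>)))"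
    by (rule sqnorm_add_le) auto
  also have "\<dots> = 2 * (ennreal (a\<^sup>2) * sqnorm M (\<lambda>\<omega>. X \<omega> - (c + ugint N \<eta> \<omega>))) + 2 * (ennreal (b\<^sup>2) * sqnorm M (\<lambda>\<omega>. Y \<omega> - (c' + ugint N' \<theta> \<omega>)))"
    by (subst (1 2) sqnorm_cmult) auto
  also have "\<dots> \<le> 2 * (ennreal (a\<^sup>2) * ennreal e') + 2 * (ennreal (b\<^sup>2) * ennreal e')"
    by (intro add_mono mult_left_mono u u') auto
  also have "\<dots> = ennreal (2 * (a\<^sup>2 + b\<^sup>2) * e')"
    using e' by (simp add: ennreal_mult[symmetric] ennreal_plus[symmetric] algebra_simps flip: ennreal_numeral del: ennreal_plus)
  also have "\<dots> \<le> ennreal e"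
  proof (rule ennreal_leI)
    have "2 * (a\<^sup>2 + b\<^sup>2) * e' \<le> 2 * (a\<^sup>2 + b\<^sup>2 + 1) * e'" using e' by (intro mult_right_mono) auto
    also have "\<dots> = e" using p by (simp add: e'_def)
    finally show "2 * (a\<^sup>2 + b\<^sup>2) * e' \<le> e" .
  qed
  finally show "\<exists>c N \<eta>. unif N \<eta> \<and> sqnorm M (\<lambda>\<omega>. a * X \<omega> + b * Y \<omega> - (c + ugint N \<eta> \<omega>)) \<le> ennreal e"
    using uz by blast
qed

lemma repr_sum:
  assumes "finite I" "\<And>i. i \<in> I \<Longrightarrow> repr (X i)"
  shows "repr (\<lambda>\<omega>. \<Sum>i\<in>I. a i * X i \<omega>)"
  using assms
proof (induction I rule: finite_induct)
  case empty
  then show ?case by (simp add: repr_const)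
next
  case (insert i I)
  then show ?case using repr_lincomb[of "X i" "\<lambda>\<omega>. \<Sum>i\<in>I. a i * X i \<omega>" "a i" 1] by simp
qed

text \<open>Simple integrals are centred, hence orthogonal to constants. So the distance between two
  integrals is at most the distance between the full approximants, which makes the integrals Cauchy
  on their own, while the constants converge to the mean of \<open>X\<close>. The two limits can
  thus be taken separately.\<close>

theorem repr_ito_integral:
  assumes X: "repr X"
  obtains c Z I where "has_ito_integral M F T B Z I" "AE \<omega> in M. X \<omega> = c + I T \<omega>"
proof -
  have "\<forall>k. \<exists>c N \<eta>. unif N \<eta> \<and> sqnorm M (\<lambda>\<omega>. X \<omega> - (c + ugint N \<eta> \<omega>)) \<le> ennreal ((1/4)^k)"
    using X unfolding repr_def by (meson zero_less_divide_1_iff zero_less_numeral zero_less_power)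
  then obtain c N \<eta> where u: "\<And>k. unif (N k) (\<eta> k)" and app: "\<And>k. sqnorm M (\<lambda>\<omega>. X \<omega> - (c k + ugint (N k) (\<eta> k) \<omega>)) \<le> ennreal ((1/4)^k)"
    by metis
  define S where "S k = ugint (N k) (\<eta> k)" for k
  have Npos: "0 < N k" for k using u[of k] by (simp add: unif_def)
  have S: "S k = simple_ito_integral B (N k) (grid (N k)) (\<eta> k) T" for k
    unfolding S_def using ugint_eq[OF Npos] by simp
  note app' = app[folded S_def]
  note XL = reprD_L2[OF X]
  have SL: "S k \<in> L2_space M (F T)" for k unfolding S_def by (rule ugint_L2[OF u])
  have [measurable]: "X \<in> borel_measurable M" "S k \<in> borel_measurable M" for k
    using L2_measurable[OF order_refl XL] L2_measurable[OF order_refl SL] by auto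
  have mean0: "(\<integral>\<omega>. S k \<omega> \<partial>M) = 0" for k
    using martingale_integral_eq[OF martingale_simple[OF unif_simple[OF u[of k]]], of 0 T "\<lambda>_. 1"] T_pos
      simple_ito_integral_0[OF unif_simple[OF u[of k]]] L2_const[of 1] by (simp add: S)
  have SI: "integrable M (S k)" for k using L2_integrable[OF order_refl SL] .
  have diff_le: "sqnorm M (\<lambda>\<omega>. S (Suc k) \<omega> - S k \<omega>) \<le> ennreal (4 * (1/4)^k)" for k
  proof -
    let ?d = "\<lambda>\<omega>. S (Suc k) \<omega> - S k \<omega>" and ?c = "c (Suc k) - c k"
    have dL: "?d \<in> L2_space M (F T)" by (intro L2_diff SL) simp
    have d2: "integrable M (\<lambda>\<omega>. (?d \<omega>)\<^sup>2)" using L2_square_integrable[OF dL] .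
    have dI: "integrable M ?d" using SI by auto
    have "(\<integral>\<omega>. (?c + ?d \<omega>)\<^sup>2 \<partial>M) = (\<integral>\<omega>. ?c\<^sup>2 + 2 * ?c * ?d \<omega> + (?d \<omega>)\<^sup>2 \<partial>M)"
    proof -
      have "(a + b)\<^sup>2 = a\<^sup>2 + 2 * a * b + b\<^sup>2" for a b :: real by (simp add: power2_sum)
      then show ?thesis by (simp only:)
    qed
    also have "\<dots> = ?c\<^sup>2 + 2 * ?c * (\<integral>\<omega>. ?d \<omega> \<partial>M) + (\<integral>\<omega>. (?d \<omega>)\<^sup>2 \<partial>M)"
      using dI d2 by (simp add: prob_space del: Bochner_Integration.integral_diff)
    also have "(\<integral>\<omega>. ?d \<omega> \<partial>M) = 0" using SI mean0 by simp
    finally have "(\<integral>\<omega>. (?d \<omega>)\<^sup>2 \<partial>M) \<le> (\<integral>\<omega>. (?c + ?d \<omega>)\<^sup>2 \<partial>M)" by simp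
    then have "sqnorm M ?d \<le> sqnorm M (\<lambda>\<omega>. ?c + ?d \<omega>)"
      using sqnorm_eq_integral_L2[OF dL] sqnorm_eq_integral_L2[OF L2_add[OF order_refl L2_const dL, of ?c]] by (simp add: ennreal_leI)
    also have "(\<lambda>\<omega>. ?c + ?d \<omega>) = (\<lambda>\<omega>. (c (Suc k) + S (Suc k) \<omega>) - (c k + S k \<omega>))" by auto
    also have "sqnorm M \<dots> \<le> 2 * sqnorm M (\<lambda>\<omega>. (c (Suc k) + S (Suc k) \<omega>) - X \<omega>) + 2 * sqnorm M (\<lambda>\<omega>. X \<omega> - (c k + S k \<omega>))"
      by (rule sqnorm_diff_triangle) auto
    also have "\<dots> \<le> 2 * ennreal ((1/4)^Suc k) + 2 * ennreal ((1/4)^k)"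
      using app'[of k] app'[of "Suc k"] sqnorm_minus_commute[of M X "\<lambda>\<omega>. c (Suc k) + S (Suc k) \<omega>"]
      by (intro add_mono mult_left_mono) auto
    also have "\<dots> = ennreal (2 * (1/4)^Suc k + 2 * (1/4)^k)"
      by (simp add: ennreal_mult[symmetric] ennreal_plus[symmetric] flip: ennreal_numeral del: ennreal_plus)
    also have "\<dots> \<le> ennreal (4 * (1/4)^k)" by (rule ennreal_leI) simp
    finally show ?thesis .
  qed
  obtain Z I where I: "has_ito_integral M F T B Z I" and lim: "(\<lambda>k. sqnorm M (\<lambda>\<omega>. S k \<omega> - I T \<omega>)) \<longlonglongrightarrow> 0"
    using ito_integral_of_Cauchy[OF unif_simple[OF u] diff_le[unfolded S]] unfolding S by auto
  have IT: "I T \<in> L2_space M (F T)" using martingale_L2[OF has_ito_integral_martingale[OF I]] T_pos by auto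
  then have [measurable]: "I T \<in> borel_measurable M" using L2_measurable by blast
  have "(\<lambda>k. ennreal ((1/4)^k)) \<longlonglongrightarrow> ennreal 0" by (intro tendsto_ennrealI LIMSEQ_power_zero) auto
  then have Wlim: "(\<lambda>k. sqnorm M (\<lambda>\<omega>. (c k + S k \<omega>) - X \<omega>)) \<longlonglongrightarrow> 0"
    using app' sqnorm_minus_commute[of M X] by (intro sqnorm_tendsto_0_le[where g = "\<lambda>k. ennreal ((1/4)^k)"]) auto
  define C where "C = (\<integral>\<omega>. X \<omega> \<partial>M)"
  have "(\<lambda>k. \<integral>\<omega>. 1 * (c k + S k \<omega>) \<partial>M) \<longlonglongrightarrow> (\<integral>\<omega>. 1 * X \<omega> \<partial>M)"
    using L2_square_integrable[OF L2_add[OF order_refl L2_const SL]] L2_square_integrable[OF XL]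
    by (intro integral_mult_tendsto[OF _ _ _ _ _ _ Wlim]) auto
  then have "c \<longlonglongrightarrow> C" using SI mean0 by (simp add: C_def prob_space)
  then have "(\<lambda>k. ennreal ((c k - C)\<^sup>2)) \<longlonglongrightarrow> ennreal 0"
    by (intro tendsto_ennrealI) (simp add: LIM_zero_iff tendsto_null_power)
  then have clim: "(\<lambda>k. sqnorm M (\<lambda>\<omega>. c k - C)) \<longlonglongrightarrow> 0"
    by (simp add: sqnorm_def emeasure_space_1)
  have cI: "(\<lambda>k. sqnorm M (\<lambda>\<omega>. (c k + S k \<omega>) - (C + I T \<omega>))) \<longlonglongrightarrow> 0"
  proof (rule sqnorm_tendsto_0_le)
    show "sqnorm M (\<lambda>\<omega>. (c k + S k \<omega>) - (C + I T \<omega>)) \<le> 2 * sqnorm M (\<lambda>\<omega>. c k - C) + 2 * sqnorm M (\<lambda>\<omega>. S k \<omega> - I T \<omega>)" for k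
      using sqnorm_add_le[of "\<lambda>\<omega>. c k - C" M "\<lambda>\<omega>. S k \<omega> - I T \<omega>"] by (simp add: algebra_simps)
    show "(\<lambda>k. 2 * sqnorm M (\<lambda>\<omega>. c k - C) + 2 * sqnorm M (\<lambda>\<omega>. S k \<omega> - I T \<omega>)) \<longlonglongrightarrow> 0"
      by (intro ennreal_tendsto_0_lincomb clim lim) auto
  qed
  have "(\<lambda>k::nat. sqnorm M (\<lambda>\<omega>. X \<omega> - (C + I T \<omega>))) \<longlonglongrightarrow> 0"
  proof (rule sqnorm_tendsto_0_le)
    show "sqnorm M (\<lambda>\<omega>. X \<omega> - (C + I T \<omega>)) \<le> 2 * sqnorm M (\<lambda>\<omega>. (c k + S k \<omega>) - X \<omega>) + 2 * sqnorm M (\<lambda>\<omega>. (c k + S k \<omega>) - (C + I T \<omega>))" for k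
      using sqnorm_diff_triangle[of X M "\<lambda>\<omega>. c k + S k \<omega>" "\<lambda>\<omega>. C + I T \<omega>"] sqnorm_minus_commute[of M X] by simp
    show "(\<lambda>k. 2 * sqnorm M (\<lambda>\<omega>. (c k + S k \<omega>) - X \<omega>) + 2 * sqnorm M (\<lambda>\<omega>. (c k + S k \<omega>) - (C + I T \<omega>))) \<longlonglongrightarrow> 0"
      by (intro ennreal_tendsto_0_lincomb Wlim cI) auto
  qed
  then have "sqnorm M (\<lambda>\<omega>. X \<omega> - (C + I T \<omega>)) = 0" by (simp add: LIMSEQ_const_iff)
  then have "AE \<omega> in M. X \<omega> = C + I T \<omega>" by (subst (asm) sqnorm_eq_0_iff) auto
  with I show ?thesis by (rule that)
qed

section \<open>Trigonometric functions of the Brownian motion\<close>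

lemma cos_sin_Taylor:
  fixes x :: real
  shows "\<bar>cos x - 1\<bar> \<le> x\<^sup>2 / 2" "\<bar>sin x - x\<bar> \<le> x\<^sup>2 / 2"
proof -
  have le: "cmod (iexp x - (1 + \<i> * x)) \<le> x\<^sup>2 / 2"
    using iexp_approx1[of x 1] by (simp add: numeral_2_eq_2)
  show "\<bar>cos x - 1\<bar> \<le> x\<^sup>2 / 2"
    using order_trans[OF abs_Re_le_cmod le] by (simp add: Re_exp)
  show "\<bar>sin x - x\<bar> \<le> x\<^sup>2 / 2"
    using order_trans[OF abs_Im_le_cmod le] by (simp add: Im_exp)
qed

text \<open>First-order remainders of the exponential martingale \<open>exp (i v \<bullet> x + c)\<close> over one time step.\<close>

definition rem_cos :: "real \<Rightarrow> real ^ 'd \<Rightarrow> real ^ 'd \<Rightarrow> real" where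
  "rem_cos c v x = exp c * cos (v \<bullet> x) - 1"

definition rem_sin :: "real \<Rightarrow> real ^ 'd \<Rightarrow> real ^ 'd \<Rightarrow> real" where
  "rem_sin c v x = exp c * sin (v \<bullet> x) - v \<bullet> x"

lemma rem_measurable [measurable]: "rem_cos c v \<in> borel_measurable borel" "rem_sin c v \<in> borel_measurable borel"
  unfolding rem_cos_def[abs_def] rem_sin_def[abs_def] by measurable

lemma rem_bounds:
  assumes "c \<ge> 0"
  shows "\<bar>rem_cos c v x\<bar> \<le> (exp c - 1) + (v \<bullet> x)\<^sup>2 / 2" "\<bar>rem_sin c v x\<bar> \<le> (exp c - 1) + (v \<bullet> x)\<^sup>2 / 2"
proof -
  have e: "exp c - 1 \<ge> 0" using assms by simp
  have "\<bar>(exp c - 1) * cos (v \<bullet> x)\<bar> \<le> exp c - 1"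
    using mult_left_mono[OF abs_cos_le_one e, of "v \<bullet> x"] e by (simp add: abs_mult)
  moreover have "rem_cos c v x = (exp c - 1) * cos (v \<bullet> x) + (cos (v \<bullet> x) - 1)"
    by (simp add: rem_cos_def algebra_simps)
  ultimately show "\<bar>rem_cos c v x\<bar> \<le> (exp c - 1) + (v \<bullet> x)\<^sup>2 / 2"
    using cos_sin_Taylor(1)[of "v \<bullet> x"] by linarith
  have "\<bar>(exp c - 1) * sin (v \<bullet> x)\<bar> \<le> exp c - 1"
    using mult_left_mono[OF abs_sin_le_one e, of "v \<bullet> x"] e by (simp add: abs_mult)
  moreover have "rem_sin c v x = (exp c - 1) * sin (v \<bullet> x) + (sin (v \<bullet> x) - v \<bullet> x)"
    by (simp add: rem_sin_def algebra_simps)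
  ultimately show "\<bar>rem_sin c v x\<bar> \<le> (exp c - 1) + (v \<bullet> x)\<^sup>2 / 2"
    using cos_sin_Taylor(2)[of "v \<bullet> x"] by linarith
qed

text \<open>The one-step remainders are quadratic in the increment, so their squares need fourth
  moments. The resulting order (t - s)^2 is what makes the accumulated error vanish with the
  mesh.\<close>

lemma increment_norm_fourth:
  assumes st: "0 \<le> s" "s \<le> t" "t \<le> T"
  shows "integrable M (\<lambda>\<omega>. (norm (B t \<omega> - B s \<omega>))^4)"
    and "(\<integral>\<omega>. (norm (B t \<omega> - B s \<omega>))^4 \<partial>M) \<le> 3 * (real CARD('d))\<^sup>2 * (t - s)\<^sup>2"
proof -
  let ?D = "\<lambda>\<omega>. B t \<omega> - B s \<omega>"
  have [measurable]: "B s \<in> borel_measurable M" "B t \<in> borel_measurable M" using st by auto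
  have le: "(norm x)^4 \<le> real CARD('d) * (\<Sum>i\<in>UNIV. (x $ i)^4)" for x :: "real ^ 'd"
  proof -
    have "(norm x)^4 = ((norm x)\<^sup>2)\<^sup>2" by simp
    also have "\<dots> = (\<Sum>i\<in>UNIV. (x $ i)\<^sup>2)\<^sup>2"
      unfolding power2_norm_eq_inner inner_vec_def by (simp add: power2_eq_square)
    also have "\<dots> \<le> real CARD('d) * (\<Sum>i\<in>UNIV. ((x $ i)\<^sup>2)\<^sup>2)"
      using sum_squared_le_sum_of_squares[of "\<lambda>i. (x $ i)\<^sup>2" UNIV] by (simp add: mult.commute)
    also have "\<dots> = real CARD('d) * (\<Sum>i\<in>UNIV. (x $ i)^4)" by simp
    finally show ?thesis .
  qed
  have i: "integrable M (\<lambda>\<omega>. real CARD('d) * (\<Sum>i\<in>UNIV. (?D \<omega> $ i)^4))"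
    using increment_integrable_power[OF st] by (intro integrable_mult_right Bochner_Integration.integrable_sum) auto
  show i2: "integrable M (\<lambda>\<omega>. (norm (?D \<omega>))^4)"
    by (rule Bochner_Integration.integrable_bound[OF i]) (use le in \<open>auto intro!: AE_I2 order_trans[OF le] simp del: vector_minus_component\<close>)
  have "(\<integral>\<omega>. (norm (?D \<omega>))^4 \<partial>M) \<le> (\<integral>\<omega>. real CARD('d) * (\<Sum>i\<in>UNIV. (?D \<omega> $ i)^4) \<partial>M)"
    by (rule integral_mono[OF i2 i]) (rule le)
  also have "\<dots> = real CARD('d) * (\<Sum>i\<in>UNIV. \<integral>\<omega>. (?D \<omega> $ i)^4 \<partial>M)"
    using increment_integrable_power[OF st] by (subst integral_mult_right_zero, subst Bochner_Integration.integral_sum) auto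
  also have "\<dots> = 3 * (real CARD('d))\<^sup>2 * (t - s)\<^sup>2"
    unfolding increment_fourth_moment[OF st] by (simp add: power2_eq_square)
  finally show "(\<integral>\<omega>. (norm (?D \<omega>))^4 \<partial>M) \<le> 3 * (real CARD('d))\<^sup>2 * (t - s)\<^sup>2" .
qed

text \<open>The value of \<open>c\<close> is exactly the one for which exp c * cos (v \<bullet> D)
  has mean 1, \<open>D\<close> being the increment; this centres \<open>rem_cos\<close>.
  \<open>rem_sin\<close> is centred because the sine and the linear term both have mean 0. The
  second moments come from exp c - 1 \<le> c * exp c, which is of order t - s, and from the fourth
  moment; the constant depends on \<open>v\<close> only through the bound \<open>L\<close>, so it is
  the same for all steps of a refined grid.\<close>

lemma rem_increment:
  fixes v :: "real ^ 'd"
  assumes st: "0 \<le> s" "s \<le> t" "t \<le> T"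
  defines "c \<equiv> (norm v)\<^sup>2 * (t - s) / 2"
  shows "(\<lambda>\<omega>. rem_cos c v (B t \<omega> - B s \<omega>)) \<in> L2_space M (F t)" "(\<lambda>\<omega>. rem_sin c v (B t \<omega> - B s \<omega>)) \<in> L2_space M (F t)"
    and "(\<integral>\<omega>. rem_cos c v (B t \<omega> - B s \<omega>) \<partial>M) = 0" "(\<integral>\<omega>. rem_sin c v (B t \<omega> - B s \<omega>) \<partial>M) = 0"
    and "norm v \<le> L \<Longrightarrow> (\<integral>\<omega>. (rem_cos c v (B t \<omega> - B s \<omega>))\<^sup>2 \<partial>M) \<le> (L^4 * exp (L\<^sup>2 * T) + 2 * L^4 * (real CARD('d))\<^sup>2) * (t - s)\<^sup>2"
    and "norm v \<le> L \<Longrightarrow> (\<integral>\<omega>. (rem_sin c v (B t \<omega> - B s \<omega>))\<^sup>2 \<partial>M) \<le> (L^4 * exp (L\<^sup>2 * T) + 2 * L^4 * (real CARD('d))\<^sup>2) * (t - s)\<^sup>2"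
proof -
  let ?D = "\<lambda>\<omega>. B t \<omega> - B s \<omega>"
  have B[measurable]: "B s \<in> borel_measurable M" "B t \<in> borel_measurable M" using st by auto
  have BF[measurable]: "B s \<in> borel_measurable (F t)" "B t \<in> borel_measurable (F t)" using st B_measurable_F by auto
  have c0: "c \<ge> 0" unfolding c_def using st by simp
  have dom: "y\<^sup>2 \<le> 2 * (exp c - 1)\<^sup>2 + (norm v)^4 * (norm x)^4 / 2" if y: "\<bar>y\<bar> \<le> (exp c - 1) + (v \<bullet> x)\<^sup>2 / 2" for x and y :: real
  proof -
    have "y\<^sup>2 \<le> ((exp c - 1) + (v \<bullet> x)\<^sup>2 / 2)\<^sup>2" using y by (metis abs_ge_zero power2_abs power_mono)
    also have "\<dots> \<le> 2 * (exp c - 1)\<^sup>2 + 2 * ((v \<bullet> x)\<^sup>2 / 2)\<^sup>2"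
      using sum_squares_bound[of "exp c - 1" "(v \<bullet> x)\<^sup>2 / 2"] by (simp add: power2_sum)
    also have "2 * ((v \<bullet> x)\<^sup>2 / 2)\<^sup>2 = \<bar>v \<bullet> x\<bar>^4 / 2" by (simp add: power_divide power_even_abs)
    also have "\<dots> \<le> (norm v * norm x)^4 / 2"
      using Cauchy_Schwarz_ineq2[of v x] by (intro divide_right_mono power_mono) auto
    finally show ?thesis by (simp add: power_mult_distrib)
  qed
  note n4 = increment_norm_fourth[OF st]
  have iD: "integrable M (\<lambda>\<omega>. 2 * (exp c - 1)\<^sup>2 + (norm v)^4 * (norm (?D \<omega>))^4 / 2)" using n4 by simp
  have L2: "(\<lambda>\<omega>. u (?D \<omega>)) \<in> L2_space M (F t)" if u: "u \<in> borel_measurable borel" "\<And>x. \<bar>u x\<bar> \<le> (exp c - 1) + (v \<bullet> x)\<^sup>2 / 2" for u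
    unfolding L2_space_iff
  proof
    note [measurable] = u(1)
    show "(\<lambda>\<omega>. u (?D \<omega>)) \<in> borel_measurable (F t)" by measurable
    show "integrable M (\<lambda>\<omega>. (u (?D \<omega>))\<^sup>2)"
      by (rule Bochner_Integration.integrable_bound[OF iD]) (use dom[OF u(2)] in \<open>auto intro!: AE_I2 order_trans[OF _ abs_ge_self]\<close>)
  qed
  have bound: "(\<integral>\<omega>. (u (?D \<omega>))\<^sup>2 \<partial>M) \<le> (L^4 * exp (L\<^sup>2 * T) + 2 * L^4 * (real CARD('d))\<^sup>2) * (t - s)\<^sup>2"
    if u: "u \<in> borel_measurable borel" "\<And>x. \<bar>u x\<bar> \<le> (exp c - 1) + (v \<bullet> x)\<^sup>2 / 2" and v: "norm v \<le> L" for u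
  proof -
    have "(\<integral>\<omega>. (u (?D \<omega>))\<^sup>2 \<partial>M) \<le> (\<integral>\<omega>. 2 * (exp c - 1)\<^sup>2 + (norm v)^4 * (norm (?D \<omega>))^4 / 2 \<partial>M)"
      using L2_square_integrable[OF L2[OF u]] iD dom[OF u(2)] by (intro integral_mono)
    also have "\<dots> = 2 * (exp c - 1)\<^sup>2 + (norm v)^4 * (\<integral>\<omega>. (norm (?D \<omega>))^4 \<partial>M) / 2"
      using n4 by (simp add: prob_space)
    also have "\<dots> \<le> 2 * (L\<^sup>2 * (t - s) / 2 * exp (L\<^sup>2 * T / 2))\<^sup>2 + L^4 * (3 * (real CARD('d))\<^sup>2 * (t - s)\<^sup>2) / 2"
    proof (intro add_mono mult_left_mono divide_right_mono power_mono mult_mono n4(2) v)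
      have "(norm v)\<^sup>2 \<le> L\<^sup>2" using v by (intro power_mono) auto
      then have cle: "c \<le> L\<^sup>2 * (t - s) / 2" unfolding c_def using st by (intro divide_right_mono mult_right_mono) auto
      have cT: "c \<le> L\<^sup>2 * T / 2" using cle st by (intro order_trans[OF cle] divide_right_mono mult_left_mono) auto
      have "exp c - 1 \<le> c * exp c"
      proof -
        have "1 - c \<le> exp (- c)" using exp_ge_add_one_self[of "- c"] by simp
        then have "(1 - c) * exp c \<le> exp (- c) * exp c" by (rule mult_right_mono) simp
        then show ?thesis by (simp add: exp_minus algebra_simps)
      qed
      also have "\<dots> \<le> L\<^sup>2 * (t - s) / 2 * exp (L\<^sup>2 * T / 2)"
        using cle cT c0 by (intro mult_mono) auto
      finally show "exp c - 1 \<le> L\<^sup>2 * (t - s) / 2 * exp (L\<^sup>2 * T / 2)" .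
    qed (use c0 in auto)
    also have "2 * (L\<^sup>2 * (t - s) / 2 * exp (L\<^sup>2 * T / 2))\<^sup>2 = L^4 * exp (L\<^sup>2 * T) * (t - s)\<^sup>2 / 2"
      by (simp add: power_mult_distrib power_divide exp_double[symmetric])
    also have "L^4 * exp (L\<^sup>2 * T) * (t - s)\<^sup>2 / 2 + L^4 * (3 * (real CARD('d))\<^sup>2 * (t - s)\<^sup>2) / 2
       \<le> (L^4 * exp (L\<^sup>2 * T) + 2 * L^4 * (real CARD('d))\<^sup>2) * (t - s)\<^sup>2"
    proof -
      define p q where "p = L^4 * exp (L\<^sup>2 * T) * (t - s)\<^sup>2" and "q = L^4 * (real CARD('d))\<^sup>2 * (t - s)\<^sup>2"
      have "p \<ge> 0" "q \<ge> 0" unfolding p_def q_def by auto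
      then have "p / 2 + 3 * q / 2 \<le> p + 2 * q" by simp
      then show ?thesis by (simp add: p_def q_def algebra_simps)
    qed
    finally show ?thesis .
  qed
  show L2c: "(\<lambda>\<omega>. rem_cos c v (?D \<omega>)) \<in> L2_space M (F t)" by (rule L2) (auto intro: rem_bounds c0)
  show L2s: "(\<lambda>\<omega>. rem_sin c v (?D \<omega>)) \<in> L2_space M (F t)" by (rule L2) (auto intro: rem_bounds c0)
  show "norm v \<le> L \<Longrightarrow> (\<integral>\<omega>. (rem_cos c v (?D \<omega>))\<^sup>2 \<partial>M) \<le> (L^4 * exp (L\<^sup>2 * T) + 2 * L^4 * (real CARD('d))\<^sup>2) * (t - s)\<^sup>2"
    by (rule bound) (auto intro: rem_bounds c0)
  show "norm v \<le> L \<Longrightarrow> (\<integral>\<omega>. (rem_sin c v (?D \<omega>))\<^sup>2 \<partial>M) \<le> (L^4 * exp (L\<^sup>2 * T) + 2 * L^4 * (real CARD('d))\<^sup>2) * (t - s)\<^sup>2"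
    by (rule bound) (auto intro: rem_bounds c0)
  have icos: "integrable M (\<lambda>\<omega>. cos (v \<bullet> ?D \<omega>))" "integrable M (\<lambda>\<omega>. sin (v \<bullet> ?D \<omega>))"
    by (rule integrable_const_bound[where B = 1]; simp)+
  have iv: "integrable M (\<lambda>\<omega>. v \<bullet> ?D \<omega>)" and v0: "(\<integral>\<omega>. v \<bullet> ?D \<omega> \<partial>M) = 0"
    using increment_integrable_power[OF st, of _ 1] increment_mean[OF st]
    by (simp_all add: inner_vec_def)
  show "(\<integral>\<omega>. rem_cos c v (?D \<omega>) \<partial>M) = 0"
    unfolding rem_cos_def using icos increment_cos_sin(1)[OF st, of v] by (simp add: prob_space c_def exp_minus)
  show "(\<integral>\<omega>. rem_sin c v (?D \<omega>) \<partial>M) = 0"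
    unfolding rem_sin_def using icos iv v0 increment_cos_sin(2)[OF st, of v] by simp
qed

text \<open>The process \<open>E n * cos (\<Theta> n + c)\<close> is the real part of an exponential
  martingale. The addition formula splits each step into a stochastic integral term and a centred
  remainder. Remainders of different steps are orthogonal, so their squares add: \<open>N\<close>
  terms of order 1/N^2 give an error of order 1/N. After division by \<open>E N\<close> all
  coefficients are bounded by 1, whatever the number of steps.\<close>

lemma repr_cos_step:
  fixes v :: "nat \<Rightarrow> real ^ 'd"
  assumes N: "0 < N" and L: "\<And>k. k < N \<Longrightarrow> norm (v k) \<le> L"
  defines "C \<equiv> L^4 * exp (L\<^sup>2 * T) + 2 * L^4 * (real CARD('d))\<^sup>2"
  shows "\<exists>c' \<eta>. unif N \<eta> \<and> sqnorm M (\<lambda>\<omega>. cos (ugint N (\<lambda>k _. v k) \<omega> + c) - (c' + ugint N \<eta> \<omega>)) \<le> ennreal (4 * C * T\<^sup>2 / real N)"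
proof -
  define \<Theta> where "\<Theta> n \<omega> = (\<Sum>k<n. v k \<bullet> (B (grid N (Suc k)) \<omega> - B (grid N k) \<omega>))" for n \<omega>
  define h where "h k = (norm (v k))\<^sup>2 * (grid N (Suc k) - grid N k) / 2" for k
  define E where "E n = exp (\<Sum>k<n. h k)" for n
  define D where "D k \<omega> = B (grid N (Suc k)) \<omega> - B (grid N k) \<omega>" for k \<omega>
  define R where "R k \<omega> = (E k / E N) * cos (\<Theta> k \<omega> + c) * rem_cos (h k) (v k) (D k \<omega>) - (E k / E N) * sin (\<Theta> k \<omega> + c) * rem_sin (h k) (v k) (D k \<omega>)" for k \<omega>
  \<comment> \<open>The derivative of the cosine, scaled by the exponential factor: the coefficient
    of the term linear in the increment.\<close>
  define \<eta> where "\<eta> k \<omega> = (- (E k / E N) * sin (\<Theta> k \<omega> + c)) *\<^sub>R v k" for k \<omega>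
  have h0: "h k \<ge> 0" for k unfolding h_def using grid_mono[of k "Suc k" N] by simp
  have E0: "E n > 0" for n unfolding E_def by simp
  have EN: "0 \<le> E k / E N" "E k / E N \<le> 1" if "k \<le> N" for k
  proof -
    have "(\<Sum>j<k. h j) \<le> (\<Sum>j<N. h j)" using that h0 by (intro sum_mono2) auto
    then show "E k / E N \<le> 1" using E0 by (simp add: E_def)
    show "0 \<le> E k / E N" using E0 by (simp add: less_imp_le)
  qed
  have gb: "0 \<le> grid N k" "grid N k \<le> T" if "k \<le> N" for k using grid_bounds[OF that N] by auto
  have g_le: "grid N k \<le> grid N (Suc k)" for k by (rule grid_mono) simp
  have telescope: "E n * cos (\<Theta> n \<omega> + c) = cos c + (\<Sum>k<n. E N * (\<eta> k \<omega> \<bullet> D k \<omega>)) + (\<Sum>k<n. E N * R k \<omega>)" for n \<omega>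
  proof (induction n)
    case 0
    then show ?case by (simp add: E_def \<Theta>_def)
  next
    case (Suc n)
    let ?G = "v n \<bullet> D n \<omega>" and ?t = "\<Theta> n \<omega> + c"
    have 1: "E N * (\<eta> n \<omega> \<bullet> D n \<omega>) = - (E n * sin ?t * ?G)" using E0[of N] by (simp add: \<eta>_def)
    have 2: "E N * R n \<omega> = E n * cos ?t * rem_cos (h n) (v n) (D n \<omega>) - E n * sin ?t * rem_sin (h n) (v n) (D n \<omega>)"
      using E0[of N] by (simp add: R_def right_diff_distrib)
    have "E (Suc n) * cos (\<Theta> (Suc n) \<omega> + c) = E n * exp (h n) * cos (?t + ?G)"
      by (simp add: E_def exp_add \<Theta>_def D_def algebra_simps)
    also have "\<dots> = E n * cos ?t + E N * (\<eta> n \<omega> \<bullet> D n \<omega>) + E N * R n \<omega>"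
      unfolding 1 2 rem_cos_def rem_sin_def cos_add by (simp add: algebra_simps)
    finally show ?case using Suc.IH by simp
  qed
  have \<Theta>F: "\<Theta> k \<in> borel_measurable (F (grid N k))" if "k \<le> N" for k
    unfolding \<Theta>_def[abs_def]
  proof (rule borel_measurable_sum)
    fix j assume "j \<in> {..<k}"
    then have [measurable]: "B (grid N j) \<in> borel_measurable (F (grid N k))" "B (grid N (Suc j)) \<in> borel_measurable (F (grid N k))"
      using that gb[of j] gb[of "Suc j"] grid_mono[of j k N] grid_mono[of "Suc j" k N] by (auto intro!: B_measurable_F)
    show "(\<lambda>\<omega>. v j \<bullet> (B (grid N (Suc j)) \<omega> - B (grid N j) \<omega>)) \<in> borel_measurable (F (grid N k))" by measurable
  qed
  have u\<eta>: "unif N \<eta>"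
    unfolding unif_def bounded_meas_def
  proof (intro conjI allI impI N)
    fix k assume k: "k < N"
    have [measurable]: "\<Theta> k \<in> borel_measurable (F (grid N k))" using \<Theta>F k by simp
    show "\<eta> k \<in> borel_measurable (F (grid N k))" unfolding \<eta>_def[abs_def] by measurable
    show "bounded (\<eta> k ` space M)"
    proof (rule boundedI[of _ "norm (v k)"], safe)
      fix \<omega>
      have "\<bar>(E k / E N) * sin (\<Theta> k \<omega> + c)\<bar> \<le> 1 * 1"
        unfolding abs_mult using EN[of k] k by (intro mult_mono) auto
      then show "norm (\<eta> k \<omega>) \<le> norm (v k)" unfolding \<eta>_def
        using mult_right_mono[of "\<bar>(E k / E N) * sin (\<Theta> k \<omega> + c)\<bar>" 1 "norm (v k)"] by simp
    qed
  qed
  define X where "X k \<omega> = (E k / E N) * cos (\<Theta> k \<omega> + c)" for k \<omega>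
  define Y where "Y k \<omega> = - ((E k / E N) * sin (\<Theta> k \<omega> + c))" for k \<omega>
  have XY: "X k \<in> borel_measurable (F (grid N k))" "Y k \<in> borel_measurable (F (grid N k))" "\<bar>X k \<omega>\<bar> \<le> 1" "\<bar>Y k \<omega>\<bar> \<le> 1"
    if "k < N" for k \<omega>
  proof -
    have [measurable]: "\<Theta> k \<in> borel_measurable (F (grid N k))" using \<Theta>F that by simp
    show "X k \<in> borel_measurable (F (grid N k))" "Y k \<in> borel_measurable (F (grid N k))" unfolding X_def[abs_def] Y_def[abs_def] by measurable
    have "\<bar>X k \<omega>\<bar> \<le> 1 * 1" unfolding X_def abs_mult using EN[of k] that by (intro mult_mono) auto
    then show "\<bar>X k \<omega>\<bar> \<le> 1" by simp
    have "\<bar>Y k \<omega>\<bar> \<le> 1 * 1" unfolding Y_def abs_mult abs_minus_cancel using EN[of k] that by (intro mult_mono) auto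
    then show "\<bar>Y k \<omega>\<bar> \<le> 1" by simp
  qed
  have R_eq: "R k \<omega> = rem_cos (h k) (v k) (D k \<omega>) * X k \<omega> + rem_sin (h k) (v k) (D k \<omega>) * Y k \<omega>" for k \<omega>
    by (simp add: R_def X_def Y_def algebra_simps)
  have step: "0 \<le> grid N k" "grid N k \<le> grid N (Suc k)" "grid N (Suc k) \<le> T" if "k < N" for k
    using gb[of k] gb[of "Suc k"] g_le that by auto
  have rem: "(\<lambda>\<omega>. rem_cos (h k) (v k) (D k \<omega>)) \<in> L2_space M (F (grid N (Suc k)))"
      "(\<lambda>\<omega>. rem_sin (h k) (v k) (D k \<omega>)) \<in> L2_space M (F (grid N (Suc k)))"
      "(\<integral>\<omega>. rem_cos (h k) (v k) (D k \<omega>) \<partial>M) = 0" "(\<integral>\<omega>. rem_sin (h k) (v k) (D k \<omega>) \<partial>M) = 0"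
      "(\<integral>\<omega>. (rem_cos (h k) (v k) (D k \<omega>))\<^sup>2 \<partial>M) \<le> C * (T / real N)\<^sup>2"
      "(\<integral>\<omega>. (rem_sin (h k) (v k) (D k \<omega>))\<^sup>2 \<partial>M) \<le> C * (T / real N)\<^sup>2" if k: "k < N" for k
    using rem_increment[OF step[OF k], of "v k"] L[OF k] unfolding D_def h_def C_def grid_Suc[OF N] by simp_all
  have RL: "R k \<in> L2_space M (F (grid N (Suc k)))" if k: "k < N" for k
  proof -
    have XY': "X k \<in> borel_measurable (F (grid N (Suc k)))" "Y k \<in> borel_measurable (F (grid N (Suc k)))"
      using XY[OF k] F_measurable_mono[OF g_le] by auto
    show ?thesis unfolding R_eq[abs_def]
      by (intro L2_add L2_bounded_mult[OF _ _ XY'(1) XY(3)[OF k]] L2_bounded_mult[OF _ _ XY'(2) XY(4)[OF k]] rem(1,2) k step(3))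
  qed
  have Rsq: "(\<integral>\<omega>. (R k \<omega>)\<^sup>2 \<partial>M) \<le> 4 * C * (T / real N)\<^sup>2" if k: "k < N" for k
  proof -
    have le: "(R k \<omega>)\<^sup>2 \<le> 2 * (rem_cos (h k) (v k) (D k \<omega>))\<^sup>2 + 2 * (rem_sin (h k) (v k) (D k \<omega>))\<^sup>2" for \<omega>
    proof -
      have "(R k \<omega>)\<^sup>2 \<le> 2 * (rem_cos (h k) (v k) (D k \<omega>) * X k \<omega>)\<^sup>2 + 2 * (rem_sin (h k) (v k) (D k \<omega>) * Y k \<omega>)\<^sup>2"
        unfolding R_eq using power2_norm_add_le[of "rem_cos (h k) (v k) (D k \<omega>) * X k \<omega>"] by simp
      also have "\<dots> \<le> 2 * (rem_cos (h k) (v k) (D k \<omega>))\<^sup>2 + 2 * (rem_sin (h k) (v k) (D k \<omega>))\<^sup>2"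
        unfolding power_mult_distrib using XY(3,4)[OF k, of \<omega>]
        by (intro add_mono mult_left_mono mult_left_le) (auto simp: abs_square_le_1)
      finally show ?thesis .
    qed
    note sq = L2_square_integrable[OF rem(1)[OF k]] L2_square_integrable[OF rem(2)[OF k]]
    have "(\<integral>\<omega>. (R k \<omega>)\<^sup>2 \<partial>M) \<le> (\<integral>\<omega>. 2 * (rem_cos (h k) (v k) (D k \<omega>))\<^sup>2 + 2 * (rem_sin (h k) (v k) (D k \<omega>))\<^sup>2 \<partial>M)"
      by (rule integral_mono[OF L2_square_integrable[OF RL[OF k]] _ le]) (use sq in auto)
    also have "\<dots> = 2 * (\<integral>\<omega>. (rem_cos (h k) (v k) (D k \<omega>))\<^sup>2 \<partial>M) + 2 * (\<integral>\<omega>. (rem_sin (h k) (v k) (D k \<omega>))\<^sup>2 \<partial>M)"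
      using sq by simp
    also have "\<dots> \<le> 2 * (C * (T / real N)\<^sup>2) + 2 * (C * (T / real N)\<^sup>2)"
      using rem(5,6)[OF k] by (intro add_mono mult_left_mono) auto
    finally show ?thesis by simp
  qed
  have orth: "(\<integral>\<omega>. W \<omega> * R k \<omega> \<partial>M) = 0" "integrable M (\<lambda>\<omega>. W \<omega> * R k \<omega>)" if k: "k < N" and W: "W \<in> L2_space M (F (grid N k))" for k W
  proof -
    have kT: "grid N k \<le> T" using gb k by auto
    note WX = L2_bounded_mult[OF kT W XY(1)[OF k] XY(3)[OF k]] and WY = L2_bounded_mult[OF kT W XY(2)[OF k] XY(4)[OF k]]
    have mX: "(\<lambda>\<omega>. W \<omega> * X k \<omega>) \<in> borel_measurable (F (grid N k))" "(\<lambda>\<omega>. W \<omega> * Y k \<omega>) \<in> borel_measurable (F (grid N k))"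
      using WX WY by (auto simp: L2_space_iff)
    note ic = L2_integrable[OF step(3)[OF k] rem(1)[OF k]] and isn = L2_integrable[OF step(3)[OF k] rem(2)[OF k]]
    note c = increment_indep_integral[OF step[OF k] mX(1) L2_integrable[OF kT WX] rem_measurable(1) ic[unfolded D_def], folded D_def]
    note s = increment_indep_integral[OF step[OF k] mX(2) L2_integrable[OF kT WY] rem_measurable(2) isn[unfolded D_def], folded D_def]
    have eq: "W \<omega> * R k \<omega> = W \<omega> * X k \<omega> * rem_cos (h k) (v k) (D k \<omega>) + W \<omega> * Y k \<omega> * rem_sin (h k) (v k) (D k \<omega>)" for \<omega>
      by (simp add: R_eq algebra_simps)
    show "integrable M (\<lambda>\<omega>. W \<omega> * R k \<omega>)" unfolding eq using c(1) s(1) by simp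
    show "(\<integral>\<omega>. W \<omega> * R k \<omega> \<partial>M) = 0" unfolding eq using c s rem(3,4)[OF k] by simp
  qed
  have sumL: "(\<lambda>\<omega>. \<Sum>k<n. R k \<omega>) \<in> L2_space M (F (grid N n))" if "n \<le> N" for n
    using that
  proof (induction n)
    case 0
    then show ?case by (simp add: L2_const)
  next
    case (Suc n)
    then show ?case using L2_add[OF step(3) L2_mono[OF g_le] RL] by simp
  qed
  \<comment> \<open>Pythagoras: the partial sum is known at the left end of step \<open>n\<close>,
    and \<open>R n\<close> is orthogonal to everything known there.\<close>
  have sumsq: "(\<integral>\<omega>. (\<Sum>k<n. R k \<omega>)\<^sup>2 \<partial>M) = (\<Sum>k<n. \<integral>\<omega>. (R k \<omega>)\<^sup>2 \<partial>M)" if "n \<le> N" for n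
    using that
  proof (induction n)
    case (Suc n)
    then have n: "n < N" by simp
    note o = orth[OF n sumL[of n]]
    have "(\<integral>\<omega>. (\<Sum>k<Suc n. R k \<omega>)\<^sup>2 \<partial>M) = (\<integral>\<omega>. (\<Sum>k<n. R k \<omega>)\<^sup>2 + 2 * ((\<Sum>k<n. R k \<omega>) * R n \<omega>) + (R n \<omega>)\<^sup>2 \<partial>M)"
    proof -
      have "(a + b)\<^sup>2 = a\<^sup>2 + 2 * (a * b) + b\<^sup>2" for a b :: real by (simp add: power2_sum)
      then show ?thesis by (simp only: sum.lessThan_Suc)
    qed
    also have "\<dots> = (\<integral>\<omega>. (\<Sum>k<n. R k \<omega>)\<^sup>2 \<partial>M) + 2 * (\<integral>\<omega>. (\<Sum>k<n. R k \<omega>) * R n \<omega> \<partial>M) + (\<integral>\<omega>. (R n \<omega>)\<^sup>2 \<partial>M)"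
      using o(2) n L2_square_integrable[OF sumL[of n]] L2_square_integrable[OF RL[OF n]] by simp
    finally show ?case using o(1) n Suc by simp
  qed simp
  have final: "cos (ugint N (\<lambda>k _. v k) \<omega> + c) - (cos c / E N + ugint N \<eta> \<omega>) = (\<Sum>k<N. R k \<omega>)" for \<omega>
  proof -
    have "ugint N (\<lambda>k _. v k) \<omega> = \<Theta> N \<omega>" by (simp add: ugint_def incr_def \<Theta>_def)
    moreover have "ugint N \<eta> \<omega> = (\<Sum>k<N. \<eta> k \<omega> \<bullet> D k \<omega>)" by (simp add: ugint_def incr_def D_def)
    moreover have "E N * cos (\<Theta> N \<omega> + c) = cos c + E N * (\<Sum>k<N. \<eta> k \<omega> \<bullet> D k \<omega>) + E N * (\<Sum>k<N. R k \<omega>)"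
      using telescope[of N \<omega>] by (simp add: sum_distrib_left)
    ultimately show ?thesis using E0[of N] by (simp add: field_simps)
  qed
  have "sqnorm M (\<lambda>\<omega>. cos (ugint N (\<lambda>k _. v k) \<omega> + c) - (cos c / E N + ugint N \<eta> \<omega>)) = ennreal (\<integral>\<omega>. (\<Sum>k<N. R k \<omega>)\<^sup>2 \<partial>M)"
    unfolding final by (rule sqnorm_eq_integral_L2[OF sumL]) simp
  also have "\<dots> \<le> ennreal (4 * C * T\<^sup>2 / real N)"
  proof (rule ennreal_leI)
    have "(\<integral>\<omega>. (\<Sum>k<N. R k \<omega>)\<^sup>2 \<partial>M) \<le> (\<Sum>k<N. 4 * C * (T / real N)\<^sup>2)"
      unfolding sumsq[OF order_refl] by (rule sum_mono) (use Rsq in auto)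
    also have "\<dots> = 4 * C * T\<^sup>2 / real N" using N by (simp add: power2_eq_square)
    finally show "(\<integral>\<omega>. (\<Sum>k<N. R k \<omega>)\<^sup>2 \<partial>M) \<le> 4 * C * T\<^sup>2 / real N" .
  qed
  finally show ?thesis using u\<eta> by blast
qed

text \<open>Refining the grid leaves the integral of the step function \<open>v\<close> and the
  bound \<open>L\<close> unchanged, while the error of \<open>repr_cos_step\<close> tends to
  0.\<close>

lemma repr_cos:
  fixes v :: "nat \<Rightarrow> real ^ 'd"
  assumes N: "0 < N"
  shows "repr (\<lambda>\<omega>. cos (ugint N (\<lambda>k _. v k) \<omega> + c))"
  unfolding repr_def
proof (intro conjI allI impI)
  have u: "unif N (\<lambda>k _. v k)" unfolding unif_def bounded_meas_def using N by (auto intro!: boundedI)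
  have [measurable]: "ugint N (\<lambda>k _. v k) \<in> borel_measurable (F T)" using ugint_L2[OF u] by (simp add: L2_space_iff)
  show "(\<lambda>\<omega>. cos (ugint N (\<lambda>k _. v k) \<omega> + c)) \<in> L2_space M (F T)" by (rule L2_bounded[where K = 1]) auto
  fix e :: real assume e: "e > 0"
  define L where "L = (\<Sum>k<N. norm (v k))"
  have L: "norm (v k) \<le> L" if "k < N" for k unfolding L_def using that by (intro member_le_sum) auto
  define C where "C = L^4 * exp (L\<^sup>2 * T) + 2 * L^4 * (real CARD('d))\<^sup>2"
  obtain m :: nat where m: "4 * C * T\<^sup>2 / e < real m" using reals_Archimedean2 by blast
  define m' where "m' = Suc m"
  have m': "0 < m'" by (simp add: m'_def)
  have Nm: "0 < N * m'" using N m' by simp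
  have "4 * C * T\<^sup>2 / real (N * m') \<le> e"
  proof -
    have "4 * C * T\<^sup>2 \<le> real m * e" using m e by (simp add: field_simps)
    also have "\<dots> \<le> real (N * m') * e"
    proof (rule mult_right_mono)
      have "m \<le> N * m'" using N m'_def by (cases N) auto
      then show "real m \<le> real (N * m')" by (rule of_nat_mono)
    qed (use e in simp)
    finally show ?thesis using Nm by (simp add: divide_le_eq mult.commute)
  qed
  then have le: "ennreal (4 * C * T\<^sup>2 / real (N * m')) \<le> ennreal e" by (rule ennreal_leI)
  have "norm (v (k div m')) \<le> L" if "k < N * m'" for k
    using that by (intro L) (simp add: less_mult_imp_div_less)
  from repr_cos_step[where v = "\<lambda>k. v (k div m')" and L = L and c = c and N = "N * m'", OF Nm this, folded C_def]
  obtain c' \<eta> where \<eta>: "unif (N * m') \<eta>" "sqnorm M (\<lambda>\<omega>. cos (ugint (N * m') (\<lambda>k _. v (k div m')) \<omega> + c) - (c' + ugint (N * m') \<eta> \<omega>)) \<le> ennreal (4 * C * T\<^sup>2 / real (N * m'))"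
    by blast
  have "ugint (N * m') (\<lambda>k _. v (k div m')) \<omega> = ugint N (\<lambda>k _. v k) \<omega>" for \<omega>
    by (rule ugint_refine[OF m', of N "\<lambda>k _. v k"])
  with \<eta>(2) le have "sqnorm M (\<lambda>\<omega>. cos (ugint N (\<lambda>k _. v k) \<omega> + c) - (c' + ugint (N * m') \<eta> \<omega>)) \<le> ennreal e"
    by (simp only: order_trans)
  with \<eta>(1) show "\<exists>c' N' \<eta>. unif N' \<eta> \<and> sqnorm M (\<lambda>\<omega>. cos (ugint N (\<lambda>k _. v k) \<omega> + c) - (c' + ugint N' \<eta> \<omega>)) \<le> ennreal e"
    by blast
qed


section \<open>The representation theorem\<close>

text \<open>The phase \<open>c\<close> covers the sine as well, and v = 0 gives the constants.
  Product-to-sum formulas make this linear span an algebra.\<close>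

inductive_set trig :: "('w \<Rightarrow> real) set" where
  trig_cos: "0 < N \<Longrightarrow> (\<lambda>\<omega>. cos (ugint N (\<lambda>k _. v k) \<omega> + c)) \<in> trig"
| trig_lincomb: "U \<in> trig \<Longrightarrow> V \<in> trig \<Longrightarrow> (\<lambda>\<omega>. a * U \<omega> + b * V \<omega>) \<in> trig"

lemma trig_repr: "U \<in> trig \<Longrightarrow> repr U"
  by (induction rule: trig.induct) (auto intro: repr_cos repr_lincomb)

lemma trig_bounded: "U \<in> trig \<Longrightarrow> \<exists>K. \<forall>\<omega>. \<bar>U \<omega>\<bar> \<le> K"
proof (induction rule: trig.induct)
  case (trig_cos N v c)
  then show ?case by (intro exI[of _ 1]) auto
next
  case (trig_lincomb U V a b)
  then obtain K K' where K: "\<And>\<omega>. \<bar>U \<omega>\<bar> \<le> K" "\<And>\<omega>. \<bar>V \<omega>\<bar> \<le> K'" by auto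
  have "\<bar>a * U \<omega> + b * V \<omega>\<bar> \<le> \<bar>a\<bar> * K + \<bar>b\<bar> * K'" for \<omega>
    using K mult_left_mono[OF K(1), of "\<bar>a\<bar>" \<omega>] mult_left_mono[OF K(2), of "\<bar>b\<bar>" \<omega>]
    by (auto simp: abs_mult intro!: order_trans[OF abs_triangle_ineq] add_mono)
  then show ?case by auto
qed

lemma ugint_const_lincomb:
  fixes v v' :: "nat \<Rightarrow> real ^ 'd"
  assumes "0 < N" "0 < N'"
  shows "ugint (N * N') (\<lambda>k _. v (k div N') + x *\<^sub>R v' (k div N)) \<omega> = ugint N (\<lambda>k _. v k) \<omega> + x * ugint N' (\<lambda>k _. v' k) \<omega>"
proof -
  have "ugint (N * N') (\<lambda>k _. v (k div N') + x *\<^sub>R v' (k div N)) \<omega>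
      = ugint (N * N') (\<lambda>k _. v (k div N')) \<omega> + x * ugint (N * N') (\<lambda>k _. v' (k div N)) \<omega>"
    unfolding ugint_def incr_def by (simp add: inner_add_left sum.distrib sum_distrib_left)
  then show ?thesis
    using ugint_refine[OF assms(2), of N "\<lambda>k _. v k"] ugint_refine[OF assms(1), of N' "\<lambda>k _. v' k"] by (simp add: mult.commute)
qed

text \<open>cos x cos y = (cos (x + y) + cos (x - y)) / 2. The sum and difference of two step
  functions are again step functions on the common refinement.\<close>

lemma trig_mult_cos:
  fixes v :: "nat \<Rightarrow> real ^ 'd"
  assumes "V \<in> trig" and N: "0 < N"
  shows "(\<lambda>\<omega>. cos (ugint N (\<lambda>k _. v k) \<omega> + c) * V \<omega>) \<in> trig"
  using assms(1)
proof (induction rule: trig.induct)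
  case (trig_cos N' v' c')
  have NN: "0 < N * N'" using N trig_cos by simp
  have "(\<lambda>\<omega>. 1/2 * cos (ugint (N * N') (\<lambda>k _. v (k div N') + 1 *\<^sub>R v' (k div N)) \<omega> + (c + c'))
      + 1/2 * cos (ugint (N * N') (\<lambda>k _. v (k div N') + (-1) *\<^sub>R v' (k div N)) \<omega> + (c - c'))) \<in> trig"
    by (intro trig.intros NN)
  also have "(\<lambda>\<omega>. 1/2 * cos (ugint (N * N') (\<lambda>k _. v (k div N') + 1 *\<^sub>R v' (k div N)) \<omega> + (c + c'))
      + 1/2 * cos (ugint (N * N') (\<lambda>k _. v (k div N') + (-1) *\<^sub>R v' (k div N)) \<omega> + (c - c')))
      = (\<lambda>\<omega>. cos (ugint N (\<lambda>k _. v k) \<omega> + c) * cos (ugint N' (\<lambda>k _. v' k) \<omega> + c'))"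
  proof (rule ext)
    fix \<omega>
    let ?a = "ugint N (\<lambda>k _. v k) \<omega> + c" and ?b = "ugint N' (\<lambda>k _. v' k) \<omega> + c'"
    have "1/2 * cos (x + y) + 1/2 * cos (x - y) = cos x * cos y" for x y :: real by (simp add: cos_times_cos add_divide_distrib)
    from this[of ?a ?b] have "1/2 * cos (?a + ?b) + 1/2 * cos (?a - ?b) = cos ?a * cos ?b" .
    then show "1/2 * cos (ugint (N * N') (\<lambda>k _. v (k div N') + 1 *\<^sub>R v' (k div N)) \<omega> + (c + c'))
      + 1/2 * cos (ugint (N * N') (\<lambda>k _. v (k div N') + (-1) *\<^sub>R v' (k div N)) \<omega> + (c - c')) = cos ?a * cos ?b"
      unfolding ugint_const_lincomb[OF N trig_cos] by (simp only: mult_1_left mult_minus_left add_diff_add minus_add_distrib diff_conv_add_uminus add_ac)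
  qed
  finally show ?case .
next
  case (trig_lincomb U V a b)
  have "(\<lambda>\<omega>. a * (cos (ugint N (\<lambda>k _. v k) \<omega> + c) * U \<omega>) + b * (cos (ugint N (\<lambda>k _. v k) \<omega> + c) * V \<omega>)) \<in> trig"
    by (intro trig.trig_lincomb trig_lincomb.IH)
  then show ?case by (simp add: algebra_simps)
qed

lemma trig_mult:
  assumes "U \<in> trig" "V \<in> trig" shows "(\<lambda>\<omega>. U \<omega> * V \<omega>) \<in> trig"
  using assms(1)
proof (induction rule: trig.induct)
  case (trig_cos N v c)
  then show ?case by (rule trig_mult_cos[OF assms(2)])
next
  case (trig_lincomb U U' a b)
  have "(\<lambda>\<omega>. a * (U \<omega> * V \<omega>) + b * (U' \<omega> * V \<omega>)) \<in> trig"
    by (intro trig.trig_lincomb trig_lincomb.IH)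
  then show ?case by (simp add: algebra_simps)
qed

lemma trig_const: "(\<lambda>\<omega>. c) \<in> trig"
proof -
  have 1: "(\<lambda>\<omega>. cos (ugint 1 (\<lambda>k _. 0) \<omega> + 0)) \<in> trig" by (rule trig_cos) simp
  from trig_lincomb[OF this this, of c 0] show ?thesis by (simp add: ugint_def incr_def)
qed

text \<open>The uniform closure of \<open>trig\<close>. Passing to it makes truncated linear
  functions of trigonometric variables available, from which indicators are built.\<close>

definition unifc :: "('w \<Rightarrow> real) set" where
  "unifc = {V. \<forall>e>0. \<exists>U\<in>trig. \<forall>\<omega>\<in>space M. \<bar>V \<omega> - U \<omega>\<bar> \<le> e}"

lemma unifcI: "(\<And>e. e > 0 \<Longrightarrow> \<exists>U\<in>trig. \<forall>\<omega>\<in>space M. \<bar>V \<omega> - U \<omega>\<bar> \<le> e) \<Longrightarrow> V \<in> unifc"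
  unfolding unifc_def by blast

lemma unifcE:
  assumes "V \<in> unifc" "e > 0"
  obtains U where "U \<in> trig" "\<And>\<omega>. \<omega> \<in> space M \<Longrightarrow> \<bar>V \<omega> - U \<omega>\<bar> \<le> e"
  using assms unfolding unifc_def by blast

lemma trig_unifc: "U \<in> trig \<Longrightarrow> U \<in> unifc"
  by (rule unifcI) (auto intro!: bexI[of _ U])

lemma unifc_bounded:
  assumes "V \<in> unifc"
  obtains K where "K > 0" "\<And>\<omega>. \<omega> \<in> space M \<Longrightarrow> \<bar>V \<omega>\<bar> \<le> K"
proof -
  obtain U where U: "U \<in> trig" "\<And>\<omega>. \<omega> \<in> space M \<Longrightarrow> \<bar>V \<omega> - U \<omega>\<bar> \<le> 1" using unifcE[OF assms, of 1] by auto
  obtain K where K: "\<And>\<omega>. \<bar>U \<omega>\<bar> \<le> K" using trig_bounded[OF U(1)] by auto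
  show ?thesis
  proof (rule that[of "K + 1"])
    show "K + 1 > 0" using K[of undefined] by linarith
    show "\<bar>V \<omega>\<bar> \<le> K + 1" if "\<omega> \<in> space M" for \<omega> using U(2)[OF that] K[of \<omega>] by linarith
  qed
qed

lemma unifc_repr:
  assumes V: "V \<in> unifc" shows "repr V"
proof (rule repr_limit)
  have "\<forall>n. \<exists>U. U \<in> trig \<and> (\<forall>\<omega>\<in>space M. \<bar>V \<omega> - U \<omega>\<bar> \<le> 1 / real (Suc n))"
  proof
    fix n
    show "\<exists>U. U \<in> trig \<and> (\<forall>\<omega>\<in>space M. \<bar>V \<omega> - U \<omega>\<bar> \<le> 1 / real (Suc n))"
      by (rule unifcE[OF V, of "1 / real (Suc n)"]) auto
  qed
  then obtain U where U: "\<And>n. U n \<in> trig" "\<And>n \<omega>. \<omega> \<in> space M \<Longrightarrow> \<bar>V \<omega> - U n \<omega>\<bar> \<le> 1 / real (Suc n)"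
    by metis
  obtain K where K: "\<And>\<omega>. \<omega> \<in> space M \<Longrightarrow> \<bar>V \<omega>\<bar> \<le> K" using unifc_bounded[OF V] by metis
  have VF: "V \<in> borel_measurable (F T)"
  proof (rule borel_measurable_LIMSEQ_real)
    show "U n \<in> borel_measurable (F T)" for n using reprD_L2[OF trig_repr[OF U(1)]] by (auto simp: L2_space_iff)
    fix \<omega> assume "\<omega> \<in> space (F T)"
    then have \<omega>: "\<omega> \<in> space M" by simp
    have "(\<lambda>n. U n \<omega> - V \<omega>) \<longlonglongrightarrow> 0"
    proof (rule Lim_null_comparison)
      show "\<forall>\<^sub>F n in sequentially. norm (U n \<omega> - V \<omega>) \<le> 1 / real (Suc n)"
        using U(2)[OF \<omega>] by (intro always_eventually) (simp add: abs_minus_commute)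
      show "(\<lambda>n. 1 / real (Suc n)) \<longlonglongrightarrow> 0" by (rule LIMSEQ_Suc[OF lim_const_over_n])
    qed
    then show "(\<lambda>n. U n \<omega>) \<longlonglongrightarrow> V \<omega>" by (simp add: LIM_zero_iff)
  qed
  show "V \<in> L2_space M (F T)" by (rule L2_bounded[OF order_refl VF K])
  fix e :: real assume e: "e > 0"
  obtain U where U: "U \<in> trig" "\<And>\<omega>. \<omega> \<in> space M \<Longrightarrow> \<bar>V \<omega> - U \<omega>\<bar> \<le> sqrt e" using unifcE[OF V, of "sqrt e"] e by auto
  have "sqnorm M (\<lambda>\<omega>. V \<omega> - U \<omega>) \<le> sqnorm M (\<lambda>\<omega>. sqrt e)"
    by (rule sqnorm_mono_AE) (use U(2) e in \<open>auto intro!: AE_I2\<close>)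
  also have "\<dots> = ennreal e" using e by (simp add: sqnorm_def emeasure_space_1)
  finally show "\<exists>Y. repr Y \<and> sqnorm M (\<lambda>\<omega>. V \<omega> - Y \<omega>) \<le> ennreal e" using trig_repr[OF U(1)] by blast
qed

lemma unifc_lincomb:
  assumes V: "V \<in> unifc" and W: "W \<in> unifc" shows "(\<lambda>\<omega>. a * V \<omega> + b * W \<omega>) \<in> unifc"
proof (rule unifcI)
  fix e :: real assume e: "e > 0"
  define d where "d = e / (\<bar>a\<bar> + \<bar>b\<bar> + 1)"
  have d: "d > 0" unfolding d_def using e by (intro divide_pos_pos) auto
  obtain U where U: "U \<in> trig" "\<And>\<omega>. \<omega> \<in> space M \<Longrightarrow> \<bar>V \<omega> - U \<omega>\<bar> \<le> d" using unifcE[OF V d] by auto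
  obtain U' where U': "U' \<in> trig" "\<And>\<omega>. \<omega> \<in> space M \<Longrightarrow> \<bar>W \<omega> - U' \<omega>\<bar> \<le> d" using unifcE[OF W d] by auto
  show "\<exists>U\<in>trig. \<forall>\<omega>\<in>space M. \<bar>a * V \<omega> + b * W \<omega> - U \<omega>\<bar> \<le> e"
  proof (intro bexI ballI)
    fix \<omega> assume \<omega>: "\<omega> \<in> space M"
    have "\<bar>a * V \<omega> + b * W \<omega> - (a * U \<omega> + b * U' \<omega>)\<bar> = \<bar>a * (V \<omega> - U \<omega>) + b * (W \<omega> - U' \<omega>)\<bar>"
      by (simp add: algebra_simps)
    also have "\<dots> \<le> \<bar>a\<bar> * \<bar>V \<omega> - U \<omega>\<bar> + \<bar>b\<bar> * \<bar>W \<omega> - U' \<omega>\<bar>"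
      by (rule order_trans[OF abs_triangle_ineq]) (simp add: abs_mult)
    also have "\<dots> \<le> \<bar>a\<bar> * d + \<bar>b\<bar> * d" using U U' \<omega> by (intro add_mono mult_left_mono) auto
    also have "\<dots> \<le> (\<bar>a\<bar> + \<bar>b\<bar> + 1) * d" using d by (simp add: algebra_simps)
    also have "\<dots> = e" unfolding d_def by (simp add: add_nonneg_pos less_imp_neq[symmetric])
    finally show "\<bar>a * V \<omega> + b * W \<omega> - (a * U \<omega> + b * U' \<omega>)\<bar> \<le> e" .
  qed (rule trig_lincomb[OF U(1) U'(1)])
qed

lemma unifc_mult:
  assumes V: "V \<in> unifc" and W: "W \<in> unifc" shows "(\<lambda>\<omega>. V \<omega> * W \<omega>) \<in> unifc"
proof (rule unifcI)
  fix e :: real assume e: "e > 0"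
  obtain K where K: "K > 0" "\<And>\<omega>. \<omega> \<in> space M \<Longrightarrow> \<bar>V \<omega>\<bar> \<le> K" using unifc_bounded[OF V] by metis
  define d where "d = min 1 (e / (2 * K))"
  have d: "d > 0" unfolding d_def using e K by simp
  obtain U' where U': "U' \<in> trig" "\<And>\<omega>. \<omega> \<in> space M \<Longrightarrow> \<bar>W \<omega> - U' \<omega>\<bar> \<le> d" using unifcE[OF W d] by auto
  obtain K' where K': "\<And>\<omega>. \<bar>U' \<omega>\<bar> \<le> K'" using trig_bounded[OF U'(1)] by auto
  define d' where "d' = e / (2 * (\<bar>K'\<bar> + 1))"
  have d': "d' > 0" unfolding d'_def using e by (intro divide_pos_pos) auto
  obtain U where U: "U \<in> trig" "\<And>\<omega>. \<omega> \<in> space M \<Longrightarrow> \<bar>V \<omega> - U \<omega>\<bar> \<le> d'" using unifcE[OF V d'] by auto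
  show "\<exists>U\<in>trig. \<forall>\<omega>\<in>space M. \<bar>V \<omega> * W \<omega> - U \<omega>\<bar> \<le> e"
  proof (intro bexI ballI)
    fix \<omega> assume \<omega>: "\<omega> \<in> space M"
    have "\<bar>V \<omega> * W \<omega> - U \<omega> * U' \<omega>\<bar> = \<bar>V \<omega> * (W \<omega> - U' \<omega>) + (V \<omega> - U \<omega>) * U' \<omega>\<bar>"
      by (simp add: algebra_simps)
    also have "\<dots> \<le> \<bar>V \<omega>\<bar> * \<bar>W \<omega> - U' \<omega>\<bar> + \<bar>V \<omega> - U \<omega>\<bar> * \<bar>U' \<omega>\<bar>"
      by (rule order_trans[OF abs_triangle_ineq]) (simp add: abs_mult)
    also have "\<dots> \<le> K * d + d' * (\<bar>K'\<bar> + 1)" using U U' \<omega> K K'[of \<omega>] d d' by (intro add_mono mult_mono) auto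
    also have "d' * (\<bar>K'\<bar> + 1) = e / 2" unfolding d'_def by (simp add: field_simps add_nonneg_pos less_imp_neq[symmetric])
    also have "K * d \<le> e / 2" using mult_left_mono[of d "e / (2 * K)" K] K unfolding d_def by simp
    finally show "\<bar>V \<omega> * W \<omega> - U \<omega> * U' \<omega>\<bar> \<le> e" by simp
  qed (rule trig_mult[OF U(1) U'(1)])
qed

lemma unifc_polynomial:
  assumes p: "real_polynomial_function p" and V: "V \<in> unifc"
  shows "(\<lambda>\<omega>. p (V \<omega>)) \<in> unifc"
  using p
proof (induction rule: real_polynomial_function.induct)
  case (linear f)
  have "f (V \<omega>) = f 1 * V \<omega> + 0 * V \<omega>" for \<omega>
    using bounded_linear.linear[OF linear] linear_scale[of f "V \<omega>" 1] by (simp add: mult.commute)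
  then have "(\<lambda>\<omega>. f (V \<omega>)) = (\<lambda>\<omega>. f 1 * V \<omega> + 0 * V \<omega>)" by (rule ext)
  then show ?case using unifc_lincomb[OF V V, of "f 1" 0] by (simp only:)
next
  case (const c)
  then show ?case by (rule trig_unifc[OF trig_const])
next
  case (add f g)
  then show ?case using unifc_lincomb[of _ _ 1 1] by simp
next
  case (mult f g)
  then show ?case using unifc_mult by blast
qed

text \<open>The range of \<open>V\<close> is bounded, so Weierstrass approximates \<open>h\<close>
  there by polynomials, and \<open>unifc\<close> is closed under these as an algebra.\<close>

lemma unifc_continuous:
  assumes h: "continuous_on UNIV h" and V: "V \<in> unifc"
  shows "(\<lambda>\<omega>. h (V \<omega>)) \<in> unifc"
proof (rule unifcI)
  fix e :: real assume e: "e > 0"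
  obtain K where K: "\<And>\<omega>. \<omega> \<in> space M \<Longrightarrow> \<bar>V \<omega>\<bar> \<le> K" using unifc_bounded[OF V] by metis
  obtain p where p: "real_polynomial_function p" "\<And>x. x \<in> {-K..K} \<Longrightarrow> \<bar>h x - p x\<bar> < e/2"
    using Stone_Weierstrass_real_polynomial_function[of "{-K..K}" h "e/2"] continuous_on_subset[OF h, of "{-K..K}"] e by auto
  obtain U where U: "U \<in> trig" "\<And>\<omega>. \<omega> \<in> space M \<Longrightarrow> \<bar>p (V \<omega>) - U \<omega>\<bar> \<le> e/2"
    using unifcE[OF unifc_polynomial[OF p(1) V], of "e/2"] e by auto
  show "\<exists>U\<in>trig. \<forall>\<omega>\<in>space M. \<bar>h (V \<omega>) - U \<omega>\<bar> \<le> e"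
  proof (intro bexI[OF _ U(1)] ballI)
    fix \<omega> assume \<omega>: "\<omega> \<in> space M"
    have "V \<omega> \<in> {-K..K}" using K[OF \<omega>] by (simp add: abs_le_iff)
    from p(2)[OF this] U(2)[OF \<omega>] show "\<bar>h (V \<omega>) - U \<omega>\<bar> \<le> e" by linarith
  qed
qed

text \<open>Sets whose indicators are bounded limits of \<open>unifc\<close>; products of the limiting sequences make them a pi-system.\<close>

definition indicator_approx :: "(nat \<Rightarrow> 'w \<Rightarrow> real) \<Rightarrow> 'w set \<Rightarrow> bool" where
  "indicator_approx f A \<longleftrightarrow> (\<forall>n. f n \<in> unifc) \<and> (\<forall>n. \<forall>\<omega>\<in>space M. 0 \<le> f n \<omega> \<and> f n \<omega> \<le> 1) \<and>
     (\<forall>\<omega>\<in>space M. (\<lambda>n. f n \<omega>) \<longlonglongrightarrow> indicat_real A \<omega>)"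

lemma indicator_approxD:
  assumes "indicator_approx f A"
  shows "\<And>n. f n \<in> unifc" "\<And>n \<omega>. \<omega> \<in> space M \<Longrightarrow> 0 \<le> f n \<omega> \<and> f n \<omega> \<le> 1"
    "\<And>\<omega>. \<omega> \<in> space M \<Longrightarrow> (\<lambda>n. f n \<omega>) \<longlonglongrightarrow> indicat_real A \<omega>"
  using assms unfolding indicator_approx_def by blast+

definition trig_sets :: "'w set set" where
  "trig_sets = {A. A \<subseteq> space M \<and> (\<exists>f. indicator_approx f A)}"

lemma trig_sets_Int_stable: "Int_stable trig_sets"
proof (rule Int_stableI)
  fix A A' assume "A \<in> trig_sets" "A' \<in> trig_sets"
  then obtain f f' where sub: "A \<subseteq> space M" "A' \<subseteq> space M" and a: "indicator_approx f A" "indicator_approx f' A'"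
    unfolding trig_sets_def by blast
  note f = indicator_approxD[OF a(1)] and f' = indicator_approxD[OF a(2)]
  show "A \<inter> A' \<in> trig_sets" unfolding trig_sets_def indicator_approx_def
  proof (intro CollectI conjI exI[of _ "\<lambda>n \<omega>. f n \<omega> * f' n \<omega>"] allI ballI)
    show "(\<lambda>\<omega>. f n \<omega> * f' n \<omega>) \<in> unifc" for n by (intro unifc_mult f f')
    fix \<omega> assume \<omega>: "\<omega> \<in> space M"
    show "0 \<le> f n \<omega> * f' n \<omega>" "f n \<omega> * f' n \<omega> \<le> 1" for n using f(2)[OF \<omega>, of n] f'(2)[OF \<omega>, of n] by (auto intro: mult_le_one)
    show "(\<lambda>n. f n \<omega> * f' n \<omega>) \<longlonglongrightarrow> indicat_real (A \<inter> A') \<omega>"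
      unfolding indicator_inter_arith by (intro tendsto_mult f(3) f'(3) \<omega>)
  qed (use sub in auto)
qed

text \<open>The ramps max 0 (min 1 (n (x - a))) tend to the indicator of x > a. They are continuous
  functions of \<open>U\<close>, hence in \<open>unifc\<close>.\<close>

lemma trig_greater_set:
  assumes U: "U \<in> trig" shows "{\<omega>\<in>space M. a < U \<omega>} \<in> trig_sets"
  unfolding trig_sets_def indicator_approx_def
proof (intro CollectI conjI exI[of _ "\<lambda>n \<omega>. max 0 (min 1 (real n * (U \<omega> - a)))"] allI ballI)
  show "(\<lambda>\<omega>. max 0 (min 1 (real n * (U \<omega> - a)))) \<in> unifc" for n
    by (rule unifc_continuous[OF _ trig_unifc[OF U], of "\<lambda>x. max 0 (min 1 (real n * (x - a)))"]) (intro continuous_intros)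
  fix \<omega> assume \<omega>: "\<omega> \<in> space M"
  show "(\<lambda>n. max 0 (min 1 (real n * (U \<omega> - a)))) \<longlonglongrightarrow> indicat_real {\<omega>\<in>space M. a < U \<omega>} \<omega>"
  proof (cases "a < U \<omega>")
    case True
    then obtain m :: nat where m: "1 / (U \<omega> - a) < real m" using reals_Archimedean2 by blast
    have "max 0 (min 1 (real n * (U \<omega> - a))) = 1" if "n \<ge> m" for n
    proof -
      have "1 / (U \<omega> - a) \<le> real n" using m that by linarith
      then have "1 \<le> real n * (U \<omega> - a)" using True by (simp add: divide_le_eq)
      then show ?thesis by simp
    qed
    then have "\<forall>\<^sub>F n in sequentially. max 0 (min 1 (real n * (U \<omega> - a))) = 1"
      unfolding eventually_sequentially by blast
    then have "(\<lambda>n. max 0 (min 1 (real n * (U \<omega> - a)))) \<longlonglongrightarrow> 1" by (rule tendsto_eventually)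
    then show ?thesis using True \<omega> by simp
  next
    case False
    then have "real n * (U \<omega> - a) \<le> 0" for n by (intro mult_nonneg_nonpos) auto
    then have "max 0 (min 1 (real n * (U \<omega> - a))) = 0" for n by (simp add: max_absorb1 min.coboundedI2)
    then show ?thesis using False by simp
  qed
qed auto

lemma bounded_limit_repr:
  assumes A: "A \<subseteq> space M" and f: "\<And>n. repr (f n)" "\<And>n \<omega>. \<omega> \<in> space M \<Longrightarrow> 0 \<le> f n \<omega> \<and> f n \<omega> \<le> 1"
    "\<And>\<omega>. \<omega> \<in> space M \<Longrightarrow> (\<lambda>n. f n \<omega>) \<longlonglongrightarrow> indicat_real A \<omega>"
  shows "repr (indicat_real A)"
proof (rule repr_tendsto[OF _ f(1)])
  have m: "indicat_real A \<in> borel_measurable (F T)"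
    by (rule borel_measurable_LIMSEQ_real[of _ f]) (use f reprD_L2 in \<open>auto simp: L2_space_iff\<close>)
  show "indicat_real A \<in> L2_space M (F T)" by (rule L2_bounded[OF _ m, of 1]) auto
  show "(\<lambda>n. sqnorm M (\<lambda>\<omega>. f n \<omega> - indicat_real A \<omega>)) \<longlonglongrightarrow> 0"
  proof (rule sqnorm_dominated_tendsto[where w = "\<lambda>_. 1"])
    show "f n \<in> borel_measurable M" for n using L2_measurable[OF order_refl reprD_L2[OF f(1)]] .
    show "indicat_real A \<in> borel_measurable M" using F_measurable_M[OF _ m] by simp
    show "AE \<omega> in M. (norm (f n \<omega> - indicat_real A \<omega>))\<^sup>2 \<le> 1" for n
    proof (rule AE_I2)
      fix \<omega> assume "\<omega> \<in> space M"
      then have "\<bar>f n \<omega> - indicat_real A \<omega>\<bar> \<le> 1" using f(2)[of \<omega> n] by (auto simp: indicator_def)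
      then show "(norm (f n \<omega> - indicat_real A \<omega>))\<^sup>2 \<le> 1" by (simp add: abs_square_le_1)
    qed
    show "AE \<omega> in M. (\<lambda>n. f n \<omega>) \<longlonglongrightarrow> indicat_real A \<omega>" using f(3) by (rule AE_I2)
  qed auto
qed

lemma trig_sets_subset: "trig_sets \<subseteq> Pow (space M)"
  unfolding trig_sets_def by auto

text \<open>Representability of indicators passes to complements by linearity and to disjoint unions
  by bounded limits. It is not visibly stable under intersections, which is why the induction starts
  from a pi-system.\<close>

lemma sigma_trig_sets_repr:
  assumes A: "A \<in> sigma_sets (space M) trig_sets"
  shows "repr (indicat_real A)"
  using trig_sets_Int_stable trig_sets_subset A
proof (induction rule: sigma_sets_induct_disjoint)
  case (basic A)
  then obtain f where A: "A \<subseteq> space M" and a: "indicator_approx f A" unfolding trig_sets_def by blast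
  show ?case
    by (rule bounded_limit_repr[OF A unifc_repr]) (rule indicator_approxD[OF a]; assumption)+
next
  case empty
  then show ?case using repr_const[of 0] by simp
next
  case (compl A)
  show ?case
  proof (rule repr_AE_cong)
    show "repr (\<lambda>\<omega>. 1 * 1 + (-1) * indicat_real A \<omega>)" by (intro repr_lincomb repr_const compl)
    show "AE \<omega> in M. 1 * 1 + - 1 * indicat_real A \<omega> = indicat_real (space M - A) \<omega>" by (auto simp: indicator_def)
  qed
next
  case (union A)
  show ?case
  proof (rule bounded_limit_repr)
    have "A i \<in> sigma_sets (space M) trig_sets" for i using union by auto
    then show "(\<Union>i. A i) \<subseteq> space M" using sigma_sets_into_sp[OF trig_sets_subset] by blast
    have eq: "(\<Sum>i<n. 1 * indicat_real (A i) \<omega>) = indicat_real (\<Union>i<n. A i) \<omega>" for n \<omega>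
      using indicator_UN_disjoint[of "{..<n}" A \<omega>, where 'c = real] union(1) disjoint_family_on_mono[of "{..<n}" UNIV A] by simp
    show "repr (\<lambda>\<omega>. \<Sum>i<n. 1 * indicat_real (A i) \<omega>)" for n by (rule repr_sum) (use union in auto)
    show "0 \<le> (\<Sum>i<n. 1 * indicat_real (A i) \<omega>) \<and> (\<Sum>i<n. 1 * indicat_real (A i) \<omega>) \<le> 1" for n \<omega>
      unfolding eq by (simp add: indicator_def)
    show "(\<lambda>n. \<Sum>i<n. 1 * indicat_real (A i) \<omega>) \<longlonglongrightarrow> indicat_real (\<Union>i. A i) \<omega>" for \<omega>
      unfolding eq by (rule LIMSEQ_indicator_UN)
  qed
qed

section \<open>Trigonometric functions generate the Brownian filtration up to null sets\<close>

definition trig_alg :: "'w measure" where "trig_alg = sigma (space M) trig_sets"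

lemma space_trig_alg [simp]: "space trig_alg = space M"
  unfolding trig_alg_def by (rule space_measure_of[OF trig_sets_subset])

lemma sets_trig_alg: "sets trig_alg = sigma_sets (space M) trig_sets"
  unfolding trig_alg_def by (rule sets_measure_of[OF trig_sets_subset])

lemma trig_measurable: "U \<in> trig \<Longrightarrow> U \<in> borel_measurable trig_alg"
  unfolding borel_measurable_iff_greater sets_trig_alg using trig_greater_set by (auto intro: sigma_sets.Basic)

lemma sets_trig_alg_F: "sets trig_alg \<subseteq> sets (F T)"
proof
  fix A assume A: "A \<in> sets trig_alg"
  then have "indicat_real A \<in> borel_measurable (F T)"
    using reprD_L2[OF sigma_trig_sets_repr] unfolding sets_trig_alg by (auto simp: L2_space_iff)
  then have "A \<inter> space (F T) \<in> sets (F T)" by (simp only: borel_measurable_indicator_iff)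
  moreover have "A \<subseteq> space M" using sets.sets_into_space[OF A] by simp
  ultimately show "A \<in> sets (F T)" by (simp add: Int_absorb2)
qed

text \<open>The coordinate \<open>y\<close> of an increment is unbounded and so not itself a
  trigonometric function. It is the limit of m * sin (y / m), with error at most y^2 / (2m); the
  phase - pi / 2 turns cosine into sine.\<close>

lemma grid_increment_measurable:
  assumes N: "0 < N" and j: "j \<le> N"
  shows "(\<lambda>\<omega>. B (grid N j) \<omega> - B 0 \<omega>) \<in> borel_measurable trig_alg"
proof -
  have comp: "(\<lambda>\<omega>. (B (grid N j) \<omega> - B 0 \<omega>) $ i) \<in> borel_measurable trig_alg" for i
  proof (rule borel_measurable_LIMSEQ_real)
    let ?v = "\<lambda>n k. if k < j then (1 / real (Suc n)) *\<^sub>R axis i 1 else (0 :: real ^ 'd)"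
    let ?y = "\<lambda>\<omega>. (B (grid N j) \<omega> - B 0 \<omega>) $ i"
    have ug: "ugint N (\<lambda>k _. ?v n k) \<omega> = ?y \<omega> / real (Suc n)" for n \<omega>
    proof -
      have "ugint N (\<lambda>k _. ?v n k) \<omega> = (\<Sum>k<N. if k < j then (B (grid N (Suc k)) \<omega> $ i - B (grid N k) \<omega> $ i) / real (Suc n) else 0)"
        unfolding ugint_def incr_def by (intro sum.cong refl) (simp add: inner_axis' )
      also have "\<dots> = (\<Sum>k<j. (B (grid N (Suc k)) \<omega> $ i - B (grid N k) \<omega> $ i) / real (Suc n))"
        by (rule sum.mono_neutral_cong_right) (use j in auto)
      also have "\<dots> = ?y \<omega> / real (Suc n)"
        unfolding sum_divide_distrib[symmetric] sum_lessThan_telescope[of "\<lambda>k. B (grid N k) \<omega> $ i"] by (simp add: grid_def)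
      finally show ?thesis .
    qed
    have tr: "(\<lambda>\<omega>. real (Suc n) * cos (ugint N (\<lambda>k _. ?v n k) \<omega> + (- pi / 2)) + 0 * cos (ugint N (\<lambda>k _. ?v n k) \<omega> + (- pi / 2))) \<in> trig" for n
      by (intro trig_lincomb trig_cos N)
    have "(\<lambda>\<omega>. real (Suc n) * sin (?y \<omega> / real (Suc n))) \<in> trig" for n
    proof -
      have "cos (x + (- pi / 2)) = sin x" for x :: real by (simp add: cos_diff)
      then show ?thesis using tr[of n] unfolding ug by (simp only: mult_zero_left add_0_right)
    qed
    then show "(\<lambda>\<omega>. real (Suc n) * sin (?y \<omega> / real (Suc n))) \<in> borel_measurable trig_alg" for n by (rule trig_measurable)
    show "(\<lambda>n. real (Suc n) * sin (?y \<omega> / real (Suc n))) \<longlonglongrightarrow> ?y \<omega>" for \<omega>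
    proof -
      have "(\<lambda>n. real (Suc n) * sin (?y \<omega> / real (Suc n)) - ?y \<omega>) \<longlonglongrightarrow> 0"
      proof (rule Lim_null_comparison)
        show "(\<lambda>n. (?y \<omega>)\<^sup>2 / 2 / real (Suc n)) \<longlonglongrightarrow> 0" by (rule LIMSEQ_Suc[OF lim_const_over_n])
        have "\<bar>m * sin (x / m) - x\<bar> \<le> x\<^sup>2 / 2 / m" if m: "m > 0" for m x :: real
        proof -
          have "\<bar>m * sin (x / m) - x\<bar> = \<bar>m * (sin (x / m) - x / m)\<bar>" using m by (simp add: right_diff_distrib)
          also have "\<dots> = m * \<bar>sin (x / m) - x / m\<bar>" using m by (simp add: abs_mult)
          also have "\<dots> \<le> m * ((x / m)\<^sup>2 / 2)" using m by (intro mult_left_mono cos_sin_Taylor) auto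
          also have "\<dots> = x\<^sup>2 / 2 / m" using m by (simp add: power2_eq_square)
          finally show ?thesis .
        qed
        from this[of "real (Suc _)" "?y \<omega>"]
        have "\<bar>real (Suc n) * sin (?y \<omega> / real (Suc n)) - ?y \<omega>\<bar> \<le> (?y \<omega>)\<^sup>2 / 2 / real (Suc n)" for n
          by (simp del: of_nat_Suc)
        then show "\<forall>\<^sub>F n in sequentially. norm (real (Suc n) * sin (?y \<omega> / real (Suc n)) - ?y \<omega>) \<le> (?y \<omega>)\<^sup>2 / 2 / real (Suc n)"
          by (intro always_eventually) (simp del: of_nat_Suc)
      qed
      then show ?thesis by (simp only: LIM_zero_iff)
    qed
  qed
  show ?thesis
  proof (subst borel_measurable_euclidean_space, rule ballI)
    fix b :: "real ^ 'd" assume "b \<in> Basis"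
    then obtain i where b: "b = axis i 1" by (auto simp: Basis_vec_def)
    show "(\<lambda>\<omega>. (B (grid N j) \<omega> - B 0 \<omega>) \<bullet> b) \<in> borel_measurable trig_alg" using comp[of i] by (simp add: b inner_axis)
  qed
qed

lemma AE_B_0: "AE \<omega> in M. B 0 \<omega> = 0"
  using BM unfolding brownian_motion_def by auto

text \<open>\<open>trig_alg\<close> controls only increments from time 0 at grid points. The added
  null sets take care of the rest: B 0 = 0 and path continuity hold merely almost surely.\<close>

lemma sets_F_trig_alg: "sets (F T) \<subseteq> sigma_sets (space M) (sets trig_alg \<union> null_sets M)"
proof -
  define G where "G = sigma (space M) (sets trig_alg \<union> null_sets M)"
  have gen: "sets trig_alg \<union> null_sets M \<subseteq> Pow (space M)"
    using sets.space_closed[of trig_alg] sets.space_closed[of M] by auto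
  have spG: "space G = space M" unfolding G_def by (rule space_measure_of[OF gen])
  have setsG: "sets G = sigma_sets (space M) (sets trig_alg \<union> null_sets M)" unfolding G_def by (rule sets_measure_of[OF gen])
  have nullG: "null_sets M \<subseteq> sets G" unfolding setsG by auto
  have sub: "subalgebra G trig_alg" unfolding subalgebra_def spG setsG by auto
  have Bgrid: "B (grid N j) \<in> borel_measurable G" if "0 < N" "j \<le> N" for N j
  proof (rule measurable_AE_cong[OF spG nullG])
    show "(\<lambda>\<omega>. B (grid N j) \<omega> - B 0 \<omega>) \<in> borel_measurable G"
      by (rule measurable_from_subalg[OF sub grid_increment_measurable[OF that]])
    show "AE \<omega> in M. B (grid N j) \<omega> - B 0 \<omega> = B (grid N j) \<omega>" using AE_B_0 by eventually_elim simp
  qed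
  have BG: "B t \<in> borel_measurable G" if t: "t \<in> {0..T}" for t
  proof (rule measurable_AE_cong[OF spG nullG])
    define k where "k n = nat \<lfloor>t * real (Suc n) / T\<rfloor>" for n
    have t': "0 \<le> t" "t \<le> T" using t by auto
    note ga = grid_approx[OF t' k_def, folded grid_def]
    have [measurable]: "B (grid (Suc n) (k n)) \<in> borel_measurable G" for n using Bgrid ga(1) by simp
    show "(\<lambda>\<omega>. lim (\<lambda>n. B (grid (Suc n) (k n)) \<omega>)) \<in> borel_measurable G" by measurable
    show "AE \<omega> in M. lim (\<lambda>n. B (grid (Suc n) (k n)) \<omega>) = B t \<omega>"
      using AE_B_continuous
    proof eventually_elim
      case (elim \<omega>)
      have "(\<lambda>n. B (grid (Suc n) (k n)) \<omega>) \<longlonglongrightarrow> B t \<omega>"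
        by (rule continuous_on_tendsto_compose[OF elim ga(2) t]) (use grid_bounds[OF ga(1)] in auto)
      then show ?case by (rule limI)
    qed
  qed
  have "sets (F T) \<subseteq> sets G"
    unfolding sets_F spG[symmetric]
  proof (rule sets.sigma_sets_subset, rule Un_least)
    show "sets (natural_filtration M B T) \<subseteq> sets G"
      unfolding sets_natural_filtration spG[symmetric]
    proof (rule sets.sigma_sets_subset, safe)
      fix s X assume s: "s \<in> {0..T}" "X \<in> sets (vimage_algebra (space G) (B s) borel)"
      then show "X \<in> sets G" using BG[OF s(1)] by (auto simp: sets_vimage_algebra2 measurable_sets)
    qed
  qed (rule nullG)
  then show ?thesis unfolding setsG .
qed

lemma indicator_repr:
  assumes A: "A \<in> sets (F T)" shows "repr (indicat_real A)"
proof -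
  have sub: "sets trig_alg \<subseteq> sets M" using sets_trig_alg_F sets_F_subset_M[of T] by auto
  obtain A' where A': "A' \<in> sets trig_alg" "A - A' \<in> null_sets M" "A' - A \<in> null_sets M"
    using sigma_sets_augment[OF _ sub, of A] sets.sigma_algebra_axioms[of trig_alg] sets_F_trig_alg A by auto
  show ?thesis
  proof (rule repr_AE_cong)
    show "repr (indicat_real A')" using sigma_trig_sets_repr A'(1) unfolding sets_trig_alg .
    show "AE \<omega> in M. indicat_real A' \<omega> = indicat_real A \<omega>"
      using AE_not_in[OF A'(2)] AE_not_in[OF A'(3)] by eventually_elim (auto simp: indicator_def)
  qed
qed

theorem L2_repr:
  assumes X: "X \<in> L2_space M (F T)" shows "repr X"
proof -
  have XF: "X \<in> borel_measurable (F T)" using X by (auto simp: L2_space_iff)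
  obtain S where S: "\<And>i. simple_function (F T) (S i)" "\<And>\<omega>. \<omega> \<in> space (F T) \<Longrightarrow> (\<lambda>i. S i \<omega>) \<longlonglongrightarrow> X \<omega>"
      "\<And>i \<omega>. \<omega> \<in> space (F T) \<Longrightarrow> dist (S i \<omega>) 0 \<le> 2 * dist (X \<omega>) 0"
    using borel_measurable_implies_sequence_metric[OF XF, of 0] by blast
  have Sr: "repr (S i)" for i
  proof (rule repr_AE_cong)
    have fin: "finite (S i ` space M)" using simple_functionD(1)[OF S(1)] by simp
    have "repr (indicat_real (S i -` {y} \<inter> space M))" for y
      using indicator_repr simple_functionD(2)[OF S(1), of i "{y}"] by simp
    then show "repr (\<lambda>\<omega>. \<Sum>y\<in>S i ` space M. y * indicat_real (S i -` {y} \<inter> space M) \<omega>)"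
      by (intro repr_sum fin)
    show "AE \<omega> in M. (\<Sum>y\<in>S i ` space M. y * indicat_real (S i -` {y} \<inter> space M) \<omega>) = S i \<omega>"
    proof (rule AE_I2)
      fix \<omega> assume \<omega>: "\<omega> \<in> space M"
      have "(\<Sum>y\<in>S i ` space M. y * indicat_real (S i -` {y} \<inter> space M) \<omega>) = (\<Sum>y\<in>S i ` space M. if y = S i \<omega> then y else 0)"
        using \<omega> by (intro sum.cong refl) (auto simp: indicator_def)
      also have "\<dots> = S i \<omega>" using fin \<omega> by (simp add: sum.delta)
      finally show "(\<Sum>y\<in>S i ` space M. y * indicat_real (S i -` {y} \<inter> space M) \<omega>) = S i \<omega>" .
    qed
  qed
  show ?thesis
  proof (rule repr_tendsto[OF X Sr])
    show "(\<lambda>i. sqnorm M (\<lambda>\<omega>. S i \<omega> - X \<omega>)) \<longlonglongrightarrow> 0"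
    \<comment> \<open>The approximants satisfy |S| \<le> 2 |X|, hence |S - X| \<le> 3 |X|, whose
      square is the majorant.\<close>
    proof (rule sqnorm_dominated_tendsto[where w = "\<lambda>\<omega>. 9 * (X \<omega>)\<^sup>2"])
      show "S i \<in> borel_measurable M" for i using L2_measurable[OF order_refl reprD_L2[OF Sr]] .
      show "X \<in> borel_measurable M" using L2_measurable[OF order_refl X] .
      show "integrable M (\<lambda>\<omega>. 9 * (X \<omega>)\<^sup>2)" using L2_square_integrable[OF X] by simp
      show "AE \<omega> in M. (norm (S i \<omega> - X \<omega>))\<^sup>2 \<le> 9 * (X \<omega>)\<^sup>2" for i
      proof (rule AE_I2)
        fix \<omega> assume "\<omega> \<in> space M"
        then have "\<bar>S i \<omega> - X \<omega>\<bar> \<le> 3 * \<bar>X \<omega>\<bar>" using S(3)[of \<omega> i] by (simp add: dist_real_def)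
        then have "\<bar>S i \<omega> - X \<omega>\<bar>\<^sup>2 \<le> (3 * \<bar>X \<omega>\<bar>)\<^sup>2" by (rule power_mono) simp
        then show "(norm (S i \<omega> - X \<omega>))\<^sup>2 \<le> 9 * (X \<omega>)\<^sup>2" by (simp add: power_mult_distrib)
      qed
      show "AE \<omega> in M. (\<lambda>i. S i \<omega>) \<longlonglongrightarrow> X \<omega>" using S(2) by (auto intro!: AE_I2)
    qed
  qed
qed

theorem martingale_representation:
  assumes "X \<in> L2_space M (F T)"
  obtains c Z I where "has_ito_integral M F T B Z I" "AE \<omega> in M. X \<omega> = c + I T \<omega>"
  using repr_ito_integral[OF L2_repr[OF assms]] .


section \<open>Linear backward equations\<close>

definition driver :: "('w \<times> real \<Rightarrow> real) \<Rightarrow> bool" where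
  "driver g \<longleftrightarrow> g \<in> borel_measurable Prog \<and> sqnorm P g < \<infinity>"

definition Jint :: "('w \<times> real \<Rightarrow> real) \<Rightarrow> real \<Rightarrow> real \<Rightarrow> 'w \<Rightarrow> real" where
  "Jint g a b \<omega> = (LINT s:{a..b}|lborel. g (\<omega>, s))"

lemma driver_P: "driver g \<Longrightarrow> g \<in> borel_measurable P"
  unfolding driver_def using Prog_measurable_P by auto

lemma driver_diff:
  assumes "driver g" "driver g'" shows "driver (\<lambda>x. g x - g' x)"
  using assms driver_P[OF assms(1)] driver_P[OF assms(2)]
  by (auto simp: driver_def ennreal_mult_less_top intro!: order.strict_trans1[OF sqnorm_diff_le])

lemma section_measurable:
  assumes g: "g \<in> borel_measurable P" and \<omega>: "\<omega> \<in> space M"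
  shows "(\<lambda>s. g (\<omega>, s)) \<in> borel_measurable (restrict_space lborel {0..T})"
  using measurable_compose[OF measurable_Pair1'[OF \<omega>] g] .

lemma AE_sq_finite:
  assumes "driver g"
  shows "AE \<omega> in M. (\<integral>\<^sup>+s\<in>{0..T}. ennreal ((g (\<omega>, s))\<^sup>2) \<partial>lborel) < \<infinity>"
proof -
  note [measurable] = driver_P[OF assms]
  have "(\<integral>\<^sup>+\<omega>. (\<integral>\<^sup>+s. ennreal ((g (\<omega>, s))\<^sup>2) \<partial>restrict_space lborel {0..T}) \<partial>M) = sqnorm P g"
    unfolding sqnorm_def by (subst P.M2.nn_integral_fst) auto
  also have "\<dots> < \<infinity>" using assms unfolding driver_def by auto
  finally have "AE \<omega> in M. (\<integral>\<^sup>+s. ennreal ((g (\<omega>, s))\<^sup>2) \<partial>restrict_space lborel {0..T}) \<noteq> \<infinity>"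
    by (intro nn_integral_PInf_AE P.M2.borel_measurable_nn_integral_fst) auto
  then show ?thesis by eventually_elim (simp add: nn_integral_restrict_space less_top)
qed

lemma AE_integrable:
  assumes g: "driver g"
  shows "AE \<omega> in M. set_integrable lborel {0..T} (\<lambda>s. g (\<omega>, s))"
  using AE_sq_finite[OF g] AE_space
proof eventually_elim
  case (elim \<omega>)
  interpret L: finite_measure "restrict_space lborel {0..T::real}" by (rule finite_measure_time)
  note m = section_measurable[OF driver_P[OF g] elim(2)]
  have "integrable (restrict_space lborel {0..T}) (\<lambda>s. (g (\<omega>, s))\<^sup>2)"
    unfolding integrable_iff_bounded using m elim(1) by (simp add: nn_integral_restrict_space)
  from L.square_integrable_imp_integrable[OF m this]
  show ?case unfolding set_integrable_def by (simp add: integrable_restrict_space)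
qed

text \<open>Progressive measurability makes \<open>g\<close> jointly measurable for
  \<open>F t\<close> and the Borel sets of {0..t}, so the integral over that interval is known at
  time \<open>t\<close>.\<close>

lemma Jint_F_measurable:
  assumes g: "driver g" and t: "t \<in> {0..T}"
  shows "Jint g 0 t \<in> borel_measurable (F t)"
proof -
  interpret L: finite_measure "restrict_space lborel {0..t::real}"
    using t by (intro finite_measureI) (simp add: emeasure_restrict_space space_restrict_space)
  have "g \<in> borel_measurable (time_alg t)" using Prog_measurableD[OF _ t] g unfolding driver_def by auto
  moreover have "sets (F t \<Otimes>\<^sub>M restrict_space lborel {0..t}) = sets (time_alg t)"
    by (intro sets_pair_measure_cong sets_restrict_space_cong) auto
  ultimately have "g \<in> borel_measurable (F t \<Otimes>\<^sub>M restrict_space lborel {0..t})"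
    by (simp cong: measurable_cong_sets)
  then have "(\<lambda>\<omega>. \<integral>s. g (\<omega>, s) \<partial>restrict_space lborel {0..t}) \<in> borel_measurable (F t)"
    by (intro L.borel_measurable_lebesgue_integral) simp
  then show ?thesis unfolding Jint_def[abs_def] set_lebesgue_integral_def by (simp add: integral_restrict_space)
qed

lemma Jint_eq_integral:
  assumes "set_integrable lborel {0..T} (\<lambda>s. g (\<omega>, s))" "0 \<le> a" "b \<le> T"
  shows "Jint g a b \<omega> = integral {a..b} (\<lambda>s. g (\<omega>, s))" "(\<lambda>s. g (\<omega>, s)) integrable_on {a..b}"
  using set_borel_integral_eq_integral[OF set_integrable_subset[OF assms(1), of "{a..b}"]] assms unfolding Jint_def by auto

lemma Jint_combine:
  assumes "set_integrable lborel {0..T} (\<lambda>s. g (\<omega>, s))" "t \<in> {0..T}"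
  shows "Jint g 0 t \<omega> + Jint g t T \<omega> = Jint g 0 T \<omega>"
  using assms Henstock_Kurzweil_Integration.integral_combine[of 0 t T "\<lambda>s. g (\<omega>, s)"]
    Jint_eq_integral[OF assms(1), of 0 t] Jint_eq_integral[OF assms(1), of t T] Jint_eq_integral[OF assms(1), of 0 T] by simp

lemma Jint_continuous:
  assumes "set_integrable lborel {0..T} (\<lambda>s. g (\<omega>, s))"
  shows "continuous_on {0..T} (\<lambda>t. Jint g 0 t \<omega>)"
proof -
  have "continuous_on {0..T} (\<lambda>t. integral {0..t} (\<lambda>s. g (\<omega>, s)))"
    by (rule indefinite_integral_continuous_1) (use Jint_eq_integral[OF assms] in auto)
  then show ?thesis by (rule continuous_on_eq) (use Jint_eq_integral[OF assms] in auto)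
qed

lemma Jint_diff:
  assumes "set_integrable lborel {0..T} (\<lambda>s. g (\<omega>, s))" "set_integrable lborel {0..T} (\<lambda>s. g' (\<omega>, s))" "t \<in> {0..T}"
  shows "Jint (\<lambda>x. g x - g' x) t T \<omega> = Jint g t T \<omega> - Jint g' t T \<omega>"
  unfolding Jint_def
  by (rule set_integral_diff) (use assms in \<open>auto intro: set_integrable_subset\<close>)

text \<open>Cauchy-Schwarz with the weight \<open>exp (\<gamma> s)\<close>, which is what makes the fixed point map contract on all of \<open>[0, T]\<close> at once.\<close>

lemma Jint_weighted_bound:
  assumes i: "set_integrable lborel {0..T} (\<lambda>s. g (\<omega>, s))" and t: "t \<in> {0..T}" and \<gamma>: "\<gamma> > 0"
  shows "ennreal ((Jint g t T \<omega>)\<^sup>2) \<le> ennreal (exp (- \<gamma> * t) / \<gamma>) * (\<integral>\<^sup>+s\<in>{t..T}. ennreal (exp (\<gamma> * s) * (g (\<omega>, s))\<^sup>2) \<partial>lborel)"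
proof -
  let ?h = "\<lambda>s. g (\<omega>, s)"
  have i': "set_integrable lborel {t..T} ?h" by (rule set_integrable_subset[OF i]) (use t in auto)
  then have m[measurable]: "(\<lambda>s. indicat_real {t..T} s * ?h s) \<in> borel_measurable lborel"
    unfolding set_integrable_def by (auto dest: borel_measurable_integrable)
  \<comment> \<open>The factor 1 = exp (- \<gamma> s / 2) * exp (\<gamma> s / 2) is shared out
    between \<open>a\<close> and \<open>b\<close>; the square of \<open>a\<close> integrates to at
    most exp (- \<gamma> t) / \<gamma>.\<close>
  define a where "a s = ennreal (indicat_real {t..T} s * exp (- \<gamma> * s / 2))" for s
  define b where "b s = ennreal (exp (\<gamma> * s / 2) * \<bar>indicat_real {t..T} s * ?h s\<bar>)" for s
  have am: "a \<in> borel_measurable lborel" unfolding a_def[abs_def] by measurable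
  have bm: "b \<in> borel_measurable lborel" unfolding b_def[abs_def] by measurable
  have ab: "a s * b s = ennreal \<bar>indicat_real {t..T} s * ?h s\<bar>" for s
    by (auto simp: a_def b_def indicator_def ennreal_mult[symmetric] mult.assoc[symmetric] exp_add[symmetric])
  have a2: "(\<integral>\<^sup>+s. a s ^ 2 \<partial>lborel) \<le> ennreal (exp (- \<gamma> * t) / \<gamma>)"
  proof -
    have "(\<integral>\<^sup>+s. a s ^ 2 \<partial>lborel) = (\<integral>\<^sup>+s. ennreal (exp (- \<gamma> * s)) * indicator {t..T} s \<partial>lborel)"
      by (intro nn_integral_cong) (auto simp: a_def indicator_def ennreal_power exp_double[symmetric])
    also have "\<dots> = ennreal ((- exp (- \<gamma> * T) / \<gamma>) - (- exp (- \<gamma> * t) / \<gamma>))"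
      by (rule nn_integral_FTC_Icc) (use \<gamma> t in \<open>auto intro!: derivative_eq_intros\<close>)
    also have "\<dots> \<le> ennreal (exp (- \<gamma> * t) / \<gamma>)" using \<gamma> by (intro ennreal_leI) simp
    finally show ?thesis .
  qed
  have b2: "(\<integral>\<^sup>+s. b s ^ 2 \<partial>lborel) = (\<integral>\<^sup>+s\<in>{t..T}. ennreal (exp (\<gamma> * s) * (?h s)\<^sup>2) \<partial>lborel)"
    by (intro nn_integral_cong) (auto simp: b_def indicator_def ennreal_power power_mult_distrib exp_double[symmetric])
  have "ennreal \<bar>Jint g t T \<omega>\<bar> \<le> (\<integral>\<^sup>+s. a s * b s \<partial>lborel)"
    using integral_norm_bound_ennreal[OF i'[unfolded set_integrable_def]]
    unfolding ab Jint_def set_lebesgue_integral_def by simp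
  then have "(ennreal \<bar>Jint g t T \<omega>\<bar>)\<^sup>2 \<le> (\<integral>\<^sup>+s. a s * b s \<partial>lborel)\<^sup>2" by (rule power_mono) simp
  also have "\<dots> \<le> (\<integral>\<^sup>+s. a s ^ 2 \<partial>lborel) * (\<integral>\<^sup>+s. b s ^ 2 \<partial>lborel)" by (rule Cauchy_Schwarz_nn_integral[OF am bm])
  also have "\<dots> \<le> ennreal (exp (- \<gamma> * t) / \<gamma>) * (\<integral>\<^sup>+s\<in>{t..T}. ennreal (exp (\<gamma> * s) * (?h s)\<^sup>2) \<partial>lborel)"
    unfolding b2 by (intro mult_right_mono a2) simp
  finally show ?thesis by (simp add: ennreal_power)
qed

text \<open>The mean of the right-hand side of \<open>Jint_weighted_bound\<close>. Both the
  prefactor and the integral over times after \<open>t\<close> decrease in \<open>t\<close>. This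
  monotonicity lets the bound at \<open>t\<close> serve for the running supremum over all later
  times.\<close>

definition tail :: "real \<Rightarrow> ('w \<times> real \<Rightarrow> real) \<Rightarrow> real \<Rightarrow> ennreal" where
  "tail \<gamma> g t = ennreal (exp (- \<gamma> * t) / \<gamma>) * (\<integral>\<^sup>+x. ennreal (exp (\<gamma> * snd x) * (g x)\<^sup>2) * indicator {t..} (snd x) \<partial>P)"

lemma tail_mono: "0 < \<gamma> \<Longrightarrow> s \<le> t \<Longrightarrow> tail \<gamma> g t \<le> tail \<gamma> g s"
  unfolding tail_def by (intro mult_mono nn_integral_mono ennreal_leI divide_right_mono) (auto simp: indicator_def)

lemma Jint_sqnorm_le:
  assumes g: "driver g" and t: "t \<in> {0..T}" and \<gamma>: "\<gamma> > 0"
  shows "sqnorm M (Jint g t T) \<le> tail \<gamma> g t"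
proof -
  note [measurable] = driver_P[OF g] snd_measurable_P
  have q: "(\<lambda>x. ennreal (exp (\<gamma> * snd x) * (g x)\<^sup>2) * indicator {t..} (snd x)) \<in> borel_measurable P" by measurable
  note q' = P.M2.borel_measurable_nn_integral_fst[OF q, simplified]
  have "sqnorm M (Jint g t T) \<le> (\<integral>\<^sup>+\<omega>. ennreal (exp (- \<gamma> * t) / \<gamma>) * (\<integral>\<^sup>+s. ennreal (exp (\<gamma> * s) * (g (\<omega>, s))\<^sup>2) * indicator {t..} s \<partial>restrict_space lborel {0..T}) \<partial>M)"
    unfolding sqnorm_def
  proof (rule nn_integral_mono_AE, use AE_integrable[OF g] in eventually_elim)
    case (elim \<omega>)
    have "(\<integral>\<^sup>+s\<in>{t..T}. ennreal (exp (\<gamma> * s) * (g (\<omega>, s))\<^sup>2) \<partial>lborel) = (\<integral>\<^sup>+s. ennreal (exp (\<gamma> * s) * (g (\<omega>, s))\<^sup>2) * indicator {t..} s \<partial>restrict_space lborel {0..T})"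
      using t by (subst nn_integral_restrict_space) (auto intro!: nn_integral_cong simp: indicator_def)
    then show ?case using Jint_weighted_bound[OF elim t \<gamma>] by simp
  qed
  also have "\<dots> = ennreal (exp (- \<gamma> * t) / \<gamma>) * (\<integral>\<^sup>+\<omega>. (\<integral>\<^sup>+s. ennreal (exp (\<gamma> * s) * (g (\<omega>, s))\<^sup>2) * indicator {t..} s \<partial>restrict_space lborel {0..T}) \<partial>M)"
    using q' by (intro nn_integral_cmult) simp
  also have "\<dots> = tail \<gamma> g t"
    unfolding tail_def using P.M2.nn_integral_fst[OF q] by simp
  finally show ?thesis .
qed

definition wnorm :: "real \<Rightarrow> ('w \<times> real \<Rightarrow> 'b::{banach, second_countable_topology}) \<Rightarrow> ennreal" where
  "wnorm \<beta> g = (\<integral>\<^sup>+x. ennreal (exp (\<beta> * snd x) * (norm (g x))\<^sup>2) \<partial>P)"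

text \<open>On the time interval the weight lies between 1 and exp (\<beta> T). So contraction may
  be measured in the weighted norm and completeness used in the plain one.\<close>

lemma wnorm_sqnorm:
  assumes \<beta>: "\<beta> \<ge> 0" and [measurable]: "g \<in> borel_measurable P"
  shows "sqnorm P g \<le> wnorm \<beta> g" "wnorm \<beta> g \<le> ennreal (exp (\<beta> * T)) * sqnorm P g"
proof -
  show "sqnorm P g \<le> wnorm \<beta> g"
    unfolding sqnorm_def wnorm_def
  proof (intro nn_integral_mono ennreal_leI)
    fix x assume "x \<in> space P"
    then have "1 \<le> exp (\<beta> * snd x)" using \<beta> by (auto simp: space_P)
    from mult_right_mono[OF this, of "(norm (g x))\<^sup>2"] show "(norm (g x))\<^sup>2 \<le> exp (\<beta> * snd x) * (norm (g x))\<^sup>2" by simp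
  qed
  have "wnorm \<beta> g \<le> (\<integral>\<^sup>+x. ennreal (exp (\<beta> * T)) * ennreal ((norm (g x))\<^sup>2) \<partial>P)"
    unfolding wnorm_def
  proof (rule nn_integral_mono)
    fix x assume "x \<in> space P"
    then have "exp (\<beta> * snd x) \<le> exp (\<beta> * T)" using \<beta> by (auto simp: space_P mult_left_mono)
    then show "ennreal (exp (\<beta> * snd x) * (norm (g x))\<^sup>2) \<le> ennreal (exp (\<beta> * T)) * ennreal ((norm (g x))\<^sup>2)"
      by (simp add: ennreal_mult[symmetric] mult_right_mono)
  qed
  also have "\<dots> = ennreal (exp (\<beta> * T)) * sqnorm P g"
    unfolding sqnorm_def by (rule nn_integral_cmult) measurable
  finally show "wnorm \<beta> g \<le> ennreal (exp (\<beta> * T)) * sqnorm P g" .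
qed

lemma tail_0_le:
  assumes "\<gamma> > 0" and [measurable]: "g \<in> borel_measurable P"
  shows "tail \<gamma> g 0 \<le> ennreal (1 / \<gamma>) * wnorm (2 * \<gamma>) g"
  unfolding tail_def wnorm_def
proof (intro mult_mono nn_integral_mono)
  fix x assume "x \<in> space P"
  then have "exp (\<gamma> * snd x) \<le> exp (2 * \<gamma> * snd x)" using assms by (auto simp: space_P)
  then show "ennreal (exp (\<gamma> * snd x) * (g x)\<^sup>2) * indicator {0..} (snd x) \<le> ennreal (exp (2 * \<gamma> * snd x) * (norm (g x))\<^sup>2)"
    using assms(1) by (auto simp: indicator_def intro!: ennreal_leI mult_right_mono)
qed auto

lemma nn_integral_exp:
  assumes "\<gamma> > 0" "0 \<le> s"
  shows "(\<integral>\<^sup>+t\<in>{0..s}. ennreal (exp (\<gamma> * t)) \<partial>lborel) = ennreal ((exp (\<gamma> * s) - 1) / \<gamma>)"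
proof -
  have "(\<integral>\<^sup>+t\<in>{0..s}. ennreal (exp (\<gamma> * t)) \<partial>lborel) = ennreal (exp (\<gamma> * s) / \<gamma> - exp (\<gamma> * 0) / \<gamma>)"
    by (rule nn_integral_FTC_Icc) (use assms in \<open>auto intro!: derivative_eq_intros\<close>)
  then show ?thesis by (simp add: diff_divide_distrib)
qed

text \<open>Tonelli on the triangle of pairs of times t \<le> s; the measurability of that triangle
  is the only work.\<close>

lemma nn_integral_swap_time:
  fixes q :: "'w \<times> real \<Rightarrow> ennreal" and r :: "real \<Rightarrow> ennreal"
  assumes [measurable]: "q \<in> borel_measurable P" "r \<in> borel_measurable borel"
  shows "(\<integral>\<^sup>+t\<in>{0..T}. r t * (\<integral>\<^sup>+x. q x * indicator {t..} (snd x) \<partial>P) \<partial>lborel) = (\<integral>\<^sup>+x. q x * (\<integral>\<^sup>+t\<in>{0..snd x}. r t \<partial>lborel) \<partial>P)"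
proof -
  note [measurable] = snd_measurable_P
  interpret PP: pair_sigma_finite P lborel
    unfolding pair_sigma_finite_def using finite_measure_P finite_measure.axioms(1) sigma_finite_lborel by auto
  have meas_le: "{y \<in> space (P \<Otimes>\<^sub>M lborel). snd y \<le> snd (fst y)} \<in> sets (P \<Otimes>\<^sub>M lborel)"
    by (rule borel_measurable_le) (auto intro: measurable_compose[OF measurable_fst snd_measurable_P])
  have [measurable]: "(\<lambda>y. indicator {0..T} (snd y) * r (snd y) * (q (fst y) * indicator {y. snd y \<le> snd (fst y)} y)) \<in> borel_measurable (P \<Otimes>\<^sub>M lborel)"
  proof -
    have "(\<lambda>y. indicator {y \<in> space (P \<Otimes>\<^sub>M lborel). snd y \<le> snd (fst y)} y :: ennreal) \<in> borel_measurable (P \<Otimes>\<^sub>M lborel)"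
      by (rule borel_measurable_indicator[OF meas_le])
    then have "(\<lambda>y. indicator {y. snd y \<le> snd (fst y)} y :: ennreal) \<in> borel_measurable (P \<Otimes>\<^sub>M lborel)"
      by (rule measurable_cong[THEN iffD1, rotated]) (auto simp: indicator_def)
    then show ?thesis by measurable
  qed
  have "(\<integral>\<^sup>+t\<in>{0..T}. r t * (\<integral>\<^sup>+x. q x * indicator {t..} (snd x) \<partial>P) \<partial>lborel)
    = (\<integral>\<^sup>+t. (\<integral>\<^sup>+x. indicator {0..T} t * r t * (q x * indicator {y. snd y \<le> snd (fst y)} (x, t)) \<partial>P) \<partial>lborel)"
  proof (rule nn_integral_cong)
    fix t
    have "(\<integral>\<^sup>+x. indicator {0..T} t * r t * (q x * indicator {y. snd y \<le> snd (fst y)} (x, t)) \<partial>P) = indicator {0..T} t * r t * (\<integral>\<^sup>+x. q x * indicator {t..} (snd x) \<partial>P)"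
      by (subst nn_integral_cmult[symmetric]) (auto intro!: nn_integral_cong simp: indicator_def)
    then show "r t * (\<integral>\<^sup>+x. q x * indicator {t..} (snd x) \<partial>P) * indicator {0..T} t = (\<integral>\<^sup>+x. indicator {0..T} t * r t * (q x * indicator {y. snd y \<le> snd (fst y)} (x, t)) \<partial>P)"
      by (simp add: mult_ac)
  qed
  also have "\<dots> = (\<integral>\<^sup>+x. (\<integral>\<^sup>+t. indicator {0..T} t * r t * (q x * indicator {y. snd y \<le> snd (fst y)} (x, t)) \<partial>lborel) \<partial>P)"
    using PP.Fubini[of "\<lambda>y. indicator {0..T} (snd y) * r (snd y) * (q (fst y) * indicator {y. snd y \<le> snd (fst y)} y)"] by simp
  also have "\<dots> = (\<integral>\<^sup>+x. q x * (\<integral>\<^sup>+t\<in>{0..snd x}. r t \<partial>lborel) \<partial>P)"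
  proof (rule nn_integral_cong)
    fix x assume "x \<in> space P"
    then have x: "0 \<le> snd x" "snd x \<le> T" by (auto simp: space_P)
    have "(\<integral>\<^sup>+t. indicator {0..T} t * r t * (q x * indicator {y. snd y \<le> snd (fst y)} (x, t)) \<partial>lborel) = (\<integral>\<^sup>+t. q x * (r t * indicator {0..snd x} t) \<partial>lborel)"
      using x by (intro nn_integral_cong) (auto simp: indicator_def mult_ac)
    also have "\<dots> = q x * (\<integral>\<^sup>+t\<in>{0..snd x}. r t \<partial>lborel)" by (rule nn_integral_cmult) measurable
    finally show "(\<integral>\<^sup>+t. indicator {0..T} t * r t * (q x * indicator {y. snd y \<le> snd (fst y)} (x, t)) \<partial>lborel) = q x * (\<integral>\<^sup>+t\<in>{0..snd x}. r t \<partial>lborel)" .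
  qed
  finally show ?thesis .
qed

text \<open>The weight exp (2 \<gamma> t) meets exp (- \<gamma> t) / \<gamma> from
  \<open>tail\<close>. Integrating exp (\<gamma> t) / \<gamma> up to time \<open>s\<close> gives at
  most exp (\<gamma> s) / \<gamma>^2, and together with the weight exp (\<gamma> s) already inside
  \<open>tail\<close> this is the weight of \<open>wnorm (2 * \<gamma>)\<close>. So the same norm
  appears on both sides of the contraction estimate.\<close>

lemma tail_weighted_integral:
  assumes \<gamma>: "\<gamma> > 0" and c: "c \<ge> 0" and g[measurable]: "g \<in> borel_measurable P"
  shows "(\<integral>\<^sup>+t\<in>{0..T}. ennreal (c * exp (2 * \<gamma> * t)) * tail \<gamma> g t \<partial>lborel) \<le> ennreal (c / \<gamma>\<^sup>2) * wnorm (2 * \<gamma>) g"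
proof -
  note [measurable] = snd_measurable_P
  let ?q = "\<lambda>x. ennreal (exp (\<gamma> * snd x) * (g x)\<^sup>2)"
  have "(\<integral>\<^sup>+t\<in>{0..T}. ennreal (c * exp (2 * \<gamma> * t)) * tail \<gamma> g t \<partial>lborel)
     = (\<integral>\<^sup>+t\<in>{0..T}. ennreal (c * exp (\<gamma> * t) / \<gamma>) * (\<integral>\<^sup>+x. ?q x * indicator {t..} (snd x) \<partial>P) \<partial>lborel)"
  proof (intro nn_integral_cong)
    fix t
    have "ennreal (c * exp (2 * \<gamma> * t)) * ennreal (exp (- \<gamma> * t) / \<gamma>) = ennreal (c * exp (\<gamma> * t) / \<gamma>)"
      using \<gamma> c by (simp add: ennreal_mult[symmetric] exp_add[symmetric] mult.assoc)
    then show "ennreal (c * exp (2 * \<gamma> * t)) * tail \<gamma> g t * indicator {0..T} t = ennreal (c * exp (\<gamma> * t) / \<gamma>) * (\<integral>\<^sup>+x. ?q x * indicator {t..} (snd x) \<partial>P) * indicator {0..T} t"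
      unfolding tail_def by (simp add: mult.assoc[symmetric])
  qed
  also have "\<dots> = (\<integral>\<^sup>+x. ?q x * (\<integral>\<^sup>+t\<in>{0..snd x}. ennreal (c * exp (\<gamma> * t) / \<gamma>) \<partial>lborel) \<partial>P)"
    by (rule nn_integral_swap_time) measurable
  also have "\<dots> \<le> (\<integral>\<^sup>+x. ennreal (c / \<gamma>\<^sup>2) * ennreal (exp (2 * \<gamma> * snd x) * (norm (g x))\<^sup>2) \<partial>P)"
  proof (rule nn_integral_mono)
    fix x assume "x \<in> space P"
    then have x: "0 \<le> snd x" by (auto simp: space_P)
    have "(\<integral>\<^sup>+t\<in>{0..snd x}. ennreal (c * exp (\<gamma> * t) / \<gamma>) \<partial>lborel) = ennreal (c / \<gamma>) * (\<integral>\<^sup>+t\<in>{0..snd x}. ennreal (exp (\<gamma> * t)) \<partial>lborel)"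
      using \<gamma> c by (subst nn_integral_cmult[symmetric]) (auto intro!: nn_integral_cong simp: ennreal_mult[symmetric] mult.assoc[symmetric])
    also have "\<dots> = ennreal (c / \<gamma> * ((exp (\<gamma> * snd x) - 1) / \<gamma>))"
    proof -
      have "0 \<le> (exp (\<gamma> * snd x) - 1) / \<gamma>" using \<gamma> x by simp
      then show ?thesis unfolding nn_integral_exp[OF \<gamma> x] using \<gamma> c by (intro ennreal_mult[symmetric]) auto
    qed
    also have "\<dots> \<le> ennreal (c * exp (\<gamma> * snd x) / \<gamma>\<^sup>2)"
      using \<gamma> c by (intro ennreal_leI) (simp add: power2_eq_square divide_right_mono mult_left_mono)
    finally have "?q x * (\<integral>\<^sup>+t\<in>{0..snd x}. ennreal (c * exp (\<gamma> * t) / \<gamma>) \<partial>lborel) \<le> ?q x * ennreal (c * exp (\<gamma> * snd x) / \<gamma>\<^sup>2)"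
      by (rule mult_left_mono) simp
    also have "\<dots> = ennreal (c / \<gamma>\<^sup>2) * ennreal (exp (2 * \<gamma> * snd x) * (norm (g x))\<^sup>2)"
    proof -
      have "exp (2 * \<gamma> * snd x) = exp (\<gamma> * snd x) * exp (\<gamma> * snd x)" by (simp add: exp_add[symmetric])
      then have "exp (\<gamma> * snd x) * (g x)\<^sup>2 * (c * exp (\<gamma> * snd x) / \<gamma>\<^sup>2) = c / \<gamma>\<^sup>2 * (exp (2 * \<gamma> * snd x) * (norm (g x))\<^sup>2)"
        by simp
      then show ?thesis using c by (subst (1 2) ennreal_mult[symmetric]) (simp_all only: zero_le_mult_iff divide_nonneg_nonneg zero_le_power2 exp_ge_zero, auto)
    qed
    finally show "?q x * (\<integral>\<^sup>+t\<in>{0..snd x}. ennreal (c * exp (\<gamma> * t) / \<gamma>) \<partial>lborel) \<le> ennreal (c / \<gamma>\<^sup>2) * ennreal (exp (2 * \<gamma> * snd x) * (norm (g x))\<^sup>2)" .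
  qed
  also have "\<dots> = ennreal (c / \<gamma>\<^sup>2) * wnorm (2 * \<gamma>) g"
    unfolding wnorm_def by (rule nn_integral_cmult) measurable
  finally show ?thesis .
qed

lemma AE_P_fst:
  assumes "AE \<omega> in M. Q \<omega>" shows "AE x in P. Q (fst x)"
proof -
  obtain N where N: "N \<in> null_sets M" "{\<omega>\<in>space M. \<not> Q \<omega>} \<subseteq> N" using assms by (auto simp: eventually_ae_filter)
  have "N \<times> {0..T} \<in> null_sets P"
  proof (rule null_setsI)
    show "N \<times> {0..T} \<in> sets P" using N by (intro pair_measureI) (auto simp: sets_restrict_space)
    have "emeasure P (N \<times> {0..T}) = emeasure M N * emeasure (restrict_space lborel {0..T}) {0..T}"
      using N by (intro P.M2.emeasure_pair_measure_Times) (auto simp: sets_restrict_space)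
    then show "emeasure P (N \<times> {0..T}) = 0" using N by auto
  qed
  then show ?thesis by (rule AE_I') (use N in \<open>auto simp: space_P\<close>)
qed

text \<open>For \<open>z\<close> only integrals over (t, T] are bounded, not values at single times.
  Writing exp (2 \<gamma> s) as 1 plus the integral of 2 \<gamma> exp (2 \<gamma> t) over t \<le> s
  expresses the weighted norm through these integrals. The 1 contributes 1/\<gamma>, the integral
  2/\<gamma>.\<close>

lemma wnorm_le_of_tails:
  fixes z :: "'w \<times> real \<Rightarrow> 'b::{banach, second_countable_topology}"
  assumes \<gamma>: "\<gamma> > 0" and g[measurable]: "g \<in> borel_measurable P" and z[measurable]: "z \<in> borel_measurable P"
    and le: "\<And>t. t \<in> {0..T} \<Longrightarrow> sqnorm P (\<lambda>x. indicat_real {t<..T} (snd x) *\<^sub>R z x) \<le> tail \<gamma> g t"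
  shows "wnorm (2 * \<gamma>) z \<le> ennreal (3 / \<gamma>) * wnorm (2 * \<gamma>) g"
proof -
  note [measurable] = snd_measurable_P
  let ?q = "\<lambda>x. ennreal ((norm (z x))\<^sup>2)"
  \<comment> \<open>The isometry uses (t, T], Tonelli's theorem the closed half-line from
    \<open>t\<close>; the instant \<open>t\<close> itself is null.\<close>
  have null: "(\<integral>\<^sup>+x. ?q x * indicator {t..} (snd x) \<partial>P) = sqnorm P (\<lambda>x. indicat_real {t<..T} (snd x) *\<^sub>R z x)" if "t \<in> {0..T}" for t
  proof -
    have "space M \<times> {t} \<in> null_sets P"
    proof (rule null_setsI)
      show "space M \<times> {t} \<in> sets P" using that by (intro pair_measureI) (auto simp: sets_restrict_space)
      have "emeasure P (space M \<times> {t}) = emeasure M (space M) * emeasure (restrict_space lborel {0..T}) {t}"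
        using that by (intro P.M2.emeasure_pair_measure_Times) (auto simp: sets_restrict_space)
      then show "emeasure P (space M \<times> {t}) = 0" using that by (simp add: emeasure_restrict_space)
    qed
    then have "AE x in P. snd x \<noteq> t" by (rule AE_I') (auto simp: space_P)
    then have "AE x in P. ?q x * indicator {t..} (snd x) = ennreal ((norm (indicat_real {t<..T} (snd x) *\<^sub>R z x))\<^sup>2)"
      using AE_space by eventually_elim (auto simp: space_P indicator_def)
    then show ?thesis unfolding sqnorm_def by (rule nn_integral_cong_AE)
  qed
  let ?S = "\<integral>\<^sup>+x. ?q x * (\<integral>\<^sup>+t\<in>{0..snd x}. ennreal (2 * \<gamma> * exp (2 * \<gamma> * t)) \<partial>lborel) \<partial>P"
  have "wnorm (2 * \<gamma>) z = (\<integral>\<^sup>+x. ?q x + ?q x * (\<integral>\<^sup>+t\<in>{0..snd x}. ennreal (2 * \<gamma> * exp (2 * \<gamma> * t)) \<partial>lborel) \<partial>P)"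
    unfolding wnorm_def
  proof (rule nn_integral_cong)
    fix x assume "x \<in> space P"
    then have x: "0 \<le> snd x" by (auto simp: space_P)
    have "(\<integral>\<^sup>+t\<in>{0..snd x}. ennreal (2 * \<gamma> * exp (2 * \<gamma> * t)) \<partial>lborel) = ennreal (exp (2 * \<gamma> * snd x) - exp (2 * \<gamma> * 0))"
      by (rule nn_integral_FTC_Icc) (use \<gamma> x in \<open>auto intro!: derivative_eq_intros\<close>)
    then have "?q x + ?q x * (\<integral>\<^sup>+t\<in>{0..snd x}. ennreal (2 * \<gamma> * exp (2 * \<gamma> * t)) \<partial>lborel) = ennreal ((norm (z x))\<^sup>2 + (norm (z x))\<^sup>2 * (exp (2 * \<gamma> * snd x) - 1))"
      using \<gamma> x by (simp add: ennreal_plus ennreal_mult)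
    then show "ennreal (exp (2 * \<gamma> * snd x) * (norm (z x))\<^sup>2) = ?q x + ?q x * (\<integral>\<^sup>+t\<in>{0..snd x}. ennreal (2 * \<gamma> * exp (2 * \<gamma> * t)) \<partial>lborel)"
      by (simp add: algebra_simps)
  qed
  also have "\<dots> = (\<integral>\<^sup>+x. ?q x \<partial>P) + (\<integral>\<^sup>+x. ?q x * (\<integral>\<^sup>+t\<in>{0..snd x}. ennreal (2 * \<gamma> * exp (2 * \<gamma> * t)) \<partial>lborel) \<partial>P)"
  proof (rule nn_integral_add)
    have "(\<lambda>x. ?q x * ennreal (exp (2 * \<gamma> * snd x) - 1)) \<in> borel_measurable P" by measurable
    moreover have "?q x * ennreal (exp (2 * \<gamma> * snd x) - 1) = ?q x * (\<integral>\<^sup>+t\<in>{0..snd x}. ennreal (2 * \<gamma> * exp (2 * \<gamma> * t)) \<partial>lborel)" if "x \<in> space P" for x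
    proof -
      have x: "0 \<le> snd x" using that by (auto simp: space_P)
      have "(\<integral>\<^sup>+t\<in>{0..snd x}. ennreal (2 * \<gamma> * exp (2 * \<gamma> * t)) \<partial>lborel) = ennreal (exp (2 * \<gamma> * snd x) - exp (2 * \<gamma> * 0))"
        by (rule nn_integral_FTC_Icc) (use \<gamma> x in \<open>auto intro!: derivative_eq_intros\<close>)
      then show ?thesis by simp
    qed
    ultimately show "(\<lambda>x. ?q x * (\<integral>\<^sup>+t\<in>{0..snd x}. ennreal (2 * \<gamma> * exp (2 * \<gamma> * t)) \<partial>lborel)) \<in> borel_measurable P"
      by (simp cong: measurable_cong)
  qed measurable
  finally have split: "wnorm (2 * \<gamma>) z = (\<integral>\<^sup>+x. ?q x \<partial>P) + ?S" .
  have "?S = (\<integral>\<^sup>+t\<in>{0..T}. ennreal (2 * \<gamma> * exp (2 * \<gamma> * t)) * (\<integral>\<^sup>+x. ?q x * indicator {t..} (snd x) \<partial>P) \<partial>lborel)"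
    by (rule nn_integral_swap_time[symmetric]) measurable
  also have "\<dots> \<le> (\<integral>\<^sup>+t\<in>{0..T}. ennreal (2 * \<gamma> * exp (2 * \<gamma> * t)) * tail \<gamma> g t \<partial>lborel)"
  proof (rule nn_integral_mono)
    fix t
    show "ennreal (2 * \<gamma> * exp (2 * \<gamma> * t)) * (\<integral>\<^sup>+x. ?q x * indicator {t..} (snd x) \<partial>P) * indicator {0..T} t \<le> ennreal (2 * \<gamma> * exp (2 * \<gamma> * t)) * tail \<gamma> g t * indicator {0..T} t"
      using null[of t] le[of t] by (auto simp: indicator_def intro!: mult_left_mono)
  qed
  also have "\<dots> \<le> ennreal (2 * \<gamma> / \<gamma>\<^sup>2) * wnorm (2 * \<gamma>) g"
    by (rule tail_weighted_integral) (use \<gamma> in auto)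
  finally have S: "?S \<le> ennreal (2 * \<gamma> / \<gamma>\<^sup>2) * wnorm (2 * \<gamma>) g" .
  have "(\<integral>\<^sup>+x. ?q x \<partial>P) = (\<integral>\<^sup>+x. ?q x * indicator {0..} (snd x) \<partial>P)"
    by (rule nn_integral_cong) (auto simp: space_P indicator_def)
  also have "\<dots> \<le> ennreal (1 / \<gamma>) * wnorm (2 * \<gamma>) g"
    using null[of 0] le[of 0] tail_0_le[OF \<gamma> g] T_pos by auto
  finally have "(\<integral>\<^sup>+x. ?q x \<partial>P) \<le> ennreal (1 / \<gamma>) * wnorm (2 * \<gamma>) g" .
  then have "wnorm (2 * \<gamma>) z \<le> ennreal (1 / \<gamma>) * wnorm (2 * \<gamma>) g + ennreal (2 * \<gamma> / \<gamma>\<^sup>2) * wnorm (2 * \<gamma>) g"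
    unfolding split by (rule add_mono[OF _ S])
  also have "\<dots> = (ennreal (1 / \<gamma>) + ennreal (2 * \<gamma> / \<gamma>\<^sup>2)) * wnorm (2 * \<gamma>) g" by (simp add: distrib_right)
  also have "ennreal (1 / \<gamma>) + ennreal (2 * \<gamma> / \<gamma>\<^sup>2) = ennreal (3 / \<gamma>)"
    using \<gamma> by (simp add: ennreal_plus[symmetric] power2_eq_square field_simps del: ennreal_plus)
  finally show ?thesis .
qed

end

section \<open>A deterministic Skorokhod problem\<close>

text \<open>
  Here \<open>h t\<close> stands for $x \mapsto \mathbb{E}[\ell(t, x + X_t)]$ and \<open>L t\<close> for
  $L_t(X_t)$; the solution is the running supremum of \<open>L\<close> over future times.
\<close>

locale skorokhod =
  fixes T :: real and h :: "real \<Rightarrow> real \<Rightarrow> real" and L :: "real \<Rightarrow> real"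
  assumes T: "0 < T"
    and h_cont: "\<And>x. continuous_on {0..T} (\<lambda>t. h t x)"
    and h_cont2: "\<And>t x. t \<in> {0..T} \<Longrightarrow> isCont (h t) x"
    and h_mono: "\<And>t. t \<in> {0..T} \<Longrightarrow> strict_mono (h t)"
    and L_nonneg: "\<And>t. t \<in> {0..T} \<Longrightarrow> 0 \<le> L t"
    and L_iff: "\<And>t x. t \<in> {0..T} \<Longrightarrow> 0 \<le> x \<Longrightarrow> 0 \<le> h t x \<longleftrightarrow> L t \<le> x"
begin

lemma h_near:
  assumes t: "t \<in> {0..T}"
  shows "0 < h t x \<Longrightarrow> \<exists>d>0. \<forall>s\<in>{0..T}. \<bar>s - t\<bar> < d \<longrightarrow> 0 < h s x"
    and "h t x < 0 \<Longrightarrow> \<exists>d>0. \<forall>s\<in>{0..T}. \<bar>s - t\<bar> < d \<longrightarrow> h s x < 0"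
proof -
  have c: "\<exists>d>0. \<forall>s\<in>{0..T}. \<bar>s - t\<bar> < d \<longrightarrow> \<bar>h s x - h t x\<bar> < e" if "e > 0" for e
    using h_cont[of x] t that unfolding continuous_on_iff by (simp add: dist_real_def)
  show "\<exists>d>0. \<forall>s\<in>{0..T}. \<bar>s - t\<bar> < d \<longrightarrow> 0 < h s x" if "0 < h t x"
  proof -
    obtain d where "d > 0" and d: "\<forall>s\<in>{0..T}. \<bar>s - t\<bar> < d \<longrightarrow> \<bar>h s x - h t x\<bar> < h t x" using c[OF \<open>0 < h t x\<close>] by blast
    have "0 < h s x" if "s \<in> {0..T}" "\<bar>s - t\<bar> < d" for s using bspec[OF d that(1)] that(2) by linarith
    with \<open>d > 0\<close> show ?thesis by blast
  qed
  show "\<exists>d>0. \<forall>s\<in>{0..T}. \<bar>s - t\<bar> < d \<longrightarrow> h s x < 0" if "h t x < 0"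
  proof -
    have "0 < - h t x" using that by simp
    then obtain d where "d > 0" and d: "\<forall>s\<in>{0..T}. \<bar>s - t\<bar> < d \<longrightarrow> \<bar>h s x - h t x\<bar> < - h t x" using c by blast
    have "h s x < 0" if "s \<in> {0..T}" "\<bar>s - t\<bar> < d" for s using bspec[OF d that(1)] that(2) by linarith
    with \<open>d > 0\<close> show ?thesis by blast
  qed
qed

text \<open>Strict monotonicity makes \<open>h t\<close> positive slightly above \<open>L t\<close>,
  and it is negative slightly below if that point is still nonnegative. These signs persist at
  nearby times and trap \<open>L\<close>. If the lower point is negative, nonnegativity of
  \<open>L\<close> takes over.\<close>

lemma L_continuous: "continuous_on {0..T} L"
  unfolding continuous_on_iff
proof (intro ballI allI impI)
  fix t e :: real assume t: "t \<in> {0..T}" and e: "e > 0"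
  define e' where "e' = e / 2"
  have e': "e' > 0" "e' < e" using e by (auto simp: e'_def)
  have "0 \<le> h t (L t)" using L_iff[OF t L_nonneg[OF t]] by simp
  also have "h t (L t) < h t (L t + e')" using h_mono[OF t] e' by (simp add: strict_mono_def)
  finally obtain d1 where d1: "d1 > 0" "\<And>s. s \<in> {0..T} \<Longrightarrow> \<bar>s - t\<bar> < d1 \<Longrightarrow> 0 < h s (L t + e')"
    using h_near(1)[OF t] by blast
  have up: "L s \<le> L t + e'" if "s \<in> {0..T}" "\<bar>s - t\<bar> < d1" for s
    using L_iff[OF that(1), of "L t + e'"] d1(2)[OF that] L_nonneg[OF t] e' by simp
  obtain d2 where d2: "d2 > 0" "\<And>s. s \<in> {0..T} \<Longrightarrow> \<bar>s - t\<bar> < d2 \<Longrightarrow> L t - e' < L s"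
  proof (cases "0 \<le> L t - e'")
    case True
    have "h t (L t - e') < 0" using L_iff[OF t True] e' by simp
    then obtain d where d: "d > 0" "\<And>s. s \<in> {0..T} \<Longrightarrow> \<bar>s - t\<bar> < d \<Longrightarrow> h s (L t - e') < 0"
      using h_near(2)[OF t] by blast
    show ?thesis
    proof (rule that[OF d(1)])
      fix s assume "s \<in> {0..T}" "\<bar>s - t\<bar> < d"
      then show "L t - e' < L s" using d(2)[of s] L_iff[of s "L t - e'"] True by auto
    qed
  next
    case False
    have "L t - e' < L s" if "s \<in> {0..T}" for s using False L_nonneg[OF that] by linarith
    then show ?thesis using that[of 1] by simp
  qed
  show "\<exists>d>0. \<forall>s\<in>{0..T}. dist s t < d \<longrightarrow> dist (L s) (L t) < e"
  proof (intro exI[of _ "min d1 d2"] conjI ballI impI)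
    fix s assume s: "s \<in> {0..T}" "dist s t < min d1 d2"
    then have "L s \<le> L t + e'" "L t - e' < L s" using up[of s] d2(2)[of s] by (auto simp: dist_real_def)
    then show "dist (L s) (L t) < e" using e' by (simp add: dist_real_def)
  qed (use d1 d2 in auto)
qed

definition future_sup :: "real \<Rightarrow> real" where
  "future_sup t = (SUP s\<in>{t..T}. L s)"

lemma L_bdd: "0 \<le> t \<Longrightarrow> bdd_above (L ` {t..T})"
  using compact_continuous_image[OF continuous_on_subset[OF L_continuous, of "{t..T}"]]
  by (auto intro!: bounded_imp_bdd_above compact_imp_bounded)

lemma future_sup_ge: "0 \<le> t \<Longrightarrow> t \<le> s \<Longrightarrow> s \<le> T \<Longrightarrow> L s \<le> future_sup t"
  unfolding future_sup_def by (intro cSUP_upper L_bdd) auto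

lemma future_sup_le: "t \<le> T \<Longrightarrow> (\<And>s. t \<le> s \<Longrightarrow> s \<le> T \<Longrightarrow> L s \<le> c) \<Longrightarrow> future_sup t \<le> c"
  unfolding future_sup_def by (intro cSUP_least) auto

lemma future_sup_antimono: "0 \<le> s \<Longrightarrow> s \<le> t \<Longrightarrow> t \<le> T \<Longrightarrow> future_sup t \<le> future_sup s"
  by (rule future_sup_le) (auto intro: future_sup_ge)

lemma future_sup_nonneg: "t \<in> {0..T} \<Longrightarrow> 0 \<le> future_sup t"
  using future_sup_ge[of t t] L_nonneg[of t] by auto

lemma future_sup_T: "future_sup T = L T"
  unfolding future_sup_def by simp

lemma future_sup_split:
  assumes "0 \<le> s" "s \<le> t" "t \<le> T" "\<And>r. s \<le> r \<Longrightarrow> r \<le> t \<Longrightarrow> L r \<le> c" "future_sup t \<le> c"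
  shows "future_sup s \<le> c"
proof (rule future_sup_le)
  show "s \<le> T" using assms by simp
  fix r assume r: "s \<le> r" "r \<le> T"
  show "L r \<le> c"
  proof (cases "r \<le> t")
    case False
    then have "L r \<le> future_sup t" using r assms by (intro future_sup_ge) auto
    with assms show ?thesis by simp
  qed (use r assms in auto)
qed

lemma future_sup_continuous: "continuous_on {0..T} future_sup"
proof -
  have u: "uniformly_continuous_on {0..T} L"
    by (rule compact_uniformly_continuous[OF L_continuous]) simp
  show ?thesis unfolding continuous_on_iff
  proof (intro ballI allI impI)
    fix t e :: real assume t: "t \<in> {0..T}" and e: "e > 0"
    obtain d where d: "d > 0" "\<And>s s'. s \<in> {0..T} \<Longrightarrow> s' \<in> {0..T} \<Longrightarrow> dist s' s < d \<Longrightarrow> dist (L s') (L s) < e/2"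
      using u e unfolding uniformly_continuous_on_def by (meson half_gt_zero)
    have *: "\<bar>future_sup s - future_sup r\<bar> \<le> e/2" if sr: "s \<in> {0..T}" "r \<in> {0..T}" "s \<le> r" "r - s < d" for s r
    proof -
      have "future_sup r \<le> future_sup s" using sr by (intro future_sup_antimono) auto
      moreover have "future_sup s \<le> future_sup r + e/2"
      proof (rule future_sup_split)
        fix q assume q: "s \<le> q" "q \<le> r"
        then have "dist (L q) (L r) < e/2" using sr by (intro d(2)) (auto simp: dist_real_def)
        then have "\<bar>L q - L r\<bar> < e/2" by (simp only: dist_real_def)
        then have "L q \<le> L r + e/2" by linarith
        also have "L r \<le> future_sup r" using sr by (intro future_sup_ge) auto
        finally show "L q \<le> future_sup r + e/2" by simp
      qed (use sr e in auto)
      ultimately show ?thesis using e by simp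
    qed
    show "\<exists>d>0. \<forall>s\<in>{0..T}. dist s t < d \<longrightarrow> dist (future_sup s) (future_sup t) < e"
    proof (intro exI[of _ d] conjI ballI impI d(1))
      fix s assume s: "s \<in> {0..T}" "dist s t < d"
      then have "\<bar>future_sup s - future_sup t\<bar> \<le> e/2"
        using *[of s t] *[of t s] t by (cases "s \<le> t") (auto simp: dist_real_def abs_minus_commute)
      then show "dist (future_sup s) (future_sup t) < e" using e by (simp add: dist_real_def)
    qed
  qed
qed

lemma future_sup_h_nonneg: "t \<in> {0..T} \<Longrightarrow> 0 \<le> h t (future_sup t)"
  using L_iff[of t "future_sup t"] future_sup_nonneg[of t] future_sup_ge[of t t] by auto

text \<open>Where the constraint is slack it stays slack near \<open>t\<close> for some level
  \<open>c\<close> a little below the supremum. So \<open>L\<close> does not exceed \<open>c\<close>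
  nearby, and times near \<open>t\<close> do not influence the supremum.\<close>

lemma future_sup_locally_const:
  assumes t: "t \<in> {0..T}" and pos: "0 < h t (future_sup t)"
  shows "\<exists>d>0. \<forall>s\<in>{0..T}. \<bar>s - t\<bar> < d \<longrightarrow> future_sup s = future_sup t"
proof -
  \<comment> \<open>If the supremum is 0 there is no admissible level below it. Then c = 0 serves,
    since \<open>future_sup\<close> is nonnegative anyway.\<close>
  obtain c where c: "0 \<le> c" "c \<le> future_sup t" "0 < h t c" "c < future_sup t \<or> c = 0"
  proof (cases "future_sup t = 0")
    case True
    then show ?thesis using that[of 0] pos by simp
  next
    case False
    then have p: "0 < future_sup t" using future_sup_nonneg[OF t] by simp
    obtain d where d: "d > 0" "\<And>x. \<bar>x - future_sup t\<bar> < d \<Longrightarrow> 0 < h t x"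
    proof -
      have "\<forall>\<^sub>F x in at (future_sup t). 0 < h t x"
        using order_tendstoD(1)[OF isContD[OF h_cont2[OF t]] pos] .
      then obtain d where "d > 0" "\<And>x. x \<noteq> future_sup t \<Longrightarrow> dist x (future_sup t) < d \<Longrightarrow> 0 < h t x"
        unfolding eventually_at by blast
      then show ?thesis using that[of d] pos by (metis dist_real_def)
    qed
    define c where "c = max (future_sup t / 2) (future_sup t - d / 2)"
    show ?thesis
      by (rule that[of c]) (use p d(1) d(2)[of c] in \<open>auto simp: c_def max_def abs_if\<close>)
  qed
  obtain d where d: "d > 0" "\<And>s. s \<in> {0..T} \<Longrightarrow> \<bar>s - t\<bar> < d \<Longrightarrow> 0 < h s c"
    using h_near(1)[OF t c(3)] by blast
  have Lc: "L s \<le> c" if "s \<in> {0..T}" "\<bar>s - t\<bar> < d" for s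
    using L_iff[OF that(1) c(1)] d(2)[OF that] by simp
  show ?thesis
  proof (intro exI[of _ d] conjI ballI impI d(1))
    fix s assume s: "s \<in> {0..T}" "\<bar>s - t\<bar> < d"
    show "future_sup s = future_sup t"
    proof (cases "s \<le> t")
      case True
      have "future_sup s \<le> future_sup t"
        by (rule future_sup_split[of s t]) (use s t True Lc c in \<open>auto intro!: order_trans[OF Lc c(2)]\<close>)
      then show ?thesis using future_sup_antimono[of s t] True s t by auto
    next
      case False
      have le: "future_sup s \<le> future_sup t" using future_sup_antimono[of t s] False s t by auto
      have "future_sup t \<le> max c (future_sup s)"
        by (rule future_sup_split[of t s]) (use s t False in \<open>auto intro!: max.coboundedI1 Lc\<close>)
      then have "future_sup t \<le> future_sup s" using c(4) future_sup_nonneg[OF s(1)] by auto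
      then show ?thesis using le by simp
    qed
  qed
qed

definition clamp :: "real \<Rightarrow> real" where "clamp t = max 0 (min T t)"

lemma clamp_in: "clamp t \<in> {0..T}" and clamp_id: "t \<in> {0..T} \<Longrightarrow> clamp t = t"
  using T by (auto simp: clamp_def)

lemma clamp_mono: "s \<le> t \<Longrightarrow> clamp s \<le> clamp t"
  by (auto simp: clamp_def)

lemma clamp_dist: "\<bar>clamp s - clamp t\<bar> \<le> \<bar>s - t\<bar>"
  by (auto simp: clamp_def max_def min_def)

lemma emeasure_clamp:
  assumes K: "mono_on {0..T} K" "continuous_on {0..T} K" and ab: "a \<le> b"
  shows "emeasure (interval_measure (\<lambda>t. K (max 0 (min T t)))) {a<..b} = ennreal (K (clamp b) - K (clamp a))"
  unfolding clamp_def[symmetric]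
proof (rule emeasure_interval_measure_Ioc[OF ab])
  show "K (clamp x) \<le> K (clamp y)" if "x \<le> y" for x y
    using mono_onD[OF K(1) clamp_in clamp_in clamp_mono[OF that]] .
  have "continuous_on UNIV (\<lambda>t. K (clamp t))"
    by (rule continuous_on_compose2[OF K(2)]) (use T in \<open>auto simp: clamp_def intro!: continuous_intros\<close>)
  then show "continuous (at_right x) (\<lambda>t. K (clamp t))" for x
    by (auto simp: continuous_on_eq_continuous_at intro: continuous_within_subset)
qed

text \<open>Each time with a slack constraint lies in a half-open interval with rational ends on
  which \<open>K\<close> is constant. There are countably many such intervals and each has measure
  0.\<close>

lemma future_sup_flat:
  defines "K \<equiv> \<lambda>t. future_sup 0 - future_sup t"
  shows "(LINT t:{0..T}|interval_measure (\<lambda>t. K (max 0 (min T t))). h t (future_sup t)) = 0"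
proof -
  let ?m = "interval_measure (\<lambda>t. K (max 0 (min T t)))"
  have K: "mono_on {0..T} K" "continuous_on {0..T} K"
    unfolding K_def by (auto intro!: mono_onI future_sup_antimono continuous_intros future_sup_continuous)
  define Q where "Q = {(q, r). q \<in> \<rat> \<and> r \<in> \<rat> \<and> q \<le> r \<and> K (clamp q) = K (clamp r)}"
  have "countable Q"
    by (rule countable_subset[of _ "\<rat> \<times> \<rat>"]) (auto simp: Q_def countable_rat)
  then have null: "(\<Union>(q, r)\<in>Q. {q<..r}) \<in> null_sets ?m"
  proof (rule null_sets_UN')
    fix x assume "x \<in> Q"
    then obtain q r where x: "x = (q, r)" "q \<le> r" "K (clamp q) = K (clamp r)" unfolding Q_def by auto
    show "(case x of (q, r) \<Rightarrow> {q<..r}) \<in> null_sets ?m"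
      using emeasure_clamp[OF K x(2)] x by (auto intro!: null_setsI)
  qed
  have sub: "{t \<in> space ?m. \<not> indicat_real {0..T} t *\<^sub>R h t (future_sup t) = 0} \<subseteq> (\<Union>(q, r)\<in>Q. {q<..r})"
  proof
    fix t assume "t \<in> {t \<in> space ?m. \<not> indicat_real {0..T} t *\<^sub>R h t (future_sup t) = 0}"
    then have t: "t \<in> {0..T}" "h t (future_sup t) \<noteq> 0" by (auto simp: indicator_def split: if_splits)
    then have "0 < h t (future_sup t)" using future_sup_h_nonneg[OF t(1)] by simp
    from future_sup_locally_const[OF t(1) this] obtain d where d: "d > 0" "\<And>s. s \<in> {0..T} \<Longrightarrow> \<bar>s - t\<bar> < d \<Longrightarrow> future_sup s = future_sup t"
      by blast
    obtain q where q: "q \<in> \<rat>" "t - d < q" "q < t" using Rats_dense_in_real[of "t - d" t] d by auto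
    obtain r where r: "r \<in> \<rat>" "t < r" "r < t + d" using Rats_dense_in_real[of t "t + d"] d by auto
    have "future_sup (clamp x) = future_sup t" if "\<bar>x - t\<bar> < d" for x
      using d(2)[OF clamp_in, of x] clamp_dist[of x t] clamp_id[OF t(1)] that by simp
    then have "K (clamp q) = K (clamp r)" using q r by (simp add: K_def)
    then have "(q, r) \<in> Q" using q r by (simp add: Q_def)
    then show "t \<in> (\<Union>(q, r)\<in>Q. {q<..r})" using q r by (intro UN_I[of "(q, r)"]) auto
  qed
  show ?thesis unfolding set_lebesgue_integral_def
    by (rule integral_eq_zero_AE) (rule AE_I'[OF null sub])
qed

text \<open>The constraint gives L \<le> k, and \<open>k\<close> is nonincreasing, so k \<ge>
  \<open>future_sup\<close>. If this were strict at \<open>t\<close>, then \<open>k\<close>, which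
  ends at 0, would pass through a level \<open>v\<close> in between at some time \<open>u\<close>.
  Up to \<open>u\<close> it stays above \<open>L\<close>, the constraint is slack, and flatness
  forbids \<open>K\<close> to grow on (t, u]; yet \<open>k\<close> has dropped from
  \<open>k t\<close> to \<open>v\<close>.\<close>

lemma flat_unique:
  assumes K: "mono_on {0..T} K" "continuous_on {0..T} K"
    and k: "\<And>t. t \<in> {0..T} \<Longrightarrow> k t = K T - K t"
    and nonneg: "\<And>t. t \<in> {0..T} \<Longrightarrow> 0 \<le> h t (k t)"
    and cont: "continuous_on {0..T} (\<lambda>t. h t (k t))"
    and flat: "(LINT t:{0..T}|interval_measure (\<lambda>t. K (max 0 (min T t))). h t (k t)) = 0"
    and t: "t \<in> {0..T}"
  shows "k t = future_sup t"
proof (rule ccontr)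
  let ?m = "interval_measure (\<lambda>t. K (max 0 (min T t)))"
  have k_anti: "k s \<le> k r" if "r \<le> s" "r \<in> {0..T}" "s \<in> {0..T}" for r s
    using mono_onD[OF K(1) that(2,3,1)] k that by simp
  have k0: "0 \<le> k s" if "s \<in> {0..T}" for s using mono_onD[OF K(1) that, of T] k[OF that] that by simp
  have kL: "L s \<le> k s" if "s \<in> {0..T}" for s using L_iff[OF that k0[OF that]] nonneg[OF that] by simp
  have "future_sup t \<le> k t"
    by (rule future_sup_le) (use t kL k_anti in \<open>auto intro: order_trans\<close>)
  moreover assume "k t \<noteq> future_sup t"
  ultimately have gt: "future_sup t < k t" by simp
  define v where "v = (k t + future_sup t) / 2"
  have v: "future_sup t < v" "v < k t" using gt by (auto simp: v_def)
  have kT: "k T = 0" using k[of T] T by simp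
  have kc: "continuous_on {t..T} k"
  proof (rule continuous_on_eq)
    show "continuous_on {t..T} (\<lambda>s. K T - K s)" using t by (intro continuous_intros continuous_on_subset[OF K(2)]) auto
  qed (use k t in auto)
  have "\<exists>u\<ge>t. u \<le> T \<and> k u = v"
    by (rule IVT2') (use v kT future_sup_nonneg[OF t] t kc in auto)
  then obtain u where u: "t \<le> u" "u \<le> T" "k u = v" by auto
  have pos: "0 < h s (k s)" if s: "t \<le> s" "s \<le> u" for s
  proof -
    have sT: "s \<in> {0..T}" using s u t by auto
    have "L s \<le> future_sup t" using s u t by (intro future_sup_ge) auto
    also have "\<dots> < k s" using v k_anti[OF s(2) sT] u t by auto
    finally have "h s (L s) < h s (k s)" using h_mono[OF sT] by (simp add: strict_mono_def)
    moreover have "0 \<le> h s (L s)" using L_iff[OF sT L_nonneg[OF sT]] by simp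
    ultimately show ?thesis by simp
  qed
  \<comment> \<open>The measure is computed on half-open intervals. Starting at -1, where the
    extension of \<open>K\<close> is constant, makes the interval contain 0.\<close>
  have fin: "emeasure ?m {-1<..T} = ennreal (K T - K 0)"
    using emeasure_clamp[OF K, of "-1" T] T by (simp add: clamp_def)
  obtain C where C: "\<And>s. s \<in> {0..T} \<Longrightarrow> \<bar>h s (k s)\<bar> \<le> C"
    using compact_imp_bounded[OF compact_continuous_image[OF cont]] unfolding bounded_iff by force
  have "integrable ?m (\<lambda>s. indicat_real {0..T} s *\<^sub>R (indicat_real {0..T} s *\<^sub>R h s (k s)))"
  proof (rule integrableI_bounded_set_indicator[where B = C])
    show "{0..T} \<in> sets ?m" by simp
    have "(\<lambda>s. indicat_real {0..T} s *\<^sub>R h s (k s)) \<in> borel_measurable borel"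
      by (rule borel_measurable_continuous_on_indicator[OF _ cont]) simp
    then show "(\<lambda>s. indicat_real {0..T} s *\<^sub>R h s (k s)) \<in> borel_measurable ?m" by simp
    have "emeasure ?m {0..T} \<le> emeasure ?m {-1<..T}" by (rule emeasure_mono) auto
    then show "emeasure ?m {0..T} < \<infinity>" using fin by (auto simp: less_top[symmetric] top_unique)
  qed (use C in \<open>auto intro!: AE_I2\<close>)
  then have int: "integrable ?m (\<lambda>s. indicat_real {0..T} s *\<^sub>R h s (k s))"
    by (rule Bochner_Integration.integrable_cong[THEN iffD1, rotated 2]) (auto simp: indicator_def)
  have "AE s in ?m. indicat_real {0..T} s *\<^sub>R h s (k s) = 0"
    using flat integral_nonneg_eq_0_iff_AE[OF int] nonneg unfolding set_lebesgue_integral_def by (auto simp: indicator_def)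
  then have "AE s in ?m. s \<notin> {t<..u}"
  proof eventually_elim
    case (elim s)
    then show ?case using pos[of s] t u by (auto simp: indicator_def split: if_splits)
  qed
  then have "emeasure ?m {t<..u} = 0" by (subst (asm) AE_iff_measurable[of "{t<..u}"]) auto
  then have "K u \<le> K t" using emeasure_clamp[OF K u(1)] clamp_id[OF t] clamp_id[of u] u t by (simp add: ennreal_eq_0_iff)
  then show False using k[OF t] k[of u] u t v by auto
qed

end

lemma future_sup_dist:
  assumes "skorokhod T h L" "skorokhod T h' L'" and t: "t \<in> {0..T}"
    and le: "\<And>s. t \<le> s \<Longrightarrow> s \<le> T \<Longrightarrow> \<bar>L s - L' s\<bar> \<le> c"
  shows "\<bar>skorokhod.future_sup T L t - skorokhod.future_sup T L' t\<bar> \<le> c"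
proof -
  interpret A: skorokhod T h L by fact
  interpret B: skorokhod T h' L' by fact
  have "A.future_sup t \<le> B.future_sup t + c"
  proof (rule A.future_sup_le)
    fix s assume s: "t \<le> s" "s \<le> T"
    then have "L s \<le> L' s + c" using le[OF s] by simp
    also have "L' s \<le> B.future_sup t" using s t by (intro B.future_sup_ge) auto
    finally show "L s \<le> B.future_sup t + c" by simp
  qed (use t in auto)
  moreover have "B.future_sup t \<le> A.future_sup t + c"
  proof (rule B.future_sup_le)
    fix s assume s: "t \<le> s" "s \<le> T"
    then have "L' s \<le> L s + c" using le[OF s] by simp
    also have "L s \<le> A.future_sup t" using s t by (intro A.future_sup_ge) auto
    finally show "L' s \<le> A.future_sup t + c" by simp
  qed (use t in auto)
  ultimately show ?thesis by simp
qed

context brownian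
begin

lemma S2_square_finite:
  "Y \<in> S2_space M F T \<Longrightarrow> (\<integral>\<^sup>+\<omega>. (SUP t\<in>{0..T}. ennreal (\<bar>Y t \<omega>\<bar>\<^sup>2)) \<partial>M) < \<infinity>"
  unfolding S2_space_def by auto

lemma S2_continuous: "Y \<in> S2_space M F T \<Longrightarrow> \<omega> \<in> space M \<Longrightarrow> continuous_on {0..T} (\<lambda>t. Y t \<omega>)"
  unfolding S2_space_def by auto

lemma S2_F_measurable: "Y \<in> S2_space M F T \<Longrightarrow> t \<in> {0..T} \<Longrightarrow> Y t \<in> borel_measurable (F t)"
  unfolding S2_space_def by auto

lemma S2_sqnorm_le:
  assumes "t \<in> {0..T}"
  shows "sqnorm M (Y t) \<le> (\<integral>\<^sup>+\<omega>. (SUP t\<in>{0..T}. ennreal (\<bar>Y t \<omega>\<bar>\<^sup>2)) \<partial>M)"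
  unfolding sqnorm_def by (intro nn_integral_mono SUP_upper2[OF assms]) simp

text \<open>The supremum over all grid points is a measurable version of the supremum over \<open>[0, T]\<close>.\<close>

lemma S2_dominated:
  assumes Y: "Y \<in> S2_space M F T"
  obtains W where "integrable M W" "integrable M (\<lambda>\<omega>. (W \<omega>)\<^sup>2)" "AE \<omega> in M. \<forall>t\<in>{0..T}. \<bar>Y t \<omega>\<bar> \<le> W \<omega>"
proof -
  define I where "I = {(n, k). k \<le> Suc n}"
  define D where "D \<omega> = (SUP (n, k)\<in>I. ennreal (\<bar>Y (grid (Suc n) k) \<omega>\<bar>\<^sup>2))" for \<omega>
  have g: "grid (Suc n) k \<in> {0..T}" if "k \<le> Suc n" for n k using grid_bounds[OF that] by auto
  have Ym: "Y t \<in> borel_measurable M" if "t \<in> {0..T}" for t using L2_measurable[OF _ S2_L2[OF Y that]] that by auto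
  have [measurable]: "D \<in> borel_measurable M"
    unfolding D_def using Ym[OF g] by (intro borel_measurable_SUP) (auto simp: I_def)
  have "D \<omega> \<le> (SUP t\<in>{0..T}. ennreal (\<bar>Y t \<omega>\<bar>\<^sup>2))" for \<omega>
    unfolding D_def by (rule SUP_least) (use g in \<open>auto simp: I_def intro!: SUP_upper2\<close>)
  then have "(\<integral>\<^sup>+\<omega>. D \<omega> \<partial>M) \<le> (\<integral>\<^sup>+\<omega>. (SUP t\<in>{0..T}. ennreal (\<bar>Y t \<omega>\<bar>\<^sup>2)) \<partial>M)"
    by (intro nn_integral_mono)
  also have "\<dots> < \<infinity>" by (rule S2_square_finite[OF Y])
  finally have fin: "(\<integral>\<^sup>+\<omega>. D \<omega> \<partial>M) < \<infinity>" .
  then have AEfin: "AE \<omega> in M. D \<omega> \<noteq> \<infinity>" by (intro nn_integral_PInf_AE) auto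
  have Dup: "ennreal (\<bar>Y t \<omega>\<bar>\<^sup>2) \<le> D \<omega>" if t: "t \<in> {0..T}" and \<omega>: "\<omega> \<in> space M" for t \<omega>
  proof -
    define k where "k n = nat \<lfloor>t * real (Suc n) / T\<rfloor>" for n
    have t': "0 \<le> t" "t \<le> T" using t by auto
    note ga = grid_approx[OF t' k_def, folded grid_def]
    have "(\<lambda>n. Y (grid (Suc n) (k n)) \<omega>) \<longlonglongrightarrow> Y t \<omega>"
      by (rule continuous_on_tendsto_compose[OF S2_continuous[OF Y \<omega>] ga(2) t]) (use g[OF ga(1)] in auto)
    then have "(\<lambda>n. ennreal (\<bar>Y (grid (Suc n) (k n)) \<omega>\<bar>\<^sup>2)) \<longlonglongrightarrow> ennreal (\<bar>Y t \<omega>\<bar>\<^sup>2)"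
      by (intro tendsto_ennrealI tendsto_power tendsto_rabs)
    then show ?thesis
    proof (rule LIMSEQ_le_const2, intro exI allI impI)
      show "ennreal (\<bar>Y (grid (Suc n) (k n)) \<omega>\<bar>\<^sup>2) \<le> D \<omega>" for n
        unfolding D_def by (rule SUP_upper2[of "(n, k n)"]) (use ga(1) in \<open>auto simp: I_def\<close>)
    qed
  qed
  define W where "W \<omega> = sqrt (enn2real (D \<omega>))" for \<omega>
  have [measurable]: "W \<in> borel_measurable M" unfolding W_def[abs_def] by measurable
  have W2: "(W \<omega>)\<^sup>2 = enn2real (D \<omega>)" for \<omega> by (simp add: W_def)
  have i2: "integrable M (\<lambda>\<omega>. (W \<omega>)\<^sup>2)"
  proof (rule integrableI_bounded)
    have "(\<integral>\<^sup>+\<omega>. ennreal (norm ((W \<omega>)\<^sup>2)) \<partial>M) = (\<integral>\<^sup>+\<omega>. D \<omega> \<partial>M)"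
      unfolding W2 by (rule nn_integral_cong_AE) (use AEfin in \<open>eventually_elim, simp add: less_top\<close>)
    then show "(\<integral>\<^sup>+\<omega>. ennreal (norm ((W \<omega>)\<^sup>2)) \<partial>M) < \<infinity>" using fin by simp
  qed measurable
  show ?thesis
  proof (rule that[OF _ i2])
    show "integrable M W" by (rule square_integrable_imp_integrable[OF _ i2]) measurable
    show "AE \<omega> in M. \<forall>t\<in>{0..T}. \<bar>Y t \<omega>\<bar> \<le> W \<omega>"
      using AEfin AE_space
    proof eventually_elim
      case (elim \<omega>)
      have "\<bar>Y t \<omega>\<bar> \<le> W \<omega>" if "t \<in> {0..T}" for t
      proof -
        have "ennreal (\<bar>Y t \<omega>\<bar>\<^sup>2) \<le> ennreal (enn2real (D \<omega>))" using Dup[OF that elim(2)] elim(1) by (simp add: less_top)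
        then have "\<bar>Y t \<omega>\<bar>\<^sup>2 \<le> enn2real (D \<omega>)" by (subst (asm) ennreal_le_iff) auto
        then show ?thesis unfolding W_def by (rule real_le_rsqrt)
      qed
      then show ?case by blast
    qed
  qed
qed

lemma S2_add_deterministic:
  assumes Y: "Y \<in> S2_space M F T" and k: "continuous_on {0..T} k"
  shows "(\<lambda>t \<omega>. Y t \<omega> + k t) \<in> S2_space M F T"
  unfolding S2_space_def
proof (intro CollectI conjI ballI)
  show "(\<lambda>\<omega>. Y t \<omega> + k t) \<in> borel_measurable (F t)" if "t \<in> {0..T}" for t using S2_F_measurable[OF Y that] by auto
  show "continuous_on {0..T} (\<lambda>t. Y t \<omega> + k t)" if "\<omega> \<in> space M" for \<omega>
    by (intro continuous_on_add S2_continuous[OF Y that] k)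
  obtain W where "integrable M W" and W: "integrable M (\<lambda>\<omega>. (W \<omega>)\<^sup>2)" "AE \<omega> in M. \<forall>t\<in>{0..T}. \<bar>Y t \<omega>\<bar> \<le> W \<omega>" using S2_dominated[OF Y] .
  obtain C where C: "\<And>t. t \<in> {0..T} \<Longrightarrow> \<bar>k t\<bar> \<le> C"
  proof -
    have "bounded (k ` {0..T})" by (intro compact_imp_bounded compact_continuous_image k) simp
    then obtain C where "\<forall>x\<in>k ` {0..T}. norm x \<le> C" unfolding bounded_iff by blast
    then show ?thesis using that[of C] by simp
  qed
  have "(\<integral>\<^sup>+\<omega>. (SUP t\<in>{0..T}. ennreal (\<bar>Y t \<omega> + k t\<bar>\<^sup>2)) \<partial>M) \<le> (\<integral>\<^sup>+\<omega>. ennreal (2 * (W \<omega>)\<^sup>2 + 2 * C\<^sup>2) \<partial>M)"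
  proof (rule nn_integral_mono_AE, use W(2) in eventually_elim, rule SUP_least)
    fix \<omega> t assume a: "\<forall>t\<in>{0..T}. \<bar>Y t \<omega>\<bar> \<le> W \<omega>" and t: "t \<in> {0..T}"
    have "\<bar>Y t \<omega> + k t\<bar>\<^sup>2 \<le> 2 * \<bar>Y t \<omega>\<bar>\<^sup>2 + 2 * \<bar>k t\<bar>\<^sup>2" using power2_norm_add_le[of "Y t \<omega>" "k t"] by simp
    also have "\<dots> \<le> 2 * (W \<omega>)\<^sup>2 + 2 * C\<^sup>2" using a t C[OF t] by (intro add_mono mult_left_mono power_mono) auto
    finally show "ennreal (\<bar>Y t \<omega> + k t\<bar>\<^sup>2) \<le> ennreal (2 * (W \<omega>)\<^sup>2 + 2 * C\<^sup>2)" by (rule ennreal_leI)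
  qed
  also have "\<dots> < \<infinity>"
    using W(1) by (subst nn_integral_eq_integral) auto
  finally show "(\<integral>\<^sup>+\<omega>. (SUP t\<in>{0..T}. ennreal (\<bar>Y t \<omega> + k t\<bar>\<^sup>2)) \<partial>M) < \<infinity>" .
qed

text \<open>Continuous adapted processes are progressive. Rounding the time argument down to a
  multiple of 1 / (n + 1) and capping it at \<open>t\<close> uses only values of \<open>Y\<close> at
  times up to \<open>t\<close>; the approximants converge by path continuity.\<close>

lemma S2_Prog:
  assumes Y: "Y \<in> S2_space M F T"
  shows "(\<lambda>(\<omega>, s). Y s \<omega>) \<in> borel_measurable Prog"
proof (rule Prog_measurableI)
  fix t assume t: "t \<in> {0..T}"
  have snd_m: "snd \<in> borel_measurable (time_alg t)"
  proof -
    have "(\<lambda>r. r) \<in> borel_measurable (restrict_space borel {0..t})" by (rule measurable_restrict_space1) simp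
    from measurable_compose[OF measurable_snd[of "F t" "restrict_space borel {0..t}"] this] show ?thesis by simp
  qed
  define r where "r n x = min t (real (nat \<lfloor>snd x * real (Suc n)\<rfloor>) / real (Suc n))" for n and x :: "'w \<times> real"
  show "(\<lambda>(\<omega>, s). Y s \<omega>) \<in> borel_measurable (time_alg t)"
  proof (rule borel_measurable_LIMSEQ_real)
    fix n
    have Yk: "(\<lambda>x. Y (min t (real k / real (Suc n))) (fst x)) \<in> borel_measurable (time_alg t)" for k
    proof -
      have "Y (min t (real k / real (Suc n))) \<in> borel_measurable (F t)"
        using t by (intro F_measurable_mono[OF _ S2_F_measurable[OF Y]]) auto
      then show ?thesis using measurable_compose[OF measurable_fst] by blast
    qed
    have "(\<lambda>x. nat \<lfloor>snd x * real (Suc n)\<rfloor>) \<in> measurable (time_alg t) (count_space UNIV)"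
      using snd_m by measurable
    then show "(\<lambda>x. Y (r n x) (fst x)) \<in> borel_measurable (time_alg t)"
      unfolding r_def by (rule measurable_compose_countable[OF Yk])
  next
    fix x assume "x \<in> space (time_alg t)"
    then obtain \<omega> s where x: "x = (\<omega>, s)" "\<omega> \<in> space M" "0 \<le> s" "s \<le> t" by (auto simp: space_time_alg)
    have rs: "(\<lambda>n. r n x) \<longlonglongrightarrow> s"
    proof (rule tendsto_sandwich[of "\<lambda>n. s - 1 / real (Suc n)" _ _ "\<lambda>n. s"])
      have b: "s - 1 / m \<le> real (nat \<lfloor>s * m\<rfloor>) / m \<and> real (nat \<lfloor>s * m\<rfloor>) / m \<le> s" if m: "m > 0" for m :: real
      proof -
        have "0 \<le> s * m" using x m by simp
        then have "s * m - 1 \<le> real (nat \<lfloor>s * m\<rfloor>)" "real (nat \<lfloor>s * m\<rfloor>) \<le> s * m" by linarith+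
        then show ?thesis using m by (simp add: pos_divide_le_eq pos_le_divide_eq left_diff_distrib del: of_nat_nat)
      qed
      have "s - 1 / real (Suc n) \<le> r n x \<and> r n x \<le> s" for n
        using b[of "real (Suc n)"] x unfolding r_def by (auto simp: min_def simp del: of_nat_Suc)
      then show "\<forall>\<^sub>F n in sequentially. s - 1 / real (Suc n) \<le> r n x" "\<forall>\<^sub>F n in sequentially. r n x \<le> s" by auto
      have "(\<lambda>n. s - 1 / real (Suc n)) \<longlonglongrightarrow> s - 0" by (intro tendsto_diff tendsto_const LIMSEQ_Suc[OF lim_const_over_n])
      then show "(\<lambda>n. s - 1 / real (Suc n)) \<longlonglongrightarrow> s" by simp
    qed simp
    have "(\<lambda>n. Y (r n x) \<omega>) \<longlonglongrightarrow> Y s \<omega>"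
    proof (rule continuous_on_tendsto_compose[OF S2_continuous[OF Y x(2)] rs])
      have "r n x \<in> {0..T}" for n using t by (auto simp: r_def min.coboundedI1)
      then show "\<forall>\<^sub>F n in sequentially. r n x \<in> {0..T}" by (rule always_eventually[OF allI])
    qed (use x t in auto)
    then show "(\<lambda>n. Y (r n x) (fst x)) \<longlonglongrightarrow> (case x of (\<omega>, s) \<Rightarrow> Y s \<omega>)" using x by simp
  qed
qed

lemma S2_sqnorm_P:
  assumes Y: "Y \<in> S2_space M F T"
  shows "sqnorm P (\<lambda>(\<omega>, s). Y s \<omega>) < \<infinity>"
proof -
  let ?C = "(\<integral>\<^sup>+\<omega>. (SUP t\<in>{0..T}. ennreal (\<bar>Y t \<omega>\<bar>\<^sup>2)) \<partial>M)"
  note [measurable] = Prog_measurable_P[OF S2_Prog[OF Y]]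
  have "sqnorm P (\<lambda>(\<omega>, s). Y s \<omega>) = (\<integral>\<^sup>+s. (\<integral>\<^sup>+\<omega>. ennreal ((norm (Y s \<omega>))\<^sup>2) \<partial>M) \<partial>restrict_space lborel {0..T})"
    unfolding sqnorm_def by (subst P.nn_integral_snd[symmetric]) auto
  also have "\<dots> \<le> (\<integral>\<^sup>+s. ?C \<partial>restrict_space lborel {0..T})"
    by (rule nn_integral_mono) (use S2_sqnorm_le in \<open>auto simp: space_restrict_space sqnorm_def\<close>)
  also have "\<dots> < \<infinity>" using S2_square_finite[OF Y] T_pos
    by (simp add: emeasure_restrict_space space_restrict_space ennreal_mult_less_top)
  finally show ?thesis .
qed

section \<open>Existence and stability for linear backward equations\<close>

definition linear_bsde :: "('w \<Rightarrow> real) \<Rightarrow> ('w \<times> real \<Rightarrow> real) \<Rightarrow> (real \<Rightarrow> 'w \<Rightarrow> real) \<Rightarrow> (real \<Rightarrow> 'w \<Rightarrow> real ^ 'd) \<Rightarrow> (real \<Rightarrow> 'w \<Rightarrow> real) \<Rightarrow> bool" where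
  "linear_bsde \<xi> g X Z I \<longleftrightarrow> X \<in> S2_space M F T \<and> has_ito_integral M F T B Z I \<and>
     (AE \<omega> in M. \<forall>t\<in>{0..T}. X t \<omega> = \<xi> \<omega> + Jint g t T \<omega> - (I T \<omega> - I t \<omega>))"

lemma Jint_T_L2:
  assumes g: "driver g" shows "Jint g 0 T \<in> L2_space M (F T)"
proof -
  have m: "Jint g 0 T \<in> borel_measurable (F T)" using Jint_F_measurable[OF g] T_pos by auto
  have "sqnorm M (Jint g 0 T) \<le> tail 1 g 0" using Jint_sqnorm_le[OF g, of 0 1] T_pos by simp
  also have "\<dots> \<le> ennreal (1 / 1) * wnorm (2 * 1) g" by (rule tail_0_le) (use driver_P[OF g] in auto)
  also have "\<dots> \<le> ennreal (exp (2 * T)) * sqnorm P g" using wnorm_sqnorm(2)[of 2 g] driver_P[OF g] by simp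
  also have "\<dots> < \<infinity>" using g by (simp add: driver_def ennreal_mult_less_top)
  finally show ?thesis using m sqnorm_finite_iff[OF F_measurable_M[OF _ m]] by (simp add: L2_space_iff)
qed

text \<open>Representing \<xi> plus the total integral of \<open>g\<close> as \<open>c + I T\<close>
  produces the closed martingale \<open>c + I t\<close>; subtracting the part of the integral
  already accumulated gives \<open>X\<close>.\<close>

lemma linear_bsde_exists:
  assumes g: "driver g" and \<xi>: "\<xi> \<in> L2_space M (F T)"
  shows "\<exists>X Z I. linear_bsde \<xi> g X Z I"
proof -
  have "(\<lambda>\<omega>. \<xi> \<omega> + Jint g 0 T \<omega>) \<in> L2_space M (F T)" by (intro L2_add \<xi> Jint_T_L2 g) simp
  then obtain c Z I where I: "has_ito_integral M F T B Z I" and rep: "AE \<omega> in M. \<xi> \<omega> + Jint g 0 T \<omega> = c + I T \<omega>"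
    using martingale_representation by blast
  have IS2: "I \<in> S2_space M F T" using I unfolding has_ito_integral_def by auto
  define good where "good \<omega> \<longleftrightarrow> set_integrable lborel {0..T} (\<lambda>s. g (\<omega>, s))" for \<omega>
  have good: "AE \<omega> in M. good \<omega>" using AE_integrable[OF g] unfolding good_def .
  \<comment> \<open>The paths of the integral are continuous only where \<open>g\<close> is
    integrable in time; the default 0 makes all paths continuous.\<close>
  define X where "X t \<omega> = (if good \<omega> then c + I t \<omega> - Jint g 0 t \<omega> else 0)" for t \<omega>
  define Q where "Q \<omega> = ennreal (exp T) * (\<integral>\<^sup>+s\<in>{0..T}. ennreal ((g (\<omega>, s))\<^sup>2) \<partial>lborel)" for \<omega>
  have [measurable]: "g \<in> borel_measurable P" by (rule driver_P[OF g])
  have q_eq: "(\<integral>\<^sup>+s\<in>{0..T}. ennreal ((g (\<omega>, s))\<^sup>2) \<partial>lborel) = (\<integral>\<^sup>+s. ennreal ((g (\<omega>, s))\<^sup>2) \<partial>restrict_space lborel {0..T})" for \<omega>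
    by (simp add: nn_integral_restrict_space)
  have [measurable]: "(\<lambda>\<omega>. \<integral>\<^sup>+s. ennreal ((g (\<omega>, s))\<^sup>2) \<partial>restrict_space lborel {0..T}) \<in> borel_measurable M"
    by (rule P.M2.borel_measurable_nn_integral_fst[of "\<lambda>x. ennreal ((g x)\<^sup>2)"]) measurable
  have Qm[measurable]: "Q \<in> borel_measurable M" unfolding Q_def q_eq by measurable
  have Qfin: "(\<integral>\<^sup>+\<omega>. Q \<omega> \<partial>M) < \<infinity>"
  proof -
    have "(\<integral>\<^sup>+\<omega>. Q \<omega> \<partial>M) = ennreal (exp T) * sqnorm P g"
      unfolding Q_def q_eq sqnorm_def
      using P.M2.nn_integral_fst[of "\<lambda>x. ennreal ((g x)\<^sup>2)" M] by (subst nn_integral_cmult) auto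
    also have "\<dots> < \<infinity>" using g by (simp add: driver_def ennreal_mult_less_top)
    finally show ?thesis .
  qed
  have JQ: "ennreal ((Jint g t T \<omega>)\<^sup>2) \<le> Q \<omega>" if "good \<omega>" "t \<in> {0..T}" for t \<omega>
  proof -
    have "ennreal ((Jint g t T \<omega>)\<^sup>2) \<le> ennreal (exp (- 1 * t) / 1) * (\<integral>\<^sup>+s\<in>{t..T}. ennreal (exp (1 * s) * (g (\<omega>, s))\<^sup>2) \<partial>lborel)"
      by (rule Jint_weighted_bound) (use that in \<open>auto simp: good_def\<close>)
    also have "\<dots> \<le> 1 * (\<integral>\<^sup>+s. ennreal (exp T) * (ennreal ((g (\<omega>, s))\<^sup>2) * indicator {0..T} s) \<partial>lborel)"
    proof (rule mult_mono)
      show "ennreal (exp (- 1 * t) / 1) \<le> 1" using that by simp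
      show "(\<integral>\<^sup>+s\<in>{t..T}. ennreal (exp (1 * s) * (g (\<omega>, s))\<^sup>2) \<partial>lborel) \<le> (\<integral>\<^sup>+s. ennreal (exp T) * (ennreal ((g (\<omega>, s))\<^sup>2) * indicator {0..T} s) \<partial>lborel)"
        by (rule nn_integral_mono) (use that in \<open>auto simp: indicator_def ennreal_mult[symmetric] intro!: ennreal_leI mult_right_mono\<close>)
    qed auto
    also have "\<dots> \<le> Q \<omega>"
    proof -
      have "(\<lambda>s. ennreal ((g (\<omega>, s))\<^sup>2) * indicator {0..T} s) \<in> borel_measurable lborel"
      proof -
        have "(\<lambda>s. indicat_real {0..T} s *\<^sub>R g (\<omega>, s)) \<in> borel_measurable lborel"
          using \<open>good \<omega>\<close> unfolding good_def set_integrable_def by (rule borel_measurable_integrable)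
        then have "(\<lambda>s. ennreal ((indicat_real {0..T} s *\<^sub>R g (\<omega>, s))\<^sup>2)) \<in> borel_measurable lborel" by measurable
        also have "(\<lambda>s. ennreal ((indicat_real {0..T} s *\<^sub>R g (\<omega>, s))\<^sup>2)) = (\<lambda>s. ennreal ((g (\<omega>, s))\<^sup>2) * indicator {0..T} s)"
          by (auto simp: indicator_def)
        finally show ?thesis .
      qed
      then show ?thesis unfolding Q_def by (subst nn_integral_cmult) auto
    qed
    finally show ?thesis .
  qed
  have XS2: "X \<in> S2_space M F T"
    unfolding S2_space_def
  proof (intro CollectI conjI ballI)
    fix t assume t: "t \<in> {0..T}"
    have [measurable]: "I t \<in> borel_measurable (F t)" "Jint g 0 t \<in> borel_measurable (F t)"
      using S2_F_measurable[OF IS2 t] Jint_F_measurable[OF g t] by auto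
    show "X t \<in> borel_measurable (F t)"
    proof (rule F_measurable_AE)
      show "(\<lambda>\<omega>. c + I t \<omega> - Jint g 0 t \<omega>) \<in> borel_measurable (F t)" by measurable
      show "AE \<omega> in M. c + I t \<omega> - Jint g 0 t \<omega> = X t \<omega>" using good by eventually_elim (simp add: X_def)
    qed
  next
    fix \<omega> assume \<omega>: "\<omega> \<in> space M"
    show "continuous_on {0..T} (\<lambda>t. X t \<omega>)"
    proof (cases "good \<omega>")
      case True
      then show ?thesis unfolding X_def good_def
        by (simp, intro continuous_intros S2_continuous[OF IS2 \<omega>] Jint_continuous)
    qed (simp add: X_def)
  next
    obtain W where "integrable M W" and W: "integrable M (\<lambda>\<omega>. (W \<omega>)\<^sup>2)" "AE \<omega> in M. \<forall>t\<in>{0..T}. \<bar>I t \<omega>\<bar> \<le> W \<omega>" using S2_dominated[OF IS2] .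
    have [measurable]: "(\<lambda>\<omega>. (W \<omega>)\<^sup>2) \<in> borel_measurable M" using W by auto
    have "(\<integral>\<^sup>+\<omega>. (SUP t\<in>{0..T}. ennreal (\<bar>X t \<omega>\<bar>\<^sup>2)) \<partial>M) \<le> (\<integral>\<^sup>+\<omega>. ennreal (4 * c\<^sup>2 + 4 * (W \<omega>)\<^sup>2) + 8 * Q \<omega> \<partial>M)"
    proof (rule nn_integral_mono_AE, use W(2) good in eventually_elim, rule SUP_least)
      fix \<omega> t assume a: "\<forall>t\<in>{0..T}. \<bar>I t \<omega>\<bar> \<le> W \<omega>" "good \<omega>" and t: "t \<in> {0..T}"
      \<comment> \<open>The majorant \<open>Q\<close> bounds integrals running up to
        \<open>T\<close>, so the integral from 0 is written as a difference of two such.\<close>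
      have J: "Jint g 0 t \<omega> = Jint g 0 T \<omega> - Jint g t T \<omega>"
        using Jint_combine[OF a(2)[unfolded good_def] t] by simp
      have "\<bar>X t \<omega>\<bar>\<^sup>2 \<le> 4 * c\<^sup>2 + 4 * (I t \<omega>)\<^sup>2 + 2 * (Jint g 0 t \<omega>)\<^sup>2"
        using power2_norm_add_le[of "c + I t \<omega>" "- Jint g 0 t \<omega>"] power2_norm_add_le[of c "I t \<omega>"] a(2) by (simp add: X_def)
      also have "\<dots> \<le> (4 * c\<^sup>2 + 4 * (W \<omega>)\<^sup>2) + (4 * (Jint g 0 T \<omega>)\<^sup>2 + 4 * (Jint g t T \<omega>)\<^sup>2)"
      proof -
        have "(I t \<omega>)\<^sup>2 \<le> (W \<omega>)\<^sup>2" using a(1) t by (metis abs_ge_zero power2_abs power_mono)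
        moreover have "(Jint g 0 t \<omega>)\<^sup>2 \<le> 2 * (Jint g 0 T \<omega>)\<^sup>2 + 2 * (Jint g t T \<omega>)\<^sup>2"
          unfolding J using power2_norm_add_le[of "Jint g 0 T \<omega>" "- Jint g t T \<omega>"] by simp
        ultimately show ?thesis by linarith
      qed
      finally have "ennreal (\<bar>X t \<omega>\<bar>\<^sup>2) \<le> ennreal ((4 * c\<^sup>2 + 4 * (W \<omega>)\<^sup>2) + (4 * (Jint g 0 T \<omega>)\<^sup>2 + 4 * (Jint g t T \<omega>)\<^sup>2))"
        by (rule ennreal_leI)
      also have "\<dots> = ennreal (4 * c\<^sup>2 + 4 * (W \<omega>)\<^sup>2) + (4 * ennreal ((Jint g 0 T \<omega>)\<^sup>2) + 4 * ennreal ((Jint g t T \<omega>)\<^sup>2))"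
        by (simp add: ennreal_plus ennreal_mult)
      also have "\<dots> \<le> ennreal (4 * c\<^sup>2 + 4 * (W \<omega>)\<^sup>2) + (4 * Q \<omega> + 4 * Q \<omega>)"
        using JQ[OF a(2) t] JQ[OF a(2), of 0] T_pos by (intro add_mono mult_left_mono) auto
      also have "4 * Q \<omega> + 4 * Q \<omega> = 8 * Q \<omega>" by (simp add: distrib_right[symmetric])
      finally show "ennreal (\<bar>X t \<omega>\<bar>\<^sup>2) \<le> ennreal (4 * c\<^sup>2 + 4 * (W \<omega>)\<^sup>2) + 8 * Q \<omega>" .
    qed
    also have "\<dots> = (\<integral>\<^sup>+\<omega>. ennreal (4 * c\<^sup>2 + 4 * (W \<omega>)\<^sup>2) \<partial>M) + 8 * (\<integral>\<^sup>+\<omega>. Q \<omega> \<partial>M)"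
      by (subst nn_integral_add) (auto simp: nn_integral_cmult)
    also have "\<dots> < \<infinity>"
      using W(1) Qfin by (subst nn_integral_eq_integral) (auto simp: ennreal_mult_less_top)
    finally show "(\<integral>\<^sup>+\<omega>. (SUP t\<in>{0..T}. ennreal (\<bar>X t \<omega>\<bar>\<^sup>2)) \<partial>M) < \<infinity>" .
  qed
  have "AE \<omega> in M. \<forall>t\<in>{0..T}. X t \<omega> = \<xi> \<omega> + Jint g t T \<omega> - (I T \<omega> - I t \<omega>)"
    using good rep
  proof eventually_elim
    case (elim \<omega>)
    show ?case
    proof
      fix t assume t: "t \<in> {0..T}"
      show "X t \<omega> = \<xi> \<omega> + Jint g t T \<omega> - (I T \<omega> - I t \<omega>)"
        using Jint_combine[OF elim(1)[unfolded good_def] t] elim by (simp add: X_def)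
    qed
  qed
  then show ?thesis using XS2 I unfolding linear_bsde_def by blast
qed

text \<open>X_t - X'_t is known at time \<open>t\<close> and the later increment of I - I' is
  orthogonal to it, while their sum is the integral of g - g' over [t, T]. Pythagoras bounds both at
  once, and the isometry rewrites the second in terms of Z - Z'.\<close>

lemma linear_bsde_stability:
  assumes g: "driver g" "driver g'" and X: "linear_bsde \<xi> g X Z I" "linear_bsde \<xi> g' X' Z' I'"
    and t: "t \<in> {0..T}" and \<gamma>: "\<gamma> > 0"
  shows "sqnorm M (\<lambda>\<omega>. X t \<omega> - X' t \<omega>) + sqnorm P (\<lambda>(\<omega>, r). indicat_real {t<..T} r *\<^sub>R (Z r \<omega> - Z' r \<omega>)) \<le> tail \<gamma> (\<lambda>x. g x - g' x) t"
proof -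
  have I: "has_ito_integral M F T B Z I" "has_ito_integral M F T B Z' I'" using X unfolding linear_bsde_def by auto
  define N where "N = (\<lambda>r \<omega>. I r \<omega> - I' r \<omega>)"
  have mart: "martingale N" unfolding N_def by (rule martingale_diff[OF has_ito_integral_martingale[OF I(1)] has_ito_integral_martingale[OF I(2)]])
  define d where "d \<omega> = X t \<omega> - X' t \<omega>" for \<omega>
  define e where "e \<omega> = N T \<omega> - N t \<omega>" for \<omega>
  have tT: "0 \<le> t" "t \<le> T" using t by auto
  have dL: "d \<in> L2_space M (F t)"
    unfolding d_def using X t tT by (intro L2_diff S2_L2) (auto simp: linear_bsde_def)
  then have dLT: "d \<in> L2_space M (F T)" using L2_mono tT by blast
  have eL: "e \<in> L2_space M (F T)"
    unfolding e_def using martingale_L2[OF mart, of T] martingale_L2[OF mart, of t] L2_mono[of t T "N t"] tT by (intro L2_diff) auto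
  have orth: "(\<integral>\<omega>. d \<omega> * e \<omega> \<partial>M) = 0"
    unfolding e_def by (rule martingale_orthogonal[OF mart tT _ dL]) simp
  have "(\<integral>\<omega>. (d \<omega> + e \<omega>)\<^sup>2 \<partial>M) = (\<integral>\<omega>. (d \<omega>)\<^sup>2 + 2 * (d \<omega> * e \<omega>) + (e \<omega>)\<^sup>2 \<partial>M)"
  proof -
    have "(a + b)\<^sup>2 = a\<^sup>2 + 2 * (a * b) + b\<^sup>2" for a b :: real by (simp add: power2_sum)
    then show ?thesis by (simp only:)
  qed
  also have "\<dots> = (\<integral>\<omega>. (d \<omega>)\<^sup>2 \<partial>M) + (\<integral>\<omega>. (e \<omega>)\<^sup>2 \<partial>M)"
    using orth L2_square_integrable[OF dL] L2_square_integrable[OF eL] L2_mult_integrable[OF order_refl dLT eL] by simp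
  finally have "sqnorm M d + sqnorm M e = sqnorm M (\<lambda>\<omega>. d \<omega> + e \<omega>)"
    unfolding sqnorm_eq_integral_L2[OF dL] sqnorm_eq_integral_L2[OF eL] sqnorm_eq_integral_L2[OF L2_add[OF order_refl dLT eL]]
    by (simp add: ennreal_plus[symmetric] del: ennreal_plus)
  also have "\<dots> = sqnorm M (Jint (\<lambda>x. g x - g' x) t T)"
  proof (rule sqnorm_cong_AE)
    have "AE \<omega> in M. \<forall>t\<in>{0..T}. X t \<omega> = \<xi> \<omega> + Jint g t T \<omega> - (I T \<omega> - I t \<omega>)"
      "AE \<omega> in M. \<forall>t\<in>{0..T}. X' t \<omega> = \<xi> \<omega> + Jint g' t T \<omega> - (I' T \<omega> - I' t \<omega>)"
      using X unfolding linear_bsde_def by auto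
    then show "AE \<omega> in M. d \<omega> + e \<omega> = Jint (\<lambda>x. g x - g' x) t T \<omega>"
      using AE_integrable[OF g(1)] AE_integrable[OF g(2)]
    proof eventually_elim
      case (elim \<omega>)
      then show ?case using t Jint_diff[OF elim(3,4) t] unfolding d_def e_def N_def by simp
    qed
  qed
  also have "\<dots> \<le> tail \<gamma> (\<lambda>x. g x - g' x) t" by (rule Jint_sqnorm_le[OF driver_diff[OF g] t \<gamma>])
  finally have le: "sqnorm M d + sqnorm M e \<le> tail \<gamma> (\<lambda>x. g x - g' x) t" .
  have "e = (\<lambda>\<omega>. (I T \<omega> - I t \<omega>) - (I' T \<omega> - I' t \<omega>))" by (auto simp: e_def N_def)
  then have "sqnorm M e = sqnorm P (\<lambda>(\<omega>, r). indicat_real {t<..T} r *\<^sub>R (Z r \<omega> - Z' r \<omega>))"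
    using ito_isometry[OF I tT(1) tT(2) order_refl] by simp
  with le show ?thesis by (simp add: d_def[abs_def])
qed

end

section \<open>The loss functional\<close>

locale mean_reflected = brownian M T B for M :: "'w measure" and T :: real and B :: "real \<Rightarrow> 'w \<Rightarrow> real ^ 'd" +
  fixes \<xi> :: "'w \<Rightarrow> real" and f :: "'w \<Rightarrow> real \<Rightarrow> real \<Rightarrow> real ^ 'd \<Rightarrow> real" and l :: "'w \<Rightarrow> real \<Rightarrow> real \<Rightarrow> real"
  assumes xi: "H_xi M F T l \<xi>" and Hf: "H_f M F T f" and Hell: "H_ell M F T l" and HL: "H_L M F T l"
begin

lemma ell_measurable:
  assumes t: "t \<in> {0..T}" and X: "X \<in> borel_measurable (F T)"
  shows "(\<lambda>\<omega>. l \<omega> t (X \<omega>)) \<in> borel_measurable M"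
proof -
  have m: "(\<lambda>(\<omega>, t, y). l \<omega> t y) \<in> borel_measurable (F T \<Otimes>\<^sub>M (restrict_space borel {0..T} \<Otimes>\<^sub>M borel))"
    using Hell unfolding H_ell_def by blast
  have c: "(\<lambda>\<omega>. t) \<in> measurable (F T) (restrict_space borel {0..T})"
    using t by (intro measurable_const) (simp add: space_restrict_space)
  have "(\<lambda>\<omega>. (\<omega>, t, X \<omega>)) \<in> measurable (F T) (F T \<Otimes>\<^sub>M (restrict_space borel {0..T} \<Otimes>\<^sub>M borel))"
    by (intro measurable_Pair c X) simp
  from measurable_compose[OF this m] have "(\<lambda>\<omega>. l \<omega> t (X \<omega>)) \<in> borel_measurable (F T)" by simp
  then show ?thesis by (rule F_measurable_M[rotated]) simp
qed

lemma ell_growth: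
  obtains C where "C \<ge> 0" "AE \<omega> in M. \<forall>t\<in>{0..T}. \<forall>y. \<bar>l \<omega> t y\<bar> \<le> C * (1 + \<bar>y\<bar>)"
  using Hell unfolding H_ell_def by blast

lemma ell_strict_mono: "AE \<omega> in M. \<forall>t\<in>{0..T}. strict_mono (l \<omega> t)"
  and ell_continuous: "AE \<omega> in M. continuous_on ({0..T} \<times> UNIV) (\<lambda>(t, y). l \<omega> t y)"
  and ell_limit: "t \<in> {0..T} \<Longrightarrow> ereal_expectation M (\<lambda>\<omega>. Lim at_top (\<lambda>y. ereal (l \<omega> t y))) > 0"
  using Hell unfolding H_ell_def by blast+

lemma ell_integrable:
  assumes t: "t \<in> {0..T}" and X: "X \<in> borel_measurable (F T)" "integrable M X"
  shows "integrable M (\<lambda>\<omega>. l \<omega> t (X \<omega>))"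
proof -
  obtain C where C: "C \<ge> 0" "AE \<omega> in M. \<forall>t\<in>{0..T}. \<forall>y. \<bar>l \<omega> t y\<bar> \<le> C * (1 + \<bar>y\<bar>)" by (rule ell_growth)
  show ?thesis
  proof (rule Bochner_Integration.integrable_bound[OF _ ell_measurable[OF t X(1)]])
    show "integrable M (\<lambda>\<omega>. C * (1 + \<bar>X \<omega>\<bar>))" using X by auto
    show "AE \<omega> in M. norm (l \<omega> t (X \<omega>)) \<le> norm (C * (1 + \<bar>X \<omega>\<bar>))"
      using C(2) by eventually_elim (use t C(1) in auto)
  qed
qed

text \<open>Joint continuity of the loss gives pointwise convergence and linear growth gives the
  majorant. Moving time and argument together lets one lemma yield continuity in the shift
  \<open>x\<close> and continuity in \<open>t\<close> along a process.\<close>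

lemma expected_loss_tendsto:
  assumes t: "\<And>n. t n \<in> {0..T}" "s \<in> {0..T}" "t \<longlonglongrightarrow> s"
    and X: "\<And>n. X n \<in> borel_measurable (F T)" "Y \<in> borel_measurable (F T)" "AE \<omega> in M. (\<lambda>n. X n \<omega>) \<longlonglongrightarrow> Y \<omega>"
    and W: "integrable M W" "AE \<omega> in M. \<forall>n. \<bar>X n \<omega>\<bar> \<le> W \<omega>"
  shows "(\<lambda>n. \<integral>\<omega>. l \<omega> (t n) (X n \<omega>) \<partial>M) \<longlonglongrightarrow> (\<integral>\<omega>. l \<omega> s (Y \<omega>) \<partial>M)"
proof -
  obtain C where C: "C \<ge> 0" "AE \<omega> in M. \<forall>t\<in>{0..T}. \<forall>y. \<bar>l \<omega> t y\<bar> \<le> C * (1 + \<bar>y\<bar>)" by (rule ell_growth)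
  show ?thesis
  proof (rule integral_dominated_convergence[where w = "\<lambda>\<omega>. C * (1 + W \<omega>)"])
    show "(\<lambda>\<omega>. l \<omega> s (Y \<omega>)) \<in> borel_measurable M" using ell_measurable t X by auto
    show "(\<lambda>\<omega>. l \<omega> (t n) (X n \<omega>)) \<in> borel_measurable M" for n using ell_measurable t X by auto
    show "integrable M (\<lambda>\<omega>. C * (1 + W \<omega>))" using W(1) by auto
    show "AE \<omega> in M. norm (l \<omega> (t n) (X n \<omega>)) \<le> C * (1 + W \<omega>)" for n
      using C(2) W(2)
    proof eventually_elim
      case (elim \<omega>)
      have "\<bar>l \<omega> (t n) (X n \<omega>)\<bar> \<le> C * (1 + \<bar>X n \<omega>\<bar>)" using elim(1) t(1) by blast
      also have "\<dots> \<le> C * (1 + W \<omega>)" using elim(2) C(1) by (intro mult_left_mono) auto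
      finally show ?case by simp
    qed
    show "AE \<omega> in M. (\<lambda>n. l \<omega> (t n) (X n \<omega>)) \<longlonglongrightarrow> l \<omega> s (Y \<omega>)"
      using ell_continuous X(3)
    proof eventually_elim
      case (elim \<omega>)
      have "(\<lambda>n. (\<lambda>(t, y). l \<omega> t y) (t n, X n \<omega>)) \<longlonglongrightarrow> (\<lambda>(t, y). l \<omega> t y) (s, Y \<omega>)"
        by (rule continuous_on_tendsto_compose[OF elim(1) tendsto_Pair[OF t(3) elim(2)]]) (use t in auto)
      then show ?case by simp
    qed
  qed
qed

lemma expected_loss_strict_mono:
  assumes t: "t \<in> {0..T}" and X: "X \<in> borel_measurable (F T)" "integrable M X"
  shows "strict_mono (\<lambda>x. \<integral>\<omega>. l \<omega> t (x + X \<omega>) \<partial>M)"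
proof (rule strict_monoI)
  fix x y :: real assume xy: "x < y"
  have "(\<lambda>\<omega>. z + X \<omega>) \<in> borel_measurable (F T)" for z using X(1) by simp
  note i = ell_integrable[OF t this]
  show "(\<integral>\<omega>. l \<omega> t (x + X \<omega>) \<partial>M) < (\<integral>\<omega>. l \<omega> t (y + X \<omega>) \<partial>M)"
  proof (rule integral_less_AE_space)
    show "AE \<omega> in M. l \<omega> t (x + X \<omega>) < l \<omega> t (y + X \<omega>)"
      using ell_strict_mono by eventually_elim (use t xy in \<open>auto simp: strict_mono_def\<close>)
    show "emeasure M (space M) \<noteq> 0" by (simp add: emeasure_space_1)
  qed (use i X in auto)
qed

lemma expected_loss_isCont:
  assumes t: "t \<in> {0..T}" and X: "X \<in> borel_measurable (F T)" "integrable M X"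
  shows "isCont (\<lambda>x. \<integral>\<omega>. l \<omega> t (x + X \<omega>) \<partial>M) x"
proof (rule continuous_at_sequentiallyI)
  fix u assume u: "u \<longlonglongrightarrow> x"
  then obtain c where c: "\<And>n. \<bar>u n\<bar> \<le> c" using convergent_imp_Bseq[OF convergentI[OF u]] unfolding Bseq_def real_norm_def by blast
  show "(\<lambda>n. \<integral>\<omega>. l \<omega> t (u n + X \<omega>) \<partial>M) \<longlonglongrightarrow> (\<integral>\<omega>. l \<omega> t (x + X \<omega>) \<partial>M)"
  proof (rule expected_loss_tendsto)
    show "(\<lambda>n. t) \<longlonglongrightarrow> t" by simp
    show "AE \<omega> in M. (\<lambda>n. u n + X \<omega>) \<longlonglongrightarrow> x + X \<omega>" using u by (intro AE_I2 tendsto_add) auto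
    show "integrable M (\<lambda>\<omega>. c + \<bar>X \<omega>\<bar>)" using X by auto
    show "AE \<omega> in M. \<forall>n. \<bar>u n + X \<omega>\<bar> \<le> c + \<bar>X \<omega>\<bar>"
    proof (intro AE_I2 allI)
      fix \<omega> n show "\<bar>u n + X \<omega>\<bar> \<le> c + \<bar>X \<omega>\<bar>" using c[of n] by linarith
    qed
  qed (use t X in auto)
qed

lemma expected_loss_continuous_on:
  assumes Y: "Y \<in> S2_space M F T"
  shows "continuous_on {0..T} (\<lambda>t. \<integral>\<omega>. l \<omega> t (Y t \<omega>) \<partial>M)"
proof (rule continuous_on_sequentiallyI)
  fix u :: "nat \<Rightarrow> real" and a assume u: "\<forall>n. u n \<in> {0..T}" "a \<in> {0..T}" "u \<longlonglongrightarrow> a"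
  obtain W where W: "integrable M W" "integrable M (\<lambda>\<omega>. (W \<omega>)\<^sup>2)" "AE \<omega> in M. \<forall>t\<in>{0..T}. \<bar>Y t \<omega>\<bar> \<le> W \<omega>"
    by (rule S2_dominated[OF Y])
  have m: "Y t \<in> borel_measurable (F T)" if "t \<in> {0..T}" for t
    using F_measurable_mono[OF _ S2_F_measurable[OF Y that]] that by auto
  show "(\<lambda>n. \<integral>\<omega>. l \<omega> (u n) (Y (u n) \<omega>) \<partial>M) \<longlonglongrightarrow> (\<integral>\<omega>. l \<omega> a (Y a \<omega>) \<partial>M)"
  proof (rule expected_loss_tendsto[OF _ _ _ _ _ _ W(1)])
    show "AE \<omega> in M. (\<lambda>n. Y (u n) \<omega>) \<longlonglongrightarrow> Y a \<omega>"
    proof (rule AE_I2)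
      fix \<omega> assume "\<omega> \<in> space M"
      from continuous_on_tendsto_compose[OF S2_continuous[OF Y this] u(3) u(2)] u(1)
      show "(\<lambda>n. Y (u n) \<omega>) \<longlonglongrightarrow> Y a \<omega>" by auto
    qed
    show "AE \<omega> in M. \<forall>n. \<bar>Y (u n) \<omega>\<bar> \<le> W \<omega>" using W(3) by eventually_elim (use u in auto)
  qed (use u m in auto)
qed

lemma ereal_mono_tendsto_SUP:
  fixes k :: "real \<Rightarrow> real" assumes "mono k"
  shows "((\<lambda>y. ereal (k y)) \<longlongrightarrow> (SUP y. ereal (k y))) at_top"
proof (rule increasing_tendsto)
  show "\<forall>\<^sub>F y in at_top. ereal (k y) \<le> (SUP y. ereal (k y))" by (intro always_eventually allI SUP_upper) simp
  fix x assume "x < (SUP y. ereal (k y))"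
  then obtain z where z: "x < ereal (k z)" by (auto simp: less_SUP_iff)
  show "\<forall>\<^sub>F y in at_top. x < ereal (k y)"
    using eventually_ge_at_top[of z]
  proof eventually_elim
    case (elim y)
    show ?case using less_le_trans[OF z, of "ereal (k y)"] monoD[OF assms elim] by simp
  qed
qed

text \<open>If the expected loss were negative for all integer shifts, its positive part would have
  smaller mean than its negative part each time. The positive parts increase and the negative parts
  decrease with the shift, so monotone convergence makes the expectation of the limit at infinity
  nonpositive, against the third condition of \<open>H_ell\<close>.\<close>

lemma expected_loss_eventually_nonneg:
  assumes t: "t \<in> {0..T}" and X: "X \<in> borel_measurable (F T)" "integrable M X"
  shows "\<exists>x\<ge>0. (\<integral>\<omega>. l \<omega> t (x + X \<omega>) \<partial>M) \<ge> 0"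
proof (rule ccontr)
  assume "\<not> ?thesis"
  then have neg: "(\<integral>\<omega>. l \<omega> t (real n + X \<omega>) \<partial>M) < 0" for n by (meson not_le of_nat_0_le_iff)
  define u where "u n \<omega> = l \<omega> t (real n + X \<omega>)" for n \<omega>
  define lim where "lim \<omega> = Lim at_top (\<lambda>y. ereal (l \<omega> t y))" for \<omega>
  have "(\<lambda>\<omega>. real n + X \<omega>) \<in> borel_measurable (F T)" for n using X(1) by simp
  then have i: "integrable M (u n)" and m[measurable]: "u n \<in> borel_measurable M" for n
    unfolding u_def using ell_integrable[OF t] ell_measurable[OF t] X(2) by auto
  have u_mono: "AE \<omega> in M. \<forall>n m. n \<le> m \<longrightarrow> u n \<omega> \<le> u m \<omega>"
    using ell_strict_mono
  proof eventually_elim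
    case (elim \<omega>)
    then have "mono (l \<omega> t)" using t by (auto dest: strict_mono_mono)
    then show ?case by (auto simp: u_def intro!: monoD[of "l \<omega> t"])
  qed
  have u_lim: "AE \<omega> in M. (\<lambda>n. ereal (u n \<omega>)) \<longlonglongrightarrow> lim \<omega>"
    using ell_strict_mono
  proof eventually_elim
    case (elim \<omega>)
    then have "mono (l \<omega> t)" using t by (auto dest: strict_mono_mono)
    from ereal_mono_tendsto_SUP[OF this] have T: "((\<lambda>y. ereal (l \<omega> t y)) \<longlongrightarrow> lim \<omega>) at_top"
      unfolding lim_def by (subst tendsto_Lim) auto
    have "filterlim (\<lambda>n. real n + X \<omega>) at_top sequentially"
      using filterlim_tendsto_add_at_top[OF tendsto_const filterlim_real_sequentially, of "X \<omega>"] by (simp add: add.commute)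
    from filterlim_compose[OF T this] show ?case by (simp add: u_def)
  qed
  define p where "p n = (\<integral>\<^sup>+\<omega>. ennreal (u n \<omega>) \<partial>M)" for n
  define q where "q n = (\<integral>\<^sup>+\<omega>. ennreal (- u n \<omega>) \<partial>M)" for n
  have q_fin: "q n < \<infinity>" and p_fin: "p n < \<infinity>" for n
    using i[of n] unfolding q_def p_def real_integrable_def by (auto simp: top.not_eq_extremum)
  have pq: "p n \<le> q n" for n
  proof -
    have "enn2real (p n) - enn2real (q n) < 0"
      using neg[of n] unfolding u_def[symmetric] real_lebesgue_integral_def[OF i] p_def q_def .
    then show ?thesis using p_fin[of n] q_fin[of n] by (metis enn2real_mono less_eq_real_def less_iff_diff_less_0 linorder_not_le order_less_imp_not_less infinity_ennreal_def)
  qed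
  have p_mono: "p n \<le> p m" if "n \<le> m" for n m
    unfolding p_def by (rule nn_integral_mono_AE) (use u_mono that in \<open>auto intro!: ennreal_leI\<close>)
  have q_mono: "q m \<le> q n" if "n \<le> m" for n m
    unfolding q_def by (rule nn_integral_mono_AE) (use u_mono that in \<open>auto intro!: ennreal_leI\<close>)
  have PQ: "(SUP n. p n) \<le> (INF n. q n)"
  proof (intro SUP_least INF_greatest)
    fix n m
    show "p n \<le> q m" using p_mono[of n "max n m"] pq[of "max n m"] q_mono[of m "max n m"] by simp
  qed
  have e: "(\<lambda>n. e2ennreal (a n)) \<longlonglongrightarrow> e2ennreal b" if "a \<longlonglongrightarrow> b" for a b
    using continuous_at_e2ennreal[of b UNIV] that by (auto simp: continuous_within intro: tendsto_compose isCont_tendsto_compose)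
  have "(\<integral>\<^sup>+\<omega>. e2ennreal (lim \<omega>) \<partial>M) \<le> (\<integral>\<^sup>+\<omega>. (SUP n. ennreal (u n \<omega>)) \<partial>M)"
  proof (rule nn_integral_mono_AE)
    show "AE \<omega> in M. e2ennreal (lim \<omega>) \<le> (SUP n. ennreal (u n \<omega>))" using u_lim
    proof eventually_elim
      case (elim \<omega>)
      show ?case by (rule LIMSEQ_le_const2[OF e[OF elim]]) (auto intro!: SUP_upper)
    qed
  qed
  also have "\<dots> = (SUP n. p n)"
    unfolding p_def by (rule nn_integral_monotone_convergence_SUP_AE) (use u_mono in \<open>auto intro!: ennreal_leI\<close>)
  also note PQ
  also have "(INF n. q n) = (\<integral>\<^sup>+\<omega>. (INF n. ennreal (- u n \<omega>)) \<partial>M)"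
    unfolding q_def by (rule nn_integral_monotone_convergence_INF_AE'[symmetric]) (use u_mono q_fin[of 0] in \<open>auto simp: q_def intro!: ennreal_leI\<close>)
  also have "\<dots> \<le> (\<integral>\<^sup>+\<omega>. e2ennreal (- lim \<omega>) \<partial>M)"
  proof (rule nn_integral_mono_AE)
    show "AE \<omega> in M. (INF n. ennreal (- u n \<omega>)) \<le> e2ennreal (- lim \<omega>)" using u_lim
    proof eventually_elim
      case (elim \<omega>)
      have "(\<lambda>n. - ereal (u n \<omega>)) \<longlonglongrightarrow> - lim \<omega>" using elim by (rule tendsto_uminus_ereal)
      from e[OF this] show ?case by (rule LIMSEQ_le_const) (auto intro!: INF_lower)
    qed
  qed
  finally have le: "(\<integral>\<^sup>+\<omega>. e2ennreal (lim \<omega>) \<partial>M) \<le> (\<integral>\<^sup>+\<omega>. e2ennreal (- lim \<omega>) \<partial>M)" .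
  have "(\<integral>\<^sup>+\<omega>. e2ennreal (- lim \<omega>) \<partial>M) \<le> q 0"
    unfolding q_def
  proof (rule nn_integral_mono_AE)
    show "AE \<omega> in M. e2ennreal (- lim \<omega>) \<le> ennreal (- u 0 \<omega>)" using u_lim u_mono
    proof eventually_elim
      case (elim \<omega>)
      have "ereal (u 0 \<omega>) \<le> lim \<omega>" by (rule LIMSEQ_le_const[OF elim(1)]) (use elim(2) in auto)
      then have "- lim \<omega> \<le> ereal (- u 0 \<omega>)" by (metis ereal_minus_le_minus uminus_ereal.simps(1))
      from e2ennreal_mono[OF this] show ?case by simp
    qed
  qed
  also note q_fin[of 0]
  finally have fin: "(\<integral>\<^sup>+\<omega>. e2ennreal (- lim \<omega>) \<partial>M) < top" by simp
  \<comment> \<open>Finiteness of the negative part rules out a difference of two infinite values,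
    to which the comparison a \<le> b would not carry over.\<close>
  have *: "\<not> 0 < enn2ereal a - enn2ereal b" if "a \<le> b" "b < top" for a b
    using that by (cases a; cases b) (auto simp: top_unique)
  have "\<not> 0 < ereal_expectation M lim"
    unfolding ereal_expectation_def by (rule *[OF le fin])
  then show False using ell_limit[OF t] unfolding lim_def by simp
qed

text \<open>By continuity a negative expected loss at \<open>x\<close> stays negative slightly to
  the right, and by monotonicity everywhere to the left, so the infimum lies strictly beyond
  \<open>x\<close>. Thus it is attained, and the constraint becomes an inequality against
  \<open>L_op\<close>. Nonemptiness of the set is what gives the infimum a meaning.\<close>

lemma L_op_nonneg_iff:
  assumes t: "t \<in> {0..T}" and X: "X \<in> borel_measurable (F T)" "integrable M X"
  shows "0 \<le> L_op M l t X" "0 \<le> x \<Longrightarrow> 0 \<le> (\<integral>\<omega>. l \<omega> t (x + X \<omega>) \<partial>M) \<longleftrightarrow> L_op M l t X \<le> x"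
proof -
  define h where "h x = (\<integral>\<omega>. l \<omega> t (x + X \<omega>) \<partial>M)" for x
  define S where "S = {x. x \<ge> 0 \<and> h x \<ge> 0}"
  have L: "L_op M l t X = Inf S" unfolding L_op_def S_def h_def ..
  have ne: "S \<noteq> {}" using expected_loss_eventually_nonneg[OF t X] unfolding S_def h_def by blast
  have bdd: "bdd_below S" by (rule bdd_belowI[of _ 0]) (simp add: S_def)
  show "0 \<le> L_op M l t X" unfolding L using ne by (intro cInf_greatest) (auto simp: S_def)
  have mono: "strict_mono h" unfolding h_def by (rule expected_loss_strict_mono[OF t X])
  have cont: "isCont h x" unfolding h_def by (rule expected_loss_isCont[OF t X])
  have "L_op M l t X \<le> x" if "0 \<le> x" "0 \<le> h x"
    unfolding L using that by (intro cInf_lower bdd) (simp add: S_def)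
  moreover have "x < L_op M l t X" if "0 \<le> x" "h x < 0"
  proof -
    have "\<exists>d>0. \<forall>y. \<bar>y - x\<bar> < d \<longrightarrow> \<bar>h y - h x\<bar> < - h x"
      using cont that(2) unfolding continuous_at_eps_delta by (auto simp: dist_real_def)
    then obtain d where d: "d > 0" "\<And>y. \<bar>y - x\<bar> < d \<Longrightarrow> \<bar>h y - h x\<bar> < - h x" by blast
    have "h (x + d / 2) < 0" using d(2)[of "x + d / 2"] d(1) by simp
    have "x + d / 2 \<le> y" if "y \<in> S" for y
    proof (rule ccontr)
      assume "\<not> x + d / 2 \<le> y"
      then have "h y < h (x + d / 2)" using mono by (auto simp: strict_mono_def)
      with \<open>h (x + d / 2) < 0\<close> that show False by (simp add: S_def)
    qed
    then have "x + d / 2 \<le> Inf S" by (rule cInf_greatest[OF ne])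
    then show ?thesis using d(1) by (simp add: L)
  qed
  ultimately show "0 \<le> (\<integral>\<omega>. l \<omega> t (x + X \<omega>) \<partial>M) \<longleftrightarrow> L_op M l t X \<le> x" if "0 \<le> x"
    using that unfolding h_def[symmetric] by (meson not_le)
qed

lemma S2_F_T: "X \<in> S2_space M F T \<Longrightarrow> t \<in> {0..T} \<Longrightarrow> X t \<in> borel_measurable (F T)"
  using F_measurable_mono[OF _ S2_F_measurable] by auto

lemma S2_integrable: "X \<in> S2_space M F T \<Longrightarrow> t \<in> {0..T} \<Longrightarrow> integrable M (X t)"
  using L2_integrable[OF _ S2_L2] by auto

lemma skorokhod_loss:
  assumes X: "X \<in> S2_space M F T"
  shows "skorokhod T (\<lambda>t x. \<integral>\<omega>. l \<omega> t (x + X t \<omega>) \<partial>M) (\<lambda>t. L_op M l t (X t))"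
proof
  show "0 < T" by (rule T_pos)
  fix x
  have "(\<lambda>t \<omega>. x + X t \<omega>) \<in> S2_space M F T"
    using S2_add_deterministic[OF X, of "\<lambda>_. x"] by (simp add: add.commute)
  from expected_loss_continuous_on[OF this]
  show "continuous_on {0..T} (\<lambda>t. \<integral>\<omega>. l \<omega> t (x + X t \<omega>) \<partial>M)" .
  fix t assume t: "t \<in> {0..T}"
  note X' = S2_F_T[OF X t] S2_integrable[OF X t]
  show "isCont (\<lambda>x. \<integral>\<omega>. l \<omega> t (x + X t \<omega>) \<partial>M) x" by (rule expected_loss_isCont[OF t X'])
  show "strict_mono (\<lambda>x. \<integral>\<omega>. l \<omega> t (x + X t \<omega>) \<partial>M)" by (rule expected_loss_strict_mono[OF t X'])
  show "0 \<le> L_op M l t (X t)" by (rule L_op_nonneg_iff(1)[OF t X'])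
  show "0 \<le> x \<Longrightarrow> 0 \<le> (\<integral>\<omega>. l \<omega> t (x + X t \<omega>) \<partial>M) \<longleftrightarrow> L_op M l t (X t) \<le> x"
    by (rule L_op_nonneg_iff(2)[OF t X'])
qed

definition kap :: "(real \<Rightarrow> 'w \<Rightarrow> real) \<Rightarrow> real \<Rightarrow> real" where
  "kap X = skorokhod.future_sup T (\<lambda>t. L_op M l t (X t))"

end

section \<open>Reduction to a fixed point problem for the driver\<close>

context mean_reflected
begin

definition fd :: "(real \<Rightarrow> 'w \<Rightarrow> real) \<Rightarrow> (real \<Rightarrow> 'w \<Rightarrow> real ^ 'd) \<Rightarrow> 'w \<times> real \<Rightarrow> real" where
  "fd Y Z = (\<lambda>(\<omega>, s). f \<omega> s (Y s \<omega>) (Z s \<omega>))"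

lemma fd_measurable:
  assumes Y: "(\<lambda>(\<omega>, s). Y s \<omega>) \<in> borel_measurable Prog" and Z: "(\<lambda>(\<omega>, s). Z s \<omega>) \<in> borel_measurable Prog"
  shows "fd Y Z \<in> borel_measurable Prog"
proof -
  have m: "(\<lambda>((\<omega>, t), y, z). f \<omega> t y z) \<in> borel_measurable (Prog \<Otimes>\<^sub>M (borel \<Otimes>\<^sub>M borel))"
    using Hf unfolding H_f_def by blast
  have "(\<lambda>x. (x, (\<lambda>(\<omega>, s). Y s \<omega>) x, (\<lambda>(\<omega>, s). Z s \<omega>) x)) \<in> measurable Prog (Prog \<Otimes>\<^sub>M (borel \<Otimes>\<^sub>M borel))"
    by (intro measurable_Pair Y Z) simp
  from measurable_compose[OF this m] show ?thesis by (simp add: fd_def case_prod_beta')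
qed

lemma f_lipschitz:
  obtains c where "c \<ge> 0" "AE \<omega> in M. \<forall>t\<in>{0..T}. \<forall>y p z q. \<bar>f \<omega> t y z - f \<omega> t p q\<bar> \<le> c * (\<bar>y - p\<bar> + norm (z - q))"
  using Hf unfolding H_f_def by blast

text \<open>The Lipschitz condition in weighted norms. The constant is the same for every weight
  \<beta>; this matters because the weight is chosen afterwards, depending on the constant.\<close>

definition fd_bound :: "real \<Rightarrow> bool" where
  "fd_bound c \<longleftrightarrow> c > 0 \<and> (\<forall>\<beta> Y Z Y' Z'. (\<lambda>(\<omega>, s). Y s \<omega>) \<in> borel_measurable P \<longrightarrow> (\<lambda>(\<omega>, s). Z s \<omega>) \<in> borel_measurable P \<longrightarrow>
    (\<lambda>(\<omega>, s). Y' s \<omega>) \<in> borel_measurable P \<longrightarrow> (\<lambda>(\<omega>, s). Z' s \<omega>) \<in> borel_measurable P \<longrightarrow>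
    wnorm \<beta> (\<lambda>x. fd Y Z x - fd Y' Z' x) \<le> ennreal c * (wnorm \<beta> (\<lambda>(\<omega>, s). Y s \<omega> - Y' s \<omega>) + wnorm \<beta> (\<lambda>(\<omega>, s). Z s \<omega> - Z' s \<omega>)))"

lemma fd_boundD:
  assumes "fd_bound c" "(\<lambda>(\<omega>, s). Y s \<omega>) \<in> borel_measurable P" "(\<lambda>(\<omega>, s). Z s \<omega>) \<in> borel_measurable P"
    "(\<lambda>(\<omega>, s). Y' s \<omega>) \<in> borel_measurable P" "(\<lambda>(\<omega>, s). Z' s \<omega>) \<in> borel_measurable P"
  shows "wnorm \<beta> (\<lambda>x. fd Y Z x - fd Y' Z' x) \<le> ennreal c * (wnorm \<beta> (\<lambda>(\<omega>, s). Y s \<omega> - Y' s \<omega>) + wnorm \<beta> (\<lambda>(\<omega>, s). Z s \<omega> - Z' s \<omega>))"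
  using assms unfolding fd_bound_def by blast

lemma fd_bound_exists: "\<exists>c. fd_bound c"
proof -
  obtain c where c: "c \<ge> 0" "AE \<omega> in M. \<forall>t\<in>{0..T}. \<forall>y p z q. \<bar>f \<omega> t y z - f \<omega> t p q\<bar> \<le> c * (\<bar>y - p\<bar> + norm (z - q))"
    by (rule f_lipschitz)
  \<comment> \<open>2 c^2 comes from squaring the Lipschitz bound with two summands; the added 1
    keeps the constant positive when c = 0.\<close>
  define c' where "c' = 2 * c\<^sup>2 + 1"
  have c': "c' > 0" unfolding c'_def using zero_le_power2[of c] by linarith
  show ?thesis
    unfolding fd_bound_def
  proof (intro exI[of _ c'] conjI allI impI c')
    fix \<beta> and Y Y' :: "real \<Rightarrow> 'w \<Rightarrow> real" and Z Z' :: "real \<Rightarrow> 'w \<Rightarrow> real ^ 'd"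
    assume [measurable]: "(\<lambda>(\<omega>, s). Y s \<omega>) \<in> borel_measurable P" "(\<lambda>(\<omega>, s). Z s \<omega>) \<in> borel_measurable P"
      "(\<lambda>(\<omega>, s). Y' s \<omega>) \<in> borel_measurable P" "(\<lambda>(\<omega>, s). Z' s \<omega>) \<in> borel_measurable P"
    note [measurable] = snd_measurable_P
    define y where "y = (\<lambda>x. (\<lambda>(\<omega>, s). Y s \<omega>) x - (\<lambda>(\<omega>, s). Y' s \<omega>) x)"
    define z where "z = (\<lambda>x. (\<lambda>(\<omega>, s). Z s \<omega>) x - (\<lambda>(\<omega>, s). Z' s \<omega>) x)"
    have [measurable]: "y \<in> borel_measurable P" "z \<in> borel_measurable P" unfolding y_def z_def by measurable
    have y: "(\<lambda>(\<omega>, s). Y s \<omega> - Y' s \<omega>) = y" and z: "(\<lambda>(\<omega>, s). Z s \<omega> - Z' s \<omega>) = z"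
      by (auto simp: y_def z_def)
    let ?e = "\<lambda>x :: 'w \<times> real. exp (\<beta> * snd x)"
    have "wnorm \<beta> (\<lambda>x. fd Y Z x - fd Y' Z' x)
      \<le> (\<integral>\<^sup>+x. ennreal c' * (ennreal (?e x * (norm (y x))\<^sup>2) + ennreal (?e x * (norm (z x))\<^sup>2)) \<partial>P)"
      unfolding wnorm_def
    proof (rule nn_integral_mono_AE)
      show "AE x in P. ennreal (?e x * (norm (fd Y Z x - fd Y' Z' x))\<^sup>2)
          \<le> ennreal c' * (ennreal (?e x * (norm (y x))\<^sup>2) + ennreal (?e x * (norm (z x))\<^sup>2))"
        using AE_P_fst[OF c(2)] AE_space
      proof eventually_elim
        case (elim x)
        obtain \<omega> s where x: "x = (\<omega>, s)" by (cases x)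
        have s: "s \<in> {0..T}" using elim(2) unfolding x space_P by auto
        have "\<bar>fd Y Z x - fd Y' Z' x\<bar> \<le> c * (\<bar>y x\<bar> + norm (z x))"
          using elim(1) s by (simp add: x fd_def y_def z_def)
        then have "\<bar>fd Y Z x - fd Y' Z' x\<bar>\<^sup>2 \<le> (c * (\<bar>y x\<bar> + norm (z x)))\<^sup>2" by (rule power_mono) simp
        also have "\<dots> \<le> c' * (\<bar>y x\<bar>\<^sup>2 + (norm (z x))\<^sup>2)"
        proof -
          have "(a + b)\<^sup>2 \<le> 2 * (a\<^sup>2 + b\<^sup>2)" for a b :: real
            using sum_squares_bound[of a b] by (simp add: power2_sum)
          from mult_left_mono[OF this[of "\<bar>y x\<bar>" "norm (z x)"], of "c\<^sup>2"] have "(c * (\<bar>y x\<bar> + norm (z x)))\<^sup>2 \<le> 2 * c\<^sup>2 * (\<bar>y x\<bar>\<^sup>2 + (norm (z x))\<^sup>2)"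
            unfolding power_mult_distrib by (simp only: mult_ac zero_le_power2)
          also have "\<dots> \<le> c' * (\<bar>y x\<bar>\<^sup>2 + (norm (z x))\<^sup>2)" unfolding c'_def by (intro mult_right_mono) auto
          finally show ?thesis .
        qed
        finally have "?e x * (norm (fd Y Z x - fd Y' Z' x))\<^sup>2 \<le> ?e x * (c' * ((norm (y x))\<^sup>2 + (norm (z x))\<^sup>2))"
          by (intro mult_left_mono) auto
        also have "\<dots> = c' * (?e x * (norm (y x))\<^sup>2 + ?e x * (norm (z x))\<^sup>2)" by (simp add: algebra_simps)
        finally have "ennreal (?e x * (norm (fd Y Z x - fd Y' Z' x))\<^sup>2) \<le> ennreal (c' * (?e x * (norm (y x))\<^sup>2 + ?e x * (norm (z x))\<^sup>2))"
          by (rule ennreal_leI)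
        also have "\<dots> = ennreal c' * (ennreal (?e x * (norm (y x))\<^sup>2) + ennreal (?e x * (norm (z x))\<^sup>2))"
          using c' by (simp add: ennreal_mult ennreal_plus del: ennreal_plus[symmetric])
        finally show ?case .
      qed
    qed
    also have "\<dots> = ennreal c' * (wnorm \<beta> y + wnorm \<beta> z)"
      unfolding wnorm_def by (subst nn_integral_cmult) (auto simp: nn_integral_add)
    finally show "wnorm \<beta> (\<lambda>x. fd Y Z x - fd Y' Z' x) \<le> ennreal c' * (wnorm \<beta> (\<lambda>(\<omega>, s). Y s \<omega> - Y' s \<omega>) + wnorm \<beta> (\<lambda>(\<omega>, s). Z s \<omega> - Z' s \<omega>))"
      unfolding y z .
  qed
qed

lemma H2_Prog:
  fixes Z :: "real \<Rightarrow> 'w \<Rightarrow> real ^ 'd"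
  shows "Z \<in> H2_space M F T \<Longrightarrow> (\<lambda>(\<omega>, s). Z s \<omega>) \<in> borel_measurable Prog"
  unfolding H2_space_iff using Pred_measurable_Prog by blast

text \<open>Comparison with the driver at y = 0, z = 0, which is square-integrable by
  \<open>H_f\<close>. The Lipschitz bound is applied with weight exponent 0, where
  \<open>wnorm\<close> is \<open>sqnorm\<close>.\<close>

lemma driver_fd:
  assumes Y: "Y \<in> S2_space M F T" and Z: "Z \<in> H2_space M F T"
  shows "driver (fd Y Z)"
proof -
  let ?O = "fd (\<lambda>_ _. 0) (\<lambda>_ _. 0)"
  have m: "fd Y Z \<in> borel_measurable Prog" "?O \<in> borel_measurable Prog"
    by (auto intro!: fd_measurable S2_Prog[OF Y] H2_Prog[OF Z] simp: case_prod_beta')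
  note [measurable] = m[THEN Prog_measurable_P]
  have m': "(\<lambda>(\<omega>, s). Y s \<omega>) \<in> borel_measurable P" "(\<lambda>(\<omega>, s). Z s \<omega>) \<in> borel_measurable P"
    using Prog_measurable_P S2_Prog[OF Y] H2_Prog[OF Z] by auto
  have "(\<lambda>(\<omega>, s). (\<lambda>_ _. 0) s \<omega>) \<in> borel_measurable P" by (simp add: case_prod_beta')
  moreover obtain c where "fd_bound c" using fd_bound_exists by blast
  ultimately have c: "wnorm 0 (\<lambda>x. fd Y Z x - ?O x)
      \<le> ennreal c * (wnorm 0 (\<lambda>(\<omega>, s). Y s \<omega> - 0) + wnorm 0 (\<lambda>(\<omega>, s). Z s \<omega> - 0))"
    by (intro fd_boundD m') (simp_all add: case_prod_beta')
  have w: "wnorm 0 g = sqnorm P g" for g :: "'w \<times> real \<Rightarrow> 'b::{banach, second_countable_topology}"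
    unfolding wnorm_def sqnorm_def by simp
  have "sqnorm P (\<lambda>x. fd Y Z x - ?O x) < \<infinity>"
  proof -
    have "sqnorm P (\<lambda>x. fd Y Z x - ?O x) \<le> ennreal c * (sqnorm P (\<lambda>(\<omega>, s). Y s \<omega>) + sqnorm P (\<lambda>(\<omega>, s). Z s \<omega>))"
      using c unfolding w by simp
    also have "\<dots> < \<infinity>" using S2_sqnorm_P[OF Y] Z unfolding H2_space_iff by (simp add: ennreal_mult_less_top)
    finally show ?thesis .
  qed
  moreover have "sqnorm P ?O < \<infinity>"
  proof -
    have "(\<integral>\<^sup>+\<omega>. (\<integral>\<^sup>+t\<in>{0..T}. ennreal (\<bar>f \<omega> t 0 0\<bar>\<^sup>2) \<partial>lborel) \<partial>M) < \<infinity>" using Hf unfolding H_f_def by blast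
    then show ?thesis using m(2)[THEN Prog_measurable_P] by (subst sqnorm_P_eq[symmetric]) (auto simp: fd_def)
  qed
  moreover have "sqnorm P (fd Y Z) \<le> 2 * sqnorm P (\<lambda>x. fd Y Z x - ?O x) + 2 * sqnorm P ?O"
    using sqnorm_add_le[of "\<lambda>x. fd Y Z x - ?O x" P ?O] by simp
  ultimately have "sqnorm P (fd Y Z) < \<infinity>"
    by (elim order.strict_trans1) (simp add: ennreal_mult_less_top)
  then show ?thesis unfolding driver_def using m by simp
qed

lemma Jint_cong_AE:
  assumes [measurable]: "g \<in> borel_measurable P" "g' \<in> borel_measurable P" and eq: "AE x in P. g x = g' x"
  shows "AE \<omega> in M. \<forall>t\<in>{0..T}. Jint g t T \<omega> = Jint g' t T \<omega>"
  using P.AE_pair[OF eq] AE_space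
proof eventually_elim
  case (elim \<omega>)
  have m: "(\<lambda>s. indicat_real {t..T} s *\<^sub>R h (\<omega>, s)) \<in> borel_measurable lborel"
    if "t \<in> {0..T}" "h \<in> borel_measurable P" for t and h :: "'w \<times> real \<Rightarrow> real"
  proof -
    have "(\<lambda>s. h (\<omega>, s)) \<in> borel_measurable (restrict_space lborel {0..T})" by (rule section_measurable[OF that(2) elim(2)])
    then have [measurable]: "(\<lambda>s. indicat_real {0..T} s *\<^sub>R h (\<omega>, s)) \<in> borel_measurable lborel"
      using borel_measurable_restrict_space_iff[of "{0..T}" lborel "\<lambda>s. h (\<omega>, s)"] by auto
    have "(\<lambda>s. indicat_real {t..T} s *\<^sub>R (indicat_real {0..T} s *\<^sub>R h (\<omega>, s))) \<in> borel_measurable lborel" by measurable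
    also have "(\<lambda>s. indicat_real {t..T} s *\<^sub>R (indicat_real {0..T} s *\<^sub>R h (\<omega>, s))) = (\<lambda>s. indicat_real {t..T} s *\<^sub>R h (\<omega>, s))"
      using that(1) by (auto simp: fun_eq_iff indicator_def)
    finally show ?thesis .
  qed
  have ae: "AE s in lborel. s \<in> {0..T} \<longrightarrow> g (\<omega>, s) = g' (\<omega>, s)"
    using elim(1) by (subst (asm) AE_restrict_space_iff) auto
  show ?case
  proof
    fix t assume t: "t \<in> {0..T}"
    show "Jint g t T \<omega> = Jint g' t T \<omega>"
      unfolding Jint_def set_lebesgue_integral_def
      by (rule integral_cong_AE[OF m[OF t assms(1)] m[OF t assms(2)]])
        (use ae in eventually_elim, use t in \<open>auto simp: indicator_def\<close>)
  qed
qed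

lemma linear_bsde_cong:
  assumes g: "g \<in> borel_measurable P" "g' \<in> borel_measurable P" and eq: "AE x in P. g x = g' x"
    and X: "linear_bsde \<zeta> g X Z I"
  shows "linear_bsde \<zeta> g' X Z I"
proof -
  have "AE \<omega> in M. \<forall>t\<in>{0..T}. X t \<omega> = \<zeta> \<omega> + Jint g' t T \<omega> - (I T \<omega> - I t \<omega>)"
    using Jint_cong_AE[OF g eq] X[unfolded linear_bsde_def, THEN conjunct2, THEN conjunct2]
    by eventually_elim auto
  then show ?thesis using X unfolding linear_bsde_def by blast
qed

lemma S2_deterministic:
  assumes "continuous_on {0..T} k" shows "(\<lambda>t \<omega>. k t) \<in> S2_space M F T"
proof -
  have "(\<lambda>t \<omega>. 0) \<in> S2_space M F T" unfolding S2_space_def using T_pos by (auto simp: SUP_constant)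
  from S2_add_deterministic[OF this assms] show ?thesis by simp
qed

lemma linear_bsde_terminal:
  assumes "driver g" "linear_bsde \<zeta> g X Z I" shows "AE \<omega> in M. X T \<omega> = \<zeta> \<omega>"
  using AE_integrable[OF assms(1)] assms(2)[unfolded linear_bsde_def, THEN conjunct2, THEN conjunct2]
proof eventually_elim
  case (elim \<omega>)
  then show ?case using Jint_combine[OF elim(1), of T] T_pos by auto
qed

lemma linear_bsde_S2: "linear_bsde \<zeta> g X Z I \<Longrightarrow> X \<in> S2_space M F T"
  and linear_bsde_H2: "linear_bsde \<zeta> g X Z I \<Longrightarrow> Z \<in> H2_space M F T"
  unfolding linear_bsde_def has_ito_integral_def by blast+

lemma kap_continuous: "X \<in> S2_space M F T \<Longrightarrow> continuous_on {0..T} (kap X)"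
  unfolding kap_def by (rule skorokhod.future_sup_continuous[OF skorokhod_loss])

definition reflected :: "(real \<Rightarrow> 'w \<Rightarrow> real) \<Rightarrow> real \<Rightarrow> 'w \<Rightarrow> real" where
  "reflected X = (\<lambda>t \<omega>. kap X t + X t \<omega>)"

lemma reflected_S2: "X \<in> S2_space M F T \<Longrightarrow> reflected X \<in> S2_space M F T"
  unfolding reflected_def using S2_add_deterministic[OF _ kap_continuous] by (simp add: add.commute)

text \<open>Adding the future supremum to \<open>X\<close> enforces the constraint, and its decrease
  defines a flat \<open>K\<close>. The driver has to match its fixed-point form only almost
  everywhere, since it enters through time integrals.\<close>

lemma flat_solution_of_linear_bsde:
  assumes g: "driver g" and X: "linear_bsde \<xi> g X Z I" and eq: "AE x in P. g x = fd (reflected X) Z x"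
  shows "deterministic_flat_solution M F T B \<xi> f l (reflected X) Z (\<lambda>t. kap X 0 - kap X t)"
proof -
  note S2 = linear_bsde_S2[OF X] and H2 = linear_bsde_H2[OF X]
  interpret S: skorokhod T "\<lambda>t x. \<integral>\<omega>. l \<omega> t (x + X t \<omega>) \<partial>M" "\<lambda>t. L_op M l t (X t)"
    by (rule skorokhod_loss[OF S2])
  have k: "kap X = S.future_sup" unfolding kap_def ..
  note Y = reflected_S2[OF S2]
  have T: "T \<in> {0..T}" using T_pos by simp
  have "(\<lambda>t \<omega>. kap X 0 - kap X t) \<in> S2_space M F T"
    by (intro S2_deterministic continuous_intros kap_continuous S2)
  then have K: "(\<lambda>t. kap X 0 - kap X t) \<in> A2D_space M F T"
    unfolding A2D_space_def A2_space_def by (auto intro!: mono_onI S.future_sup_antimono simp: k)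
  \<comment> \<open>The terminal constraint in \<open>H_xi\<close> forces \<open>kap X T\<close> to
    vanish; the reflected process therefore still ends at \<xi>.\<close>
  have "(\<integral>\<omega>. l \<omega> T (0 + X T \<omega>) \<partial>M) = (\<integral>\<omega>. l \<omega> T (\<xi> \<omega>) \<partial>M)"
  proof (rule integral_cong_AE)
    show "AE \<omega> in M. l \<omega> T (0 + X T \<omega>) = l \<omega> T (\<xi> \<omega>)" using linear_bsde_terminal[OF g X] by eventually_elim simp
    show "(\<lambda>\<omega>. l \<omega> T (0 + X T \<omega>)) \<in> borel_measurable M" using ell_measurable[OF T S2_F_T[OF S2 T]] by simp
    show "(\<lambda>\<omega>. l \<omega> T (\<xi> \<omega>)) \<in> borel_measurable M"
      by (rule ell_measurable[OF T]) (use xi in \<open>auto simp: H_xi_def L2_space_iff\<close>)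
  qed
  then have "0 \<le> (\<integral>\<omega>. l \<omega> T (0 + X T \<omega>) \<partial>M)" using xi unfolding H_xi_def by simp
  then have kT: "kap X T = 0"
    using S.L_iff[OF T, of 0] S.L_nonneg[OF T] S.future_sup_T unfolding k by simp
  have J: "AE \<omega> in M. \<forall>t\<in>{0..T}. Jint g t T \<omega> = Jint (fd (reflected X) Z) t T \<omega>"
    by (rule Jint_cong_AE[OF driver_P[OF g] driver_P[OF driver_fd[OF Y H2]] eq])
  have "AE \<omega> in M. \<forall>t\<in>{0..T}. reflected X t \<omega> = \<xi> \<omega> + (LINT s:{t..T}|lborel. f \<omega> s (reflected X s \<omega>) (Z s \<omega>))
                     - (I T \<omega> - I t \<omega>) + (kap X 0 - kap X T) - (kap X 0 - kap X t)"
    using J X[unfolded linear_bsde_def, THEN conjunct2, THEN conjunct2]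
  proof eventually_elim
    case (elim \<omega>)
    have "Jint (fd (reflected X) Z) t T \<omega> = (LINT s:{t..T}|lborel. f \<omega> s (reflected X s \<omega>) (Z s \<omega>))" for t
      unfolding Jint_def fd_def by simp
    then show ?case using elim kT by (simp add: reflected_def)
  qed
  then have eqn: "\<exists>I. has_ito_integral M F T B Z I \<and> (AE \<omega> in M. \<forall>t\<in>{0..T}.
       reflected X t \<omega> = \<xi> \<omega> + (LINT s:{t..T}|lborel. f \<omega> s (reflected X s \<omega>) (Z s \<omega>))
                     - (I T \<omega> - I t \<omega>) + (kap X 0 - kap X T) - (kap X 0 - kap X t))"
    using X unfolding linear_bsde_def by blast
  show ?thesis
    unfolding deterministic_flat_solution_def
    using Y H2 K eqn S.future_sup_h_nonneg S.future_sup_flat by (simp add: reflected_def k)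
qed

text \<open>Subtracting the remaining reflection leaves a linear equation whose driver is frozen
  along the given solution. Uniqueness in the deterministic Skorokhod problem then identifies the
  reflection with \<open>kap\<close>.\<close>

lemma linear_bsde_of_flat_solution:
  assumes s: "deterministic_flat_solution M F T B \<xi> f l Y Z K"
  obtains X I where "linear_bsde \<xi> (fd Y Z) X Z I" "\<forall>t\<in>{0..T}. \<forall>\<omega>. Y t \<omega> = reflected X t \<omega>" "\<forall>t\<in>{0..T}. K t = kap X 0 - kap X t"
proof -
  have Y: "Y \<in> S2_space M F T" and Z: "Z \<in> H2_space M F T" and K: "K \<in> A2D_space M F T"
    and nonneg: "\<And>t. t \<in> {0..T} \<Longrightarrow> (\<integral>\<omega>. l \<omega> t (Y t \<omega>) \<partial>M) \<ge> 0"
    and flat: "(LINT t:{0..T}|interval_measure (\<lambda>t. K (max 0 (min T t))). (\<integral>\<omega>. l \<omega> t (Y t \<omega>) \<partial>M)) = 0"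
    using s unfolding deterministic_flat_solution_def by blast+
  obtain I where I: "has_ito_integral M F T B Z I"
    and eqn: "AE \<omega> in M. \<forall>t\<in>{0..T}. Y t \<omega> = \<xi> \<omega> + (LINT s:{t..T}|lborel. f \<omega> s (Y s \<omega>) (Z s \<omega>)) - (I T \<omega> - I t \<omega>) + K T - K t"
    using s unfolding deterministic_flat_solution_def by blast
  \<comment> \<open>\<open>A2D_space\<close> states the properties of \<open>K\<close> at every
    sample point; reading them off takes one such point.\<close>
  obtain \<omega>0 where w0: "\<omega>0 \<in> space M" using not_empty by blast
  have Kc: "continuous_on {0..T} K" and Km: "mono_on {0..T} K" and K0: "K 0 = 0"
    using K w0 unfolding A2D_space_def A2_space_def S2_space_def by auto
  define k where "k t = K T - K t" for t
  define X where "X t \<omega> = Y t \<omega> + - k t" for t \<omega>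
  have S2: "X \<in> S2_space M F T"
    unfolding X_def k_def by (intro S2_add_deterministic Y continuous_intros Kc)
  have "AE \<omega> in M. \<forall>t\<in>{0..T}. X t \<omega> = \<xi> \<omega> + Jint (fd Y Z) t T \<omega> - (I T \<omega> - I t \<omega>)"
    using eqn by eventually_elim (auto simp: X_def k_def Jint_def fd_def)
  then have lin: "linear_bsde \<xi> (fd Y Z) X Z I" unfolding linear_bsde_def using S2 I by blast
  interpret S: skorokhod T "\<lambda>t x. \<integral>\<omega>. l \<omega> t (x + X t \<omega>) \<partial>M" "\<lambda>t. L_op M l t (X t)"
    by (rule skorokhod_loss[OF S2])
  have h: "(\<integral>\<omega>. l \<omega> t (k t + X t \<omega>) \<partial>M) = (\<integral>\<omega>. l \<omega> t (Y t \<omega>) \<partial>M)" for t by (simp add: X_def)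
  have kap: "k t = kap X t" if t: "t \<in> {0..T}" for t
    unfolding kap_def
  proof (rule S.flat_unique[OF Km Kc _ _ _ _ t])
    show "continuous_on {0..T} (\<lambda>t. \<integral>\<omega>. l \<omega> t (k t + X t \<omega>) \<partial>M)"
      unfolding h by (rule expected_loss_continuous_on[OF Y])
  qed (simp_all add: h nonneg flat, simp add: k_def)
  show thesis
  proof (rule that[OF lin])
    show "\<forall>t\<in>{0..T}. \<forall>\<omega>. Y t \<omega> = reflected X t \<omega>" using kap by (simp add: reflected_def X_def)
    show "\<forall>t\<in>{0..T}. K t = kap X 0 - kap X t"
      using kap[of 0] T_pos by (simp add: kap[symmetric] k_def K0)
  qed
qed

end

section \<open>Contraction, existence and uniqueness\<close>

context mean_reflected
begin

definition L_bound :: "real \<Rightarrow> bool" where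
  "L_bound C \<longleftrightarrow> C \<ge> 0 \<and> (\<forall>t\<in>{0..T}. \<forall>X\<in>L2_space M (F t). \<forall>X'\<in>L2_space M (F t).
        \<bar>L_op M l t X - L_op M l t X'\<bar> \<le> C * (\<integral>\<omega>. \<bar>X \<omega> - X' \<omega>\<bar> \<partial>M))"

lemma L_bound_exists: "\<exists>C. L_bound C"
  using HL unfolding H_L_def L_bound_def by blast

text \<open>\<open>H_L\<close> is a bound in L^1 while stability is in L^2; on a probability space
  Cauchy-Schwarz against 1 links them.\<close>

lemma L_bound_sqnorm:
  assumes C: "L_bound C" and t: "t \<in> {0..T}" and X: "X \<in> L2_space M (F t)" "X' \<in> L2_space M (F t)"
    and r: "r \<ge> 0" "sqnorm M (\<lambda>\<omega>. X \<omega> - X' \<omega>) \<le> ennreal r"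
  shows "\<bar>L_op M l t X - L_op M l t X'\<bar> \<le> C * sqrt r"
proof -
  have tT: "t \<le> T" using t by simp
  define D where "D \<omega> = X \<omega> - X' \<omega>" for \<omega>
  have D: "D \<in> L2_space M (F t)" unfolding D_def by (rule L2_diff[OF tT X])
  note [measurable] = L2_measurable[OF tT D]
  have "ennreal (\<integral>\<omega>. (D \<omega>)\<^sup>2 \<partial>M) \<le> ennreal r" using r(2) unfolding D_def[symmetric] sqnorm_eq_integral_L2[OF D] .
  then have "(\<integral>\<omega>. (D \<omega>)\<^sup>2 \<partial>M) \<le> r" using r(1) by simp
  moreover have "\<bar>\<integral>\<omega>. \<bar>D \<omega>\<bar> * 1 \<partial>M\<bar> \<le> sqrt (\<integral>\<omega>. \<bar>D \<omega>\<bar>\<^sup>2 \<partial>M) * sqrt (\<integral>\<omega>. 1\<^sup>2 \<partial>M)"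
    by (rule Cauchy_Schwarz_integral') (use L2_square_integrable[OF D] in auto)
  ultimately have "(\<integral>\<omega>. \<bar>D \<omega>\<bar> \<partial>M) \<le> sqrt r"
    by (simp add: prob_space) (meson order_trans real_sqrt_le_mono abs_le_D1)
  moreover have "\<bar>L_op M l t X - L_op M l t X'\<bar> \<le> C * (\<integral>\<omega>. \<bar>D \<omega>\<bar> \<partial>M)"
    using C t X unfolding L_bound_def D_def by blast
  moreover have "C \<ge> 0" using C unfolding L_bound_def by blast
  ultimately show ?thesis by (meson mult_left_mono order_trans)
qed

lemma driver_wnorm_finite: "driver g \<Longrightarrow> \<beta> \<ge> 0 \<Longrightarrow> wnorm \<beta> g < \<infinity>"
  by (rule order.strict_trans1[OF wnorm_sqnorm(2)]) (auto simp: driver_def ennreal_mult_less_top Prog_measurable_P)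

text \<open>A difference of suprema is at most the supremum of the differences. At each time s \<ge>
  t the stability bound is \<open>tail\<close> at \<open>s\<close>, which is at most
  \<open>tail\<close> at \<open>t\<close>; finiteness of the latter provides the real bound
  \<open>r\<close>.\<close>

lemma kap_dist:
  assumes C: "L_bound C" and g: "driver g" "driver g'" and X: "linear_bsde \<xi> g X Z I" "linear_bsde \<xi> g' X' Z' I'"
    and t: "t \<in> {0..T}" and \<gamma>: "\<gamma> > 0"
  shows "ennreal ((kap X t - kap X' t)\<^sup>2) \<le> ennreal (C\<^sup>2) * tail \<gamma> (\<lambda>x. g x - g' x) t"
proof -
  note d = driver_diff[OF g]
  note S2 = linear_bsde_S2[OF X(1)] linear_bsde_S2[OF X(2)]
  have "tail \<gamma> (\<lambda>x. g x - g' x) t \<le> tail \<gamma> (\<lambda>x. g x - g' x) 0" using tail_mono[OF \<gamma>] t by simp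
  also have "\<dots> \<le> ennreal (1 / \<gamma>) * wnorm (2 * \<gamma>) (\<lambda>x. g x - g' x)" by (rule tail_0_le[OF \<gamma> driver_P[OF d]])
  also have "\<dots> < \<infinity>" using driver_wnorm_finite[OF d, of "2 * \<gamma>"] \<gamma> by (simp add: ennreal_mult_less_top)
  finally obtain r where r: "r \<ge> 0" "tail \<gamma> (\<lambda>x. g x - g' x) t = ennreal r"
    by (cases "tail \<gamma> (\<lambda>x. g x - g' x) t") auto
  have "\<bar>kap X t - kap X' t\<bar> \<le> C * sqrt r"
    unfolding kap_def
  proof (rule future_sup_dist[OF skorokhod_loss[OF S2(1)] skorokhod_loss[OF S2(2)] t])
    fix s assume s: "t \<le> s" "s \<le> T"
    then have s': "s \<in> {0..T}" using t by simp
    have "sqnorm M (\<lambda>\<omega>. X s \<omega> - X' s \<omega>) \<le> tail \<gamma> (\<lambda>x. g x - g' x) s"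
      using linear_bsde_stability[OF g X s' \<gamma>] by (rule order_trans[rotated]) simp
    also have "\<dots> \<le> ennreal r" using tail_mono[OF \<gamma> s(1)] unfolding r(2)[symmetric] .
    finally show "\<bar>L_op M l s (X s) - L_op M l s (X' s)\<bar> \<le> C * sqrt r"
      by (rule L_bound_sqnorm[OF C s' S2_L2[OF S2(1) s'] S2_L2[OF S2(2) s'] r(1)])
  qed
  then have "\<bar>kap X t - kap X' t\<bar>\<^sup>2 \<le> (C * sqrt r)\<^sup>2" by (rule power_mono) simp
  then have "ennreal ((kap X t - kap X' t)\<^sup>2) \<le> ennreal (C\<^sup>2 * r)"
    using r(1) by (intro ennreal_leI) (simp add: power_mult_distrib)
  then show ?thesis using r by (simp add: ennreal_mult)
qed

text \<open>The squared triangle inequality doubles both parts: 2 C^2 comes from the reflection, 2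
  from \<open>X\<close>.\<close>

lemma reflected_dist:
  assumes C: "L_bound C" and g: "driver g" "driver g'" and X: "linear_bsde \<xi> g X Z I" "linear_bsde \<xi> g' X' Z' I'"
    and t: "t \<in> {0..T}" and \<gamma>: "\<gamma> > 0"
  shows "sqnorm M (\<lambda>\<omega>. reflected X t \<omega> - reflected X' t \<omega>) \<le> ennreal (2 + 2 * C\<^sup>2) * tail \<gamma> (\<lambda>x. g x - g' x) t"
proof -
  let ?t = "tail \<gamma> (\<lambda>x. g x - g' x) t"
  note S2 = linear_bsde_S2[OF X(1)] linear_bsde_S2[OF X(2)]
  have tT: "t \<le> T" using t by simp
  note [measurable] = L2_measurable[OF tT S2_L2[OF S2(1) t]] L2_measurable[OF tT S2_L2[OF S2(2) t]]
  have "sqnorm M (\<lambda>\<omega>. reflected X t \<omega> - reflected X' t \<omega>) = sqnorm M (\<lambda>\<omega>. (kap X t - kap X' t) + (X t \<omega> - X' t \<omega>))"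
    unfolding reflected_def by (simp add: algebra_simps)
  also have "\<dots> \<le> 2 * sqnorm M (\<lambda>\<omega>. kap X t - kap X' t) + 2 * sqnorm M (\<lambda>\<omega>. X t \<omega> - X' t \<omega>)"
    by (rule sqnorm_add_le) auto
  also have "\<dots> \<le> 2 * (ennreal (C\<^sup>2) * ?t) + 2 * ?t"
  proof (rule add_mono)
    have "sqnorm M (\<lambda>\<omega>. kap X t - kap X' t) = ennreal ((kap X t - kap X' t)\<^sup>2)"
      unfolding sqnorm_def by (simp add: emeasure_space_1)
    with kap_dist[OF C g X t \<gamma>] show "2 * sqnorm M (\<lambda>\<omega>. kap X t - kap X' t) \<le> 2 * (ennreal (C\<^sup>2) * ?t)"
      by (intro mult_left_mono) auto
    have "sqnorm M (\<lambda>\<omega>. X t \<omega> - X' t \<omega>) \<le> ?t"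
      using linear_bsde_stability[OF g X t \<gamma>] by (rule order_trans[rotated]) simp
    then show "2 * sqnorm M (\<lambda>\<omega>. X t \<omega> - X' t \<omega>) \<le> 2 * ?t" by (intro mult_left_mono) auto
  qed
  also have "2 * (ennreal (C\<^sup>2) * ?t) + 2 * ?t = (2 * ennreal (C\<^sup>2) + 2) * ?t" by (simp add: distrib_right mult.assoc)
  also have "2 * ennreal (C\<^sup>2) + 2 = ennreal (2 + 2 * C\<^sup>2)"
    by (simp add: ennreal_mult ennreal_plus add.commute flip: ennreal_numeral del: ennreal_numeral)
  finally show ?thesis .
qed

text \<open>With the time integral outermost, the estimate at a fixed time applies under it, and
  \<open>tail_weighted_integral\<close> evaluates what remains.\<close>

lemma wnorm_reflected_dist:
  assumes C: "L_bound C" and g: "driver g" "driver g'" and X: "linear_bsde \<xi> g X Z I" "linear_bsde \<xi> g' X' Z' I'"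
    and \<gamma>: "\<gamma> > 0"
  shows "wnorm (2 * \<gamma>) (\<lambda>(\<omega>, s). reflected X s \<omega> - reflected X' s \<omega>) \<le> ennreal ((2 + 2 * C\<^sup>2) / \<gamma>\<^sup>2) * wnorm (2 * \<gamma>) (\<lambda>x. g x - g' x)"
proof -
  let ?y = "\<lambda>x. (\<lambda>(\<omega>, s). reflected X s \<omega>) x - (\<lambda>(\<omega>, s). reflected X' s \<omega>) x"
  let ?c = "2 + 2 * C\<^sup>2"
  have "(\<lambda>(\<omega>, s). reflected X s \<omega>) \<in> borel_measurable P" "(\<lambda>(\<omega>, s). reflected X' s \<omega>) \<in> borel_measurable P"
    using reflected_S2[OF linear_bsde_S2[OF X(1)]] reflected_S2[OF linear_bsde_S2[OF X(2)]] S2_Prog Prog_measurable_P by blast+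
  then have y[measurable]: "?y \<in> borel_measurable P" by (rule borel_measurable_diff)
  note [measurable] = snd_measurable_P
  have "wnorm (2 * \<gamma>) (\<lambda>(\<omega>, s). reflected X s \<omega> - reflected X' s \<omega>) = wnorm (2 * \<gamma>) ?y"
    by (rule arg_cong[of _ _ "wnorm (2 * \<gamma>)"]) auto
  also have "\<dots> = (\<integral>\<^sup>+s. (\<integral>\<^sup>+\<omega>. ennreal (exp (2 * \<gamma> * snd (\<omega>, s)) * (norm (?y (\<omega>, s)))\<^sup>2) \<partial>M) \<partial>restrict_space lborel {0..T})"
    unfolding wnorm_def by (rule P.nn_integral_snd[symmetric]) measurable
  also have "\<dots> \<le> (\<integral>\<^sup>+s. ennreal (?c * exp (2 * \<gamma> * s)) * tail \<gamma> (\<lambda>x. g x - g' x) s \<partial>restrict_space lborel {0..T})"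
  proof (rule nn_integral_mono)
    fix s assume "s \<in> space (restrict_space lborel {0..T})"
    then have s: "s \<in> {0..T}" by (simp add: space_restrict_space)
    have "?y \<in> borel_measurable P" by (rule y)
    have [measurable]: "(\<lambda>\<omega>. reflected X s \<omega> - reflected X' s \<omega>) \<in> borel_measurable M"
    proof -
      have "s \<le> T" using s by simp
      from L2_measurable[OF this] show ?thesis
        using S2_L2[OF reflected_S2[OF linear_bsde_S2[OF X(1)]] s] S2_L2[OF reflected_S2[OF linear_bsde_S2[OF X(2)]] s] by auto
    qed
    have "(\<integral>\<^sup>+\<omega>. ennreal (exp (2 * \<gamma> * snd (\<omega>, s)) * (norm (?y (\<omega>, s)))\<^sup>2) \<partial>M)
       = ennreal (exp (2 * \<gamma> * s)) * sqnorm M (\<lambda>\<omega>. reflected X s \<omega> - reflected X' s \<omega>)"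
      unfolding sqnorm_def by (subst nn_integral_cmult[symmetric]) (auto simp: ennreal_mult)
    also have "\<dots> \<le> ennreal (exp (2 * \<gamma> * s)) * (ennreal ?c * tail \<gamma> (\<lambda>x. g x - g' x) s)"
      by (rule mult_left_mono[OF reflected_dist[OF C g X s \<gamma>]]) simp
    also have "\<dots> = ennreal (?c * exp (2 * \<gamma> * s)) * tail \<gamma> (\<lambda>x. g x - g' x) s"
      by (subst ennreal_mult) (auto simp: mult_ac)
    finally show "(\<integral>\<^sup>+\<omega>. ennreal (exp (2 * \<gamma> * snd (\<omega>, s)) * (norm (?y (\<omega>, s)))\<^sup>2) \<partial>M)
      \<le> ennreal (?c * exp (2 * \<gamma> * s)) * tail \<gamma> (\<lambda>x. g x - g' x) s" .
  qed
  also have "\<dots> = (\<integral>\<^sup>+s\<in>{0..T}. ennreal (?c * exp (2 * \<gamma> * s)) * tail \<gamma> (\<lambda>x. g x - g' x) s \<partial>lborel)"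
    by (rule nn_integral_restrict_space) simp
  also have "\<dots> \<le> ennreal (?c / \<gamma>\<^sup>2) * wnorm (2 * \<gamma>) (\<lambda>x. g x - g' x)"
    by (rule tail_weighted_integral[OF \<gamma> _ driver_P[OF driver_diff[OF g]]]) simp
  finally show ?thesis .
qed

lemma wnorm_Z_dist:
  assumes g: "driver g" "driver g'" and X: "linear_bsde \<xi> g X Z I" "linear_bsde \<xi> g' X' Z' I'" and \<gamma>: "\<gamma> > 0"
  shows "wnorm (2 * \<gamma>) (\<lambda>(\<omega>, s). Z s \<omega> - Z' s \<omega>) \<le> ennreal (3 / \<gamma>) * wnorm (2 * \<gamma>) (\<lambda>x. g x - g' x)"
proof (rule wnorm_le_of_tails[OF \<gamma> driver_P[OF driver_diff[OF g]]])
  have "(\<lambda>(\<omega>, s). Z s \<omega>) \<in> borel_measurable P" "(\<lambda>(\<omega>, s). Z' s \<omega>) \<in> borel_measurable P"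
    using linear_bsde_H2[OF X(1)] linear_bsde_H2[OF X(2)] H2_Prog Prog_measurable_P by blast+
  from borel_measurable_diff[OF this] show "(\<lambda>(\<omega>, s). Z s \<omega> - Z' s \<omega>) \<in> borel_measurable P"
    by (simp add: case_prod_beta')
  fix t assume t: "t \<in> {0..T}"
  have "sqnorm P (\<lambda>x. indicat_real {t<..T} (snd x) *\<^sub>R (case x of (\<omega>, s) \<Rightarrow> Z s \<omega> - Z' s \<omega>))
    = sqnorm P (\<lambda>(\<omega>, r). indicat_real {t<..T} r *\<^sub>R (Z r \<omega> - Z' r \<omega>))"
    by (simp add: case_prod_beta')
  also have "\<dots> \<le> tail \<gamma> (\<lambda>x. g x - g' x) t"
    using linear_bsde_stability[OF g X t \<gamma>] by (rule order_trans[rotated]) simp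
  finally show "sqnorm P (\<lambda>x. indicat_real {t<..T} (snd x) *\<^sub>R (case x of (\<omega>, s) \<Rightarrow> Z s \<omega> - Z' s \<omega>)) \<le> tail \<gamma> (\<lambda>x. g x - g' x) t" .
qed

text \<open>A relation and not a function: the linear equation determines \<open>X\<close> and
  \<open>Z\<close> only up to null sets and only at times in {0..T}.\<close>

definition picard :: "('w \<times> real \<Rightarrow> real) \<Rightarrow> ('w \<times> real \<Rightarrow> real) \<Rightarrow> bool" where
  "picard g g' \<longleftrightarrow> (\<exists>X Z I. linear_bsde \<xi> g X Z I \<and> g' = fd (reflected X) Z)"

lemma picard_exists: "driver g \<Longrightarrow> \<exists>g'. picard g g'"
  using linear_bsde_exists[of g \<xi>] xi unfolding picard_def H_xi_def by blast

lemma picard_driver: "picard g g' \<Longrightarrow> driver g'"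
  unfolding picard_def using driver_fd reflected_S2 linear_bsde_S2 linear_bsde_H2 by blast

text \<open>The Lipschitz constant of the driver and the constant of \<open>H_L\<close> are fixed
  before the weight, so a large \<gamma> beats both. The ratio is taken to be 1/4 because the
  squared Cauchy criterion is stated for that ratio.\<close>

lemma picard_contraction:
  "\<exists>\<gamma>>0. \<forall>g g' h h'. driver g \<longrightarrow> driver h \<longrightarrow> picard g g' \<longrightarrow> picard h h' \<longrightarrow>
     wnorm (2 * \<gamma>) (\<lambda>x. g' x - h' x) \<le> ennreal (1 / 4) * wnorm (2 * \<gamma>) (\<lambda>x. g x - h x)"
proof -
  obtain C where C: "L_bound C" using L_bound_exists by blast
  obtain c where c: "fd_bound c" using fd_bound_exists by blast
  then have c0: "c > 0" unfolding fd_bound_def by blast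
  \<comment> \<open>The \<open>Y\<close> part gives (2 + 2 C^2) / \<gamma>^2 and the
    \<open>Z\<close> part 3 / \<gamma>. For \<gamma> \<ge> 1 their sum is at most (5 + 2 C^2) /
    \<gamma>, so \<gamma> \<ge> 4 A yields the ratio 1/4.\<close>
  define A where "A = c * (5 + 2 * C\<^sup>2)"
  define \<gamma> where "\<gamma> = max 1 (4 * A)"
  have \<gamma>: "\<gamma> \<ge> 1" "\<gamma> \<ge> 4 * A" "\<gamma> > 0" unfolding \<gamma>_def by auto
  have "wnorm (2 * \<gamma>) (\<lambda>x. g' x - h' x) \<le> ennreal (1 / 4) * wnorm (2 * \<gamma>) (\<lambda>x. g x - h x)"
    if "driver g" "driver h" "picard g g'" "picard h h'" for g g' h h'
  proof -
    let ?w = "wnorm (2 * \<gamma>) (\<lambda>x. g x - h x)"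
    obtain X Z I where X: "linear_bsde \<xi> g X Z I" and g': "g' = fd (reflected X) Z" using \<open>picard g g'\<close> unfolding picard_def by blast
    obtain X' Z' I' where X': "linear_bsde \<xi> h X' Z' I'" and h': "h' = fd (reflected X') Z'" using \<open>picard h h'\<close> unfolding picard_def by blast
    have "wnorm (2 * \<gamma>) (\<lambda>x. g' x - h' x) \<le> ennreal c * (wnorm (2 * \<gamma>) (\<lambda>(\<omega>, s). reflected X s \<omega> - reflected X' s \<omega>) + wnorm (2 * \<gamma>) (\<lambda>(\<omega>, s). Z s \<omega> - Z' s \<omega>))"
      unfolding g' h'
      by (rule fd_boundD[OF c]; rule Prog_measurable_P; rule S2_Prog H2_Prog; (rule reflected_S2)?; rule linear_bsde_S2 linear_bsde_H2; rule X X')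
    also have "\<dots> \<le> ennreal c * (ennreal ((2 + 2 * C\<^sup>2) / \<gamma>\<^sup>2) * ?w + ennreal (3 / \<gamma>) * ?w)"
      by (rule mult_left_mono[OF add_mono[OF wnorm_reflected_dist[OF C that(1,2) X X' \<gamma>(3)] wnorm_Z_dist[OF that(1,2) X X' \<gamma>(3)]]]) simp
    also have "\<dots> = ennreal (c * ((2 + 2 * C\<^sup>2) / \<gamma>\<^sup>2 + 3 / \<gamma>)) * ?w"
      using c0 \<gamma>(3) by (simp add: ennreal_mult ennreal_plus distrib_right mult.assoc)
    also have "\<dots> \<le> ennreal (1 / 4) * ?w"
    proof (rule mult_right_mono[OF ennreal_leI])
      have "\<gamma> \<le> \<gamma>\<^sup>2" using \<gamma>(1) by (simp add: power2_eq_square)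
      then have "(2 + 2 * C\<^sup>2) / \<gamma>\<^sup>2 \<le> (2 + 2 * C\<^sup>2) / \<gamma>" using \<gamma>(3) by (intro divide_left_mono) auto
      then have "(2 + 2 * C\<^sup>2) / \<gamma>\<^sup>2 + 3 / \<gamma> \<le> (5 + 2 * C\<^sup>2) / \<gamma>" by (simp add: add_divide_distrib)
      from mult_left_mono[OF this, of c] have "c * ((2 + 2 * C\<^sup>2) / \<gamma>\<^sup>2 + 3 / \<gamma>) \<le> A / \<gamma>" using c0 by (simp add: A_def)
      also have "\<dots> \<le> 1 / 4" using \<gamma> by (simp add: field_simps)
      finally show "c * ((2 + 2 * C\<^sup>2) / \<gamma>\<^sup>2 + 3 / \<gamma>) \<le> 1 / 4" .
    qed simp
    finally show ?thesis .
  qed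
  then show ?thesis using \<gamma>(3) by blast
qed

text \<open>Banach's iteration, with a chosen value of the relation at each driver. The limit is
  taken over the progressive sigma-algebra, so it is again a driver; it is fixed only almost
  everywhere, which is all that the time integrals see.\<close>

lemma picard_fixed_point: "\<exists>g g'. driver g \<and> picard g g' \<and> (AE x in P. g x = g' x)"
proof -
  obtain \<gamma> where \<gamma>: "\<gamma> > 0" and contr: "\<And>g g' h h'. driver g \<Longrightarrow> driver h \<Longrightarrow> picard g g' \<Longrightarrow> picard h h' \<Longrightarrow>
     wnorm (2 * \<gamma>) (\<lambda>x. g' x - h' x) \<le> ennreal (1 / 4) * wnorm (2 * \<gamma>) (\<lambda>x. g x - h x)"
    using picard_contraction by blast
  have b: "2 * \<gamma> \<ge> 0" using \<gamma> by simp
  define \<Phi> where "\<Phi> g = (SOME g'. picard g g')" for g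
  have \<Phi>: "picard g (\<Phi> g)" if "driver g" for g unfolding \<Phi>_def by (rule someI_ex[OF picard_exists[OF that]])
  define G where "G n = (\<Phi> ^^ n) (\<lambda>_. 0)" for n
  have G_Suc: "G (Suc n) = \<Phi> (G n)" for n by (simp add: G_def)
  have dG: "driver (G n)" for n
  proof (induction n)
    case 0 show ?case by (simp add: G_def driver_def sqnorm_def)
  next
    case (Suc n) then show ?case unfolding G_Suc by (rule picard_driver[OF \<Phi>])
  qed
  note GP[measurable] = driver_P[OF dG]
  define a where "a = enn2real (wnorm (2 * \<gamma>) (\<lambda>x. G 1 x - G 0 x))"
  have a: "a \<ge> 0" "wnorm (2 * \<gamma>) (\<lambda>x. G 1 x - G 0 x) = ennreal a"
    using driver_wnorm_finite[OF driver_diff[OF dG dG] b] unfolding a_def by (auto simp: less_top[symmetric])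
  have geo: "wnorm (2 * \<gamma>) (\<lambda>x. G (Suc n) x - G n x) \<le> ennreal (a * (1/4)^n)" for n
  proof (induction n)
    case 0 then show ?case using a by simp
  next
    case (Suc n)
    have "wnorm (2 * \<gamma>) (\<lambda>x. G (Suc (Suc n)) x - G (Suc n) x) \<le> ennreal (1 / 4) * wnorm (2 * \<gamma>) (\<lambda>x. G (Suc n) x - G n x)"
      unfolding G_Suc[of "Suc n"] G_Suc[of n] by (rule contr[OF _ dG \<Phi> \<Phi>[OF dG]]) (auto simp: G_Suc[symmetric] dG)
    also have "\<dots> \<le> ennreal (1 / 4) * ennreal (a * (1/4)^n)" by (rule mult_left_mono[OF Suc]) simp
    also have "\<dots> = ennreal (a * (1/4)^Suc n)" using a(1) by (subst ennreal_mult[symmetric]) (auto simp: mult_ac)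
    finally show ?case .
  qed
  have "sqnorm P (\<lambda>x. G (Suc n) x - G n x) \<le> ennreal (a * (1/4)^n)" for n
    by (rule order_trans[OF wnorm_sqnorm(1)[OF b] geo]) measurable
  from sqnorm_Cauchy_geometric[OF GP this a(1)] have Cauchy: "sqnorm_Cauchy P G" .
  have GProg: "G n \<in> borel_measurable Prog" for n using dG unfolding driver_def by blast
  obtain g where g: "g \<in> borel_measurable Prog" and lim: "(\<lambda>k. sqnorm P (\<lambda>x. G k x - g x)) \<longlonglongrightarrow> 0"
    using Riesz_Fischer[OF subalgebra_Prog GProg Cauchy] .
  note [measurable] = Prog_measurable_P[OF g]
  have "sqnorm P g < \<infinity>"
  proof -
    obtain k where k: "sqnorm P (\<lambda>x. G k x - g x) < 1"
      using order_tendstoD(2)[OF lim, of 1] by (auto simp: eventually_sequentially)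
    have "sqnorm P (\<lambda>x. G k x - (G k x - g x)) \<le> 2 * sqnorm P (G k) + 2 * sqnorm P (\<lambda>x. G k x - g x)"
      by (rule sqnorm_diff_le) measurable
    moreover have "sqnorm P (G k) < \<infinity>" using dG unfolding driver_def by blast
    moreover have "sqnorm P (\<lambda>x. G k x - g x) < \<infinity>" using less_trans[OF k, of \<infinity>] by simp
    ultimately show ?thesis by (auto elim!: order.strict_trans1 simp: ennreal_mult_less_top)
  qed
  then have dg: "driver g" using g unfolding driver_def by blast
  note d\<Phi> = picard_driver[OF \<Phi>[OF dg]]
  note [measurable] = driver_P[OF d\<Phi>]
  let ?E = "ennreal (exp (2 * \<gamma> * T))"
  \<comment> \<open>The iterate \<open>G (Suc k)\<close> is near \<open>\<Phi> g\<close> by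
    contraction and near \<open>g\<close> by convergence. \<open>?E\<close> is the cost of returning
    from the weighted to the plain norm.\<close>
  have "sqnorm P (\<lambda>x. \<Phi> g x - g x) \<le> 2 * ?E * sqnorm P (\<lambda>x. G k x - g x) + 2 * sqnorm P (\<lambda>x. G (Suc k) x - g x)" for k
  proof -
    have "sqnorm P (\<lambda>x. \<Phi> g x - G (Suc k) x) \<le> wnorm (2 * \<gamma>) (\<lambda>x. \<Phi> g x - G (Suc k) x)"
      by (rule wnorm_sqnorm(1)[OF b]) measurable
    also have "\<dots> \<le> ennreal (1 / 4) * wnorm (2 * \<gamma>) (\<lambda>x. g x - G k x)"
      unfolding G_Suc by (rule contr[OF dg dG \<Phi>[OF dg] \<Phi>[OF dG]])
    also have "\<dots> \<le> 1 * wnorm (2 * \<gamma>) (\<lambda>x. g x - G k x)" by (rule mult_right_mono) (auto simp: ennreal_le_1)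
    also have "\<dots> \<le> ?E * sqnorm P (\<lambda>x. g x - G k x)"
      by (simp only: mult_1) (rule wnorm_sqnorm(2)[OF b], measurable)
    finally have 1: "sqnorm P (\<lambda>x. \<Phi> g x - G (Suc k) x) \<le> ?E * sqnorm P (\<lambda>x. G k x - g x)"
      by (simp only: sqnorm_minus_commute[of P g "G k"])
    have "sqnorm P (\<lambda>x. \<Phi> g x - g x) \<le> 2 * sqnorm P (\<lambda>x. \<Phi> g x - G (Suc k) x) + 2 * sqnorm P (\<lambda>x. G (Suc k) x - g x)"
      by (rule sqnorm_diff_triangle) measurable
    also have "\<dots> \<le> 2 * (?E * sqnorm P (\<lambda>x. G k x - g x)) + 2 * sqnorm P (\<lambda>x. G (Suc k) x - g x)"
      by (rule add_right_mono[OF mult_left_mono[OF 1]]) simp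
    finally show ?thesis by (simp only: mult.assoc)
  qed
  moreover have "(\<lambda>k. 2 * ?E * sqnorm P (\<lambda>x. G k x - g x) + 2 * sqnorm P (\<lambda>x. G (Suc k) x - g x)) \<longlonglongrightarrow> 0"
    by (rule ennreal_tendsto_0_lincomb[OF lim LIMSEQ_Suc[OF lim]]) (auto simp: ennreal_mult_less_top)
  ultimately have "sqnorm P (\<lambda>x. \<Phi> g x - g x) \<le> 0" by (intro LIMSEQ_le_const) auto
  then have "AE x in P. \<Phi> g x - g x = 0" by (subst (asm) le_zero_eq, subst (asm) sqnorm_eq_0_iff) auto
  then have "AE x in P. g x = \<Phi> g x" by eventually_elim simp
  then show ?thesis using dg \<Phi>[OF dg] by blast
qed

lemma flat_solution_exists: "\<exists>Y Z K. deterministic_flat_solution M F T B \<xi> f l Y Z K"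
  using picard_fixed_point flat_solution_of_linear_bsde unfolding picard_def by blast

text \<open>The exceptional sets of the countably many grid times form one null set; off it,
  continuity extends equality to all times.\<close>

lemma S2_indistinguishable:
  assumes X: "X \<in> S2_space M F T" "X' \<in> S2_space M F T" and eq: "\<And>t. t \<in> {0..T} \<Longrightarrow> AE \<omega> in M. X t \<omega> = X' t \<omega>"
  shows "AE \<omega> in M. \<forall>t\<in>{0..T}. X t \<omega> = X' t \<omega>"
proof -
  have "AE \<omega> in M. \<forall>n k. k \<le> Suc n \<longrightarrow> X (grid (Suc n) k) \<omega> = X' (grid (Suc n) k) \<omega>"
    unfolding AE_all_countable
  proof (intro allI)
    fix n k show "AE \<omega> in M. k \<le> Suc n \<longrightarrow> X (grid (Suc n) k) \<omega> = X' (grid (Suc n) k) \<omega>"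
    proof (cases "k \<le> Suc n")
      case True
      then have "grid (Suc n) k \<in> {0..T}" using grid_bounds[OF True] by simp
      from eq[OF this] show ?thesis by eventually_elim simp
    qed simp
  qed
  then show ?thesis using AE_space
  proof eventually_elim
    case (elim \<omega>)
    show ?case
    proof
      fix t assume t: "t \<in> {0..T}"
      define k where "k n = nat \<lfloor>t * real (Suc n) / T\<rfloor>" for n
      have t': "0 \<le> t" "t \<le> T" using t by auto
      note k = grid_approx[OF t' k_def]
      have g: "grid (Suc n) (k n) \<in> {0..T}" for n using grid_bounds[OF k(1)[of n]] by simp
      have lim: "(\<lambda>n. grid (Suc n) (k n)) \<longlonglongrightarrow> t" unfolding grid_def by (rule k(2))
      have "(\<lambda>n. X (grid (Suc n) (k n)) \<omega>) \<longlonglongrightarrow> X t \<omega>"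
        by (rule continuous_on_tendsto_compose[OF S2_continuous[OF X(1) elim(2)] lim t]) (use g in auto)
      moreover have "(\<lambda>n. X' (grid (Suc n) (k n)) \<omega>) \<longlonglongrightarrow> X' t \<omega>"
        by (rule continuous_on_tendsto_compose[OF S2_continuous[OF X(2) elim(2)] lim t]) (use g in auto)
      moreover have "(\<lambda>n. X (grid (Suc n) (k n)) \<omega>) = (\<lambda>n. X' (grid (Suc n) (k n)) \<omega>)" using elim(1) k(1) by auto
      ultimately show "X t \<omega> = X' t \<omega>" using LIMSEQ_unique by metis
    qed
  qed
qed

text \<open>\<open>Y\<close> and \<open>reflected X\<close> agree on {0..T} only, so their drivers
  agree on \<open>P\<close> but may differ as functions. Passing to the driver built from
  \<open>reflected X\<close> makes the fixed-point relation \<open>picard g g\<close> hold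
  literally.\<close>

lemma flat_solution_driver:
  assumes s: "deterministic_flat_solution M F T B \<xi> f l Y Z K"
  obtains g X I where "driver g" "linear_bsde \<xi> g X Z I" "picard g g"
    "\<forall>t\<in>{0..T}. \<forall>\<omega>. Y t \<omega> = reflected X t \<omega>" "\<forall>t\<in>{0..T}. K t = kap X 0 - kap X t"
proof -
  obtain X I where X: "linear_bsde \<xi> (fd Y Z) X Z I" and Y: "\<forall>t\<in>{0..T}. \<forall>\<omega>. Y t \<omega> = reflected X t \<omega>"
    and K: "\<forall>t\<in>{0..T}. K t = kap X 0 - kap X t"
    using linear_bsde_of_flat_solution[OF s] .
  note S2 = linear_bsde_S2[OF X] and H2 = linear_bsde_H2[OF X]
  have d: "driver (fd Y Z)"
    by (rule driver_fd[OF _ H2]) (use s in \<open>auto simp: deterministic_flat_solution_def\<close>)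
  have d': "driver (fd (reflected X) Z)" by (rule driver_fd[OF reflected_S2[OF S2] H2])
  have "AE x in P. fd Y Z x = fd (reflected X) Z x"
    by (rule AE_I2) (auto simp: fd_def space_P Y)
  from linear_bsde_cong[OF driver_P[OF d] driver_P[OF d'] this X]
  have lin: "linear_bsde \<xi> (fd (reflected X) Z) X Z I" .
  then have "picard (fd (reflected X) Z) (fd (reflected X) Z)" unfolding picard_def by blast
  from that[OF d' lin this Y K] show thesis .
qed

text \<open>The weighted distance of the two drivers is finite and at most a quarter of itself,
  hence 0. Every other distance, that of \<open>X\<close>, of \<open>kap\<close> and of
  \<open>Z\<close>, is bounded by a multiple of it.\<close>

lemma flat_solution_unique:
  assumes s: "deterministic_flat_solution M F T B \<xi> f l Y Z K" and s': "deterministic_flat_solution M F T B \<xi> f l Y' Z' K'"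
  shows "same_solution M T Y Z K Y' Z' K'"
proof -
  obtain g X I where g: "driver g" and X: "linear_bsde \<xi> g X Z I" and p: "picard g g"
    and Y: "\<forall>t\<in>{0..T}. \<forall>\<omega>. Y t \<omega> = reflected X t \<omega>" and K: "\<forall>t\<in>{0..T}. K t = kap X 0 - kap X t"
    using flat_solution_driver[OF s] .
  obtain g' X' I' where g': "driver g'" and X': "linear_bsde \<xi> g' X' Z' I'" and p': "picard g' g'"
    and Y': "\<forall>t\<in>{0..T}. \<forall>\<omega>. Y' t \<omega> = reflected X' t \<omega>" and K': "\<forall>t\<in>{0..T}. K' t = kap X' 0 - kap X' t"
    using flat_solution_driver[OF s'] .
  obtain \<gamma> where \<gamma>: "\<gamma> > 0" and contr: "\<And>g g' h h'. driver g \<Longrightarrow> driver h \<Longrightarrow> picard g g' \<Longrightarrow> picard h h' \<Longrightarrow>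
     wnorm (2 * \<gamma>) (\<lambda>x. g' x - h' x) \<le> ennreal (1 / 4) * wnorm (2 * \<gamma>) (\<lambda>x. g x - h x)"
    using picard_contraction by blast
  let ?w = "wnorm (2 * \<gamma>) (\<lambda>x. g x - g' x)" and ?tail = "tail \<gamma> (\<lambda>x. g x - g' x)"
  have "?w \<le> ennreal (1 / 4) * ?w" by (rule contr[OF g g' p p'])
  moreover have "?w < \<infinity>" using driver_wnorm_finite[OF driver_diff[OF g g'], of "2 * \<gamma>"] \<gamma> by simp
  ultimately have w: "?w = 0"
    by (cases ?w) (auto simp: ennreal_mult[symmetric] simp del: ennreal_le_iff2)
  have tail: "?tail t = 0" if t: "t \<in> {0..T}" for t
  proof -
    have "?tail t \<le> ?tail 0" using tail_mono[OF \<gamma>] t by simp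
    also have "\<dots> \<le> ennreal (1 / \<gamma>) * ?w" by (rule tail_0_le[OF \<gamma> driver_P[OF driver_diff[OF g g']]])
    finally show ?thesis unfolding w by simp
  qed
  obtain C where C: "L_bound C" using L_bound_exists by blast
  have kap: "kap X t = kap X' t" if t: "t \<in> {0..T}" for t
    using kap_dist[OF C g g' X X' t \<gamma>] unfolding tail[OF t] by (simp add: ennreal_eq_0_iff)
  note S2 = linear_bsde_S2[OF X] linear_bsde_S2[OF X']
  have "AE \<omega> in M. X t \<omega> = X' t \<omega>" if t: "t \<in> {0..T}" for t
  proof -
    have tT: "t \<le> T" using t by simp
    note [measurable] = L2_measurable[OF tT S2_L2[OF S2(1) t]] L2_measurable[OF tT S2_L2[OF S2(2) t]]
    have "sqnorm M (\<lambda>\<omega>. X t \<omega> - X' t \<omega>) = 0"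
      using linear_bsde_stability[OF g g' X X' t \<gamma>] unfolding tail[OF t] by simp
    then have "AE \<omega> in M. X t \<omega> - X' t \<omega> = 0" by (subst (asm) sqnorm_eq_0_iff) auto
    then show ?thesis by eventually_elim simp
  qed
  then have "AE \<omega> in M. \<forall>t\<in>{0..T}. X t \<omega> = X' t \<omega>" by (rule S2_indistinguishable[OF S2])
  then have "AE \<omega> in M. \<forall>t\<in>{0..T}. Y t \<omega> = Y' t \<omega>"
    by eventually_elim (use Y Y' kap in \<open>auto simp: reflected_def\<close>)
  moreover have "AE (\<omega>, t) in P. Z t \<omega> = Z' t \<omega>"
  proof -
    have "(\<lambda>(\<omega>, s). Z s \<omega>) \<in> borel_measurable P" "(\<lambda>(\<omega>, s). Z' s \<omega>) \<in> borel_measurable P"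
      using linear_bsde_H2[OF X] linear_bsde_H2[OF X'] H2_Prog Prog_measurable_P by blast+
    from borel_measurable_diff[OF this] have m: "(\<lambda>(\<omega>, s). Z s \<omega> - Z' s \<omega>) \<in> borel_measurable P"
      by (simp add: case_prod_beta')
    have "sqnorm P (\<lambda>(\<omega>, s). Z s \<omega> - Z' s \<omega>) \<le> wnorm (2 * \<gamma>) (\<lambda>(\<omega>, s). Z s \<omega> - Z' s \<omega>)"
      by (rule wnorm_sqnorm(1)[OF _ m]) (use \<gamma> in simp)
    also have "\<dots> \<le> ennreal (3 / \<gamma>) * ?w" by (rule wnorm_Z_dist[OF g g' X X' \<gamma>])
    finally have "sqnorm P (\<lambda>(\<omega>, s). Z s \<omega> - Z' s \<omega>) = 0" unfolding w by simp
    then have "AE x in P. (case x of (\<omega>, s) \<Rightarrow> Z s \<omega> - Z' s \<omega>) = 0" unfolding sqnorm_eq_0_iff[OF m] .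
    then show ?thesis by eventually_elim auto
  qed
  moreover have "\<forall>t\<in>{0..T}. K t = K' t" using K K' kap T_pos by simp
  ultimately show ?thesis unfolding same_solution_def by blast
qed

end

theorem theorem9:
  fixes M :: "'w measure" and T :: real and B :: "real \<Rightarrow> 'w \<Rightarrow> real ^ 'd"
    and \<xi> :: "'w \<Rightarrow> real" and f :: "'w \<Rightarrow> real \<Rightarrow> real \<Rightarrow> real ^ 'd \<Rightarrow> real"
    and l :: "'w \<Rightarrow> real \<Rightarrow> real \<Rightarrow> real"
  defines "F \<equiv> augmented_filtration M B"
  assumes "prob_space M" and "complete_measure M"
    and "T > 0"
    and "brownian_motion M T B"
    and "H_xi M F T l \<xi>"
    and "H_f M F T f"
    and "H_ell M F T l"
    and "H_L M F T l"
  shows "(\<exists>Y Z K. deterministic_flat_solution M F T B \<xi> f l Y Z K) \<and>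
    (\<forall>Y Z K Y' Z' K'.
       deterministic_flat_solution M F T B \<xi> f l Y Z K \<longrightarrow>
       deterministic_flat_solution M F T B \<xi> f l Y' Z' K' \<longrightarrow>
       same_solution M T Y Z K Y' Z' K')"
proof -
  interpret mean_reflected M T B \<xi> f l
    by (intro mean_reflected.intro brownian.intro brownian_axioms.intro mean_reflected_axioms.intro assms[unfolded F_def])
  show ?thesis
    unfolding F_def using flat_solution_exists flat_solution_unique by blast
qed

end
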